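(* Let $H$ be a separable complex Hilbert space and let $D=D^*$ have compact resolvent. Let $G$ be a positive bounded Borel function with $0<G(D)\in\mathcal{L}^{1,\infty}(H)$, let $\omega\in DL_2$, and set $\phi_\omega(\cdot)=\mathrm{Tr}_\omega(\,\cdot\,G(D))$. Let $A_1,\dots,A_n$ be commuting bounded selfadjoint operators acting non-degenerately on $H$, with generated von Neumann algebra $\mathcal{M}\cong L^\infty(E,\mu_\eta)$, joint spectrum $E$ and joint spectral representation $U:H\to L^2(F,\mu)$, such that $D$ is $(A_1,\dots,A_n,U)$-dominated and such that there is a normal $^*$-homomorphism $\cdot\circ e:L^\infty(E,\mu_\eta)\to L^\infty(F,\mu)$ with $Uf(A_1,\dots,A_n)U^*=M_{f\circ e}$ for all $f\in L^\infty(E,\mu_\eta)$. Then: (i) $\phi_\omega\in\mathcal{M}_*$, and there exists $v_{G,\omega}\in L^1(F,\mu)$ such that $$\phi_\omega(f(A_1,\dots,A_n))=\int_F f\circ e(x)\,v_{G,\omega}(x)\,d\mu(x)\qquad\text{for all } f\in L^\infty(E,\mu_\eta);$$ (ii) one has $$\phi_\omega(f(A_1,\dots,A_n))=\int_F f\circ e(x)\,v(x)\,d\mu(x)\qquad\text{for all } f\in L^\infty(E,\mu_\eta),$$ where $v=\lim_{k\to\infty}k^{-1}v_{1+k^{-1}}\in L^1(F,\mu)$ (the limit existing in the weak Banach topology $\sigma(L^1(F,\mu),L^\infty(F,\mu))$), if and only if $G(D)$ is spectrally measurable.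
   Context: Ideals and traces: $\mu_n(T)$ are the singular values of a compact operator $T$; $\mathcal{L}^{1,\infty}(H)$ is the ideal of compact $T$ with $\sup_{k}\frac{1}{\log(1+k)}\sum_{n=1}^k\mu_n(T)<\infty$. For $0<T\in\mathcal{L}^{1,\infty}$, $\gamma(T)=\{\frac{1}{\log(1+k)}\sum_{n=1}^k\mu_n(T)\}_{k}\in\ell^\infty$. With $D_2(\{a_k\})=\{a_{\lceil k/2\rceil}\}_{k}$, $DL_2$ is the set of positive functionals $\omega\in(\ell^\infty)^*$ with $\omega(1)=1$, with $\liminf_k a_k\le\omega(\{a_k\})\le\limsup_k a_k$ for bounded $a_k\ge0$, and with $\omega(D_2(\gamma(T)))=\omega(\gamma(T))$ for all $0<T\in\mathcal{L}^{1,\infty}$. $\mathrm{Tr}_\omega$ is the linear extension to $\mathcal{L}^{1,\infty}$ of $T\mapsto\omega(\gamma(T))$, $T>0$. $T\in\mathcal{L}^{1,\infty}$ is measurable (in the sense of Connes) if $\mathrm{Tr}_\omega(T)$ is independent of $\omega\in DL_2$. Spectral setting: $\{h_m\}_{m\ge1}$ is an orthonormal basis of $H$ of eigenvectors of $D$, $Dh_m=\lambda_mh_m$. $\mathcal{M}$ is the von Neumann algebra generated by $A_1,\dots,A_n$ (with predual $\mathcal{M}_*$), identified with $L^\infty(E,\mu_\eta)$, $E$ the joint spectrum, by the functional calculus $f\mapsto f(A_1,\dots,A_n)$; here $\mu_\eta$ is the finite regular Borel measure on $E$ given by $\int_E f\,d\mu_\eta=\langle\eta,f(A_1,\dots,A_n)\eta\rangle$,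 $f\in C(E)$, where $\eta=\sum_j2^{-j}\eta_j$ for a maximal family of unit vectors $\eta_j$ with $\overline{\mathcal{M}\eta_j}\cap\overline{\mathcal{M}\eta_k}=\{0\}$ ($j\neq k$) and $\oplus_j\overline{\mathcal{M}\eta_j}=H$. A joint spectral representation is a unitary $U:H\to L^2(F,\mu)$, $(F,\mu)$ a finite Borel measure space (one may take $F$ a countable disjoint union of copies of $\mathbb{R}$), with $UA_iU^*=M_{e_i}$ for bounded functions $e_i$ on $F$; $e=(e_1,\dots,e_n):F\to E$. $M_f$ denotes multiplication by $f$ on $L^2(F,\mu)$. Definitions: $D$ is $(A_1,\dots,A_n,U)$-dominated if there is $l\in L^1(F,\mu)$ with $|Uh_m|^2\le l$ $\mu$-a.e. for all $m$ (the moduli squared of the eigenfunctions of $UDU^*$ are dominated by $l$). $G(D)\in\mathcal{L}^{1,\infty}$ is spectrally measurable if $PG(D)P$ is measurable for every projection $P\in U^*L^\infty(F,\mu)U$. For $s>1$, $G(D)^s$ is trace class and $v_s\in L^1(F,\mu)$ is the Radon-Nikodym derivative determined by $\mathrm{Tr}(U^*M_fU\,G(D)^s)=\int_F f v_s\,d\mu$, $f\in L^\infty(F,\mu)$; equivalently $v_s=\sum_mG(\lambda_m)^s|Uh_m|^2$. *)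

theory Defs
  imports "HOL-Analysis.Analysis"
begin

section \<open>Complex Hilbert spaces\<close>

class complex_vector = real_vector +
  fixes scaleC :: "complex \<Rightarrow> 'a \<Rightarrow> 'a" (infixr \<open>*\<^sub>C\<close> 75)
  assumes scaleC_add_right: "c *\<^sub>C (x + y) = c *\<^sub>C x + c *\<^sub>C y"
    and scaleC_add_left: "(c + d) *\<^sub>C x = c *\<^sub>C x + d *\<^sub>C x"
    and scaleC_scaleC: "c *\<^sub>C d *\<^sub>C x = (c * d) *\<^sub>C x"
    and scaleC_one: "1 *\<^sub>C x = x"
    and scaleR_scaleC: "r *\<^sub>R x = complex_of_real r *\<^sub>C x"

text \<open>The inner product is antilinear in the first and linear in the second argument.\<close>

class complex_inner = complex_vector + real_normed_vector +
  fixes cinner :: "'a \<Rightarrow> 'a \<Rightarrow> complex"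
  assumes cinner_commute: "cinner x y = cnj (cinner y x)"
    and cinner_add_right: "cinner x (y + z) = cinner x y + cinner x z"
    and cinner_scaleC_right: "cinner x (c *\<^sub>C y) = c * cinner x y"
    and cinner_self: "cinner x x = complex_of_real ((norm x)\<^sup>2)"

class complex_hilbert = complex_inner + complete_space

global_interpretation complex_vector:
  vector_space "scaleC :: complex \<Rightarrow> 'a \<Rightarrow> 'a::complex_vector"
  by standard (simp_all add: scaleC_add_right scaleC_add_left scaleC_scaleC scaleC_one)

abbreviation cspan :: "'a::complex_vector set \<Rightarrow> 'a set"
  where "cspan \<equiv> module.span scaleC"

abbreviation cdim :: "'a::complex_vector set \<Rightarrow> nat"
  where "cdim \<equiv> vector_space.dim scaleC"

abbreviation csubspace :: "'a::complex_vector set \<Rightarrow> bool"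
  where "csubspace \<equiv> module.subspace scaleC"

definition is_onb :: "'a::complex_hilbert set \<Rightarrow> bool"
  where "is_onb B \<longleftrightarrow>
    (\<forall>b\<in>B. norm b = 1) \<and> (\<forall>b\<in>B. \<forall>c\<in>B. b \<noteq> c \<longrightarrow> cinner b c = 0) \<and>
    closure (cspan B) = UNIV"


section \<open>Bounded operators\<close>

text \<open>Operators on \<open>H\<close> are functions \<open>'h \<Rightarrow> 'h\<close>; the operator product is function composition.\<close>

definition bounded_clinear :: "('a::complex_hilbert \<Rightarrow> 'a) \<Rightarrow> bool"
  where "bounded_clinear T \<longleftrightarrow> bounded_linear T \<and> (\<forall>c x. T (c *\<^sub>C x) = c *\<^sub>C T x)"

definition adj :: "('a::complex_hilbert \<Rightarrow> 'a) \<Rightarrow> 'a \<Rightarrow> 'a"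
  where "adj T = (THE S. bounded_clinear S \<and> (\<forall>x y. cinner (S x) y = cinner x (T y)))"

definition selfadjoint_op :: "('a::complex_hilbert \<Rightarrow> 'a) \<Rightarrow> bool"
  where "selfadjoint_op T \<longleftrightarrow> bounded_clinear T \<and> (\<forall>x y. cinner (T x) y = cinner x (T y))"

definition positive_op :: "('a::complex_hilbert \<Rightarrow> 'a) \<Rightarrow> bool"
  where "positive_op T \<longleftrightarrow> bounded_clinear T \<and> (\<forall>x. cinner x (T x) \<in> \<real>\<^sub>\<ge>\<^sub>0)"

definition projection_op :: "('a::complex_hilbert \<Rightarrow> 'a) \<Rightarrow> bool"
  where "projection_op P \<longleftrightarrow> selfadjoint_op P \<and> P \<circ> P = P"

definition compact_op :: "('a::complex_hilbert \<Rightarrow> 'a) \<Rightarrow> bool"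
  where "compact_op T \<longleftrightarrow> bounded_clinear T \<and> compact (closure (T ` cball 0 1))"

text \<open>The trace; for trace class operators it does not depend on the chosen basis.\<close>

definition trace_op :: "('a::complex_hilbert \<Rightarrow> 'a) \<Rightarrow> complex"
  where "trace_op T = (\<Sum>\<^sub>\<infinity>b\<in>(SOME B. is_onb B). cinner b (T b))"


section \<open>Singular values, \<open>\<L>\<^sup>1\<^sup>,\<^sup>\<infinity>\<close> and Dixmier traces\<close>

text \<open>All sequences are indexed from 0, so entry \<open>i\<close> is the mathematical entry \<open>k = i + 1\<close>.

  \<open>sing_val T\<close> lists the eigenvalues of \<open>|T| = (T\<^sup>*T)\<^sup>1\<^sup>/\<^sup>2\<close> in decreasing order, repeated according to
  multiplicity (and continued by zeros if there are only finitely many positive ones).\<close>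

definition sing_val :: "('a::complex_hilbert \<Rightarrow> 'a) \<Rightarrow> nat \<Rightarrow> real"
  where "sing_val T = (THE s. decseq s \<and> s \<longlonglongrightarrow> 0 \<and>
    (\<forall>t>0. card {i. s i = t} = cdim {x. adj T (T x) = complex_of_real (t\<^sup>2) *\<^sub>C x}))"

definition gamma_seq :: "('a::complex_hilbert \<Rightarrow> 'a) \<Rightarrow> nat \<Rightarrow> real"
  where "gamma_seq T i = (\<Sum>n\<le>i. sing_val T n) / ln (1 + real (Suc i))"

definition L1inf :: "('a::complex_hilbert \<Rightarrow> 'a) set"
  where "L1inf = {T. compact_op T \<and> bdd_above (range (gamma_seq T))}"

text \<open>\<open>nat \<Rightarrow>\<^sub>C real\<close> is the real Banach space \<open>\<ell>\<^sup>\<infinity>\<close>; a positive functional on complex \<open>\<ell>\<^sup>\<infinity>\<close> is the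
  same thing as a positive functional on its real part.\<close>

definition gamma :: "('a::complex_hilbert \<Rightarrow> 'a) \<Rightarrow> (nat \<Rightarrow>\<^sub>C real)"
  where "gamma T = Bcontfun (gamma_seq T)"

text \<open>With \<open>k = i + 1\<close> one has \<open>\<lceil>k / 2\<rceil> = i div 2 + 1\<close>.\<close>

definition D2 :: "(nat \<Rightarrow>\<^sub>C real) \<Rightarrow> (nat \<Rightarrow>\<^sub>C real)"
  where "D2 a = Bcontfun (\<lambda>i. apply_bcontfun a (i div 2))"

definition DL2 :: "'h::complex_hilbert itself \<Rightarrow> ((nat \<Rightarrow>\<^sub>C real) \<Rightarrow>\<^sub>L real) set"
  where "DL2 _ = {\<omega>.
    (\<forall>a. (\<forall>i. 0 \<le> apply_bcontfun a i) \<longrightarrow> 0 \<le> blinfun_apply \<omega> a) \<and>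
    blinfun_apply \<omega> (const_bcontfun 1) = 1 \<and>
    (\<forall>a. (\<forall>i. 0 \<le> apply_bcontfun a i) \<longrightarrow>
      liminf (\<lambda>i. ereal (apply_bcontfun a i)) \<le> ereal (blinfun_apply \<omega> a) \<and>
      ereal (blinfun_apply \<omega> a) \<le> limsup (\<lambda>i. ereal (apply_bcontfun a i))) \<and>
    (\<forall>T::'h \<Rightarrow> 'h. positive_op T \<and> T \<in> L1inf \<longrightarrow>
      blinfun_apply \<omega> (D2 (gamma T)) = blinfun_apply \<omega> (gamma T))}"

text \<open>The linear extension is unique on \<open>L1inf\<close>, which is spanned by its positive elements.\<close>

definition dixmier_trace ::
    "((nat \<Rightarrow>\<^sub>C real) \<Rightarrow>\<^sub>L real) \<Rightarrow> ('h::complex_hilbert \<Rightarrow> 'h) \<Rightarrow> complex"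
  where "dixmier_trace \<omega> = (SOME \<tau>.
    (\<forall>S\<in>L1inf. \<forall>T\<in>L1inf. \<tau> (\<lambda>x. S x + T x) = \<tau> S + \<tau> T) \<and>
    (\<forall>T\<in>L1inf. \<forall>c. \<tau> (\<lambda>x. c *\<^sub>C T x) = c * \<tau> T) \<and>
    (\<forall>T\<in>L1inf. positive_op T \<longrightarrow> \<tau> T = complex_of_real (blinfun_apply \<omega> (gamma T))))"

definition connes_measurable :: "('h::complex_hilbert \<Rightarrow> 'h) \<Rightarrow> bool"
  where "connes_measurable T \<longleftrightarrow> T \<in> L1inf \<and>
    (\<forall>\<omega>\<in>DL2 TYPE('h). \<forall>\<omega>'\<in>DL2 TYPE('h). dixmier_trace \<omega> T = dixmier_trace \<omega>' T)"


section \<open>Selfadjoint operators with compact resolvent\<close>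

text \<open>An unbounded operator is given by its domain and a function that matters only on the domain.
  The last clause says that \<open>D\<close> and its adjoint have the same graph.\<close>

definition selfadjoint_unbounded :: "'h::complex_hilbert set \<Rightarrow> ('h \<Rightarrow> 'h) \<Rightarrow> bool"
  where "selfadjoint_unbounded domD D \<longleftrightarrow>
    csubspace domD \<and> closure domD = UNIV \<and>
    (\<forall>x\<in>domD. \<forall>y\<in>domD. D (x + y) = D x + D y) \<and>
    (\<forall>c. \<forall>x\<in>domD. D (c *\<^sub>C x) = c *\<^sub>C D x) \<and>
    (\<forall>y z. (y \<in> domD \<and> D y = z) \<longleftrightarrow> (\<forall>x\<in>domD. cinner (D x) y = cinner x z))"

definition compact_resolvent :: "'h::complex_hilbert set \<Rightarrow> ('h \<Rightarrow> 'h) \<Rightarrow> bool"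
  where "compact_resolvent domD D \<longleftrightarrow> (\<exists>z R. compact_op R \<and>
    (\<forall>x. R x \<in> domD \<and> D (R x) - z *\<^sub>C R x = x) \<and>
    (\<forall>x\<in>domD. R (D x - z *\<^sub>C x) = x))"

text \<open>Borel functional calculus \<open>G(D)\<close> for a selfadjoint operator whose eigenvectors span a dense
  subspace (in particular, for one with compact resolvent, or for a compact one).\<close>

definition eigen_calculus ::
    "'h::complex_hilbert set \<Rightarrow> ('h \<Rightarrow> 'h) \<Rightarrow> (real \<Rightarrow> real) \<Rightarrow> 'h \<Rightarrow> 'h"
  where "eigen_calculus domD D G = (THE T. bounded_clinear T \<and>
    (\<forall>t. \<forall>x\<in>domD. D x = complex_of_real t *\<^sub>C x \<longrightarrow> T x = complex_of_real (G t) *\<^sub>C x))"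

definition op_powr :: "('h::complex_hilbert \<Rightarrow> 'h) \<Rightarrow> real \<Rightarrow> 'h \<Rightarrow> 'h"
  where "op_powr T s = eigen_calculus UNIV T (\<lambda>t. t powr s)"


section \<open>Operator algebras, joint spectrum and functional calculus\<close>

definition cstar_algebra :: "('h::complex_hilbert \<Rightarrow> 'h) set \<Rightarrow> bool"
  where "cstar_algebra B \<longleftrightarrow>
    (\<forall>T\<in>B. bounded_clinear T) \<and> id \<in> B \<and>
    (\<forall>S\<in>B. \<forall>T\<in>B. (\<lambda>x. S x + T x) \<in> B \<and> S \<circ> T \<in> B) \<and>
    (\<forall>T\<in>B. adj T \<in> B \<and> (\<forall>c. (\<lambda>x. c *\<^sub>C T x) \<in> B)) \<and>
    (\<forall>X T. (\<forall>k. X k \<in> B) \<and> bounded_clinear T \<and>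
      (\<lambda>k. onorm (\<lambda>x. X k x - T x)) \<longlonglongrightarrow> 0 \<longrightarrow> T \<in> B)"

definition cstar_generated :: "('h::complex_hilbert \<Rightarrow> 'h) set \<Rightarrow> ('h \<Rightarrow> 'h) set"
  where "cstar_generated S = \<Inter>{B. cstar_algebra B \<and> S \<subseteq> B}"

definition commutant :: "('h::complex_hilbert \<Rightarrow> 'h) set \<Rightarrow> ('h \<Rightarrow> 'h) set"
  where "commutant S = {T. bounded_clinear T \<and> (\<forall>X\<in>S. T \<circ> X = X \<circ> T)}"

definition von_neumann_algebra :: "('h::complex_hilbert \<Rightarrow> 'h) set \<Rightarrow> bool"
  where "von_neumann_algebra M \<longleftrightarrow>
    (\<forall>T\<in>M. bounded_clinear T \<and> adj T \<in> M) \<and> commutant (commutant M) = M"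

definition vn_generated :: "('h::complex_hilbert \<Rightarrow> 'h) set \<Rightarrow> ('h \<Rightarrow> 'h) set"
  where "vn_generated S = \<Inter>{M. von_neumann_algebra M \<and> S \<subseteq> M}"

text \<open>The predual \<open>M\<^sub>*\<close> as the ultraweakly continuous linear functionals on \<open>M\<close>.
  Only the values of \<open>\<phi>\<close> on \<open>M\<close> matter.\<close>

definition predual :: "('h::complex_hilbert \<Rightarrow> 'h) set \<Rightarrow> (('h \<Rightarrow> 'h) \<Rightarrow> complex) set"
  where "predual M = {\<phi>. \<exists>x y :: nat \<Rightarrow> 'h.
    summable (\<lambda>n. (norm (x n))\<^sup>2) \<and> summable (\<lambda>n. (norm (y n))\<^sup>2) \<and>
    (\<forall>T\<in>M. \<phi> T = (\<Sum>n. cinner (x n) (T (y n))))}"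

definition character :: "('h::complex_hilbert \<Rightarrow> 'h) set \<Rightarrow> (('h \<Rightarrow> 'h) \<Rightarrow> complex) \<Rightarrow> bool"
  where "character B \<kappa> \<longleftrightarrow> \<kappa> id = 1 \<and>
    (\<forall>S\<in>B. \<forall>T\<in>B. \<kappa> (\<lambda>x. S x + T x) = \<kappa> S + \<kappa> T \<and> \<kappa> (S \<circ> T) = \<kappa> S * \<kappa> T) \<and>
    (\<forall>T\<in>B. \<forall>c. \<kappa> (\<lambda>x. c *\<^sub>C T x) = c * \<kappa> T)"

definition joint_spectrum :: "('n::finite \<Rightarrow> 'h::complex_hilbert \<Rightarrow> 'h) \<Rightarrow> (real ^ 'n) set"
  where "joint_spectrum A = {v. \<exists>\<kappa>. character (cstar_generated (range A)) \<kappa> \<and>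
    (\<forall>i. \<kappa> (A i) = complex_of_real (v $ i))}"

text \<open>\<open>f(A\<^sub>1,\<dots>,A\<^sub>n)\<close> for continuous \<open>f\<close> on the joint spectrum: the inverse Gelfand transform of \<open>f\<close>.\<close>

definition cont_calculus ::
    "('n::finite \<Rightarrow> 'h::complex_hilbert \<Rightarrow> 'h) \<Rightarrow> (real ^ 'n \<Rightarrow> complex) \<Rightarrow> 'h \<Rightarrow> 'h"
  where "cont_calculus A f = (THE T. T \<in> cstar_generated (range A) \<and>
    (\<forall>\<kappa>. character (cstar_generated (range A)) \<kappa> \<longrightarrow> \<kappa> T = f (\<chi> i. Re (\<kappa> (A i)))))"

text \<open>\<open>\<mu>\<^sub>x\<close>: the finite Borel measure on the joint spectrum \<open>E\<close> with \<open>\<integral> f d\<mu>\<^sub>x = \<langle>x, f(A\<^sub>1,\<dots>,A\<^sub>n) x\<rangle>\<close> for all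
  continuous \<open>f\<close>. As \<open>E\<close> is a compact subset of Euclidean space, regularity is automatic.\<close>

definition spectral_measure ::
    "('n::finite \<Rightarrow> 'h::complex_hilbert \<Rightarrow> 'h) \<Rightarrow> 'h \<Rightarrow> (real ^ 'n) measure"
  where "spectral_measure A x = (THE N.
    sets N = sets (restrict_space borel (joint_spectrum A)) \<and> finite_measure N \<and>
    (\<forall>f::real ^ 'n \<Rightarrow> complex. continuous_on (joint_spectrum A) f \<longrightarrow>
      (\<integral>t. f t \<partial>N) = cinner x (cont_calculus A f x)))"

text \<open>\<open>f(A\<^sub>1,\<dots>,A\<^sub>n)\<close> for bounded Borel \<open>f\<close>, and for \<open>f\<close> representing an element of \<open>L\<^sup>\<infinity>(E, \<mu>\<^sub>\<eta>)\<close>.\<close>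

definition joint_calculus ::
    "('n::finite \<Rightarrow> 'h::complex_hilbert \<Rightarrow> 'h) \<Rightarrow> (real ^ 'n \<Rightarrow> complex) \<Rightarrow> 'h \<Rightarrow> 'h"
  where "joint_calculus A f = (THE T. bounded_clinear T \<and>
    (\<forall>x. cinner x (T x) = (\<integral>t. f t \<partial>spectral_measure A x)))"

text \<open>\<open>(\<xi> j)\<^sub>j\<^sub>\<in>\<^sub>J\<close> is a family of unit vectors such that \<open>H\<close> is the Hilbert space direct sum of the
  subspaces \<open>closure (M \<xi>\<^sub>j)\<close>; such a family is automatically maximal.\<close>

definition cyclic_decomposition ::
    "('h::complex_hilbert \<Rightarrow> 'h) set \<Rightarrow> nat set \<Rightarrow> (nat \<Rightarrow> 'h) \<Rightarrow> bool"
  where "cyclic_decomposition M J \<xi> \<longleftrightarrow>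
    (\<forall>j\<in>J. norm (\<xi> j) = 1) \<and>
    (\<forall>j\<in>J. \<forall>k\<in>J. j \<noteq> k \<longrightarrow>
      closure ((\<lambda>T. T (\<xi> j)) ` M) \<inter> closure ((\<lambda>T. T (\<xi> k)) ` M) = {0} \<and>
      (\<forall>x\<in>closure ((\<lambda>T. T (\<xi> j)) ` M). \<forall>y\<in>closure ((\<lambda>T. T (\<xi> k)) ` M). cinner x y = 0)) \<and>
    closure (cspan (\<Union>j\<in>J. closure ((\<lambda>T. T (\<xi> j)) ` M))) = UNIV"


section \<open>\<open>L\<^sup>p\<close> spaces and the joint spectral representation\<close>

text \<open>Elements of \<open>L\<^sup>2\<close>, \<open>L\<^sup>\<infinity>\<close> and \<open>L\<^sup>1\<close> (library predicate \<^const>\<open>integrable\<close>) are represented by functions,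
  and equality is equality almost everywhere.\<close>

definition L2 :: "'a measure \<Rightarrow> ('a \<Rightarrow> complex) set"
  where "L2 M = {g. g \<in> borel_measurable M \<and> integrable M (\<lambda>y. (cmod (g y))\<^sup>2)}"

definition Linf :: "'a measure \<Rightarrow> ('a \<Rightarrow> complex) set"
  where "Linf M = {f. f \<in> borel_measurable M \<and> (\<exists>C. AE y in M. cmod (f y) \<le> C)}"

definition unitary_L2 :: "'f measure \<Rightarrow> ('h::complex_hilbert \<Rightarrow> 'f \<Rightarrow> complex) \<Rightarrow> bool"
  where "unitary_L2 M U \<longleftrightarrow>
    (\<forall>x. U x \<in> L2 M) \<and>
    (\<forall>x x'. AE y in M. U (x + x') y = U x y + U x' y) \<and>
    (\<forall>c x. AE y in M. U (c *\<^sub>C x) y = c * U x y) \<and>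
    (\<forall>x x'. (\<integral>y. cnj (U x y) * U x' y \<partial>M) = cinner x x') \<and>
    (\<forall>g\<in>L2 M. \<exists>x. AE y in M. U x y = g y)"

definition unitary_inv ::
    "'f measure \<Rightarrow> ('h::complex_hilbert \<Rightarrow> 'f \<Rightarrow> complex) \<Rightarrow> ('f \<Rightarrow> complex) \<Rightarrow> 'h"
  where "unitary_inv M U g = (THE x. AE y in M. U x y = g y)"

text \<open>\<open>mult_op M U f = U\<^sup>* M\<^sub>f U\<close>\<close>

definition mult_op ::
    "'f measure \<Rightarrow> ('h::complex_hilbert \<Rightarrow> 'f \<Rightarrow> complex) \<Rightarrow> ('f \<Rightarrow> complex) \<Rightarrow> 'h \<Rightarrow> 'h"
  where "mult_op M U f x = unitary_inv M U (\<lambda>y. f y * U x y)"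

definition joint_spectral_representation ::
    "('n::finite \<Rightarrow> 'h::complex_hilbert \<Rightarrow> 'h) \<Rightarrow> 'f measure \<Rightarrow> ('h \<Rightarrow> 'f \<Rightarrow> complex) \<Rightarrow>
      ('f \<Rightarrow> real ^ 'n) \<Rightarrow> bool"
  where "joint_spectral_representation A M U e \<longleftrightarrow>
    unitary_L2 M U \<and>
    e \<in> borel_measurable M \<and> bounded (e ` space M) \<and> e ` space M \<subseteq> joint_spectrum A \<and>
    (\<forall>i x. AE y in M. U (A i x) y = complex_of_real (e y $ i) * U x y)"

text \<open>Normal \<open>*\<close>-homomorphisms \<open>L\<^sup>\<infinity>(N) \<rightarrow> L\<^sup>\<infinity>(M)\<close>. The second clause says that \<open>\<Phi>\<close> is well defined on
  classes modulo null sets; the last one is normality, i.e. continuity for the weak-\<open>*\<close> topologies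
  given by the preduals \<open>L\<^sup>1(N)\<close> and \<open>L\<^sup>1(M)\<close>.\<close>

definition normal_star_hom ::
    "'a measure \<Rightarrow> 'b measure \<Rightarrow> (('a \<Rightarrow> complex) \<Rightarrow> 'b \<Rightarrow> complex) \<Rightarrow> bool"
  where "normal_star_hom N M \<Phi> \<longleftrightarrow>
    (\<forall>f\<in>Linf N. \<Phi> f \<in> Linf M) \<and>
    (\<forall>f\<in>Linf N. \<forall>g\<in>Linf N. (AE t in N. f t = g t) \<longrightarrow> (AE y in M. \<Phi> f y = \<Phi> g y)) \<and>
    (\<forall>f\<in>Linf N. \<forall>g\<in>Linf N. AE y in M. \<Phi> (\<lambda>t. f t + g t) y = \<Phi> f y + \<Phi> g y) \<and>
    (\<forall>f\<in>Linf N. \<forall>g\<in>Linf N. AE y in M. \<Phi> (\<lambda>t. f t * g t) y = \<Phi> f y * \<Phi> g y) \<and>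
    (\<forall>f\<in>Linf N. \<forall>c. AE y in M. \<Phi> (\<lambda>t. c * f t) y = c * \<Phi> f y) \<and>
    (\<forall>f\<in>Linf N. AE y in M. \<Phi> (\<lambda>t. cnj (f t)) y = cnj (\<Phi> f y)) \<and>
    (\<forall>g::'b \<Rightarrow> complex. integrable M g \<longrightarrow> (\<exists>h::'a \<Rightarrow> complex. integrable N h \<and>
      (\<forall>f\<in>Linf N. (\<integral>y. \<Phi> f y * g y \<partial>M) = (\<integral>t. f t * h t \<partial>N))))"

text \<open>Domination of \<open>D\<close>, expressed through its orthonormal basis \<open>(h m)\<^sub>m\<^sub>\<in>\<^sub>I\<close> of eigenvectors.\<close>

definition dominated ::
    "'f measure \<Rightarrow> ('h::complex_hilbert \<Rightarrow> 'f \<Rightarrow> complex) \<Rightarrow> nat set \<Rightarrow> (nat \<Rightarrow> 'h) \<Rightarrow> bool"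
  where "dominated M U I h \<longleftrightarrow> (\<exists>l::'f \<Rightarrow> real. integrable M l \<and>
    (\<forall>m\<in>I. AE y in M. (cmod (U (h m) y))\<^sup>2 \<le> l y))"

definition spectrally_measurable ::
    "'f measure \<Rightarrow> ('h::complex_hilbert \<Rightarrow> 'f \<Rightarrow> complex) \<Rightarrow> ('h \<Rightarrow> 'h) \<Rightarrow> bool"
  where "spectrally_measurable M U T \<longleftrightarrow>
    (\<forall>f\<in>Linf M. projection_op (mult_op M U f) \<longrightarrow>
      connes_measurable (mult_op M U f \<circ> T \<circ> mult_op M U f))"

text \<open>The function \<open>v\<^sub>s\<close> (unique almost everywhere) with \<open>Tr(U\<^sup>* M\<^sub>f U T\<^sup>s) = \<integral> f v\<^sub>s d\<mu>\<close>, where \<open>T = G(D)\<close>.\<close>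

definition zeta_density ::
    "'f measure \<Rightarrow> ('h::complex_hilbert \<Rightarrow> 'f \<Rightarrow> complex) \<Rightarrow> ('h \<Rightarrow> 'h) \<Rightarrow> real \<Rightarrow> 'f \<Rightarrow> complex"
  where "zeta_density M U T s = (SOME v. integrable M v \<and>
    (\<forall>f\<in>Linf M. trace_op (mult_op M U f \<circ> op_powr T s) = (\<integral>y. f y * v y \<partial>M)))"

definition weak_L1_limit :: "'f measure \<Rightarrow> (nat \<Rightarrow> 'f \<Rightarrow> complex) \<Rightarrow> ('f \<Rightarrow> complex) \<Rightarrow> bool"
  where "weak_L1_limit M u v \<longleftrightarrow> (\<forall>k. integrable M (u k)) \<and> integrable M v \<and>
    (\<forall>g\<in>Linf M. (\<lambda>k. \<integral>y. g y * u k y \<partial>M) \<longlonglongrightarrow> (\<integral>y. g y * v y \<partial>M))"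

end

theory Submission
  imports Defs "HOL-Library.Function_Algebras"
begin

text \<open>Let \<open>G(D)\<close> have eigenvalues \<open>s\<^sub>0 \<ge> s\<^sub>1 \<ge> \<dots>\<close> with eigenvectors \<open>f\<^sub>i\<close> taken from the given basis, and put
  \<open>p\<^sub>i(g) = \<integral> g |U f\<^sub>i|\<^sup>2 d\<mu>\<close>. The Ky Fan inequalities for \<open>X G(D) X\<^sup>*\<close> and for its complement together with
  the \<open>D\<^sub>2\<close>-invariance of \<open>\<omega>\<close> show that \<open>Tr\<^sub>\<omega>(U\<^sup>*M\<^sub>gU G(D)) = \<omega>(a(g))\<close>, where \<open>a(g)\<close> is the sequence of
  logarithmic means of \<open>s\<^sub>i p\<^sub>i(g)\<close>. Domination bounds \<open>|\<omega>(a(g))|\<close> by a multiple of \<open>\<integral> |g| l d\<mu>\<close>, so the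
  functional has an \<open>L\<^sup>1\<close> density.

  The integrals of \<open>k\<^sup>-\<^sup>1 v\<^bsub>1+1/k\<^esub>\<close> against \<open>g\<close> are the residues \<open>k\<^sup>-\<^sup>1 \<Sum> s\<^sub>i\<^bsup>1+1/k\<^esup> p\<^sub>i(g)\<close>. For \<open>0 \<le> g \<le> 1\<close> these
  converge to \<open>c\<close> if and only if \<open>a(g)\<close> does (an Abelian theorem and Karamata's Tauberian theorem), and \<open>a(g)\<close>
  converges as soon as all functionals in \<open>DL\<^sub>2\<close> agree on it, because limit points of averages over
  \<open>K, 2K, 4K, \<dots>\<close> belong to \<open>DL\<^sub>2\<close>. Applied to the projections this gives the equivalence; domination
  extends the convergence from indicator functions to all of \<open>L\<^sup>\<infinity>\<close>.\<close>

section \<open>Complex inner products and bounded operators\<close>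

text \<open>The Ky Fan estimates are one-sided. Test vectors bound the partial sums of X G X* from
  below at no cost, but a matching upper bound is available only for X together with a complement Z,
  where X*X + Z*Z = K, and it sets 2N eigenvalues of G against N of each conjugate. Since the two
  lower bounds add up exactly to K times the partial sums of G, both become equalities under a
  functional that ignores the factor 2. Hence only operators with such a complement are treated
  directly, and general multipliers follow by polarization.

  Several notions are fixed by description or choice (\<open>sing_val\<close>,
  \<open>eigen_calculus\<close>, \<open>dixmier_trace\<close>, \<open>zeta_density\<close>), so
  existence must be proved before anything is known of them; for the Dixmier trace this includes the
  linear extension itself.

  The eigenvectors of G(D) have to come from the given basis because domination speaks of that
  basis. The weighted terms s_i p_i(g) need not decrease, so the limit theorems use the monotonicity
  of s_i instead: Abel summation against its powers in one direction, polynomial approximation and a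
  matching of cut-offs in the other.\<close>

lemma cinner_add_left: "cinner (x + y) z = cinner x z + cinner (y::'a::complex_inner) z"
  by (metis cinner_commute cinner_add_right complex_cnj_add)

lemma cinner_scaleC_left: "cinner (c *\<^sub>C x) (y::'a::complex_inner) = cnj c * cinner x y"
  by (metis cinner_commute cinner_scaleC_right complex_cnj_mult)

lemma cinner_scaleR_right: "cinner x (r *\<^sub>R (y::'a::complex_inner)) = of_real r * cinner x y"
  by (simp add: scaleR_scaleC cinner_scaleC_right)

lemma cinner_scaleR_left: "cinner (r *\<^sub>R x) (y::'a::complex_inner) = of_real r * cinner x y"
  by (simp add: scaleR_scaleC cinner_scaleC_left)

lemma cinner_zero_right [simp]: "cinner x (0::'a::complex_inner) = 0"
  using cinner_scaleC_right[of x 0 0] by simp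

lemma cinner_zero_left [simp]: "cinner 0 (x::'a::complex_inner) = 0"
  using cinner_scaleC_left[of 0 0 x] by simp

lemma scaleC_minus_one: "(-1) *\<^sub>C x = - (x::'a::complex_vector)"
  by (metis complex_vector.scale_minus_left scaleC_one)

lemma cinner_minus_right: "cinner x (- y) = - cinner x (y::'a::complex_inner)"
  by (metis cinner_scaleC_right scaleC_minus_one mult_minus1)

lemma cinner_minus_left: "cinner (- x) y = - cinner x (y::'a::complex_inner)"
  by (metis cinner_commute cinner_minus_right complex_cnj_minus)

lemma cinner_diff_right: "cinner x (y - z) = cinner x y - cinner x (z::'a::complex_inner)"
  by (metis add_uminus_conv_diff cinner_add_right cinner_minus_right)

lemma cinner_diff_left: "cinner (x - y) z = cinner x z - cinner y (z::'a::complex_inner)"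
  by (metis add_uminus_conv_diff cinner_add_left cinner_minus_left)

lemma cinner_sum_right: "cinner x (\<Sum>i\<in>F. f i) = (\<Sum>i\<in>F. cinner x (f i :: 'a::complex_inner))"
  by (induction F rule: infinite_finite_induct) (simp_all add: cinner_add_right)

lemma cinner_sum_left: "cinner (\<Sum>i\<in>F. f i) x = (\<Sum>i\<in>F. cinner (f i :: 'a::complex_inner) x)"
  by (induction F rule: infinite_finite_induct) (simp_all add: cinner_add_left)

lemmas cinner_simps = cinner_add_left cinner_add_right cinner_diff_left cinner_diff_right
  cinner_scaleC_left cinner_scaleC_right cinner_sum_left cinner_sum_right
  cinner_minus_left cinner_minus_right

lemma cinner_eq_zero_iff: "cinner x x = 0 \<longleftrightarrow> (x::'a::complex_inner) = 0"
  by (simp add: cinner_self)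

lemma norm_sq_cinner: "(norm (x::'a::complex_inner))\<^sup>2 = Re (cinner x x)"
  by (simp add: cinner_self)

lemma cinner_zero_commute: "cinner x y = 0 \<longleftrightarrow> cinner y (x::'a::complex_inner) = 0"
  by (metis cinner_commute complex_cnj_zero_iff)

lemma norm_scaleC: "norm (c *\<^sub>C x) = cmod c * norm (x::'a::complex_inner)"
proof -
  have "complex_of_real ((norm (c *\<^sub>C x))\<^sup>2) = cnj c * c * cinner x x"
    by (simp only: cinner_self[symmetric] cinner_scaleC_left cinner_scaleC_right mult.assoc)
      (simp add: mult_ac)
  also have "\<dots> = of_real ((cmod c * norm x)\<^sup>2)"
    by (simp only: cinner_self of_real_mult power_mult_distrib complex_norm_square) (simp add: mult_ac)
  finally have "complex_of_real ((norm (c *\<^sub>C x))\<^sup>2) = of_real ((cmod c * norm x)\<^sup>2)" .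
  then have "(norm (c *\<^sub>C x))\<^sup>2 = (cmod c * norm x)\<^sup>2" by (simp only: of_real_eq_iff)
  then show ?thesis by (simp add: power2_eq_iff_nonneg)
qed

lemma norm_add_sq: "(norm (x + y))\<^sup>2 = (norm x)\<^sup>2 + (norm y)\<^sup>2 + 2 * Re (cinner x (y::'a::complex_inner))"
proof -
  have "Re (cinner y x) = Re (cinner x y)" by (subst cinner_commute) simp
  then show ?thesis by (simp add: norm_sq_cinner cinner_add_left cinner_add_right)
qed

lemma norm_add_sq_orthogonal:
  "cinner x y = 0 \<Longrightarrow> (norm (x + y))\<^sup>2 = (norm x)\<^sup>2 + (norm (y::'a::complex_inner))\<^sup>2"
  by (simp add: norm_add_sq)

lemma cinner_cauchy_schwarz: "cmod (cinner x y) \<le> norm x * norm (y::'a::complex_inner)"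
proof (cases "y = 0")
  case False
  define c where "c = cinner y x / of_real ((norm y)\<^sup>2)"
  define r where "r = x - c *\<^sub>C y"
  have ny: "(norm y)\<^sup>2 > 0" using False by simp
  have "cinner y r = 0"
    unfolding r_def c_def using False
    by (simp add: cinner_diff_right cinner_scaleC_right cinner_self)
  then have "cinner (c *\<^sub>C y) r = 0" by (simp add: cinner_scaleC_left)
  then have "(norm (c *\<^sub>C y + r))\<^sup>2 = (norm (c *\<^sub>C y))\<^sup>2 + (norm r)\<^sup>2"
    by (rule norm_add_sq_orthogonal)
  then have "(norm (c *\<^sub>C y))\<^sup>2 \<le> (norm x)\<^sup>2" by (simp add: r_def)
  then have "cmod c * norm y \<le> norm x"
    unfolding norm_scaleC by (rule power2_le_imp_le) simp
  then have "cmod (cinner y x) \<le> norm x * norm y"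
    using False by (simp add: c_def norm_divide norm_power power2_eq_square field_simps norm_mult)
  then show ?thesis by (metis cinner_commute complex_mod_cnj)
qed simp

lemma bounded_bilinear_cinner:
  "bounded_bilinear (cinner :: 'a::complex_inner \<Rightarrow> 'a \<Rightarrow> complex)"
proof
  show "\<exists>K. \<forall>a b. norm (cinner a b) \<le> norm (a::'a) * norm (b::'a) * K"
    by (intro exI[of _ 1]) (simp add: cinner_cauchy_schwarz)
qed (auto simp: cinner_simps cinner_scaleR_left cinner_scaleR_right scaleR_conv_of_real)

lemma bounded_bilinear_scaleC:
  "bounded_bilinear (scaleC :: complex \<Rightarrow> 'a::complex_inner \<Rightarrow> 'a)"
proof
  show "\<exists>K. \<forall>a b. norm (a *\<^sub>C (b::'a)) \<le> norm a * norm b * K"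
    by (intro exI[of _ 1]) (simp add: norm_scaleC)
qed (auto simp: scaleC_add_left scaleC_add_right scaleR_scaleC scaleC_scaleC scaleR_conv_of_real
    mult.commute)

lemmas tendsto_cinner [tendsto_intros] = bounded_bilinear.tendsto[OF bounded_bilinear_cinner]
lemmas tendsto_scaleC [tendsto_intros] = bounded_bilinear.tendsto[OF bounded_bilinear_scaleC]
lemmas continuous_on_cinner [continuous_intros] =
  bounded_bilinear.continuous_on[OF bounded_bilinear_cinner]
lemmas bounded_linear_cinner_right = bounded_bilinear.bounded_linear_right[OF bounded_bilinear_cinner]

lemma cinner_eqI: "(\<And>y. cinner y x = cinner y x') \<Longrightarrow> x = (x'::'a::complex_inner)"
  by (metis cinner_diff_right cinner_eq_zero_iff eq_iff_diff_eq_0)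

lemma onb_total:
  assumes "is_onb B" "\<And>b. b \<in> B \<Longrightarrow> cinner b x = 0"
  shows "x = 0"
proof -
  have sub: "cspan B \<subseteq> {y. cinner y x = 0}"
    by (rule complex_vector.span_minimal)
      (auto simp: assms(2) complex_vector.subspace_def cinner_simps)
  have "closed {y. cinner y x = 0}"
    by (intro closed_Collect_eq continuous_intros)
  then have "closure (cspan B) \<subseteq> {y. cinner y x = 0}"
    using sub by (simp add: closure_minimal)
  then have "cinner x x = 0" using assms(1) unfolding is_onb_def by auto
  then show ?thesis by (simp add: cinner_eq_zero_iff)
qed

text \<open>Zero vectors are allowed, so that finite systems can be continued to infinite sequences.\<close>

definition orthosys :: "'i set \<Rightarrow> ('i \<Rightarrow> 'a::complex_inner) \<Rightarrow> bool"
  where "orthosys F f \<longleftrightarrow>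
    (\<forall>i\<in>F. \<forall>j\<in>F. cinner (f i) (f j) = (if i = j \<and> f i \<noteq> 0 then 1 else 0))"

lemma orthosys_subset: "orthosys G f \<Longrightarrow> F \<subseteq> G \<Longrightarrow> orthosys F f"
  unfolding orthosys_def by blast

lemma orthosys_norm_le: "orthosys F f \<Longrightarrow> i \<in> F \<Longrightarrow> norm (f i) \<le> 1"
proof -
  assume "orthosys F f" "i \<in> F"
  then have "cinner (f i) (f i) = 0 \<or> cinner (f i) (f i) = 1" unfolding orthosys_def by auto
  then have "(norm (f i))\<^sup>2 = 0 \<or> (norm (f i))\<^sup>2 = 1" by (auto simp: norm_sq_cinner)
  then show ?thesis by (auto simp: power2_eq_1_iff)
qed

lemma orthosys_norm_eq: "orthosys F f \<Longrightarrow> i \<in> F \<Longrightarrow> f i \<noteq> 0 \<Longrightarrow> norm (f i) = 1"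
proof -
  assume "orthosys F f" "i \<in> F" "f i \<noteq> 0"
  then have "cinner (f i) (f i) = 1" unfolding orthosys_def by auto
  then have "(norm (f i))\<^sup>2 = 1" by (simp add: norm_sq_cinner)
  then show ?thesis using norm_ge_zero[of "f i"] by (simp add: power2_eq_1_iff)
qed

lemma orthosysI:
  assumes "\<And>i. i \<in> F \<Longrightarrow> norm (f i) = 1 \<or> f i = 0"
    and "\<And>i j. i \<in> F \<Longrightarrow> j \<in> F \<Longrightarrow> i \<noteq> j \<Longrightarrow> cinner (f i) (f j) = 0"
  shows "orthosys F f"
  unfolding orthosys_def using assms by (fastforce simp: cinner_self)

lemma orthosys_orthogonal: "orthosys F f \<Longrightarrow> i \<in> F \<Longrightarrow> j \<in> F \<Longrightarrow> i \<noteq> j \<Longrightarrow> cinner (f i) (f j) = 0"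
  unfolding orthosys_def by auto

lemma orthosys_cinner_sum:
  assumes "orthosys F f" "finite F" "i \<in> F"
  shows "cinner (f i) (\<Sum>j\<in>F. cinner (f j) x *\<^sub>C f j) = cinner (f i) x"
proof -
  have "cinner (f i) (\<Sum>j\<in>F. cinner (f j) x *\<^sub>C f j)
      = (\<Sum>j\<in>F. if j = i then cinner (f i) x else 0)"
    unfolding cinner_sum_right cinner_scaleC_right using assms
    by (intro sum.cong) (auto simp: orthosys_def)
  then show ?thesis using assms by simp
qed

lemma orthosys_norm_sum:
  assumes "orthosys F f" "finite F"
  shows "(norm (\<Sum>j\<in>F. c j *\<^sub>C f j))\<^sup>2 = (\<Sum>j\<in>F. if f j = 0 then 0 else (cmod (c j))\<^sup>2)"
proof -
  have "cinner (\<Sum>j\<in>F. c j *\<^sub>C f j) (\<Sum>j\<in>F. c j *\<^sub>C f j)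
      = (\<Sum>i\<in>F. \<Sum>j\<in>F. c i * (cnj (c j) * cinner (f j) (f i)))"
    unfolding cinner_sum_right cinner_scaleC_right cinner_sum_left cinner_scaleC_left
    by (simp only: sum_distrib_left)
  also have "\<dots> = (\<Sum>i\<in>F. \<Sum>j\<in>F. if j = i then (if f i = 0 then 0 else of_real ((cmod (c i))\<^sup>2)) else 0)"
    using assms(1) by (intro sum.cong refl) (auto simp: orthosys_def complex_norm_square simp del: of_real_power)
  also have "\<dots> = (\<Sum>i\<in>F. if f i = 0 then 0 else of_real ((cmod (c i))\<^sup>2))"
    using assms by simp
  also have "\<dots> = of_real (\<Sum>i\<in>F. if f i = 0 then 0 else (cmod (c i))\<^sup>2)"
    unfolding of_real_sum by (intro sum.cong) auto
  finally show ?thesis unfolding cinner_self by (simp only: of_real_eq_iff)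
qed

text \<open>Zero vectors of the system contribute nothing to either sum, so the Pythagorean identity
  keeps its usual form.\<close>

lemma orthosys_decomp:
  assumes f: "orthosys F f" and fin: "finite F"
  obtains r where "x = (\<Sum>j\<in>F. cinner (f j) x *\<^sub>C f j) + r"
    and "\<And>i. i \<in> F \<Longrightarrow> cinner (f i) r = 0"
    and "(norm x)\<^sup>2 = (\<Sum>j\<in>F. (cmod (cinner (f j) x))\<^sup>2) + (norm r)\<^sup>2"
proof -
  define s where "s = (\<Sum>j\<in>F. cinner (f j) x *\<^sub>C f j)"
  have orth: "cinner (f i) (x - s) = 0" if "i \<in> F" for i
    using orthosys_cinner_sum[OF f fin that] by (simp add: s_def cinner_diff_right)
  have "cinner s (x - s) = 0"
    unfolding s_def cinner_sum_left cinner_scaleC_left using orth unfolding s_def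
    by (intro sum.neutral) auto
  then have "(norm (s + (x - s)))\<^sup>2 = (norm s)\<^sup>2 + (norm (x - s))\<^sup>2"
    by (rule norm_add_sq_orthogonal)
  moreover have "(norm s)\<^sup>2 = (\<Sum>j\<in>F. (cmod (cinner (f j) x))\<^sup>2)"
    unfolding s_def orthosys_norm_sum[OF f fin] by (intro sum.cong) auto
  ultimately show ?thesis using orth that[of "x - s"] by (simp add: s_def)
qed

lemma bessel:
  assumes "orthosys F f" "finite F"
  shows "(\<Sum>j\<in>F. (cmod (cinner (f j) x))\<^sup>2) \<le> (norm x)\<^sup>2"
  by (metis orthosys_decomp[OF assms, of x] le_add_same_cancel1 zero_le_power2)

text \<open>The bound \<open>card B \<le> card S\<close> is the point: the counting in the min-max
  and Ky Fan arguments needs an orthonormal basis of the span that is no larger than the given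
  family.\<close>

lemma gram_schmidt:
  assumes "finite S"
  obtains B :: "'a::complex_inner set" where "finite B" "card B \<le> card S" "orthosys B (\<lambda>b. b)"
    "0 \<notin> B" "\<And>x. x \<in> S \<Longrightarrow> x = (\<Sum>b\<in>B. cinner b x *\<^sub>C b)"
proof -
  have "\<exists>B. finite B \<and> card B \<le> card S \<and> orthosys B (\<lambda>b. b) \<and> 0 \<notin> B \<and>
    (\<forall>x\<in>S. x = (\<Sum>b\<in>B. cinner b x *\<^sub>C b))"
    using assms
  proof (induction S)
    case empty
    then show ?case by (intro exI[of _ "{}"]) (auto simp: orthosys_def)
  next
    case (insert y S)
    then obtain B where B: "finite B" "card B \<le> card S" "orthosys B (\<lambda>b. b)" "0 \<notin> B"
      "\<And>x. x \<in> S \<Longrightarrow> x = (\<Sum>b\<in>B. cinner b x *\<^sub>C b)" by blast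
    obtain r where r: "y = (\<Sum>b\<in>B. cinner b y *\<^sub>C b) + r"
      "\<And>b. b \<in> B \<Longrightarrow> cinner b r = 0"
      using orthosys_decomp[OF B(3,1), of y] by metis
    show ?case
    proof (cases "r = 0")
      case True
      then show ?thesis using B r(1) insert.hyps
        by (intro exI[of _ B]) auto
    next
      case False
      define u where "u = (1 / norm r) *\<^sub>R r"
      have nu: "norm u = 1" using False by (simp add: u_def)
      have ur: "cinner b u = 0" "cinner u b = 0" if "b \<in> B" for b
        using r(2)[OF that] by (auto simp: u_def cinner_scaleR_right cinner_scaleR_left cinner_zero_commute[of r])
      have uB: "u \<notin> B" using ur(1)[of u] nu by (auto simp: cinner_eq_zero_iff)
      have "orthosys (insert u B) (\<lambda>b. b)"
        using B(3) ur nu uB unfolding orthosys_def by (auto simp: cinner_self)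
      moreover have "x = (\<Sum>b\<in>insert u B. cinner b x *\<^sub>C b)" if "x \<in> insert y S" for x
      proof (cases "x = y")
        case True
        have "cinner u y = of_real (norm r)"
          by (subst r(1)) (use ur False in \<open>simp add: cinner_simps u_def cinner_scaleR_left cinner_self power2_eq_square\<close>)
        then have "cinner u y *\<^sub>C u = r" using False
          by (simp add: u_def scaleR_scaleC scaleC_scaleC scaleC_one)
        then show ?thesis using uB B(1) r(1) by (simp add: True add.commute)
      next
        case False
        then have xS: "x \<in> S" using that by simp
        have "cinner u x = 0"
          by (subst B(5)[OF xS]) (use ur in \<open>simp add: cinner_simps\<close>)
        then show ?thesis using uB B(1) B(5)[OF xS] by simp
      qed
      ultimately show ?thesis using B insert.hyps uB nu
        by (intro exI[of _ "insert u B"]) auto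
    qed
  qed
  then show ?thesis using that by blast
qed

lemma orthosys_independent:
  assumes "orthosys F f" "inj_on f F" "0 \<notin> f ` F"
  shows "complex_vector.independent (f ` F)"
proof
  assume "complex_vector.dependent (f ` F)"
  then obtain t u where t: "finite t" "t \<subseteq> f ` F" "(\<Sum>v\<in>t. u v *\<^sub>C v) = 0" "\<exists>v\<in>t. u v \<noteq> 0"
    unfolding complex_vector.dependent_explicit by blast
  then obtain v where v: "v \<in> t" "u v \<noteq> 0" by blast
  have "cinner v w = (if w = v then 1 else 0)" if "w \<in> t" for w
  proof -
    from that v(1) t(2) obtain i j where "i \<in> F" "v = f i" "j \<in> F" "w = f j" by blast
    then show ?thesis using assms unfolding orthosys_def by (auto simp: inj_on_def image_iff)
  qed
  then have "cinner v (\<Sum>w\<in>t. u w *\<^sub>C w) = (\<Sum>w\<in>t. if w = v then u v else 0)"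
    unfolding cinner_sum_right cinner_scaleC_right by (intro sum.cong) auto
  then show False using t(1,3) v by simp
qed

section \<open>Bounded operators\<close>

lemma bounded_clinearI:
  assumes "\<And>x y. T (x + y) = T x + T y" "\<And>c x. T (c *\<^sub>C x) = c *\<^sub>C T x"
    and "\<And>x. norm (T x) \<le> K * norm x"
  shows "bounded_clinear T"
  unfolding bounded_clinear_def
proof (intro conjI allI)
  show "bounded_linear T"
    by (rule bounded_linear_intro[of _ K]) (use assms in \<open>auto simp: scaleR_scaleC mult.commute\<close>)
qed (use assms in auto)

lemma bounded_clinear_bounded_linear: "bounded_clinear T \<Longrightarrow> bounded_linear T"
  by (simp add: bounded_clinear_def)

lemma bounded_clinear_scaleC: "bounded_clinear T \<Longrightarrow> T (c *\<^sub>C x) = c *\<^sub>C T x"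
  by (simp add: bounded_clinear_def)

lemma bounded_clinear_add: "bounded_clinear T \<Longrightarrow> T (x + y) = T x + T y"
  by (simp add: bounded_clinear_bounded_linear bounded_linear.linear linear_add)

lemma bounded_clinear_diff: "bounded_clinear T \<Longrightarrow> T (x - y) = T x - T y"
  by (simp add: bounded_clinear_bounded_linear bounded_linear.linear linear_diff)

lemma bounded_clinear_zero: "bounded_clinear T \<Longrightarrow> T 0 = 0"
  by (simp add: bounded_clinear_bounded_linear bounded_linear.linear linear_0)

lemma bounded_clinear_sum: "bounded_clinear T \<Longrightarrow> T (\<Sum>i\<in>F. f i) = (\<Sum>i\<in>F. T (f i))"
  by (simp add: bounded_clinear_bounded_linear bounded_linear.linear linear_sum)

lemmas bounded_clinear_simps = bounded_clinear_scaleC bounded_clinear_add bounded_clinear_diff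
  bounded_clinear_zero bounded_clinear_sum

lemma bounded_clinear_bound:
  assumes "bounded_clinear T"
  obtains K where "K > 0" "\<And>x. norm (T x) \<le> K * norm x"
  using bounded_linear.pos_bounded[OF bounded_clinear_bounded_linear[OF assms]]
  by (auto simp: mult.commute)

lemma bounded_clinear_tendsto:
  "bounded_clinear T \<Longrightarrow> (f \<longlongrightarrow> x) net \<Longrightarrow> ((\<lambda>n. T (f n)) \<longlongrightarrow> T x) net"
  by (rule bounded_linear.tendsto[OF bounded_clinear_bounded_linear])

lemma bounded_clinear_compose:
  assumes S: "bounded_clinear S" and T: "bounded_clinear T"
  shows "bounded_clinear (S \<circ> T)"
  using bounded_linear_compose[OF S[THEN bounded_clinear_bounded_linear] T[THEN bounded_clinear_bounded_linear]] S T
  by (simp add: bounded_clinear_def o_def)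

lemma bounded_clinear_plus:
  assumes S: "bounded_clinear S" and T: "bounded_clinear T"
  shows "bounded_clinear (\<lambda>x. S x + T x)"
  using bounded_linear_add[OF S[THEN bounded_clinear_bounded_linear] T[THEN bounded_clinear_bounded_linear]] S T
  by (simp add: bounded_clinear_def scaleC_add_right)

lemma bounded_clinear_scale:
  assumes T: "bounded_clinear T"
  shows "bounded_clinear (\<lambda>x. c *\<^sub>C T x)"
  using bounded_linear_compose[OF bounded_bilinear.bounded_linear_right[OF bounded_bilinear_scaleC]
    T[THEN bounded_clinear_bounded_linear], of c] T
  by (simp add: bounded_clinear_def scaleC_scaleC mult.commute)

text \<open>\<open>adj\<close> is defined by a description, whose existence part would in general
  need the Riesz theorem. Carrying an explicit adjoint as a second operator avoids this, since the
  operators constructed here have adjoints in closed form. Boundedness is part of the relation for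
  \<open>S\<close>, not for \<open>T\<close>.\<close>

definition is_adjoint :: "('a::complex_hilbert \<Rightarrow> 'a) \<Rightarrow> ('a \<Rightarrow> 'a) \<Rightarrow> bool"
  where "is_adjoint S T \<longleftrightarrow> bounded_clinear S \<and> (\<forall>x y. cinner (S x) y = cinner x (T y))"

lemma adj_eqI: "is_adjoint S T \<Longrightarrow> adj T = S"
  unfolding adj_def is_adjoint_def
  by (rule the_equality) (metis cinner_commute cinner_eqI ext)+

lemma is_adjointD: "is_adjoint S T \<Longrightarrow> cinner (S x) y = cinner x (T y)"
  by (simp add: is_adjoint_def)

lemma is_adjointD': "is_adjoint S T \<Longrightarrow> cinner x (S y) = cinner (T x) y"
  by (metis is_adjointD cinner_commute)

lemma is_adjoint_bounded: "is_adjoint S T \<Longrightarrow> bounded_clinear S"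
  by (simp add: is_adjoint_def)

lemma is_adjoint_sym: "is_adjoint S T \<Longrightarrow> bounded_clinear T \<Longrightarrow> is_adjoint T S"
  unfolding is_adjoint_def[of T S] using is_adjointD'[of S T] by simp

lemma is_adjoint_compose:
  "is_adjoint S T \<Longrightarrow> is_adjoint S' T' \<Longrightarrow> is_adjoint (S' \<circ> S) (T \<circ> T')"
  unfolding is_adjoint_def using bounded_clinear_compose by (auto simp: o_def)

lemma is_adjoint_plus:
  "is_adjoint S T \<Longrightarrow> is_adjoint S' T' \<Longrightarrow> is_adjoint (\<lambda>x. S x + S' x) (\<lambda>x. T x + T' x)"
  unfolding is_adjoint_def using bounded_clinear_plus by (auto simp: cinner_simps)

lemma is_adjoint_scale: "is_adjoint S T \<Longrightarrow> is_adjoint (\<lambda>x. cnj c *\<^sub>C S x) (\<lambda>x. c *\<^sub>C T x)"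
  unfolding is_adjoint_def using bounded_clinear_scale by (auto simp: cinner_simps)

section \<open>Positive operators\<close>

lemma positive_op_bounded: "positive_op T \<Longrightarrow> bounded_clinear T"
  by (simp add: positive_op_def)

lemma positive_op_cinner: "positive_op T \<Longrightarrow> cinner x (T x) = of_real (Re (cinner x (T x)))"
  unfolding positive_op_def by (metis complex_nonneg_Reals_iff complex_is_Real_iff of_real_Re)

lemma positive_op_nonneg: "positive_op T \<Longrightarrow> 0 \<le> Re (cinner x (T x))"
  unfolding positive_op_def by (simp add: complex_nonneg_Reals_iff)

lemma positive_opI:
  assumes "bounded_clinear T" "\<And>x. cinner x (T x) = of_real (q x)" "\<And>x. 0 \<le> q x"
  shows "positive_op T"
  using assms by (simp add: positive_op_def complex_nonneg_Reals_iff)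

text \<open>Positivity makes the quadratic form real; reality at \<open>x + y\<close> and at
  \<open>x + \<i> *\<^sub>C y\<close> gives symmetry by polarization.\<close>

lemma positive_op_symmetric:
  assumes T: "positive_op T"
  shows "cinner (T x) y = cinner x (T y)"
proof -
  note b = positive_op_bounded[OF T]
  have im: "Im (cinner z (T z)) = 0" for z
    by (subst positive_op_cinner[OF T]) simp
  have "Im (cinner x (T y) + cinner y (T x)) = 0"
    using im[of "x + y"] im[of x] im[of y] by (simp add: bounded_clinear_simps[OF b] cinner_simps)
  moreover have "Re (cinner x (T y) - cinner y (T x)) = 0"
    using im[of "x + \<i> *\<^sub>C y"] im[of x] im[of y] by (simp add: bounded_clinear_simps[OF b] cinner_simps)
  ultimately have "cinner x (T y) = cnj (cinner y (T x))"
    by (simp add: complex_eq_iff)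
  then show ?thesis by (metis cinner_commute)
qed

lemma positive_op_adjoint: "positive_op T \<Longrightarrow> is_adjoint T T"
  by (simp add: is_adjoint_def positive_op_bounded positive_op_symmetric)

lemma positive_op_adjoint_compose:
  assumes "is_adjoint S T" "bounded_clinear T"
  shows "positive_op (S \<circ> T)"
  using assms by (intro positive_opI[of _ "\<lambda>x. (norm (T x))\<^sup>2"])
    (auto simp: bounded_clinear_compose is_adjoint_bounded is_adjointD' cinner_self)

lemma positive_op_conjugate:
  assumes "is_adjoint S T" "bounded_clinear T" "positive_op A"
  shows "positive_op (T \<circ> A \<circ> S)"
  using assms by (intro positive_opI[of _ "\<lambda>x. Re (cinner (S x) (A (S x)))"])
    (auto simp: bounded_clinear_compose is_adjoint_bounded is_adjointD[symmetric]
      positive_op_bounded positive_op_nonneg positive_op_cinner[symmetric])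

lemma positive_op_plus: "positive_op S \<Longrightarrow> positive_op T \<Longrightarrow> positive_op (\<lambda>x. S x + T x)"
  by (intro positive_opI[of _ "\<lambda>x. Re (cinner x (S x)) + Re (cinner x (T x))"])
    (auto simp: bounded_clinear_plus positive_op_bounded cinner_add_right positive_op_nonneg
      positive_op_cinner[symmetric])

lemma positive_op_scale: "positive_op T \<Longrightarrow> 0 \<le> c \<Longrightarrow> positive_op (\<lambda>x. of_real c *\<^sub>C T x)"
  by (intro positive_opI[of _ "\<lambda>x. c * Re (cinner x (T x))"])
    (auto simp: bounded_clinear_scale positive_op_bounded cinner_scaleC_right positive_op_nonneg
      positive_op_cinner[symmetric])

text \<open>The form at x - t T x is a nonnegative quadratic in t, and its discriminant gives the
  estimate. The bound \<open>K\<close> is asked for at \<open>T x\<close> alone, so that a bound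
  valid on an invariant subspace can be used.\<close>

lemma positive_op_norm_sq_le:
  assumes T: "positive_op T" and K: "0 \<le> K" "Re (cinner (T x) (T (T x))) \<le> K * (norm (T x))\<^sup>2"
  shows "(norm (T x))\<^sup>2 \<le> K * Re (cinner x (T x))"
proof -
  note b = positive_op_bounded[OF T]
  define p n where "p = Re (cinner x (T x))" and "n = (norm (T x))\<^sup>2"
  have quad: "0 \<le> p - 2 * t * n + t\<^sup>2 * (K * n)" for t
  proof -
    have "0 \<le> Re (cinner (x - of_real t *\<^sub>C T x) (T (x - of_real t *\<^sub>C T x)))"
      by (rule positive_op_nonneg[OF T])
    also have "\<dots> = p - 2 * t * n + t\<^sup>2 * Re (cinner (T x) (T (T x)))"
      unfolding p_def n_def norm_sq_cinner positive_op_symmetric[OF T, of x "T x"]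
        bounded_clinear_simps[OF b] cinner_diff_left cinner_diff_right cinner_scaleC_left
        cinner_scaleC_right
      by (simp add: positive_op_symmetric[OF T, of x "T x"] power2_eq_square algebra_simps)
    also have "\<dots> \<le> p - 2 * t * n + t\<^sup>2 * (K * n)"
      using K(2) by (simp add: n_def mult_left_mono)
    finally show ?thesis .
  qed
  show ?thesis
  proof (cases "K = 0")
    case True
    have "n = 0"
    proof (rule ccontr)
      assume "n \<noteq> 0"
      then have "n > 0" by (simp add: n_def)
      \<comment> \<open>For \<open>K = 0\<close> the quadratic degenerates to an affine function of
        \<open>t\<close> with negative slope; at this \<open>t\<close> its value is -1.\<close>
      then show False using quad[of "(p + 1) / (2 * n)"] by (simp add: True)
    qed
    then show ?thesis by (simp add: True n_def)
  next
    case False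
    then have "K > 0" using K by simp
    \<comment> \<open>\<open>t = 1 / K\<close> minimizes the right-hand side of
      \<open>quad\<close>.\<close>
    then show ?thesis using quad[of "1 / K"]
      unfolding p_def[symmetric] n_def[symmetric] by (simp add: field_simps power2_eq_square)
  qed
qed

section \<open>Compact operators\<close>

lemma compact_op_bounded: "compact_op T \<Longrightarrow> bounded_clinear T"
  by (simp add: compact_op_def)

lemma compact_op_subseq:
  assumes "compact_op T" "\<And>n. norm (x n) \<le> 1"
  obtains r y where "strict_mono (r :: nat \<Rightarrow> nat)" "(\<lambda>n. T (x (r n))) \<longlonglongrightarrow> y"
proof -
  have "compact (closure (T ` cball 0 1))" using assms by (simp add: compact_op_def)
  moreover have "T (x n) \<in> closure (T ` cball 0 1)" for n
    using assms(2)[of n] by (intro closure_subset[THEN subsetD]) auto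
  ultimately obtain l r where "strict_mono (r :: nat \<Rightarrow> nat)" "((\<lambda>n. T (x n)) \<circ> r) \<longlonglongrightarrow> l"
    unfolding compact_def by metis
  then show ?thesis using that by (simp add: o_def)
qed

lemma compact_op_subset:
  assumes "bounded_clinear T" "T ` cball 0 1 \<subseteq> K" "compact K"
  shows "compact_op T"
proof -
  have "closure (T ` cball 0 1) \<subseteq> K" using assms by (simp add: closure_minimal compact_imp_closed)
  then have "closure (T ` cball 0 1) = K \<inter> closure (T ` cball 0 1)" by auto
  then show ?thesis using assms(1,3) compact_Int_closed[of K "closure (T ` cball 0 1)"]
    by (simp add: compact_op_def)
qed

lemma compact_op_compose_left:
  assumes "bounded_clinear S" "compact_op T"
  shows "compact_op (S \<circ> T)"
proof (rule compact_op_subset)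
  show "bounded_clinear (S \<circ> T)" using assms by (simp add: bounded_clinear_compose compact_op_bounded)
  show "(S \<circ> T) ` cball 0 1 \<subseteq> S ` closure (T ` cball 0 1)"
    using closure_subset by (fastforce simp: image_comp[symmetric])
  show "compact (S ` closure (T ` cball 0 1))"
    using assms by (intro compact_continuous_image linear_continuous_on bounded_clinear_bounded_linear)
      (auto simp: compact_op_def)
qed

lemma compact_op_compose_right:
  assumes "compact_op T" "bounded_clinear S"
  shows "compact_op (T \<circ> S)"
proof -
  obtain K where K: "K > 0" "\<And>x. norm (S x) \<le> K * norm x"
    using bounded_clinear_bound[OF assms(2)] by blast
  note T = compact_op_bounded[OF assms(1)]
  show ?thesis
  proof (rule compact_op_subset)
    show "bounded_clinear (T \<circ> S)" using assms by (simp add: bounded_clinear_compose T)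
    show "(T \<circ> S) ` cball 0 1 \<subseteq> (\<lambda>x. K *\<^sub>R x) ` closure (T ` cball 0 1)"
    proof
      fix z assume "z \<in> (T \<circ> S) ` cball 0 1"
      then obtain x where x: "norm x \<le> 1" "z = T (S x)" by auto
      have "norm (S x) \<le> K" using K(2)[of x] K(1) x(1)
        by (meson mult_left_le order.strict_implies_order order_trans)
      then have "T ((1 / K) *\<^sub>R S x) \<in> closure (T ` cball 0 1)"
        using K(1) by (intro closure_subset[THEN subsetD] imageI) simp
      moreover have "z = K *\<^sub>R T ((1 / K) *\<^sub>R S x)"
        using K(1) x(2) by (simp add: bounded_clinear_simps[OF T] scaleR_scaleC scaleC_scaleC scaleC_one)
      ultimately show "z \<in> (\<lambda>x. K *\<^sub>R x) ` closure (T ` cball 0 1)" by blast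
    qed
    show "compact ((\<lambda>x. K *\<^sub>R x) ` closure (T ` cball 0 1))"
      using assms by (intro compact_scaling) (auto simp: compact_op_def)
  qed
qed

lemma compact_op_plus:
  assumes "compact_op S" "compact_op T"
  shows "compact_op (\<lambda>x. S x + T x)"
proof (rule compact_op_subset)
  show "bounded_clinear (\<lambda>x. S x + T x)" using assms by (simp add: bounded_clinear_plus compact_op_bounded)
  show "(\<lambda>x. S x + T x) ` cball 0 1 \<subseteq>
    {x + y |x y. x \<in> closure (S ` cball 0 1) \<and> y \<in> closure (T ` cball 0 1)}"
  proof
    fix z assume "z \<in> (\<lambda>x. S x + T x) ` cball 0 1"
    then obtain x where x: "x \<in> cball 0 1" "z = S x + T x" by blast
    then have "S x \<in> closure (S ` cball 0 1)" "T x \<in> closure (T ` cball 0 1)"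
      by (meson closure_subset imageI subsetD)+
    then show "z \<in> {x + y |x y. x \<in> closure (S ` cball 0 1) \<and> y \<in> closure (T ` cball 0 1)}"
      using x(2) by blast
  qed
  show "compact {x + y |x y. x \<in> closure (S ` cball 0 1) \<and> y \<in> closure (T ` cball 0 1)}"
    using assms by (intro compact_sums) (auto simp: compact_op_def)
qed

section \<open>Eigenvalues and singular values of compact operators\<close>

text \<open>A maximizing sequence of the quadratic form on the unit ball of \<open>W\<close>
  consists of approximate eigenvectors for the supremum \<open>M\<close>, and for
  \<open>M > 0\<close> compactness of \<open>A\<close> makes a subsequence converge. The value
  \<open>v = 0\<close> stands for \<open>M = 0\<close>, which keeps the later recursion
  total.\<close>

lemma compact_positive_eigenvector:
  assumes A: "positive_op A" "compact_op A"
    and W: "closed W" "0 \<in> W" "\<And>c x. x \<in> W \<Longrightarrow> c *\<^sub>C x \<in> W" "\<And>x. x \<in> W \<Longrightarrow> A x \<in> W"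
  obtains v where "v \<in> W" "norm v = 1 \<or> v = 0" "A v = of_real (Re (cinner v (A v))) *\<^sub>C v"
    "Re (cinner v (A v)) = 0 \<longleftrightarrow> v = 0"
    "\<And>x. x \<in> W \<Longrightarrow> Re (cinner x (A x)) \<le> Re (cinner v (A v)) * (norm x)\<^sup>2"
proof -
  note b = positive_op_bounded[OF A(1)]
  obtain K where K: "K > 0" "\<And>x. norm (A x) \<le> K * norm x" using bounded_clinear_bound[OF b] by blast
  define Q where "Q = (\<lambda>x. Re (cinner x (A x))) ` (W \<inter> cball 0 1)"
  define M where "M = Sup Q"
  have bd: "bdd_above Q"
  proof (rule bdd_aboveI)
    fix q assume "q \<in> Q"
    then obtain x where x: "norm x \<le> 1" "q = Re (cinner x (A x))" by (auto simp: Q_def)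
    have "q \<le> norm x * norm (A x)" unfolding x(2)
      by (rule order_trans[OF complex_Re_le_cmod cinner_cauchy_schwarz])
    also have "\<dots> \<le> 1 * (K * 1)"
      using x(1) K by (intro mult_mono order_trans[OF K(2)] mult_left_mono) auto
    finally show "q \<le> K" by simp
  qed
  have Q0: "0 \<in> Q" using W(2) unfolding Q_def by (intro image_eqI[of _ _ 0]) auto
  have M0: "M \<ge> 0" unfolding M_def using Q0 bd by (rule cSup_upper)
  have le: "Re (cinner x (A x)) \<le> M * (norm x)\<^sup>2" if x: "x \<in> W" for x
  proof (cases "x = 0")
    case False
    define u where "u = of_real (1 / norm x) *\<^sub>C x"
    have "u \<in> W \<inter> cball 0 1" using x W(3) False by (auto simp: u_def norm_scaleC norm_divide)
    then have "Re (cinner u (A u)) \<le> M" unfolding M_def using bd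
      by (intro cSup_upper) (auto simp: Q_def)
    moreover have "Re (cinner u (A u)) = Re (cinner x (A x)) / (norm x)\<^sup>2"
      by (simp add: u_def bounded_clinear_simps[OF b] cinner_simps power2_eq_square)
    ultimately show ?thesis using False by (simp add: field_simps)
  qed (simp add: bounded_clinear_zero[OF b])
  show ?thesis
  proof (cases "M = 0")
    case True
    show ?thesis using le W(2) by (intro that[of 0]) (auto simp: True bounded_clinear_zero[OF b])
  next
    case False
    then have Mp: "M > 0" using M0 by simp
    have "\<exists>x. x \<in> W \<and> norm x \<le> 1 \<and> M - 1 / real (Suc n) < Re (cinner x (A x))" for n
    proof -
      have "M - 1 / real (Suc n) < Sup Q" by (simp add: M_def)
      then obtain q where "q \<in> Q" "M - 1 / real (Suc n) < q"
        using Q0 less_cSup_iff[OF _ bd] by blast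
      then show ?thesis by (auto simp: Q_def)
    qed
    then obtain x where x: "\<And>n. x n \<in> W" "\<And>n. norm (x n) \<le> 1"
      "\<And>n. M - 1 / real (Suc n) < Re (cinner (x n) (A (x n)))" by metis
    obtain r y where r: "strict_mono (r :: nat \<Rightarrow> nat)" and y: "(\<lambda>n. A (x (r n))) \<longlonglongrightarrow> y"
      by (rule compact_op_subseq[where T = A and x = x]) (use A(2) x(2) in blast)+
    have xle: "Re (cinner (x n) (A (x n))) \<le> M" for n
      using x(2)[of n] Mp by (intro order_trans[OF le[OF x(1)]]) (simp add: power_le_one mult_left_le)
    have conv: "(\<lambda>n. Re (cinner (x n) (A (x n)))) \<longlonglongrightarrow> M"
    proof (rule tendsto_sandwich[OF _ _ _ tendsto_const])
      show "(\<lambda>n. M - 1 / real (Suc n)) \<longlonglongrightarrow> M"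
        using tendsto_diff[OF tendsto_const LIMSEQ_inverse_real_of_nat, of M] by (simp add: inverse_eq_divide)
    qed (use xle x(3) in \<open>auto intro!: always_eventually less_imp_le\<close>)
    \<comment> \<open>Expanding the square and inserting \<open>positive_op_norm_sq_le\<close>,
      which applies because \<open>W\<close> is invariant, makes the eigenvector defect proportional
      to the distance from the supremum.\<close>
    have small: "(norm (A (x n) - of_real M *\<^sub>C x n))\<^sup>2 \<le> M * (M - Re (cinner (x n) (A (x n))))" for n
    proof -
      have "(norm (A (x n) + of_real (- M) *\<^sub>C x n))\<^sup>2
        = (norm (A (x n)))\<^sup>2 + M\<^sup>2 * (norm (x n))\<^sup>2 - 2 * M * Re (cinner (x n) (A (x n)))"
        unfolding norm_add_sq norm_scaleC cinner_scaleC_right positive_op_symmetric[OF A(1)]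
        by (simp add: power_mult_distrib)
      also have "\<dots> \<le> M * Re (cinner (x n) (A (x n))) + M\<^sup>2 * 1 - 2 * M * Re (cinner (x n) (A (x n)))"
        using positive_op_norm_sq_le[OF A(1) M0 le[OF W(4)[OF x(1)]]] x(2)[of n] M0
        by (intro add_mono diff_mono mult_left_mono) (auto simp: power_le_one)
      finally show ?thesis by (simp add: power2_eq_square algebra_simps)
    qed
    have "(\<lambda>n. (norm (A (x n) - of_real M *\<^sub>C x n))\<^sup>2) \<longlonglongrightarrow> 0"
    proof (rule tendsto_sandwich[OF _ _ tendsto_const])
      show "(\<lambda>n. M * (M - Re (cinner (x n) (A (x n))))) \<longlonglongrightarrow> 0"
        using tendsto_mult[OF tendsto_const tendsto_diff[OF tendsto_const conv], of M M] by simp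
    qed (use small in auto)
    then have "(\<lambda>n. sqrt ((norm (A (x n) - of_real M *\<^sub>C x n))\<^sup>2)) \<longlonglongrightarrow> sqrt 0"
      by (rule tendsto_real_sqrt)
    then have z: "(\<lambda>n. A (x n) - of_real M *\<^sub>C x n) \<longlonglongrightarrow> 0"
      by (simp add: tendsto_norm_zero_iff)
    have "(\<lambda>n. A (x (r n)) - (A (x (r n)) - of_real M *\<^sub>C x (r n))) \<longlonglongrightarrow> y - 0"
      using LIMSEQ_subseq_LIMSEQ[OF z r] by (intro tendsto_diff y) (simp add: o_def)
    then have "(\<lambda>n. of_real (1 / M) *\<^sub>C (of_real M *\<^sub>C x (r n))) \<longlonglongrightarrow> of_real (1 / M) *\<^sub>C y"
      by (intro tendsto_scaleC tendsto_const) simp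
    then have lim: "(\<lambda>n. x (r n)) \<longlonglongrightarrow> of_real (1 / M) *\<^sub>C y"
      using Mp by (simp add: scaleC_scaleC scaleC_one flip: of_real_mult)
    define v where "v = of_real (1 / M) *\<^sub>C y"
    have vW: "v \<in> W" unfolding v_def using W(1) x(1) lim by (rule closed_sequentially[of W "\<lambda>n. x (r n)"])
    have Av: "A v = y" using LIMSEQ_unique[OF bounded_clinear_tendsto[OF b lim] y] by (simp add: v_def)
    then have Av': "A v = of_real M *\<^sub>C v" using Mp by (simp add: v_def scaleC_scaleC scaleC_one)
    have "(\<lambda>n. Re (cinner (x (r n)) (A (x (r n))))) \<longlonglongrightarrow> Re (cinner v (A v))"
      unfolding Av using lim y by (intro tendsto_intros) (auto simp: v_def)
    moreover have "(\<lambda>n. Re (cinner (x (r n)) (A (x (r n))))) \<longlonglongrightarrow> M"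
      using LIMSEQ_subseq_LIMSEQ[OF conv r] by (simp add: o_def)
    ultimately have M: "Re (cinner v (A v)) = M" by (rule LIMSEQ_unique)
    have "(norm v)\<^sup>2 = 1" using M Mp unfolding Av' by (simp add: cinner_scaleC_right cinner_self)
    then have "norm v = 1" using norm_ge_zero[of v] by (simp add: power2_eq_1_iff)
    then show ?thesis using vW Av' M Mp le by (intro that[of v]) auto
  qed
qed

text \<open>The last clause is a variational form of completeness. Together with
  \<open>l \<longlonglongrightarrow> 0\<close> it makes the quadratic form nonpositive on the
  orthogonal complement of the whole system, so kernel vectors need not be listed; zero vectors fill
  their places.\<close>

definition eig_system :: "('a::complex_hilbert \<Rightarrow> 'a) \<Rightarrow> (nat \<Rightarrow> real) \<Rightarrow> (nat \<Rightarrow> 'a) \<Rightarrow> bool"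
  where "eig_system A l e \<longleftrightarrow> decseq l \<and> l \<longlonglongrightarrow> 0 \<and> orthosys UNIV e \<and>
    (\<forall>n. 0 \<le> l n \<and> A (e n) = of_real (l n) *\<^sub>C e n \<and> (l n = 0 \<longleftrightarrow> e n = 0)) \<and>
    (\<forall>n x. (\<forall>i<n. cinner (e i) x = 0) \<longrightarrow> Re (cinner x (A x)) \<le> l n * (norm x)\<^sup>2)"

text \<open>One step of the greedy construction, given the set \<open>S\<close> of vectors already
  chosen.\<close>

definition max_vector :: "('a::complex_hilbert \<Rightarrow> 'a) \<Rightarrow> 'a set \<Rightarrow> 'a \<Rightarrow> bool"
  where "max_vector A S v \<longleftrightarrow> (\<forall>s\<in>S. cinner s v = 0) \<and> (norm v = 1 \<or> v = 0) \<and>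
    A v = of_real (Re (cinner v (A v))) *\<^sub>C v \<and> (Re (cinner v (A v)) = 0 \<longleftrightarrow> v = 0) \<and>
    (\<forall>x. (\<forall>s\<in>S. cinner s x = 0) \<longrightarrow> Re (cinner x (A x)) \<le> Re (cinner v (A v)) * (norm x)\<^sup>2)"

lemma max_vector_exists:
  assumes A: "positive_op A" "compact_op A" and S: "\<And>s. s \<in> S \<Longrightarrow> \<exists>c. A s = of_real c *\<^sub>C s"
  shows "\<exists>v. max_vector A S v"
proof -
  define W where "W = {x. \<forall>s\<in>S. cinner s x = 0}"
  have "W = (\<Inter>s\<in>S. {x. cinner s x = 0})" by (auto simp: W_def)
  moreover have "closed {x. cinner s x = 0}" for s :: 'a
    by (intro closed_Collect_eq continuous_intros)
  ultimately have cl: "closed W" by auto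
  have inv: "A x \<in> W" if "x \<in> W" for x
    unfolding W_def
  proof (intro CollectI ballI)
    fix s assume s: "s \<in> S"
    obtain c where c: "A s = of_real c *\<^sub>C s" using S[OF s] by blast
    have "cinner s (A x) = cinner (A s) x" by (rule positive_op_symmetric[OF A(1), symmetric])
    also have "\<dots> = 0" using that s by (simp add: c cinner_scaleC_left W_def)
    finally show "cinner s (A x) = 0" .
  qed
  show ?thesis
    by (rule compact_positive_eigenvector[OF A cl _ _ inv])
      (auto simp: W_def cinner_scaleC_right max_vector_def)
qed

lemma orthosys_image_less:
  assumes "\<And>n. norm (e n) = 1 \<or> e n = 0" "\<And>n i. i < n \<Longrightarrow> cinner (e i) (e n) = 0"
  shows "orthosys (UNIV :: nat set) e"
proof (rule orthosysI)
  fix i j :: nat assume "i \<noteq> j"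
  then show "cinner (e i) (e j) = 0"
    using assms(2)[of i j] assms(2)[of j i] cinner_zero_commute[of "e i" "e j"] by (cases "i < j") auto
qed (use assms in auto)

text \<open>Eigenvectors are chosen greedily, each maximizing the form orthogonally to its
  predecessors. The eigenvalues tend to 0 because orthogonal unit eigenvectors with eigenvalues at
  least \<open>L > 0\<close> have images at distance at least \<open>L\<close>, while compactness
  yields a convergent subsequence of images.\<close>

lemma eig_system_exists:
  assumes A: "positive_op A" "compact_op A"
  shows "\<exists>l e. eig_system A l e"
proof -
  \<comment> \<open>The state of the recursion is the set of all previous vectors, since the next
    vector depends on all of them; \<open>st_eq\<close> identifies it as the image of {..<n} under
    \<open>e\<close>.\<close>
  define st where "st = rec_nat {} (\<lambda>_ S. insert (SOME v. max_vector A S v) S)"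
  define e where "e n = (SOME v. max_vector A (st n) v)" for n
  have st_Suc: "st 0 = {}" "\<And>n. st (Suc n) = insert (e n) (st n)"
    by (auto simp: st_def e_def)
  have st_eq: "st n = e ` {..<n}" for n
    by (induction n) (auto simp: st_Suc lessThan_Suc)
  define l where "l n = Re (cinner (e n) (A (e n)))" for n
  have e: "max_vector A (e ` {..<n}) (e n)" for n
  proof (induction n rule: less_induct)
    case (less n)
    have "\<exists>v. max_vector A (e ` {..<n}) v"
    proof (rule max_vector_exists[OF A])
      fix s assume "s \<in> e ` {..<n}"
      then show "\<exists>c. A s = of_real c *\<^sub>C s" using less.IH unfolding max_vector_def by blast
    qed
    then show ?case unfolding e_def[of n] st_eq by (rule someI_ex)
  qed
  have orth: "orthosys UNIV e"
    by (rule orthosys_image_less) (use e in \<open>auto simp: max_vector_def\<close>)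
  have l0: "0 \<le> l n" for n unfolding l_def by (rule positive_op_nonneg[OF A(1)])
  have Ae: "A (e n) = of_real (l n) *\<^sub>C e n" "l n = 0 \<longleftrightarrow> e n = 0" for n
    using e[of n] unfolding max_vector_def l_def by auto
  have max: "Re (cinner x (A x)) \<le> l n * (norm x)\<^sup>2" if "\<forall>i<n. cinner (e i) x = 0" for n x
    using e[of n] that unfolding max_vector_def l_def by auto
  have dec: "decseq l"
  proof (rule decseq_SucI)
    fix n
    have "l (Suc n) \<le> l n * (norm (e (Suc n)))\<^sup>2"
      unfolding l_def[of "Suc n"] using orthosys_orthogonal[OF orth] by (intro max) auto
    also have "\<dots> \<le> l n" using orthosys_norm_le[OF orth, of "Suc n"] l0[of n]
      by (simp add: mult_left_le power_le_one)
    finally show "l (Suc n) \<le> l n" .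
  qed
  have "l \<longlonglongrightarrow> 0"
  proof -
    obtain L where L: "l \<longlonglongrightarrow> L" "\<And>n. L \<le> l n" using decseq_convergent[OF dec, of 0] l0 by metis
    have "L \<le> 0"
    proof (rule ccontr)
      assume "\<not> L \<le> 0"
      then have Lp: "L > 0" by simp
      obtain r y where r: "strict_mono (r :: nat \<Rightarrow> nat)" and y: "(\<lambda>n. A (e (r n))) \<longlonglongrightarrow> y"
        by (rule compact_op_subseq[where T = A and x = e])
          (use A(2) orthosys_norm_le[OF orth] in auto)
      have "Cauchy (\<lambda>n. A (e (r n)))" by (rule LIMSEQ_imp_Cauchy[OF y])
      then obtain N where N: "\<And>m n. m \<ge> N \<Longrightarrow> n \<ge> N \<Longrightarrow> dist (A (e (r m))) (A (e (r n))) < L"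
        using Lp unfolding Cauchy_def by metis
      define i j where "i = r N" and "j = r (Suc N)"
      have ij: "i \<noteq> j" using r by (auto simp: i_def j_def strict_mono_eq)
      have "e i \<noteq> 0" using L(2)[of i] Lp Ae(2)[of i] by auto
      then have ni: "norm (e i) = 1" using orthosys_norm_eq[OF orth] by auto
      have "L\<^sup>2 \<le> (norm (of_real (l i) *\<^sub>C e i))\<^sup>2"
        using L(2)[of i] Lp ni by (simp add: norm_scaleC)
      also have "\<dots> \<le> (norm (of_real (l i) *\<^sub>C e i + - (of_real (l j) *\<^sub>C e j)))\<^sup>2"
        using orthosys_orthogonal[OF orth _ _ ij]
        by (subst norm_add_sq_orthogonal) (auto simp: cinner_simps)
      also have "\<dots> = (dist (A (e i)) (A (e j)))\<^sup>2" by (simp add: Ae dist_norm)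
      also have "\<dots> < L\<^sup>2" using N[of N "Suc N"] by (auto simp: i_def j_def power_strict_mono)
      finally show False by simp
    qed
    moreover have "0 \<le> L" using LIMSEQ_le_const[OF L(1)] l0 by blast
    ultimately show ?thesis using L(1) by simp
  qed
  then have "eig_system A l e" unfolding eig_system_def using dec orth l0 Ae max by blast
  then show ?thesis by blast
qed

lemma eig_systemD:
  assumes "eig_system A l e"
  shows "decseq l" "l \<longlonglongrightarrow> 0" "orthosys UNIV e" "0 \<le> l n" "A (e n) = of_real (l n) *\<^sub>C e n"
    "l n = 0 \<longleftrightarrow> e n = 0"
    "(\<And>i. i < n \<Longrightarrow> cinner (e i) x = 0) \<Longrightarrow> Re (cinner x (A x)) \<le> l n * (norm x)\<^sup>2"
  using assms unfolding eig_system_def by auto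

lemma eig_system_finite_ge:
  assumes "eig_system A l e" "t > 0"
  shows "finite {n. t \<le> l n}"
proof -
  obtain N where "\<And>n. n \<ge> N \<Longrightarrow> l n < t"
    using order_tendstoD(2)[OF eig_systemD(2)[OF assms(1)] assms(2)] unfolding eventually_sequentially by blast
  then have "{n. t \<le> l n} \<subseteq> {..<N}" by (auto simp: not_le[symmetric])
  then show ?thesis by (rule finite_subset) simp
qed

lemma orthosys_inj_on: "orthosys F f \<Longrightarrow> (\<And>i. i \<in> F \<Longrightarrow> f i \<noteq> 0) \<Longrightarrow> inj_on f F"
  unfolding orthosys_def inj_on_def by (metis zero_neq_one)

text \<open>The remainder of an eigenvector after projection to its part of the system is orthogonal to the
  whole system, hence annihilated by \<open>A\<close>.\<close>

lemma eig_system_eigenspace_span: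
  assumes A: "positive_op A" and E: "eig_system A l e" and t: "t > 0"
  shows "{x. A x = of_real t *\<^sub>C x} = cspan (e ` {n. l n = t})"
proof -
  define F where "F = {n. l n = t}"
  note b = positive_op_bounded[OF A]
  have fin: "finite F" using eig_system_finite_ge[OF E t] by (rule finite_subset[rotated]) (auto simp: F_def)
  have orth: "orthosys F e" using eig_systemD(3)[OF E] by (rule orthosys_subset) simp
  show ?thesis unfolding F_def[symmetric]
  proof (intro equalityI subsetI)
    fix x assume "x \<in> {x. A x = of_real t *\<^sub>C x}"
    then have x: "A x = of_real t *\<^sub>C x" by simp
    define s where "s = (\<Sum>j\<in>F. cinner (e j) x *\<^sub>C e j)"
    obtain r where r: "x = s + r" "\<And>i. i \<in> F \<Longrightarrow> cinner (e i) r = 0"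
      using orthosys_decomp[OF orth fin, of x] unfolding s_def by metis
    have "A s = of_real t *\<^sub>C s"
      unfolding s_def bounded_clinear_sum[OF b] complex_vector.scale_sum_right
      using eig_systemD(5)[OF E]
      by (intro sum.cong) (auto simp: bounded_clinear_scaleC[OF b] scaleC_scaleC mult.commute F_def)
    then have Ar: "A r = of_real t *\<^sub>C r"
      using x unfolding r(1) bounded_clinear_add[OF b] scaleC_add_right by simp
    have "cinner (e n) r = 0" for n
    proof (cases "n \<in> F")
      case False
      have "of_real t * cinner (e n) r = cinner (A (e n)) r"
        by (simp add: positive_op_symmetric[OF A] Ar cinner_scaleC_right)
      then have "of_real t * cinner (e n) r = of_real (l n) * cinner (e n) r"
        by (simp add: eig_systemD(5)[OF E] cinner_scaleC_left)
      then show ?thesis using False by (auto simp: F_def)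
    qed (use r in auto)
    then have le: "Re (cinner r (A r)) \<le> l n * (norm r)\<^sup>2" for n by (intro eig_systemD(7)[OF E])
    have "(\<lambda>n. l n * (norm r)\<^sup>2) \<longlonglongrightarrow> 0 * (norm r)\<^sup>2"
      by (intro tendsto_mult tendsto_const eig_systemD(2)[OF E])
    then have "Re (cinner r (A r)) \<le> 0 * (norm r)\<^sup>2" using le by (intro LIMSEQ_le_const) auto
    then have "t * (norm r)\<^sup>2 \<le> 0" by (simp add: Ar cinner_scaleC_right cinner_self)
    then have "r = 0" using t by (simp add: mult_le_0_iff)
    then have "x = s" using r(1) by simp
    then show "x \<in> cspan (e ` F)" unfolding s_def
      by (rule ssubst) (intro complex_vector.span_sum complex_vector.span_scale complex_vector.span_base imageI)
  next
    fix x assume "x \<in> cspan (e ` F)"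
    moreover have "cspan (e ` F) \<subseteq> {x. A x = of_real t *\<^sub>C x}"
      using eig_systemD(5)[OF E]
      by (intro complex_vector.span_minimal)
        (auto simp: F_def complex_vector.subspace_def bounded_clinear_simps[OF b] scaleC_add_right
          scaleC_scaleC mult.commute)
    ultimately show "x \<in> {x. A x = of_real t *\<^sub>C x}" by blast
  qed
qed

lemma eig_system_eigenspace:
  assumes A: "positive_op A" and E: "eig_system A l e" and t: "t > 0"
  shows "cdim {x. A x = of_real t *\<^sub>C x} = card {n. l n = t}"
proof -
  have orth: "orthosys {n. l n = t} e" using eig_systemD(3)[OF E] by (rule orthosys_subset) simp
  have nz: "e i \<noteq> 0" if "i \<in> {n. l n = t}" for i using eig_systemD(6)[OF E, of i] that t by auto
  note inj = orthosys_inj_on[OF orth nz]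
  have "complex_vector.independent (e ` {n. l n = t})"
    using orthosys_independent[OF orth inj] nz by (auto simp: image_iff)
  then show ?thesis
    using inj by (simp add: eig_system_eigenspace_span[OF A E t] complex_vector.dim_eq_card_independent card_image)
qed

text \<open>At the first index where the sequences differ, the larger value \<open>u n\<close> is
  attained by the other sequence at earlier indices only, where both agree; so it has fewer
  occurrences there. Counting positive values is enough because decreasing null sequences are
  nonnegative.\<close>

lemma decseq_determined_by_multiplicities:
  fixes s s' :: "nat \<Rightarrow> real"
  assumes s: "decseq s" "s \<longlonglongrightarrow> 0" and s': "decseq s'" "s' \<longlonglongrightarrow> 0"
    and eq: "\<And>t. t > 0 \<Longrightarrow> card {i. s i = t} = card {i. s' i = t}"
  shows "s = s'"
proof -
  have nn: "0 \<le> u i" if "decseq u" "u \<longlonglongrightarrow> 0" for u :: "nat \<Rightarrow> real" and i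
    using decseq_ge[OF that] .
  have fin: "finite {i. u i = t}" if u: "u \<longlonglongrightarrow> 0" "t > 0" for u :: "nat \<Rightarrow> real" and t
  proof -
    obtain N where "\<And>n. n \<ge> N \<Longrightarrow> u n < t"
      using order_tendstoD(2)[OF u] unfolding eventually_sequentially by blast
    then have "{n. u n = t} \<subseteq> {..<N}" by (force simp: not_le[symmetric])
    then show ?thesis by (rule finite_subset) simp
  qed
  have key: False if u: "decseq u" "u \<longlonglongrightarrow> 0" "decseq w" "w \<longlonglongrightarrow> 0"
    and c: "\<And>t. t > 0 \<Longrightarrow> card {i. u i = t} = card {i. w i = t}"
    and n: "\<And>i. i < n \<Longrightarrow> u i = w i" "w n < u n" for u w :: "nat \<Rightarrow> real" and n
  proof -
    have t: "u n > 0" using nn[OF u(3,4), of n] n(2) by linarith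
    have "{i. w i = u n} \<subseteq> {i. u i = u n}"
    proof
      fix i assume "i \<in> {i. w i = u n}"
      then have i: "w i = u n" by simp
      have "i < n"
      proof (rule ccontr)
        assume "\<not> i < n"
        then have "w i \<le> w n" using u(3) by (simp add: decseq_def)
        then show False using i n(2) by simp
      qed
      then show "i \<in> {i. u i = u n}" using i n(1) by simp
    qed
    moreover have "n \<in> {i. u i = u n} - {i. w i = u n}" using n(2) by simp
    ultimately have "{i. w i = u n} \<subset> {i. u i = u n}" by blast
    then show False using psubset_card_mono[OF fin[OF u(2) t]] c[OF t] by (metis less_irrefl)
  qed
  have "s n = s' n" for n
  proof (induction n rule: less_induct)
    case (less n)
    then show ?case
      using key[OF s s', of n] key[OF s' s, of n] eq by (metis linorder_neqE_linordered_idom)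
  qed
  then show ?thesis by blast
qed

text \<open>Resolves the description in \<open>sing_val\<close>: the eigenspace dimensions of T*T
  are the multiplicities in \<open>l\<close>, and these determine a decreasing null
  sequence.\<close>

lemma sing_val_eqI:
  assumes T: "bounded_clinear T" "is_adjoint S T" and E: "eig_system (S \<circ> T) l e"
  shows "sing_val T = (\<lambda>n. sqrt (l n))"
proof -
  have pos: "positive_op (S \<circ> T)" by (rule positive_op_adjoint_compose[OF T(2,1)])
  have "card {i. sqrt (l i) = t} = cdim {x. adj T (T x) = of_real (t\<^sup>2) *\<^sub>C x}" if t: "t > 0" for t
  proof -
    have "{i. sqrt (l i) = t} = {i. l i = t\<^sup>2}"
      using eig_systemD(4)[OF E] t by (auto simp: real_sqrt_unique)
    then show ?thesis
      using eig_system_eigenspace[OF pos E, of "t\<^sup>2"] t by (simp add: adj_eqI[OF T(2)])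
  qed
  moreover have "decseq (\<lambda>n. sqrt (l n))"
    using eig_systemD(1)[OF E] by (simp add: decseq_def)
  moreover have "(\<lambda>n. sqrt (l n)) \<longlonglongrightarrow> 0"
    using tendsto_real_sqrt[OF eig_systemD(2)[OF E]] by simp
  ultimately show ?thesis unfolding sing_val_def
    by (intro the_equality) (auto intro!: decseq_determined_by_multiplicities)
qed

lemma sing_val_eig_system:
  assumes T: "compact_op T" "is_adjoint S T"
  obtains e where "eig_system (S \<circ> T) (\<lambda>n. (sing_val T n)\<^sup>2) e" "\<And>n. 0 \<le> sing_val T n"
proof -
  note b = compact_op_bounded[OF T(1)]
  obtain l e where E: "eig_system (S \<circ> T) l e"
    using eig_system_exists[OF positive_op_adjoint_compose[OF T(2) b]]
      compact_op_compose_left[OF is_adjoint_bounded[OF T(2)] T(1)] by blast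
  have "sing_val T = (\<lambda>n. sqrt (l n))" by (rule sing_val_eqI[OF b T(2) E])
  then show ?thesis using E eig_systemD(4)[OF E] by (intro that[of e]) auto
qed

lemma sing_val_nonneg: "compact_op T \<Longrightarrow> is_adjoint S T \<Longrightarrow> 0 \<le> sing_val T n"
  using sing_val_eig_system by metis

lemma sing_val_decseq: "compact_op T \<Longrightarrow> is_adjoint S T \<Longrightarrow> decseq (sing_val T)"
proof -
  assume T: "compact_op T" "is_adjoint S T"
  obtain e where e: "eig_system (S \<circ> T) (\<lambda>n. (sing_val T n)\<^sup>2) e" "\<And>n. 0 \<le> sing_val T n"
    using sing_val_eig_system[OF T] by blast
  show ?thesis using eig_systemD(1)[OF e(1)] e(2) unfolding decseq_def
    by (meson power2_le_imp_le)
qed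

text \<open>The vectors of a system for \<open>T\<close> also form one for
  \<open>T \<circ> T\<close> with squared eigenvalues, so the singular values of a positive operator
  are its eigenvalues. The variational clause for the square is
  \<open>positive_op_norm_sq_le\<close> on the complement of the first \<open>n\<close>
  vectors.\<close>

lemma positive_eig_system:
  assumes T: "positive_op T" "compact_op T"
  obtains e where "eig_system T (sing_val T) e"
proof -
  obtain l e where E: "eig_system T l e" using eig_system_exists[OF T] by blast
  note b = positive_op_bounded[OF T(1)]
  have "eig_system (T \<circ> T) (\<lambda>n. (l n)\<^sup>2) e"
    unfolding eig_system_def
  proof (intro conjI allI impI)
    show "decseq (\<lambda>n. (l n)\<^sup>2)"
      using eig_systemD(1,4)[OF E] by (auto simp: decseq_def intro: power_mono)
    show "(\<lambda>n. (l n)\<^sup>2) \<longlonglongrightarrow> 0" using tendsto_power[OF eig_systemD(2)[OF E], of 2] by simp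
    fix n
    show "(T \<circ> T) (e n) = of_real ((l n)\<^sup>2) *\<^sub>C e n"
      by (simp add: eig_systemD(5)[OF E] bounded_clinear_scaleC[OF b] scaleC_scaleC power2_eq_square)
    fix x assume x: "\<forall>i<n. cinner (e i) x = 0"
    have "cinner (e i) (T x) = 0" if "i < n" for i
      using x that positive_op_symmetric[OF T(1), of "e i" x]
      by (simp add: eig_systemD(5)[OF E] cinner_scaleC_left)
    then have "Re (cinner (T x) (T (T x))) \<le> l n * (norm (T x))\<^sup>2" by (rule eig_systemD(7)[OF E])
    then have "(norm (T x))\<^sup>2 \<le> l n * Re (cinner x (T x))"
      by (rule positive_op_norm_sq_le[OF T(1) eig_systemD(4)[OF E]])
    also have "\<dots> \<le> l n * (l n * (norm x)\<^sup>2)"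
      using x by (intro mult_left_mono eig_systemD(7)[OF E] eig_systemD(4)[OF E]) auto
    also have "(norm (T x))\<^sup>2 = Re (cinner x (T (T x)))"
      by (simp only: norm_sq_cinner positive_op_symmetric[OF T(1)])
    finally show "Re (cinner x ((T \<circ> T) x)) \<le> (l n)\<^sup>2 * (norm x)\<^sup>2"
      by (simp add: power2_eq_square mult.assoc)
  qed (use eig_systemD[OF E] in auto)
  then have "sing_val T = (\<lambda>n. sqrt ((l n)\<^sup>2))" by (rule sing_val_eqI[OF b positive_op_adjoint[OF T(1)]])
  then have "sing_val T = l" using eig_systemD(4)[OF E] by simp
  then show ?thesis using that E by simp
qed

section \<open>Min-max estimates for singular values\<close>

lemma cinner_expansion_add:
  "(\<Sum>j\<in>F. cinner (f j) (x + y) *\<^sub>C g j) =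
    (\<Sum>j\<in>F. cinner (f j) x *\<^sub>C g j) + (\<Sum>j\<in>F. cinner (f j) y *\<^sub>C (g j :: 'a::complex_inner))"
  by (simp add: cinner_add_right scaleC_add_left sum.distrib)

lemma cinner_expansion_scale:
  "(\<Sum>j\<in>F. cinner (f j) (c *\<^sub>C x) *\<^sub>C g j) = c *\<^sub>C (\<Sum>j\<in>F. cinner (f j) x *\<^sub>C (g j :: 'a::complex_inner))"
  by (simp add: cinner_scaleC_right scaleC_scaleC complex_vector.scale_sum_right)

lemma orthosys_span:
  assumes f: "orthosys F f" "finite F" and x: "x \<in> cspan (f ` F)"
  shows "x = (\<Sum>j\<in>F. cinner (f j) x *\<^sub>C f j)"
proof -
  have "cspan (f ` F) \<subseteq> {x. x = (\<Sum>j\<in>F. cinner (f j) x *\<^sub>C f j)}"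
  proof (rule complex_vector.span_minimal)
    have "f i = (\<Sum>j\<in>F. cinner (f j) (f i) *\<^sub>C f j)" if i: "i \<in> F" for i
    proof -
      have "(\<Sum>j\<in>F. cinner (f j) (f i) *\<^sub>C f j) = (\<Sum>j\<in>F. if j = i then f i else 0)"
        using f(1) i by (intro sum.cong) (auto simp: orthosys_def scaleC_one)
      then show ?thesis using f(2) i by simp
    qed
    then show "f ` F \<subseteq> {x. x = (\<Sum>j\<in>F. cinner (f j) x *\<^sub>C f j)}" by blast
    show "csubspace {x. x = (\<Sum>j\<in>F. cinner (f j) x *\<^sub>C f j)}"
    proof (rule complex_vector.subspaceI; unfold mem_Collect_eq cinner_expansion_add cinner_expansion_scale)
      fix x y and c :: complex
      assume x: "x = (\<Sum>j\<in>F. cinner (f j) x *\<^sub>C f j)"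
      show "c *\<^sub>C x = c *\<^sub>C (\<Sum>j\<in>F. cinner (f j) x *\<^sub>C f j)" by (rule arg_cong[OF x])
      assume y: "y = (\<Sum>j\<in>F. cinner (f j) y *\<^sub>C f j)"
      show "x + y = (\<Sum>j\<in>F. cinner (f j) x *\<^sub>C f j) + (\<Sum>j\<in>F. cinner (f j) y *\<^sub>C f j)"
        by (rule arg_cong2[OF x y])
    qed simp
  qed
  then show ?thesis using x by blast
qed

text \<open>Dimension count: the projection \<open>P\<close> onto a space of dimension at most
  \<open>card V\<close> cannot be injective on the span of \<open>card F\<close> independent
  vectors. The difference of two vectors with the same image is orthogonal to
  \<open>V\<close>.\<close>

lemma exists_orthogonal_vector:
  fixes f :: "'i \<Rightarrow> 'a::complex_inner"
  assumes f: "orthosys F f" "finite F" "\<And>i. i \<in> F \<Longrightarrow> f i \<noteq> 0" and V: "finite V" "card V < card F"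
  obtains x where "x \<noteq> 0" "x \<in> cspan (f ` F)" "\<And>v. v \<in> V \<Longrightarrow> cinner v x = 0"
proof -
  obtain B where B: "finite B" "card B \<le> card V" "orthosys B (\<lambda>b. b)"
    "\<And>v. v \<in> V \<Longrightarrow> v = (\<Sum>b\<in>B. cinner b v *\<^sub>C b)" using gram_schmidt[OF V(1)] by metis
  define P where "P x = (\<Sum>b\<in>B. cinner b x *\<^sub>C b)" for x
  interpret vector_space_pair "scaleC :: complex \<Rightarrow> 'a \<Rightarrow> 'a" "scaleC :: complex \<Rightarrow> 'a \<Rightarrow> 'a" ..
  have lin: "Vector_Spaces.linear scaleC scaleC P"
    unfolding Vector_Spaces.linear_iff P_def cinner_expansion_add cinner_expansion_scale
    by (simp add: complex_vector.vector_space_axioms)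
  note inj = orthosys_inj_on[OF f(1,3)]
  have ind: "complex_vector.independent (f ` F)"
    using f(3) by (intro orthosys_independent[OF f(1) inj]) auto
  have "\<not> inj_on P (cspan (f ` F))"
  proof
    assume P: "inj_on P (cspan (f ` F))"
    then have "complex_vector.independent (P ` f ` F)"
      by (rule linear_independent_injective_image[OF lin ind])
    moreover have "P z \<in> cspan B" for z
      unfolding P_def by (intro complex_vector.span_sum complex_vector.span_scale complex_vector.span_base)
    ultimately have "card (P ` f ` F) \<le> card B"
      using complex_vector.independent_span_bound[OF B(1), of "P ` f ` F"] by blast
    moreover have "inj_on P (f ` F)" using P by (rule inj_on_subset) (rule complex_vector.span_superset)
    ultimately show False using B(2) V(2) inj by (simp add: card_image)
  qed
  then obtain y z where yz: "y \<in> cspan (f ` F)" "z \<in> cspan (f ` F)" "P y = P z" "y \<noteq> z"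
    unfolding inj_on_def by blast
  have "P (y - z) = 0" using yz(3) linear_diff[OF lin, of y z] by simp
  then have b0: "cinner b (y - z) = 0" if "b \<in> B" for b
    using orthosys_cinner_sum[OF B(3,1) that, of "y - z"] unfolding P_def by simp
  have "cinner v (y - z) = 0" if "v \<in> V" for v
    by (subst B(4)[OF that]) (simp add: cinner_sum_left cinner_scaleC_left b0)
  then show ?thesis using yz by (intro that[of "y - z"]) (auto intro: complex_vector.span_diff)
qed

text \<open>A span of eigenvectors and its orthogonal complement are also orthogonal with respect to
  the form of \<open>A\<close>, so norm and form split with the same remainder
  \<open>r\<close>.\<close>

lemma eigen_decomp:
  assumes A: "positive_op A" and f: "orthosys F f" "finite F"
    and eig: "\<And>i. i \<in> F \<Longrightarrow> A (f i) = of_real (l i) *\<^sub>C f i"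
  obtains r where "\<And>i. i \<in> F \<Longrightarrow> cinner (f i) r = 0"
    "(norm x)\<^sup>2 = (\<Sum>i\<in>F. (cmod (cinner (f i) x))\<^sup>2) + (norm r)\<^sup>2"
    "Re (cinner x (A x)) = (\<Sum>i\<in>F. l i * (cmod (cinner (f i) x))\<^sup>2) + Re (cinner r (A r))"
    "x \<in> cspan (f ` F) \<longrightarrow> r = 0"
proof -
  note b = positive_op_bounded[OF A]
  define s where "s = (\<Sum>j\<in>F. cinner (f j) x *\<^sub>C f j)"
  obtain r where r: "x = s + r" "\<And>i. i \<in> F \<Longrightarrow> cinner (f i) r = 0"
    "(norm x)\<^sup>2 = (\<Sum>j\<in>F. (cmod (cinner (f j) x))\<^sup>2) + (norm r)\<^sup>2"
    by (rule orthosys_decomp[OF f, of x, folded s_def]) (rule that; assumption)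
  have As: "A s = (\<Sum>j\<in>F. (of_real (l j) * cinner (f j) x) *\<^sub>C f j)"
    unfolding s_def bounded_clinear_sum[OF b] bounded_clinear_scaleC[OF b]
    by (intro sum.cong) (auto simp: eig scaleC_scaleC mult.commute)
  have rAs: "cinner r (A s) = 0"
    unfolding As cinner_sum_right cinner_scaleC_right
    using r(2) by (intro sum.neutral) (auto simp: cinner_zero_commute[of r])
  then have sAr: "cinner s (A r) = 0"
    using positive_op_symmetric[OF A, of s r] cinner_zero_commute[of r "A s"] by simp
  have "cinner s (A s) = (\<Sum>j\<in>F. of_real (l j) * of_real ((cmod (cinner (f j) x))\<^sup>2))"
    unfolding As cinner_sum_right cinner_scaleC_right
  proof (intro sum.cong refl)
    fix j assume j: "j \<in> F"
    have "cinner s (f j) = cnj (cinner (f j) s)" by (rule cinner_commute)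
    also have "cinner (f j) s = cinner (f j) x"
      unfolding s_def by (rule orthosys_cinner_sum[OF f j])
    finally show "of_real (l j) * cinner (f j) x * cinner s (f j)
        = of_real (l j) * of_real ((cmod (cinner (f j) x))\<^sup>2)"
      by (simp add: complex_norm_square del: of_real_power)
  qed
  then have "cinner x (A x) = of_real (\<Sum>j\<in>F. l j * (cmod (cinner (f j) x))\<^sup>2) + cinner r (A r)"
    using rAs sAr by (simp add: r(1) bounded_clinear_add[OF b] cinner_simps)
  then have "Re (cinner x (A x)) = (\<Sum>i\<in>F. l i * (cmod (cinner (f i) x))\<^sup>2) + Re (cinner r (A r))"
    by simp
  moreover have "r = 0" if "x \<in> cspan (f ` F)"
    using orthosys_span[OF f that] r(1) unfolding s_def by simp
  ultimately show ?thesis using r that by blast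
qed

lemma eigen_lower_bound:
  assumes A: "positive_op A" and f: "orthosys F f" "finite F"
    and eig: "\<And>i. i \<in> F \<Longrightarrow> A (f i) = of_real (l i) *\<^sub>C f i"
  shows "(\<Sum>i\<in>F. l i * (cmod (cinner (f i) x))\<^sup>2) \<le> Re (cinner x (A x))"
  using eigen_decomp[OF A f eig, of x] positive_op_nonneg[OF A] by (metis le_add_same_cancel1)

text \<open>One half of the min-max principle: the \<open>N + 1\<close> leading eigenvectors of T*T
  span a space containing some \<open>x \<noteq> 0\<close> orthogonal to \<open>V\<close>, and there
  the norm of \<open>T x\<close> is at least \<open>sing_val T N * norm x\<close>.\<close>

lemma sing_val_le:
  fixes T :: "'a::complex_hilbert \<Rightarrow> 'a"
  assumes T: "compact_op T" "is_adjoint S T" and V: "finite V" "card V \<le> N" and K: "0 \<le> K"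
    and le: "\<And>x. (\<And>v. v \<in> V \<Longrightarrow> cinner v x = 0) \<Longrightarrow> norm (T x) \<le> K * norm x"
  shows "sing_val T N \<le> K"
\<comment> \<open>If the value is positive, none of the vectors \<open>e 0\<close>, ...,
  \<open>e N\<close> is a zero placeholder, as the dimension count requires.\<close>
proof (cases "sing_val T N = 0")
  case False
  obtain e where E: "eig_system (S \<circ> T) (\<lambda>n. (sing_val T n)\<^sup>2) e" and nn: "\<And>n. 0 \<le> sing_val T n"
    using sing_val_eig_system[OF T] by blast
  have pos: "positive_op (S \<circ> T)"
    by (rule positive_op_adjoint_compose[OF T(2) compact_op_bounded[OF T(1)]])
  have orth: "orthosys {..N} e" using eig_systemD(3)[OF E] by (rule orthosys_subset) simp
  have mono: "sing_val T N \<le> sing_val T i" if "i \<le> N" for i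
    using sing_val_decseq[OF T] that by (simp add: decseq_def)
  have nz: "e i \<noteq> 0" if "i \<in> {..N}" for i
    using eig_systemD(6)[OF E, of i] mono[of i] nn[of N] False that by auto
  have card: "card V < card {..N}" using V(2) by simp
  obtain x where x: "x \<noteq> 0" "x \<in> cspan (e ` {..N})" "\<And>v. v \<in> V \<Longrightarrow> cinner v x = 0"
    by (rule exists_orthogonal_vector[OF orth finite_atMost _ V(1) card]) (rule nz, assumption, rule that, assumption+)
  obtain r :: 'a where r: "(norm x)\<^sup>2 = (\<Sum>i\<le>N. (cmod (cinner (e i) x))\<^sup>2) + (norm r)\<^sup>2"
    "x \<in> cspan (e ` {..N}) \<longrightarrow> r = 0"
    by (rule eigen_decomp[OF pos orth finite_atMost eig_systemD(5)[OF E], where x = x]) blast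
  have "(sing_val T N)\<^sup>2 * (norm x)\<^sup>2 = (\<Sum>i\<le>N. (sing_val T N)\<^sup>2 * (cmod (cinner (e i) x))\<^sup>2)"
    using r x(2) by (simp add: sum_distrib_left)
  also have "\<dots> \<le> (\<Sum>i\<le>N. (sing_val T i)\<^sup>2 * (cmod (cinner (e i) x))\<^sup>2)"
    using mono nn by (intro sum_mono mult_right_mono power_mono) auto
  also have "\<dots> \<le> Re (cinner x ((S \<circ> T) x))"
    by (rule eigen_lower_bound[OF pos orth _ eig_systemD(5)[OF E]]) auto
  also have "\<dots> = (norm (T x))\<^sup>2" by (simp add: is_adjointD'[OF T(2)] norm_sq_cinner)
  also have "\<dots> \<le> (K * norm x)\<^sup>2" using le[OF x(3)] by (intro power_mono) auto
  finally have "(sing_val T N * norm x)\<^sup>2 \<le> (K * norm x)\<^sup>2" by (simp add: power_mult_distrib)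
  then have "sing_val T N * norm x \<le> K * norm x" by (rule power2_le_imp_le) (use K in auto)
  then show ?thesis using x(1) by simp
qed (use K in simp)

text \<open>The converse half of the min-max principle: the first \<open>n\<close> vectors of the
  system for T*T are the obstruction set. Zero vectors may coincide, hence an inequality for the
  cardinality.\<close>

lemma sing_val_approx:
  assumes T: "compact_op T" "is_adjoint S T"
  obtains V where "finite V" "card V \<le> n"
    "\<And>x. (\<And>v. v \<in> V \<Longrightarrow> cinner v x = 0) \<Longrightarrow> norm (T x) \<le> sing_val T n * norm x"
proof -
  obtain e where E: "eig_system (S \<circ> T) (\<lambda>n. (sing_val T n)\<^sup>2) e" and nn: "\<And>n. 0 \<le> sing_val T n"
    using sing_val_eig_system[OF T] by blast
  have "norm (T x) \<le> sing_val T n * norm x" if "\<And>v. v \<in> e ` {..<n} \<Longrightarrow> cinner v x = 0" for x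
  proof -
    have "(norm (T x))\<^sup>2 = Re (cinner x ((S \<circ> T) x))" by (simp add: is_adjointD'[OF T(2)] norm_sq_cinner)
    also have "\<dots> \<le> (sing_val T n)\<^sup>2 * (norm x)\<^sup>2" using that by (intro eig_systemD(7)[OF E]) auto
    finally show ?thesis
      using nn[of n] by (intro power2_le_imp_le[of "norm (T x)"]) (auto simp: power_mult_distrib)
  qed
  then show ?thesis using card_image_le[of "{..<n}" e] by (intro that[of "e ` {..<n}"]) auto
qed

text \<open>The union of the two obstruction sets has at most \<open>m + n\<close> elements, and
  both norm bounds hold orthogonally to it.\<close>

lemma sing_val_plus:
  assumes S: "compact_op S" "is_adjoint S' S" and T: "compact_op T" "is_adjoint T' T"
  shows "sing_val (\<lambda>x. S x + T x) (m + n) \<le> sing_val S m + sing_val T n"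
proof -
  obtain V where V: "finite V" "card V \<le> m"
    "\<And>x. (\<And>v. v \<in> V \<Longrightarrow> cinner v x = 0) \<Longrightarrow> norm (S x) \<le> sing_val S m * norm x"
    using sing_val_approx[OF S] by metis
  obtain W where W: "finite W" "card W \<le> n"
    "\<And>x. (\<And>v. v \<in> W \<Longrightarrow> cinner v x = 0) \<Longrightarrow> norm (T x) \<le> sing_val T n * norm x"
    using sing_val_approx[OF T] by metis
  show ?thesis
  proof (rule sing_val_le[OF compact_op_plus[OF S(1) T(1)] is_adjoint_plus[OF S(2) T(2)]])
    show "finite (V \<union> W)" using V W by simp
    show "card (V \<union> W) \<le> m + n" using card_Un_le[of V W] V(2) W(2) by linarith
    show "0 \<le> sing_val S m + sing_val T n" using sing_val_nonneg[OF S] sing_val_nonneg[OF T] by simp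
    fix x assume "\<And>v. v \<in> V \<union> W \<Longrightarrow> cinner v x = 0"
    then have "norm (S x) \<le> sing_val S m * norm x" "norm (T x) \<le> sing_val T n * norm x"
      by (auto intro: V(3) W(3))
    then show "norm (S x + T x) \<le> (sing_val S m + sing_val T n) * norm x"
      using norm_triangle_ineq[of "S x" "T x"] by (simp add: distrib_right)
  qed
qed

lemma sing_val_compose_left:
  assumes T: "compact_op T" "is_adjoint S T" and B: "bounded_clinear B" "is_adjoint C B"
    and K: "\<And>x. norm (B x) \<le> K * norm x" "0 \<le> K"
  shows "sing_val (B \<circ> T) n \<le> K * sing_val T n"
proof -
  obtain V where V: "finite V" "card V \<le> n"
    "\<And>x. (\<And>v. v \<in> V \<Longrightarrow> cinner v x = 0) \<Longrightarrow> norm (T x) \<le> sing_val T n * norm x"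
    using sing_val_approx[OF T] by metis
  show ?thesis
    by (rule sing_val_le[OF compact_op_compose_left[OF B(1) T(1)] is_adjoint_compose[OF B(2) T(2)] V(1,2)])
      (use V(3) K sing_val_nonneg[OF T] in \<open>auto intro!: order_trans[OF K(1)] simp: mult.assoc mult_left_mono\<close>)
qed

text \<open>\<open>B x\<close> is orthogonal to \<open>V\<close> exactly when \<open>x\<close> is
  orthogonal to the image of \<open>V\<close> under the adjoint \<open>C\<close>.\<close>

lemma sing_val_compose_right:
  assumes T: "compact_op T" "is_adjoint S T" and B: "bounded_clinear B" "is_adjoint C B"
    and K: "\<And>x. norm (B x) \<le> K * norm x" "0 \<le> K"
  shows "sing_val (T \<circ> B) n \<le> K * sing_val T n"
proof -
  obtain V where V: "finite V" "card V \<le> n"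
    "\<And>x. (\<And>v. v \<in> V \<Longrightarrow> cinner v x = 0) \<Longrightarrow> norm (T x) \<le> sing_val T n * norm x"
    using sing_val_approx[OF T] by metis
  show ?thesis
  proof (rule sing_val_le[OF compact_op_compose_right[OF T(1) B(1)] is_adjoint_compose[OF T(2) B(2)]])
    show "finite (C ` V)" "card (C ` V) \<le> n" using V card_image_le[OF V(1), of C] by auto
    show "0 \<le> K * sing_val T n" using K(2) sing_val_nonneg[OF T] by simp
    fix x assume "\<And>v. v \<in> C ` V \<Longrightarrow> cinner v x = 0"
    then have "norm (T (B x)) \<le> sing_val T n * norm (B x)"
      by (intro V(3)) (auto simp: is_adjointD[OF B(2), symmetric])
    also have "\<dots> \<le> sing_val T n * (K * norm x)" using K(1) sing_val_nonneg[OF T] by (intro mult_left_mono)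
    finally show "norm ((T \<circ> B) x) \<le> K * sing_val T n * norm x" by (simp add: mult_ac)
  qed
qed

section \<open>The ideal \<open>L1inf\<close>\<close>

lemma L1inf_bound:
  assumes "T \<in> L1inf"
  obtains C where "C \<ge> 0" "\<And>k. (\<Sum>n\<le>k. sing_val T n) \<le> C * ln (1 + real (Suc k))"
proof -
  have "\<exists>C. \<forall>k. gamma_seq T k \<le> C" using assms by (auto simp: L1inf_def bdd_above_def)
  then obtain C where C: "\<And>k. gamma_seq T k \<le> C" by blast
  have "(\<Sum>n\<le>k. sing_val T n) \<le> max C 0 * ln (1 + real (Suc k))" for k
  proof -
    have "gamma_seq T k \<le> max C 0" using C[of k] by simp
    then show ?thesis by (simp add: gamma_seq_def pos_divide_le_eq)
  qed
  then show ?thesis by (intro that[of "max C 0"]) auto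
qed

lemma L1infI:
  assumes "compact_op T" "\<And>k. (\<Sum>n\<le>k. sing_val T n) \<le> C * ln (1 + real (Suc k))"
  shows "T \<in> L1inf"
  using assms unfolding L1inf_def gamma_seq_def bdd_above_def
  by (auto intro!: exI[of _ C] simp: pos_divide_le_eq)

lemma L1inf_compact: "T \<in> L1inf \<Longrightarrow> compact_op T"
  by (simp add: L1inf_def)

lemma sum_div2_le:
  fixes a :: "nat \<Rightarrow> real"
  assumes "\<And>n. 0 \<le> a n"
  shows "(\<Sum>n\<le>k. a (n div 2)) \<le> 2 * (\<Sum>n\<le>k. a n)"
proof -
  have *: "(\<Sum>n\<le>Suc (2 * m). a (n div 2)) = 2 * (\<Sum>n\<le>m. a n)" for m
    by (induction m) auto
  have "(\<Sum>n\<le>k. a (n div 2)) \<le> (\<Sum>n\<le>Suc (2 * k). a (n div 2))"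
    using assms by (intro sum_mono2) auto
  then show ?thesis by (simp only: *)
qed

text \<open>Splitting the index \<open>n\<close> into two copies of \<open>n div 2\<close> costs a
  factor 2, which is harmless for membership. The sharp additivity behind the traces requires the Ky
  Fan estimates instead.\<close>

lemma L1inf_plus:
  assumes S: "S \<in> L1inf" "is_adjoint S' S" and T: "T \<in> L1inf" "is_adjoint T' T"
  shows "(\<lambda>x. S x + T x) \<in> L1inf"
proof -
  note cS = L1inf_compact[OF S(1)] S(2) and cT = L1inf_compact[OF T(1)] T(2)
  note cST = compact_op_plus[OF cS(1) cT(1)] is_adjoint_plus[OF cS(2) cT(2)]
  obtain C where C: "\<And>k. (\<Sum>n\<le>k. sing_val S n) \<le> C * ln (1 + real (Suc k))"
    using L1inf_bound[OF S(1)] by metis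
  obtain D where D: "\<And>k. (\<Sum>n\<le>k. sing_val T n) \<le> D * ln (1 + real (Suc k))"
    using L1inf_bound[OF T(1)] by metis
  show ?thesis
  proof (rule L1infI[OF cST(1)])
    fix k
    have "sing_val (\<lambda>x. S x + T x) n \<le> sing_val S (n div 2) + sing_val T (n div 2)" for n
    proof -
      have "sing_val (\<lambda>x. S x + T x) n \<le> sing_val (\<lambda>x. S x + T x) (n div 2 + n div 2)"
        using sing_val_decseq[OF cST] by (simp add: decseq_def)
      then show ?thesis using sing_val_plus[OF cS cT, of "n div 2" "n div 2"] by linarith
    qed
    then have "(\<Sum>n\<le>k. sing_val (\<lambda>x. S x + T x) n)
        \<le> (\<Sum>n\<le>k. sing_val S (n div 2)) + (\<Sum>n\<le>k. sing_val T (n div 2))"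
      by (simp add: sum_mono flip: sum.distrib)
    also have "\<dots> \<le> 2 * (C * ln (1 + real (Suc k))) + 2 * (D * ln (1 + real (Suc k)))"
      using C[of k] D[of k] sum_div2_le[of "sing_val S" k] sum_div2_le[of "sing_val T" k]
        sing_val_nonneg[OF cS] sing_val_nonneg[OF cT] by fastforce
    finally show "(\<Sum>n\<le>k. sing_val (\<lambda>x. S x + T x) n) \<le> (2 * C + 2 * D) * ln (1 + real (Suc k))"
      by (simp add: algebra_simps)
  qed
qed

lemma L1inf_dominated:
  assumes T: "T \<in> L1inf" and R: "compact_op R" "\<And>n. sing_val R n \<le> K * sing_val T n" and K: "0 \<le> K"
  shows "R \<in> L1inf"
proof -
  obtain C where C: "\<And>k. (\<Sum>n\<le>k. sing_val T n) \<le> C * ln (1 + real (Suc k))"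
    using L1inf_bound[OF T] by metis
  show ?thesis
  proof (rule L1infI[OF R(1)])
    fix k
    have "(\<Sum>n\<le>k. sing_val R n) \<le> K * (\<Sum>n\<le>k. sing_val T n)"
      unfolding sum_distrib_left by (intro sum_mono R)
    also have "\<dots> \<le> K * (C * ln (1 + real (Suc k)))" using C K by (intro mult_left_mono)
    finally show "(\<Sum>n\<le>k. sing_val R n) \<le> (K * C) * ln (1 + real (Suc k))" by simp
  qed
qed

lemma L1inf_compose_left:
  assumes T: "T \<in> L1inf" "is_adjoint S T" and B: "bounded_clinear B" "is_adjoint C B"
  shows "B \<circ> T \<in> L1inf"
proof -
  obtain K where K: "K > 0" "\<And>x. norm (B x) \<le> K * norm x" using bounded_clinear_bound[OF B(1)] by blast
  show ?thesis
    by (rule L1inf_dominated[OF T(1) compact_op_compose_left[OF B(1) L1inf_compact[OF T(1)]]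
          sing_val_compose_left[OF L1inf_compact[OF T(1)] T(2) B K(2)]]) (use K(1) in simp_all)
qed

lemma L1inf_compose_right:
  assumes T: "T \<in> L1inf" "is_adjoint S T" and B: "bounded_clinear B" "is_adjoint C B"
  shows "T \<circ> B \<in> L1inf"
proof -
  obtain K where K: "K > 0" "\<And>x. norm (B x) \<le> K * norm x" using bounded_clinear_bound[OF B(1)] by blast
  show ?thesis
    by (rule L1inf_dominated[OF T(1) compact_op_compose_right[OF L1inf_compact[OF T(1)] B(1)]
          sing_val_compose_right[OF L1inf_compact[OF T(1)] T(2) B K(2)]]) (use K(1) in simp_all)
qed

lemma is_adjoint_id: "is_adjoint (\<lambda>x. x) (\<lambda>x. x)"
  unfolding is_adjoint_def by (auto intro!: bounded_clinearI[of _ 1])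

lemma L1inf_scale:
  assumes T: "T \<in> L1inf" "is_adjoint S T"
  shows "(\<lambda>x. c *\<^sub>C T x) \<in> L1inf"
proof -
  have "bounded_clinear (\<lambda>x::'a. c *\<^sub>C x)"
    by (rule bounded_clinear_scale) (rule is_adjoint_bounded[OF is_adjoint_id])
  then have "(\<lambda>x. c *\<^sub>C x) \<circ> T \<in> L1inf"
    using is_adjoint_scale[OF is_adjoint_id] by (rule L1inf_compose_left[OF T])
  then show ?thesis by (simp add: o_def)
qed

section \<open>Ky Fan inequalities\<close>

text \<open>The test vectors \<open>y j\<close> satisfy a Bessel inequality with constant
  \<open>C\<close>; orthonormal systems have \<open>C = 1\<close>, while the compressed eigenvectors
  used for conjugates have the constant of the conjugating pair. Inserting \<open>y j\<close> and
  \<open>e i\<close> into this inequality bounds the norms of the \<open>y j\<close> and, by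
  symmetry, the column sums.\<close>

lemma ky_fan:
  assumes A: "positive_op A" and E: "eig_system A l e" and J: "finite J" "card J \<le> N"
    and y: "\<And>x. (\<Sum>j\<in>J. (cmod (cinner (y j) x))\<^sup>2) \<le> C * (norm x)\<^sup>2" and C: "0 \<le> C"
  shows "(\<Sum>j\<in>J. Re (cinner (y j) (A (y j)))) \<le> C * (\<Sum>i<N. l i)"
proof -
  have orth: "orthosys {..<N} e" using eig_systemD(3)[OF E] by (rule orthosys_subset) simp
  have mono: "l N \<le> l i" if "i < N" for i using eig_systemD(1)[OF E] that by (simp add: decseq_def)
  \<comment> \<open>Subtracting the level \<open>l N\<close> leaves the nonnegative weights
    \<open>l i - l N\<close>, so that column sums can be estimated termwise; the level itself is
    paid for by the full norm.\<close>
  have each: "Re (cinner z (A z)) \<le>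
    (\<Sum>i<N. (l i - l N) * (cmod (cinner (e i) z))\<^sup>2) + l N * (norm z)\<^sup>2" for z
  proof -
    obtain r where r: "\<And>i. i < N \<Longrightarrow> cinner (e i) r = 0"
      "(norm z)\<^sup>2 = (\<Sum>i<N. (cmod (cinner (e i) z))\<^sup>2) + (norm r)\<^sup>2"
      "Re (cinner z (A z)) = (\<Sum>i<N. l i * (cmod (cinner (e i) z))\<^sup>2) + Re (cinner r (A r))"
      by (rule eigen_decomp[OF A orth finite_lessThan eig_systemD(5)[OF E], where x = z])
        (rule that; auto)
    have "Re (cinner r (A r)) \<le> l N * (norm r)\<^sup>2" by (rule eig_systemD(7)[OF E r(1)])
    then show ?thesis
      unfolding r(2,3) by (simp add: algebra_simps sum_subtractf sum_distrib_left)
  qed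
  have yC: "(norm (y j))\<^sup>2 \<le> C" if j: "j \<in> J" for j
  proof (cases "y j = 0")
    case False
    have "(cmod (cinner (y j) (y j)))\<^sup>2 \<le> (\<Sum>i\<in>J. (cmod (cinner (y i) (y j)))\<^sup>2)"
      using J(1) j by (intro member_le_sum) auto
    also have "\<dots> \<le> C * (norm (y j))\<^sup>2" by (rule y)
    finally have "(norm (y j))\<^sup>2 * (norm (y j))\<^sup>2 \<le> C * (norm (y j))\<^sup>2"
      by (simp add: cinner_self norm_power power2_eq_square norm_mult)
    then show ?thesis by (rule mult_right_le_imp_le) (use False in simp)
  qed (use C in simp)
  have eC: "(\<Sum>j\<in>J. (cmod (cinner (e i) (y j)))\<^sup>2) \<le> C" for i
  proof -
    have "(\<Sum>j\<in>J. (cmod (cinner (e i) (y j)))\<^sup>2) = (\<Sum>j\<in>J. (cmod (cinner (y j) (e i)))\<^sup>2)"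
      by (intro sum.cong) (metis cinner_commute complex_mod_cnj)+
    also have "\<dots> \<le> C * (norm (e i))\<^sup>2" by (rule y)
    also have "\<dots> \<le> C * 1"
      using C orthosys_norm_le[OF eig_systemD(3)[OF E], of i] by (intro mult_left_mono) (auto simp: power_le_one)
    finally show ?thesis by simp
  qed
  have "(\<Sum>j\<in>J. Re (cinner (y j) (A (y j)))) \<le>
      (\<Sum>j\<in>J. (\<Sum>i<N. (l i - l N) * (cmod (cinner (e i) (y j)))\<^sup>2) + l N * (norm (y j))\<^sup>2)"
    by (intro sum_mono each)
  also have "\<dots> = (\<Sum>i<N. (l i - l N) * (\<Sum>j\<in>J. (cmod (cinner (e i) (y j)))\<^sup>2)) + l N * (\<Sum>j\<in>J. (norm (y j))\<^sup>2)"
    by (simp add: sum.distrib sum_distrib_left sum.swap[of _ J])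
  also have "\<dots> \<le> (\<Sum>i<N. (l i - l N) * C) + l N * (\<Sum>j\<in>J. C)"
    using mono eC yC eig_systemD(4)[OF E] by (intro add_mono sum_mono mult_left_mono) auto
  also have "\<dots> = C * (\<Sum>i<N. l i) - l N * C * (real N - real (card J))"
    by (simp add: sum_distrib_left sum_subtractf algebra_simps sum_distrib_right)
  also have "\<dots> \<le> C * (\<Sum>i<N. l i)" using J(2) eig_systemD(4)[OF E, of N] C by simp
  finally show ?thesis .
qed

text \<open>The hypothesis says that the sum of the rank-one operators |u_j><u_j| is at most
  \<open>A\<close>. Its trace is computed in an orthonormal basis \<open>B\<close> of the span of
  the \<open>u j\<close>, which has at most \<open>N\<close> elements, so \<open>ky_fan\<close>
  applies to \<open>B\<close>.\<close>

lemma sing_val_sum_ge: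
  assumes A: "positive_op A" "compact_op A" and J: "finite J" "card J \<le> N"
    and u: "\<And>x. (\<Sum>j\<in>J. (cmod (cinner (u j) x))\<^sup>2) \<le> Re (cinner x (A x))"
  shows "(\<Sum>j\<in>J. (norm (u j))\<^sup>2) \<le> (\<Sum>i<N. sing_val A i)"
proof -
  obtain e where E: "eig_system A (sing_val A) e" using positive_eig_system[OF A] by blast
  obtain B where B: "finite B" "card B \<le> card (u ` J)" "orthosys B (\<lambda>b. b)"
    "\<And>x. x \<in> u ` J \<Longrightarrow> x = (\<Sum>b\<in>B. cinner b x *\<^sub>C b)"
    by (rule gram_schmidt[OF finite_imageI[OF J(1), of u]]) (rule that; assumption)
  have "(norm (u j))\<^sup>2 \<le> (\<Sum>b\<in>B. (cmod (cinner (u j) b))\<^sup>2)" if j: "j \<in> J" for j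
  proof -
    have "(norm (u j))\<^sup>2 = (norm (\<Sum>b\<in>B. cinner b (u j) *\<^sub>C b))\<^sup>2"
      using B(4)[of "u j"] j by simp
    also have "\<dots> = (\<Sum>b\<in>B. if b = 0 then 0 else (cmod (cinner b (u j)))\<^sup>2)"
      by (rule orthosys_norm_sum[OF B(3,1)])
    also have "\<dots> \<le> (\<Sum>b\<in>B. (cmod (cinner (u j) b))\<^sup>2)"
      by (intro sum_mono) (metis cinner_commute complex_mod_cnj order_refl zero_le_power2)
    finally show ?thesis .
  qed
  then have "(\<Sum>j\<in>J. (norm (u j))\<^sup>2) \<le> (\<Sum>j\<in>J. \<Sum>b\<in>B. (cmod (cinner (u j) b))\<^sup>2)"
    by (rule sum_mono)
  also have "\<dots> \<le> (\<Sum>b\<in>B. Re (cinner b (A b)))"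
    by (subst sum.swap) (intro sum_mono u)
  also have "\<dots> \<le> 1 * (\<Sum>i<N. sing_val A i)"
    using bessel[OF B(3,1)] card_image_le[OF J(1), of u] B(2) J(2)
    by (intro ky_fan[OF A(1) E B(1)]) auto
  finally show ?thesis by simp
qed

lemma eig_system_value:
  assumes "eig_system A l e"
  shows "l n = Re (cinner (e n) (A (e n)))"
proof -
  have "norm (e n) = 1 \<or> l n = 0"
    using orthosys_norm_eq[OF eig_systemD(3)[OF assms]] eig_systemD(6)[OF assms] by auto
  then show ?thesis by (auto simp: eig_systemD(5)[OF assms] cinner_scaleC_right cinner_self)
qed

lemma eig_system_bessel:
  assumes "eig_system A l e" "finite J"
  shows "(\<Sum>j\<in>J. (cmod (cinner (e j) x))\<^sup>2) \<le> 1 * (norm x)\<^sup>2"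
  using bessel[OF orthosys_subset[OF eig_systemD(3)[OF assms(1)]] assms(2)] by simp

text \<open>The eigenvectors of the sum serve as test vectors in \<open>ky_fan\<close> for
  \<open>S\<close> and for \<open>T\<close>.\<close>

lemma sing_val_sum_subadditive:
  assumes S: "positive_op S" "compact_op S" and T: "positive_op T" "compact_op T"
  shows "(\<Sum>n<N. sing_val (\<lambda>x. S x + T x) n) \<le> (\<Sum>n<N. sing_val S n) + (\<Sum>n<N. sing_val T n)"
proof -
  obtain a where a: "eig_system S (sing_val S) a" using positive_eig_system[OF S] by blast
  obtain b where b: "eig_system T (sing_val T) b" using positive_eig_system[OF T] by blast
  obtain e where e: "eig_system (\<lambda>x. S x + T x) (sing_val (\<lambda>x. S x + T x)) e"
    using positive_eig_system[OF positive_op_plus[OF S(1) T(1)] compact_op_plus[OF S(2) T(2)]] by blast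
  have "(\<Sum>n<N. sing_val (\<lambda>x. S x + T x) n) =
      (\<Sum>n<N. Re (cinner (e n) (S (e n)))) + (\<Sum>n<N. Re (cinner (e n) (T (e n))))"
    unfolding eig_system_value[OF e] by (simp add: cinner_add_right sum.distrib)
  also have "\<dots> \<le> 1 * (\<Sum>n<N. sing_val S n) + 1 * (\<Sum>n<N. sing_val T n)"
    using eig_system_bessel[OF e] by (intro add_mono ky_fan[OF S(1) a] ky_fan[OF T(1) b]) auto
  finally show ?thesis by simp
qed

lemma sing_val_sum_superadditive:
  fixes S T :: "'a::complex_hilbert \<Rightarrow> 'a"
  assumes S: "positive_op S" "compact_op S" and T: "positive_op T" "compact_op T"
  shows "(\<Sum>n<N. sing_val S n) + (\<Sum>n<N. sing_val T n) \<le> (\<Sum>n<2 * N. sing_val (\<lambda>x. S x + T x) n)"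
proof -
  obtain a where a: "eig_system S (sing_val S) a" using positive_eig_system[OF S] by blast
  obtain b where b: "eig_system T (sing_val T) b" using positive_eig_system[OF T] by blast
  define u where "u = case_sum (\<lambda>n. of_real (sqrt (sing_val S n)) *\<^sub>C a n)
    (\<lambda>n. of_real (sqrt (sing_val T n)) *\<^sub>C b n)"
  have norm_u: "(norm (of_real (sqrt (l n)) *\<^sub>C e n))\<^sup>2 = l n" if "eig_system A l e"
    for A l n and e :: "nat \<Rightarrow> 'a"
    using orthosys_norm_eq[OF eig_systemD(3)[OF that], of n] eig_systemD(4,6)[OF that, of n]
    by (auto simp: norm_scaleC power_mult_distrib)
  have cinner_u: "(\<Sum>n<N. (cmod (cinner (of_real (sqrt (l n)) *\<^sub>C e n) x))\<^sup>2) \<le> Re (cinner x (A x))"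
    if "eig_system A l e" "positive_op A" for A l x and e :: "nat \<Rightarrow> 'a"
  proof -
    have "(\<Sum>n<N. l n * (cmod (cinner (e n) x))\<^sup>2) \<le> Re (cinner x (A x))"
      using eig_systemD(5)[OF that(1)]
      by (intro eigen_lower_bound[OF that(2)] orthosys_subset[OF eig_systemD(3)[OF that(1)]]) auto
    then show ?thesis
      using eig_systemD(4)[OF that(1)] by (simp add: cinner_scaleC_left norm_mult power_mult_distrib)
  qed
  have "(\<Sum>j\<in>{..<N} <+> {..<N}. (norm (u j))\<^sup>2) \<le> (\<Sum>n<2 * N. sing_val (\<lambda>x. S x + T x) n)"
  proof (rule sing_val_sum_ge[OF positive_op_plus[OF S(1) T(1)] compact_op_plus[OF S(2) T(2)]])
    show "finite ({..<N} <+> {..<N})" "card ({..<N} <+> {..<N}) \<le> 2 * N" by (auto simp: card_Plus)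
    show "(\<Sum>j\<in>{..<N} <+> {..<N}. (cmod (cinner (u j) x))\<^sup>2) \<le> Re (cinner x (S x + T x))" for x
      using add_mono[OF cinner_u[OF a S(1), of x] cinner_u[OF b T(1), of x]]
      by (simp add: sum.Plus u_def cinner_add_right)
  qed
  then show ?thesis by (simp add: sum.Plus u_def norm_u[OF a] norm_u[OF b])
qed

text \<open>\<open>eigen_lower_bound\<close> for \<open>G\<close> at the vector \<open>Y x\<close>
  is a bound for \<open>X \<circ> G \<circ> Y\<close> at \<open>x\<close>, with the scaled images
  \<open>u i\<close> of the eigenvectors as subordinate family.\<close>

lemma sing_val_conjugate_lower:
  assumes X: "bounded_clinear X" "is_adjoint Y X" and G: "positive_op G" "compact_op G"
    and f: "orthosys {..<N} f" and eig: "\<And>i. i < N \<Longrightarrow> G (f i) = of_real (l i) *\<^sub>C f i" "\<And>i. 0 \<le> l i"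
  shows "(\<Sum>i<N. l i * (norm (X (f i)))\<^sup>2) \<le> (\<Sum>n<N. sing_val (X \<circ> G \<circ> Y) n)"
proof -
  define u where "u i = of_real (sqrt (l i)) *\<^sub>C X (f i)" for i
  have "(\<Sum>i<N. (norm (u i))\<^sup>2) \<le> (\<Sum>n<N. sing_val (X \<circ> G \<circ> Y) n)"
  proof (rule sing_val_sum_ge)
    show "positive_op (X \<circ> G \<circ> Y)" by (rule positive_op_conjugate[OF X(2,1) G(1)])
    show "compact_op (X \<circ> G \<circ> Y)"
      by (intro compact_op_compose_right compact_op_compose_left X(1) G(2) is_adjoint_bounded[OF X(2)])
    fix x
    have "(\<Sum>i<N. l i * (cmod (cinner (f i) (Y x)))\<^sup>2) \<le> Re (cinner (Y x) (G (Y x)))"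
      using eig by (intro eigen_lower_bound[OF G(1) f]) auto
    then show "(\<Sum>i<N. (cmod (cinner (u i) x))\<^sup>2) \<le> Re (cinner x ((X \<circ> G \<circ> Y) x))"
      using eig(2)
      by (simp add: u_def cinner_scaleC_left norm_mult power_mult_distrib is_adjointD'[OF X(2)]
          is_adjointD[OF X(2)])
  qed auto
  then show ?thesis using eig(2) by (simp add: u_def norm_scaleC power_mult_distrib)
qed

text \<open>The vectors \<open>Y (a n)\<close> and \<open>W (b n)\<close> jointly satisfy a Bessel
  inequality with constant \<open>c\<close>, because their coefficients at \<open>x\<close> are
  those of \<open>X x\<close> and \<open>Z x\<close> in two orthonormal systems. Treated separately,
  each conjugate would cost the full constant \<open>c\<close>.\<close>

lemma sing_val_conjugate_upper:
  assumes X: "bounded_clinear X" "is_adjoint Y X" and Z: "bounded_clinear Z" "is_adjoint W Z"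
    and G: "positive_op G" "compact_op G"
    and c: "0 \<le> c" "\<And>x. (norm (X x))\<^sup>2 + (norm (Z x))\<^sup>2 \<le> c * (norm x)\<^sup>2"
  shows "(\<Sum>n<N. sing_val (X \<circ> G \<circ> Y) n) + (\<Sum>n<N. sing_val (Z \<circ> G \<circ> W) n) \<le> c * (\<Sum>n<2 * N. sing_val G n)"
proof -
  obtain g where g: "eig_system G (sing_val G) g" using positive_eig_system[OF G] by blast
  have ex: "\<exists>a. eig_system (X \<circ> G \<circ> Y) (sing_val (X \<circ> G \<circ> Y)) a"
    if "bounded_clinear X" "is_adjoint Y X" for X Y
    using positive_eig_system[OF positive_op_conjugate[OF that(2,1) G(1)]
        compact_op_compose_right[OF compact_op_compose_left[OF that(1) G(2)] is_adjoint_bounded[OF that(2)]]]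
    by blast
  obtain a where a: "eig_system (X \<circ> G \<circ> Y) (sing_val (X \<circ> G \<circ> Y)) a" using ex[OF X] by blast
  obtain b where b: "eig_system (Z \<circ> G \<circ> W) (sing_val (Z \<circ> G \<circ> W)) b" using ex[OF Z] by blast
  define y where "y = case_sum (\<lambda>n. Y (a n)) (\<lambda>n. W (b n))"
  have "(\<Sum>j\<in>{..<N} <+> {..<N}. Re (cinner (y j) (G (y j)))) \<le> c * (\<Sum>n<2 * N. sing_val G n)"
  proof (rule ky_fan[OF G(1) g])
    show "finite ({..<N} <+> {..<N})" "card ({..<N} <+> {..<N}) \<le> 2 * N" by (auto simp: card_Plus)
    show "(\<Sum>j\<in>{..<N} <+> {..<N}. (cmod (cinner (y j) x))\<^sup>2) \<le> c * (norm x)\<^sup>2" for x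
      using c(2)[of x] eig_system_bessel[OF a, of "{..<N}" "X x"] eig_system_bessel[OF b, of "{..<N}" "Z x"]
      by (simp add: sum.Plus y_def is_adjointD[OF X(2)] is_adjointD[OF Z(2)])
  qed (rule c)
  then show ?thesis
    by (simp add: sum.Plus y_def is_adjointD[OF X(2)] is_adjointD[OF Z(2)]
        eig_system_value[OF a] eig_system_value[OF b])
qed

section \<open>Dixmier traces\<close>

text \<open>\<open>Bcontfun\<close> is meaningful on bounded functions only, so every sequence fed
  to a functional needs an explicit bound before its entries can be read back.\<close>

lemma apply_Bcontfun_nat:
  fixes f :: "nat \<Rightarrow> real"
  assumes "\<And>i. \<bar>f i\<bar> \<le> C"
  shows "apply_bcontfun (Bcontfun f) = f"
  using assms by (intro Bcontfun_inverse)
    (auto simp: bcontfun_def bounded_iff intro!: continuous_on_discrete exI[of _ C])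

lemma apply_bcontfun_le: "\<bar>apply_bcontfun a i\<bar> \<le> norm (a :: nat \<Rightarrow>\<^sub>C real)"
  using norm_bounded[of a i] by simp

lemma D2_apply: "apply_bcontfun (D2 a) i = apply_bcontfun a (i div 2)"
  unfolding D2_def by (subst apply_Bcontfun_nat[of _ "norm a"]) (simp_all add: apply_bcontfun_le)

lemma D2_add: "D2 (a + b) = D2 a + D2 b"
  by (rule bcontfun_eqI) (simp add: D2_apply)

lemma gamma_seq_bounded:
  assumes T: "T \<in> L1inf" "is_adjoint S T"
  obtains C where "\<And>i. \<bar>gamma_seq T i\<bar> \<le> C"
proof -
  have "\<exists>C. \<forall>k. gamma_seq T k \<le> C" using T by (auto simp: L1inf_def bdd_above_def)
  then obtain C where C: "\<And>k. gamma_seq T k \<le> C" by blast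
  have "0 \<le> gamma_seq T i" for i
    using sing_val_nonneg[OF L1inf_compact[OF T(1)] T(2)]
    by (auto simp: gamma_seq_def intro!: divide_nonneg_nonneg sum_nonneg)
  then show ?thesis using C that[of C] by simp
qed

lemma gamma_apply:
  assumes T: "T \<in> L1inf" "is_adjoint S T"
  shows "apply_bcontfun (gamma T) = gamma_seq T"
proof -
  obtain C where "\<And>i. \<bar>gamma_seq T i\<bar> \<le> C" using gamma_seq_bounded[OF T] by blast
  then show ?thesis unfolding gamma_def by (rule apply_Bcontfun_nat)
qed

lemma DL2_nonneg: "\<omega> \<in> DL2 H \<Longrightarrow> (\<And>i. 0 \<le> apply_bcontfun a i) \<Longrightarrow> 0 \<le> blinfun_apply \<omega> a"
  unfolding DL2_def by blast

lemma DL2_one: "\<omega> \<in> DL2 H \<Longrightarrow> blinfun_apply \<omega> (const_bcontfun 1) = 1"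
  unfolding DL2_def by blast

lemma DL2_mono:
  assumes "\<omega> \<in> DL2 H" "\<And>i. apply_bcontfun a i \<le> apply_bcontfun b i"
  shows "blinfun_apply \<omega> a \<le> blinfun_apply \<omega> b"
  using DL2_nonneg[OF assms(1), of "b - a"] assms(2) by (simp add: blinfun.diff_right)

lemma DL2_const: "\<omega> \<in> DL2 H \<Longrightarrow> blinfun_apply \<omega> (const_bcontfun c) = c"
proof -
  assume w: "\<omega> \<in> DL2 H"
  have "const_bcontfun c = c *\<^sub>R const_bcontfun (1::real)" by (rule bcontfun_eqI) (simp add: const_bcontfun.rep_eq)
  then have "blinfun_apply \<omega> (const_bcontfun c) = c *\<^sub>R blinfun_apply \<omega> (const_bcontfun 1)"
    by (metis blinfun.scaleR_right)
  then show ?thesis using DL2_one[OF w] by simp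
qed

text \<open>The clause of \<open>DL2\<close> on lower and upper limits speaks about nonnegative
  sequences; adding the constant \<open>norm a\<close> reduces to that case.\<close>

lemma DL2_limit:
  assumes w: "\<omega> \<in> DL2 H" and lim: "apply_bcontfun a \<longlonglongrightarrow> c"
  shows "blinfun_apply \<omega> a = c"
proof -
  define K where "K = norm a"
  define b where "b = a + const_bcontfun K"
  have b: "apply_bcontfun b i = apply_bcontfun a i + K" for i by (simp add: b_def const_bcontfun.rep_eq)
  have nn: "0 \<le> apply_bcontfun b i" for i using apply_bcontfun_le[of a i] by (simp add: b K_def)
  have "(\<lambda>i. ereal (apply_bcontfun b i)) \<longlonglongrightarrow> ereal (c + K)"
    unfolding b using lim by (intro tendsto_intros) auto
  then have lims: "liminf (\<lambda>i. ereal (apply_bcontfun b i)) = ereal (c + K)"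
    "limsup (\<lambda>i. ereal (apply_bcontfun b i)) = ereal (c + K)"
    by (auto intro: lim_imp_Liminf lim_imp_Limsup)
  have "liminf (\<lambda>i. ereal (apply_bcontfun b i)) \<le> ereal (blinfun_apply \<omega> b) \<and>
      ereal (blinfun_apply \<omega> b) \<le> limsup (\<lambda>i. ereal (apply_bcontfun b i))"
    using w nn unfolding DL2_def by blast
  then have "blinfun_apply \<omega> b = c + K" unfolding lims by simp
  then show ?thesis by (simp add: b_def blinfun.add_right DL2_const[OF w])
qed

lemma DL2_D2:
  fixes T :: "'h::complex_hilbert \<Rightarrow> 'h"
  assumes "\<omega> \<in> DL2 TYPE('h)" "positive_op T" "T \<in> L1inf"
  shows "blinfun_apply \<omega> (D2 (gamma T)) = blinfun_apply \<omega> (gamma T)"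
  using assms unfolding DL2_def by blast

lemma filterlim_ln_div2: "filterlim (\<lambda>i. ln (real (i div 2) + 2)) at_top sequentially"
proof -
  have "filterlim (\<lambda>i::nat. i div 2) at_top sequentially"
    unfolding filterlim_at_top eventually_sequentially by (metis div_le_mono nonzero_mult_div_cancel_right zero_neq_numeral)
  then have "filterlim (\<lambda>i. 2 + real (i div 2)) at_top sequentially"
    by (intro filterlim_tendsto_add_at_top[OF tendsto_const] filterlim_compose[OF filterlim_real_sequentially])
  then show ?thesis by (simp add: add.commute filterlim_compose[OF ln_at_top])
qed

text \<open>This is where invariance under \<open>D\<^sub>2\<close> enters: a functional in \<open>DL\<^sub>2\<close> does not see the
  difference between \<open>2k\<close> and \<open>k\<close> singular values.\<close>

lemma DL2_double_le:
  fixes A :: "'h::complex_hilbert \<Rightarrow> 'h"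
  assumes w: "\<omega> \<in> DL2 TYPE('h)" and A: "positive_op A" "A \<in> L1inf" and c: "0 \<le> c"
    and x: "blinfun_apply \<omega> (D2 x) = blinfun_apply \<omega> x"
    and le: "\<And>k. apply_bcontfun x k * ln (1 + real (Suc k)) \<le> c * (\<Sum>n<2 * Suc k. sing_val A n)"
  shows "blinfun_apply \<omega> x \<le> c * blinfun_apply \<omega> (gamma A)"
proof -
  note adj = positive_op_adjoint[OF A(1)]
  note cA = L1inf_compact[OF A(2)] adj
  obtain C where C: "\<And>i. \<bar>gamma_seq A i\<bar> \<le> C" using gamma_seq_bounded[OF A(2) adj] by blast
  define s0 where "s0 = sing_val A 0"
  \<comment> \<open>With m = i div 2, \<open>d\<close> collects the errors of passing from
    \<open>2 * Suc m\<close> to \<open>Suc i\<close> singular values and from ln (i + 2) to ln (m +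
    2): one further singular value, at most \<open>s0\<close>, and a summand ln 2, weighted by
    \<open>gamma_seq A i \<le> C\<close>. Both vanish after division by the logarithm.\<close>
  define d where "d i = c * (s0 + C * ln 2) / ln (real (i div 2) + 2)" for i
  have C0: "0 \<le> C" using C[of 0] by simp
  have s00: "0 \<le> s0" unfolding s0_def by (rule sing_val_nonneg[OF cA])
  have d_lim: "d \<longlonglongrightarrow> 0"
    unfolding d_def by (rule tendsto_divide_0[OF tendsto_const filterlim_at_top_imp_at_infinity[OF filterlim_ln_div2]])
  have "\<bar>d i\<bar> \<le> c * (s0 + C * ln 2) / ln 2" for i
    unfolding d_def using c s00 C0
    by (auto simp: abs_of_nonneg intro!: divide_left_mono mult_pos_pos)
  then have d: "apply_bcontfun (Bcontfun d) = d" by (rule apply_Bcontfun_nat)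
  have "apply_bcontfun (D2 x) i \<le> c * gamma_seq A i + d i" for i
  proof -
    define m where "m = i div 2"
    define sg where "sg = (\<Sum>n\<le>i. sing_val A n)"
    have m: "2 * m \<le> i" "i \<le> 2 * m + 1" by (auto simp: m_def)
    have lnm: "0 < ln (real m + 2)" by simp
    have sg: "0 \<le> sg" unfolding sg_def by (intro sum_nonneg sing_val_nonneg[OF cA])
    \<comment> \<open>\<open>2 * Suc m\<close> is \<open>i + 2\<close> for even \<open>i\<close> and
      \<open>i + 1\<close> for odd \<open>i\<close>, so at most one term beyond index
      \<open>i\<close> occurs.\<close>
    have "(\<Sum>n<2 * Suc m. sing_val A n) \<le> (\<Sum>n\<le>Suc i. sing_val A n)"
      using m by (intro sum_mono2 sing_val_nonneg[OF cA]) auto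
    also have "\<dots> \<le> sg + s0"
      using sing_val_decseq[OF cA] by (simp add: sg_def s0_def decseq_def)
    finally have "apply_bcontfun x m * ln (real m + 2) \<le> c * (sg + s0)"
      using le[of m] c by (smt (verit) mult_left_mono of_nat_Suc)
    then have 1: "apply_bcontfun x m \<le> c * (sg + s0) / ln (real m + 2)"
      using lnm by (simp add: pos_le_divide_eq)
    have "real i + 2 \<le> 2 * (real m + 2)" using of_nat_mono[OF m(2), where 'a = real] by simp
    then have "ln (real i + 2) \<le> ln (2 * (real m + 2))" by simp
    also have "\<dots> = ln 2 + ln (real m + 2)" by (subst ln_mult) auto
    finally have "ln (real i + 2) \<le> ln 2 + ln (real m + 2)" .
    moreover have g: "gamma_seq A i * ln (real i + 2) = sg"
      by (simp add: gamma_seq_def sg_def add.commute)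
    moreover have "0 \<le> gamma_seq A i" unfolding gamma_seq_def using sg by (simp add: sg_def)
    ultimately have "sg \<le> gamma_seq A i * (ln 2 + ln (real m + 2))"
      by (metis mult_left_mono)
    also have "\<dots> \<le> C * ln 2 + gamma_seq A i * ln (real m + 2)"
      using C[of i] by (simp add: distrib_left)
    finally have "c * (sg + s0) \<le> c * (C * ln 2 + s0 + gamma_seq A i * ln (real m + 2))"
      using c by (intro mult_left_mono) auto
    then have "c * (sg + s0) / ln (real m + 2) \<le> c * (C * ln 2 + s0 + gamma_seq A i * ln (real m + 2)) / ln (real m + 2)"
      using lnm by (simp add: divide_right_mono)
    also have "\<dots> = c * gamma_seq A i + d i"
      using lnm by (simp add: d_def m_def field_simps)
    finally show ?thesis using 1 by (simp add: D2_apply m_def)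
  qed
  then have "blinfun_apply \<omega> (D2 x) \<le> blinfun_apply \<omega> (c *\<^sub>R gamma A + Bcontfun d)"
    by (intro DL2_mono[OF w]) (simp add: gamma_apply[OF A(2) adj] d)
  also have "\<dots> = c * blinfun_apply \<omega> (gamma A) + blinfun_apply \<omega> (Bcontfun d)"
    by (simp add: blinfun.add_right blinfun.scaleR_right)
  also have "blinfun_apply \<omega> (Bcontfun d) = 0"
    by (rule DL2_limit[OF w]) (simp add: d d_lim)
  finally show ?thesis by (simp add: x)
qed

lemma gamma_seq_mult_ln: "gamma_seq T k * ln (1 + real (Suc k)) = (\<Sum>n<Suc k. sing_val T n)"
  by (simp add: gamma_seq_def lessThan_Suc_atMost)

lemma gamma_seq_le_iff:
  "gamma_seq T k \<le> x \<longleftrightarrow> (\<Sum>n<Suc k. sing_val T n) \<le> x * ln (1 + real (Suc k))"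
  "x \<le> gamma_seq T k \<longleftrightarrow> x * ln (1 + real (Suc k)) \<le> (\<Sum>n<Suc k. sing_val T n)"
  by (simp_all add: gamma_seq_def lessThan_Suc_atMost pos_divide_le_eq pos_le_divide_eq)

lemma L1inf_positive_plus:
  "positive_op S \<Longrightarrow> S \<in> L1inf \<Longrightarrow> positive_op T \<Longrightarrow> T \<in> L1inf \<Longrightarrow> (\<lambda>x. S x + T x) \<in> L1inf"
  by (rule L1inf_plus) (auto intro: positive_op_adjoint)

text \<open>Subadditivity holds entry by entry. Superadditivity holds with a doubled number of
  terms, hence only after applying \<open>\<omega>\<close>, by \<open>DL2_double_le\<close> for the
  sum of two sequences on which \<open>\<omega>\<close> is invariant under
  \<open>D2\<close>.\<close>

lemma DL2_gamma_plus:
  fixes S T :: "'h::complex_hilbert \<Rightarrow> 'h"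
  assumes w: "\<omega> \<in> DL2 TYPE('h)" and S: "positive_op S" "S \<in> L1inf" and T: "positive_op T" "T \<in> L1inf"
  shows "blinfun_apply \<omega> (gamma (\<lambda>x. S x + T x)) = blinfun_apply \<omega> (gamma S) + blinfun_apply \<omega> (gamma T)"
proof (rule antisym)
  note pos = positive_op_plus[OF S(1) T(1)] and L = L1inf_positive_plus[OF S T]
  note app = gamma_apply[OF S(2) positive_op_adjoint[OF S(1)]] gamma_apply[OF T(2) positive_op_adjoint[OF T(1)]]
    gamma_apply[OF L positive_op_adjoint[OF pos]]
  note cS = S(1) L1inf_compact[OF S(2)] and cT = T(1) L1inf_compact[OF T(2)]
  show "blinfun_apply \<omega> (gamma (\<lambda>x. S x + T x)) \<le> blinfun_apply \<omega> (gamma S) + blinfun_apply \<omega> (gamma T)"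
    unfolding blinfun.add_right[symmetric]
  proof (rule DL2_mono[OF w])
    fix i show "apply_bcontfun (gamma (\<lambda>x. S x + T x)) i \<le> apply_bcontfun (gamma S + gamma T) i"
      using sing_val_sum_subadditive[OF cS cT, of "Suc i"]
      by (simp only: plus_bcontfun.rep_eq app gamma_seq_le_iff distrib_right gamma_seq_mult_ln)
  qed
  have "blinfun_apply \<omega> (gamma S + gamma T) \<le> 1 * blinfun_apply \<omega> (gamma (\<lambda>x. S x + T x))"
  proof (rule DL2_double_le[OF w pos L])
    show "blinfun_apply \<omega> (D2 (gamma S + gamma T)) = blinfun_apply \<omega> (gamma S + gamma T)"
      by (simp add: D2_add blinfun.add_right DL2_D2[OF w S] DL2_D2[OF w T])
    fix k show "apply_bcontfun (gamma S + gamma T) k * ln (1 + real (Suc k))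
        \<le> 1 * (\<Sum>n<2 * Suc k. sing_val (\<lambda>x. S x + T x) n)"
      using sing_val_sum_superadditive[OF cS cT, of "Suc k"]
      by (simp only: plus_bcontfun.rep_eq app distrib_right gamma_seq_mult_ln mult_1)
  qed simp
  then show "blinfun_apply \<omega> (gamma S) + blinfun_apply \<omega> (gamma T) \<le> blinfun_apply \<omega> (gamma (\<lambda>x. S x + T x))"
    by (simp add: blinfun.add_right)
qed

text \<open>Composition with a scalar gives one inequality; the same inequality for
  \<open>1 / c\<close> gives the reverse one.\<close>

lemma sing_val_scale:
  assumes T: "compact_op T" "is_adjoint S T" and c: "0 \<le> c"
  shows "sing_val (\<lambda>x. of_real c *\<^sub>C T x) n = c * sing_val T n"
proof -
  have le: "sing_val (\<lambda>x. of_real a *\<^sub>C R x) n \<le> a * sing_val R n"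
    if "compact_op R" "is_adjoint Q R" "0 \<le> a" for R Q :: "'a \<Rightarrow> 'a" and a n
  proof -
    have b: "bounded_clinear (\<lambda>x::'a. of_real a *\<^sub>C x)"
      by (rule bounded_clinear_scale) (rule is_adjoint_bounded[OF is_adjoint_id])
    have "sing_val ((\<lambda>x. of_real a *\<^sub>C x) \<circ> R) n \<le> a * sing_val R n"
      by (rule sing_val_compose_left[OF that(1,2) b is_adjoint_scale[OF is_adjoint_id]])
        (use that(3) in \<open>auto simp: norm_scaleC\<close>)
    then show ?thesis by (simp add: o_def)
  qed
  have b: "bounded_clinear (\<lambda>x::'a. of_real c *\<^sub>C x)"
    by (rule bounded_clinear_scale) (rule is_adjoint_bounded[OF is_adjoint_id])
  have cT: "compact_op (\<lambda>x. of_real c *\<^sub>C T x)"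
    using compact_op_compose_left[OF b T(1)] by (simp add: o_def)
  note adj = is_adjoint_scale[OF T(2), of "of_real c"]
  show ?thesis
  proof (cases "c = 0")
    case True
    then show ?thesis using le[OF T c, of n] sing_val_nonneg[OF cT adj, of n] by simp
  next
    case False
    then have cp: "c > 0" using c by simp
    have "sing_val (\<lambda>x. of_real (1 / c) *\<^sub>C (of_real c *\<^sub>C T x)) n
        \<le> (1 / c) * sing_val (\<lambda>x. of_real c *\<^sub>C T x) n"
      by (rule le[OF cT adj]) (use cp in simp)
    moreover have "(\<lambda>x. of_real (1 / c) *\<^sub>C (of_real c *\<^sub>C T x)) = T"
      using cp by (simp add: scaleC_scaleC scaleC_one)
    ultimately have "c * sing_val T n \<le> sing_val (\<lambda>x. of_real c *\<^sub>C T x) n"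
      using cp by (simp add: field_simps)
    then show ?thesis using le[OF T c, of n] by simp
  qed
qed

lemma DL2_gamma_scale:
  fixes T :: "'h::complex_hilbert \<Rightarrow> 'h"
  assumes T: "positive_op T" "T \<in> L1inf" and c: "0 \<le> c"
  shows "blinfun_apply \<omega> (gamma (\<lambda>x. of_real c *\<^sub>C T x)) = c * blinfun_apply \<omega> (gamma T)"
proof -
  note adj = positive_op_adjoint[OF T(1)]
  have "gamma (\<lambda>x. of_real c *\<^sub>C T x) = c *\<^sub>R gamma T"
  proof (rule bcontfun_eqI)
    fix i show "apply_bcontfun (gamma (\<lambda>x. of_real c *\<^sub>C T x)) i = apply_bcontfun (c *\<^sub>R gamma T) i"
      by (simp add: gamma_apply[OF L1inf_scale[OF T(2) adj] is_adjoint_scale[OF adj]] gamma_apply[OF T(2) adj]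
          gamma_seq_def sing_val_scale[OF L1inf_compact[OF T(2)] adj c] sum_distrib_left)
  qed
  then show ?thesis by (simp add: blinfun.scaleR_right)
qed

section \<open>Linear extension from the positive cone\<close>

lemma positive_op_zero: "positive_op (\<lambda>x. 0)"
  by (rule positive_opI[of _ "\<lambda>_. 0"]) (auto intro!: bounded_clinearI[of _ 0])

lemma L1inf_zero: "(\<lambda>x::'a::complex_hilbert. 0) \<in> L1inf"
proof (rule L1infI)
  have b: "bounded_clinear (\<lambda>x::'a. 0)" by (rule positive_op_bounded[OF positive_op_zero])
  show c: "compact_op (\<lambda>x::'a. 0)" by (rule compact_op_subset[OF b, of "{0}"]) auto
  have "sing_val (\<lambda>x::'a. 0) n \<le> 0" for n
    by (rule sing_val_le[OF c positive_op_adjoint[OF positive_op_zero], of "{}"]) auto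
  then show "(\<Sum>n\<le>k. sing_val (\<lambda>x::'a. 0) n) \<le> 0 * ln (1 + real (Suc k))" for k
    by (simp add: sum_nonpos)
qed

lemma positive_op_eqI:
  assumes S: "positive_op S" and T: "positive_op T" and eq: "\<And>x. Re (cinner x (S x)) = Re (cinner x (T x))"
  shows "S = T"
proof
  fix y
  have eq': "cinner x (S x - T x) = 0" for x
    by (metis S T cinner_diff_right eq positive_op_cinner right_minus_eq)
  show "S y = T y"
  proof (rule cinner_eqI)
    fix x
    have "cinner x (S y - T y) + cinner y (S x - T x) = 0"
      using eq'[of "x + y"] eq'[of x] eq'[of y] S[THEN positive_op_bounded] T[THEN positive_op_bounded]
      by (simp add: bounded_clinear_add cinner_simps algebra_simps)
    moreover have "\<i> * cinner x (S y - T y) - \<i> * cinner y (S x - T x) = 0"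
      using eq'[of "x + \<i> *\<^sub>C y"] eq'[of x] eq'[of y] S[THEN positive_op_bounded] T[THEN positive_op_bounded]
      by (simp add: bounded_clinear_add bounded_clinear_scaleC cinner_simps algebra_simps)
    ultimately show "cinner x (S y) = cinner x (T y)"
      by (simp add: cinner_diff_right)
  qed
qed

lemma sum_fun_apply: "(\<Sum>i\<in>F. f i) x = (\<Sum>i\<in>F. f i (x :: 'a) :: 'b::comm_monoid_add)"
  by (induction F rule: infinite_finite_induct) (simp_all add: zero_fun_def plus_fun_def)

lemma DL2_gamma_sum:
  fixes t :: "('h::complex_hilbert \<Rightarrow> 'h) set"
  assumes w: "\<omega> \<in> DL2 TYPE('h)" and t: "finite t" "\<And>b. b \<in> t \<Longrightarrow> positive_op b \<and> b \<in> L1inf"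
    and r: "\<And>b. b \<in> t \<Longrightarrow> 0 \<le> r b"
  shows "positive_op (\<lambda>x. \<Sum>b\<in>t. of_real (r b) *\<^sub>C b x) \<and> (\<lambda>x. \<Sum>b\<in>t. of_real (r b) *\<^sub>C b x) \<in> L1inf \<and>
    blinfun_apply \<omega> (gamma (\<lambda>x. \<Sum>b\<in>t. of_real (r b) *\<^sub>C b x)) = (\<Sum>b\<in>t. r b * blinfun_apply \<omega> (gamma b))"
  using t r
proof (induction t)
  case empty
  show ?case
    using DL2_gamma_scale[OF positive_op_zero L1inf_zero, of 0 \<omega>] positive_op_zero L1inf_zero by simp
next
  case (insert b t)
  define Q where "Q x = (\<Sum>b\<in>t. of_real (r b) *\<^sub>C b x)" for x
  have Q: "positive_op Q" "Q \<in> L1inf" "blinfun_apply \<omega> (gamma Q) = (\<Sum>b\<in>t. r b * blinfun_apply \<omega> (gamma b))"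
    using insert unfolding Q_def by auto
  have b: "positive_op b" "b \<in> L1inf" "0 \<le> r b" using insert.prems by auto
  have rb: "positive_op (\<lambda>x. of_real (r b) *\<^sub>C b x)" "(\<lambda>x. of_real (r b) *\<^sub>C b x) \<in> L1inf"
    using positive_op_scale[OF b(1,3)] L1inf_scale[OF b(2) positive_op_adjoint[OF b(1)]] by auto
  have eq: "(\<lambda>x. \<Sum>b\<in>insert b t. of_real (r b) *\<^sub>C b x) = (\<lambda>x. of_real (r b) *\<^sub>C b x + Q x)"
    using insert.hyps by (simp add: Q_def)
  show ?case
    unfolding eq
    using positive_op_plus[OF rb(1) Q(1)] L1inf_positive_plus[OF rb Q(1,2)] DL2_gamma_plus[OF w rb Q(1,2)]
      DL2_gamma_scale[OF b, of \<omega>] Q(3) insert.hyps by simp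
qed

text \<open>Negative coefficients are moved to the other side: \<open>T + SN = SP\<close> is an
  identity between sums of positive operators, on which additivity is known. This makes the
  functional independent of the way \<open>T\<close> is written as a real combination.\<close>

lemma DL2_gamma_combination:
  fixes T :: "'h::complex_hilbert \<Rightarrow> 'h"
  assumes w: "\<omega> \<in> DL2 TYPE('h)" and t: "finite t" "\<And>b. b \<in> t \<Longrightarrow> positive_op b \<and> b \<in> L1inf"
    and T: "positive_op T" "T \<in> L1inf"
    and eq: "\<And>x. Re (cinner x (T x)) = (\<Sum>b\<in>t. r b * Re (cinner x (b x)))"
  shows "blinfun_apply \<omega> (gamma T) = (\<Sum>b\<in>t. r b * blinfun_apply \<omega> (gamma b))"
proof -
  define P N where "P = {b\<in>t. 0 \<le> r b}" and "N = {b\<in>t. r b < 0}"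
  define SP SN where "SP = (\<lambda>x. \<Sum>b\<in>P. of_real (r b) *\<^sub>C b x)"
    and "SN = (\<lambda>x. \<Sum>b\<in>N. of_real (- r b) *\<^sub>C b x)"
  have split: "(\<Sum>b\<in>t. f b) = (\<Sum>b\<in>P. f b) + (\<Sum>b\<in>N. f b)" for f :: "_ \<Rightarrow> real"
    using t(1) by (subst sum.union_disjoint[symmetric]) (auto simp: P_def N_def intro!: sum.cong)
  have SP: "positive_op SP \<and> SP \<in> L1inf \<and>
      blinfun_apply \<omega> (gamma SP) = (\<Sum>b\<in>P. r b * blinfun_apply \<omega> (gamma b))"
    unfolding SP_def by (rule DL2_gamma_sum[OF w]) (use t in \<open>simp_all add: P_def\<close>)
  have SN: "positive_op SN \<and> SN \<in> L1inf \<and>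
      blinfun_apply \<omega> (gamma SN) = (\<Sum>b\<in>N. (- r b) * blinfun_apply \<omega> (gamma b))"
    unfolding SN_def by (rule DL2_gamma_sum[OF w]) (use t in \<open>simp_all add: N_def\<close>)
  have "(\<lambda>x. T x + SN x) = SP"
  proof (rule positive_op_eqI[OF positive_op_plus[OF T(1) conjunct1[OF SN]] conjunct1[OF SP]])
    fix x
    have "Re (cinner x (SN x)) = (\<Sum>b\<in>N. - r b * Re (cinner x (b x)))"
      by (simp add: SN_def cinner_sum_right cinner_scaleC_right cinner_minus_right)
    moreover have "Re (cinner x (SP x)) = (\<Sum>b\<in>P. r b * Re (cinner x (b x)))"
      by (simp add: SP_def cinner_sum_right cinner_scaleC_right)
    ultimately show "Re (cinner x (T x + SN x)) = Re (cinner x (SP x))"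
      by (simp add: cinner_add_right eq split sum_negf)
  qed
  then have "blinfun_apply \<omega> (gamma T) + blinfun_apply \<omega> (gamma SN) = blinfun_apply \<omega> (gamma SP)"
    using DL2_gamma_plus[OF w T, of SN] SN by simp
  then show ?thesis using SP SN by (simp add: split sum_negf)
qed

text \<open>The functional is first defined on a basis, consisting of positive operators, of the span of the
  positive cone of \<open>\<L>\<^sup>1\<^sup>,\<^sup>\<infinity>\<close>, and then extended linearly to all functions.\<close>

lemma dixmier_trace_exists:
  assumes w: "\<omega> \<in> DL2 TYPE('h::complex_hilbert)"
  shows "\<exists>\<tau>. (\<forall>S\<in>L1inf. \<forall>T\<in>L1inf. \<tau> (\<lambda>x. S x + T x) = \<tau> S + \<tau> T) \<and>
    (\<forall>T\<in>L1inf. \<forall>c. \<tau> (\<lambda>x. c *\<^sub>C T x) = c * \<tau> T) \<and>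
    (\<forall>T::'h \<Rightarrow> 'h\<in>L1inf. positive_op T \<longrightarrow> \<tau> T = complex_of_real (blinfun_apply \<omega> (gamma T)))"
proof -
  interpret fv: vector_space "\<lambda>(c::complex) (T :: 'h \<Rightarrow> 'h) x. c *\<^sub>C T x"
    by standard (simp_all add: fun_eq_iff plus_fun_def scaleC_add_left scaleC_add_right scaleC_scaleC scaleC_one)
  interpret vp: vector_space_pair "\<lambda>(c::complex) (T :: 'h \<Rightarrow> 'h) x. c *\<^sub>C T x" "(*) :: complex \<Rightarrow> _"
    by standard (simp_all add: algebra_simps)
  define C where "C = {T :: 'h \<Rightarrow> 'h. positive_op T \<and> T \<in> L1inf}"
  define p where "p T = blinfun_apply \<omega> (gamma T)" for T :: "'h \<Rightarrow> 'h"
  obtain B where B: "B \<subseteq> C" "fv.independent B" "C \<subseteq> fv.span B" by (rule fv.maximal_independent_subset)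
  obtain g where g: "Vector_Spaces.linear (\<lambda>(c::complex) (T :: 'h \<Rightarrow> 'h) x. c *\<^sub>C T x) (*) g"
    "\<And>b. b \<in> B \<Longrightarrow> g b = complex_of_real (p b)"
    using vp.linear_independent_extend[OF B(2), of "\<lambda>b. complex_of_real (p b)"] by blast
  have add: "g (\<lambda>x. S x + T x) = g S + g T" for S T
    using vp.linear_add[OF g(1), of S T] by (simp add: plus_fun_def)
  have scale: "g (\<lambda>x. c *\<^sub>C T x) = c * g T" for c T
    by (rule vp.linear_scale[OF g(1)])
  have "g T = complex_of_real (p T)" if T: "T \<in> C" for T
  proof -
    obtain t u where t: "finite t" "t \<subseteq> B" and Tu: "T = (\<Sum>b\<in>t. (\<lambda>x. u b *\<^sub>C b x))"
      using B(3) T unfolding fv.span_explicit by blast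
    have tC: "positive_op b \<and> b \<in> L1inf" if "b \<in> t" for b using that t(2) B(1) by (auto simp: C_def)
    have Tpos: "positive_op T" "T \<in> L1inf" using T by (auto simp: C_def)
    have form: "cinner x (T x) = (\<Sum>b\<in>t. u b * of_real (Re (cinner x (b x))))" for x
      unfolding Tu sum_fun_apply cinner_sum_right cinner_scaleC_right
      by (intro sum.cong refl arg_cong2[where f = "(*)"] positive_op_cinner conjunct1[OF tC])
    \<comment> \<open>The coefficients \<open>u b\<close> are complex, but the forms of positive
      operators are real. So the real parts alone represent \<open>T\<close>, the imaginary parts
      represent the zero operator, and \<open>DL2_gamma_combination\<close> applies to both.\<close>
    have re_form: "Re (cinner x (T x)) = (\<Sum>b\<in>t. Re (u b) * Re (cinner x (b x)))" for x
      unfolding form by simp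
    have re: "p T = (\<Sum>b\<in>t. Re (u b) * p b)"
      unfolding p_def by (rule DL2_gamma_combination[OF w t(1) _ Tpos re_form]) (rule tC)
    have "Im (cinner x (T x)) = (\<Sum>b\<in>t. Im (u b) * Re (cinner x (b x)))" for x
      unfolding form by simp
    moreover have "Im (cinner x (T x)) = 0" for x
      by (subst positive_op_cinner[OF Tpos(1)]) simp
    ultimately have im_form: "Re (cinner x 0) = (\<Sum>b\<in>t. Im (u b) * Re (cinner x (b x)))" for x by simp
    have "p (\<lambda>x. 0) = (\<Sum>b\<in>t. Im (u b) * p b)"
      unfolding p_def by (rule DL2_gamma_combination[OF w t(1) _ positive_op_zero L1inf_zero im_form]) (rule tC)
    moreover have "p (\<lambda>x. 0) = 0"
      using DL2_gamma_scale[OF positive_op_zero L1inf_zero, of 0 \<omega>] by (simp add: p_def)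
    ultimately have im: "(\<Sum>b\<in>t. Im (u b) * p b) = 0" by simp
    have "g T = (\<Sum>b\<in>t. g (\<lambda>x. u b *\<^sub>C b x))" unfolding Tu by (rule vp.linear_sum[OF g(1)])
    also have "\<dots> = (\<Sum>b\<in>t. u b * of_real (p b))"
      using t(2) by (intro sum.cong) (auto simp: scale g(2))
    also have "\<dots> = of_real (p T)"
      by (rule complex_eqI) (simp_all add: re im)
    finally show ?thesis .
  qed
  then show ?thesis using add scale by (intro exI[of _ g]) (auto simp: C_def p_def)
qed

text \<open>\<open>dixmier_trace\<close> is a choice, so it is accessible through these three
  properties alone.\<close>

lemma dixmier_trace_props:
  assumes w: "\<omega> \<in> DL2 TYPE('h::complex_hilbert)"
  shows "\<And>S T :: 'h \<Rightarrow> 'h. S \<in> L1inf \<Longrightarrow> T \<in> L1inf \<Longrightarrow>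
      dixmier_trace \<omega> (\<lambda>x. S x + T x) = dixmier_trace \<omega> S + dixmier_trace \<omega> T"
    and "\<And>(T :: 'h \<Rightarrow> 'h) c. T \<in> L1inf \<Longrightarrow> dixmier_trace \<omega> (\<lambda>x. c *\<^sub>C T x) = c * dixmier_trace \<omega> T"
    and "\<And>T :: 'h \<Rightarrow> 'h. T \<in> L1inf \<Longrightarrow> positive_op T \<Longrightarrow>
      dixmier_trace \<omega> T = complex_of_real (blinfun_apply \<omega> (gamma T))"
  using someI_ex[OF dixmier_trace_exists[OF w]] unfolding dixmier_trace_def[symmetric] by blast+

section \<open>Logarithmic means and traces of conjugates\<close>

definition log_mean :: "(nat \<Rightarrow> real) \<Rightarrow> nat \<Rightarrow> real"
  where "log_mean u k = (\<Sum>i\<le>k. u i) / ln (1 + real (Suc k))"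

lemma gamma_seq_log_mean: "gamma_seq T = log_mean (sing_val T)"
  by (rule ext) (simp add: gamma_seq_def log_mean_def)

lemma log_mean_mono: "(\<And>i. u i \<le> v i) \<Longrightarrow> log_mean u k \<le> log_mean v k"
  unfolding log_mean_def by (intro divide_right_mono sum_mono) auto

lemma log_mean_add: "log_mean (\<lambda>i. u i + v i) k = log_mean u k + log_mean v k"
  by (simp add: log_mean_def sum.distrib add_divide_distrib)

lemma log_mean_scale: "log_mean (\<lambda>i. c * u i) k = c * log_mean u k"
  by (simp add: log_mean_def sum_distrib_left)

lemma log_mean_bounded:
  assumes "\<And>i. \<bar>u i\<bar> \<le> K * l i" "\<And>k. log_mean l k \<le> C" "0 \<le> K"
  shows "\<bar>log_mean u k\<bar> \<le> K * C"
proof -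
  have "\<bar>log_mean u k\<bar> \<le> log_mean (\<lambda>i. K * l i) k"
    unfolding log_mean_def using assms(1)
    by (auto simp: abs_divide intro!: divide_right_mono order_trans[OF sum_abs] sum_mono)
  also have "\<dots> \<le> K * C" unfolding log_mean_scale using assms(2,3) by (rule mult_left_mono)
  finally show ?thesis .
qed

text \<open>The variational clause of \<open>eig_system\<close> is dropped, since the eigenvalues
  are already tied to \<open>sing_val G\<close>. This leaves the freedom to take the vectors from a
  prescribed basis.\<close>

definition eig_vectors :: "('a::complex_hilbert \<Rightarrow> 'a) \<Rightarrow> (nat \<Rightarrow> 'a) \<Rightarrow> bool"
  where "eig_vectors G f \<longleftrightarrow> orthosys UNIV f \<and>
    (\<forall>i. G (f i) = of_real (sing_val G i) *\<^sub>C f i \<and> (f i = 0 \<longrightarrow> sing_val G i = 0))"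

text \<open>A squeeze. Entry by entry the two logarithmic means lie below the sequences of the two
  conjugates, and they add up to \<open>K\<close> times the sequence of \<open>G\<close>. Under
  \<open>\<omega>\<close>, \<open>DL2_double_le\<close> bounds the sum of both conjugates by the
  same quantity, so each of the two inequalities is an equality.\<close>

lemma DL2_gamma_conjugate:
  fixes G :: "'h::complex_hilbert \<Rightarrow> 'h"
  assumes w: "\<omega> \<in> DL2 TYPE('h)" and G: "positive_op G" "G \<in> L1inf" and f: "eig_vectors G f"
    and X: "bounded_clinear X" "is_adjoint Y X" and Z: "bounded_clinear Z" "is_adjoint W Z"
    and K: "0 \<le> K" "\<And>x. (norm (X x))\<^sup>2 + (norm (Z x))\<^sup>2 = K * (norm x)\<^sup>2"
  shows "X \<circ> G \<circ> Y \<in> L1inf" "positive_op (X \<circ> G \<circ> Y)"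
    "blinfun_apply \<omega> (gamma (X \<circ> G \<circ> Y)) =
      blinfun_apply \<omega> (Bcontfun (log_mean (\<lambda>i. sing_val G i * (norm (X (f i)))\<^sup>2)))"
proof -
  have conj: "R \<circ> G \<circ> R' \<in> L1inf" "positive_op (R \<circ> G \<circ> R')" if R: "bounded_clinear R" "is_adjoint R' R" for R R'
  proof -
    note a = positive_op_adjoint[OF G(1)]
    show "R \<circ> G \<circ> R' \<in> L1inf"
      by (rule L1inf_compose_right[OF L1inf_compose_left[OF G(2) a R] is_adjoint_compose[OF R(2) a]
            is_adjoint_bounded[OF R(2)] is_adjoint_sym[OF R(2,1)]])
    show "positive_op (R \<circ> G \<circ> R')" by (rule positive_op_conjugate[OF R(2,1) G(1)])
  qed
  note XG = conj[OF X] and ZG = conj[OF Z]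
  show "X \<circ> G \<circ> Y \<in> L1inf" "positive_op (X \<circ> G \<circ> Y)" by (rule XG)+
  note cG = L1inf_compact[OF G(2)]
  have s0: "0 \<le> sing_val G i" for i by (rule sing_val_nonneg[OF cG positive_op_adjoint[OF G(1)]])
  obtain C where C: "\<And>k. log_mean (sing_val G) k \<le> C"
    using gamma_seq_bounded[OF G(2) positive_op_adjoint[OF G(1)]] unfolding gamma_seq_log_mean by (metis abs_le_D1)
  define a where "a R i = sing_val G i * (norm (R (f i)))\<^sup>2" for R :: "'h \<Rightarrow> 'h" and i
  \<comment> \<open>Where \<open>f i = 0\<close> the singular value is 0 and both sides vanish;
    every other \<open>f i\<close> is a unit vector.\<close>
  have aXZ: "a X i + a Z i = K * sing_val G i" for i
  proof -
    have "f i = 0 \<longrightarrow> sing_val G i = 0" using f by (simp add: eig_vectors_def)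
    moreover have "f i \<noteq> 0 \<longrightarrow> norm (f i) = 1" using f orthosys_norm_eq[of UNIV f i] by (auto simp: eig_vectors_def)
    ultimately have "sing_val G i * (norm (f i))\<^sup>2 = sing_val G i" by auto
    then show ?thesis unfolding a_def distrib_left[symmetric] K(2) by (simp add: mult.left_commute)
  qed
  have a0: "0 \<le> a R i" for R i using s0 by (simp add: a_def)
  have aX: "\<bar>a X i\<bar> \<le> K * sing_val G i" and aZ: "\<bar>a Z i\<bar> \<le> K * sing_val G i" for i
    using aXZ[of i] a0[of X i] a0[of Z i] by auto
  have appX: "apply_bcontfun (Bcontfun (log_mean (a X))) = log_mean (a X)"
    by (rule apply_Bcontfun_nat, rule log_mean_bounded[OF aX C K(1)])
  have appZ: "apply_bcontfun (Bcontfun (log_mean (a Z))) = log_mean (a Z)"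
    by (rule apply_Bcontfun_nat, rule log_mean_bounded[OF aZ C K(1)])
  have lower: "log_mean (a R) k \<le> apply_bcontfun (gamma (R \<circ> G \<circ> R')) k"
    if R: "bounded_clinear R" "is_adjoint R' R" for R R' k
  proof -
    have "(\<Sum>i<Suc k. a R i) \<le> (\<Sum>n<Suc k. sing_val (R \<circ> G \<circ> R') n)"
      unfolding a_def using f s0 orthosys_subset[of UNIV f "{..<Suc k}"]
      by (intro sing_val_conjugate_lower[OF R G(1) cG]) (auto simp: eig_vectors_def)
    then show ?thesis
      unfolding gamma_apply[OF conj(1)[OF R] positive_op_adjoint[OF conj(2)[OF R]]]
      by (simp add: gamma_seq_def log_mean_def lessThan_Suc_atMost divide_right_mono)
  qed
  have X_le: "blinfun_apply \<omega> (Bcontfun (log_mean (a X))) \<le> blinfun_apply \<omega> (gamma (X \<circ> G \<circ> Y))"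
    by (rule DL2_mono[OF w]) (simp only: appX lower[OF X])
  have Z_le: "blinfun_apply \<omega> (Bcontfun (log_mean (a Z))) \<le> blinfun_apply \<omega> (gamma (Z \<circ> G \<circ> W))"
    by (rule DL2_mono[OF w]) (simp only: appZ lower[OF Z])
  have "Bcontfun (log_mean (a X)) + Bcontfun (log_mean (a Z)) = K *\<^sub>R gamma G"
  proof (rule bcontfun_eqI)
    fix k
    show "apply_bcontfun (Bcontfun (log_mean (a X)) + Bcontfun (log_mean (a Z))) k = apply_bcontfun (K *\<^sub>R gamma G) k"
      by (simp add: appX appZ gamma_apply[OF G(2) positive_op_adjoint[OF G(1)]] gamma_seq_log_mean
          log_mean_add[symmetric] log_mean_scale[symmetric] aXZ)
  qed
  then have sum: "blinfun_apply \<omega> (Bcontfun (log_mean (a X))) + blinfun_apply \<omega> (Bcontfun (log_mean (a Z)))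
      = K * blinfun_apply \<omega> (gamma G)"
    by (metis blinfun.add_right blinfun.scaleR_right real_scaleR_def)
  have "blinfun_apply \<omega> (gamma (X \<circ> G \<circ> Y) + gamma (Z \<circ> G \<circ> W)) \<le> K * blinfun_apply \<omega> (gamma G)"
  proof (rule DL2_double_le[OF w G K(1)])
    show "blinfun_apply \<omega> (D2 (gamma (X \<circ> G \<circ> Y) + gamma (Z \<circ> G \<circ> W)))
        = blinfun_apply \<omega> (gamma (X \<circ> G \<circ> Y) + gamma (Z \<circ> G \<circ> W))"
      by (simp add: D2_add blinfun.add_right DL2_D2[OF w XG(2,1)] DL2_D2[OF w ZG(2,1)])
    fix k
    show "apply_bcontfun (gamma (X \<circ> G \<circ> Y) + gamma (Z \<circ> G \<circ> W)) k * ln (1 + real (Suc k))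
        \<le> K * (\<Sum>n<2 * Suc k. sing_val G n)"
      using sing_val_conjugate_upper[OF X Z G(1) cG K(1), of "Suc k"] K(2)
      by (simp only: plus_bcontfun.rep_eq gamma_apply[OF XG(1) positive_op_adjoint[OF XG(2)]]
          gamma_apply[OF ZG(1) positive_op_adjoint[OF ZG(2)]] distrib_right gamma_seq_mult_ln order_refl simp_thms)
  qed
  then show "blinfun_apply \<omega> (gamma (X \<circ> G \<circ> Y)) =
      blinfun_apply \<omega> (Bcontfun (log_mean (\<lambda>i. sing_val G i * (norm (X (f i)))\<^sup>2)))"
    using X_le Z_le sum unfolding a_def by (simp add: blinfun.add_right)
qed

text \<open>In general \<open>Z\<close> would be the square root of the positive operator K - X*X.
  For multiplication operators it is again a multiplication, so no operator square root has to be
  constructed.\<close>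

definition complemented :: "('a::complex_hilbert \<Rightarrow> 'a) \<Rightarrow> bool"
  where "complemented X \<longleftrightarrow> (\<exists>Z W K. bounded_clinear Z \<and> is_adjoint W Z \<and> 0 \<le> K \<and>
    (\<forall>x. (norm (X x))\<^sup>2 + (norm (Z x))\<^sup>2 = K * (norm x)\<^sup>2))"

text \<open>Polarization: \<open>4 B G = \<Sum>\<^sub>c c (B + c) G (B + c)\<^sup>*\<close>, where \<open>c\<close> runs through the fourth roots of unity.\<close>

lemma dixmier_trace_compose:
  fixes G :: "'h::complex_hilbert \<Rightarrow> 'h"
  assumes w: "\<omega> \<in> DL2 TYPE('h)" and G: "positive_op G" "G \<in> L1inf" and f: "eig_vectors G f"
    and B: "bounded_clinear B" "is_adjoint B' B"
    and compl: "\<And>c. c \<in> {1, \<i>, -1, -\<i>} \<Longrightarrow> complemented (\<lambda>x. B x + c *\<^sub>C x)"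
  shows "dixmier_trace \<omega> (B \<circ> G) = (\<Sum>c\<in>{1, \<i>, -1, -\<i>}.
    c / 4 * of_real (blinfun_apply \<omega> (Bcontfun (log_mean (\<lambda>i. sing_val G i * (norm (B (f i) + c *\<^sub>C f i))\<^sup>2)))))"
proof -
  note GB = positive_op_bounded[OF G(1)]
  define X where "X c x = B x + c *\<^sub>C x" for c and x :: 'h
  define Y where "Y c x = B' x + cnj c *\<^sub>C x" for c and x :: 'h
  have bid: "bounded_clinear (\<lambda>x::'h. x)" by (rule is_adjoint_bounded[OF is_adjoint_id])
  have X: "bounded_clinear (X c)" for c
    unfolding X_def by (rule bounded_clinear_plus[OF B(1) bounded_clinear_scale[OF bid]])
  have Y: "is_adjoint (Y c) (X c)" for c
    unfolding X_def Y_def by (rule is_adjoint_plus[OF B(2) is_adjoint_scale[OF is_adjoint_id]])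
  define T where "T c = X c \<circ> G \<circ> Y c" for c
  define p where "p c = blinfun_apply \<omega> (Bcontfun (log_mean (\<lambda>i. sing_val G i * (norm (B (f i) + c *\<^sub>C f i))\<^sup>2)))" for c
  have T: "T c \<in> L1inf" "positive_op (T c)" "blinfun_apply \<omega> (gamma (T c)) = p c"
    if c: "c \<in> {1, \<i>, -1, -\<i>}" for c
  proof -
    obtain Z W K where Z: "bounded_clinear Z" "is_adjoint W Z" "0 \<le> K"
      "\<And>x. (norm (X c x))\<^sup>2 + (norm (Z x))\<^sup>2 = K * (norm x)\<^sup>2"
      using compl[OF c] unfolding complemented_def X_def by blast
    show "T c \<in> L1inf" "positive_op (T c)" "blinfun_apply \<omega> (gamma (T c)) = p c"
      using DL2_gamma_conjugate[OF w G f X Y Z] unfolding T_def p_def X_def by auto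
  qed
  define R where "R c x = (c / 4) *\<^sub>C T c x" for c and x :: 'h
  have R: "R c \<in> L1inf" "is_adjoint (\<lambda>x. cnj (c / 4) *\<^sub>C T c x) (R c)"
      "dixmier_trace \<omega> (R c) = c / 4 * of_real (p c)" if c: "c \<in> {1, \<i>, -1, -\<i>}" for c
  proof -
    note adj = positive_op_adjoint[OF T(2)[OF c]]
    show "R c \<in> L1inf" unfolding R_def by (rule L1inf_scale[OF T(1)[OF c] adj])
    show "is_adjoint (\<lambda>x. cnj (c / 4) *\<^sub>C T c x) (R c)" unfolding R_def by (rule is_adjoint_scale[OF adj])
    show "dixmier_trace \<omega> (R c) = c / 4 * of_real (p c)"
      unfolding R_def dixmier_trace_props(2)[OF w T(1)[OF c]] dixmier_trace_props(3)[OF w T(1)[OF c] T(2)[OF c]] T(3)[OF c] ..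
  qed
  have c: "1 \<in> {1, \<i>, -1, -\<i>}" "\<i> \<in> {1, \<i>, -1, -\<i>}" "-1 \<in> {1, \<i>, -1, -\<i>}" "-\<i> \<in> {1, \<i>, -1, -\<i>}" by auto
  have L3: "(\<lambda>x. R (-1) x + R (-\<i>) x) \<in> L1inf"
    by (rule L1inf_plus[OF R(1,2)[OF c(3)] R(1,2)[OF c(4)]])
  note a3 = is_adjoint_plus[OF R(2)[OF c(3)] R(2)[OF c(4)]]
  have L2: "(\<lambda>x. R \<i> x + (R (-1) x + R (-\<i>) x)) \<in> L1inf"
    by (rule L1inf_plus[OF R(1,2)[OF c(2)] L3 a3])
  have "B \<circ> G = (\<lambda>x. R 1 x + (R \<i> x + (R (-1) x + R (-\<i>) x)))"
  proof (rule ext, rule cinner_eqI)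
    fix x y
    \<comment> \<open>Summed over the fourth roots of unity, c, c^2 and c^2 times the conjugate of c
      give 0, while c times its conjugate gives 4; the term of \<open>B \<circ> G\<close> is the one
      that survives.\<close>
    have expand: "cinner y (R c x) = (c / 4) * cinner y (B (G (B' x))) + (c * cnj c / 4) * cinner y (B (G x))
        + (c * c / 4) * cinner y (G (B' x)) + (c * (c * cnj c) / 4) * cinner y (G x)" for c
      by (simp add: R_def T_def X_def Y_def bounded_clinear_add[OF GB] bounded_clinear_scaleC[OF GB]
          bounded_clinear_add[OF B(1)] bounded_clinear_scaleC[OF B(1)] cinner_add_right cinner_scaleC_right
          algebra_simps)
    show "cinner y ((B \<circ> G) x) = cinner y (R 1 x + (R \<i> x + (R (-1) x + R (-\<i>) x)))"
      unfolding cinner_add_right expand by (simp add: algebra_simps)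
  qed
  then have "dixmier_trace \<omega> (B \<circ> G) = dixmier_trace \<omega> (R 1) + (dixmier_trace \<omega> (R \<i>)
      + (dixmier_trace \<omega> (R (-1)) + dixmier_trace \<omega> (R (-\<i>))))"
    using dixmier_trace_props(1)[OF w R(1)[OF c(1)] L2] dixmier_trace_props(1)[OF w R(1)[OF c(2)] L3]
      dixmier_trace_props(1)[OF w R(1)[OF c(3)] R(1)[OF c(4)]] by simp
  \<comment> \<open>The instances of \<open>complex_eq_iff\<close> separate the four roots, so that
    the sum over the set unfolds to four terms.\<close>
  then show ?thesis by (simp add: R(3) p_def complex_eq_iff[of 1 \<i>] complex_eq_iff[of \<i> 1] complex_eq_iff[of "\<i>" "-1"] complex_eq_iff[of "-\<i>" "1"] complex_eq_iff[of "1" "-\<i>"] complex_eq_iff[of "-1" "-\<i>"])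
qed

text \<open>The complement of a projection is 1 - P with \<open>K = 1\<close>, by
  Pythagoras.\<close>

lemma connes_projection:
  fixes G :: "'h::complex_hilbert \<Rightarrow> 'h"
  assumes w: "\<omega> \<in> DL2 TYPE('h)" and G: "positive_op G" "G \<in> L1inf" and f: "eig_vectors G f"
    and P: "projection_op P"
  shows "P \<circ> G \<circ> P \<in> L1inf" "dixmier_trace \<omega> (P \<circ> G \<circ> P) =
    of_real (blinfun_apply \<omega> (Bcontfun (log_mean (\<lambda>i. sing_val G i * (norm (P (f i)))\<^sup>2))))"
proof -
  have P: "bounded_clinear P" "is_adjoint P P" "\<And>x. P (P x) = P x"
    using P by (auto simp: projection_op_def selfadjoint_op_def is_adjoint_def o_def fun_eq_iff)
  define Z where "Z x = x + (-1) *\<^sub>C P x" for x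
  have bid: "bounded_clinear (\<lambda>x::'h. x)" by (rule is_adjoint_bounded[OF is_adjoint_id])
  have Z: "bounded_clinear Z"
    unfolding Z_def by (rule bounded_clinear_plus[OF bid bounded_clinear_scale[OF P(1)]])
  have ZZ: "is_adjoint (\<lambda>x. x + cnj (-1) *\<^sub>C P x) Z"
    unfolding Z_def by (rule is_adjoint_plus[OF is_adjoint_id is_adjoint_scale[OF P(2)]])
  have pyth: "(norm (P x))\<^sup>2 + (norm (Z x))\<^sup>2 = 1 * (norm x)\<^sup>2" for x
  proof -
    have "cinner (P x) (Z x) = 0"
      by (simp add: Z_def is_adjointD[OF P(2)] bounded_clinear_add[OF P(1)] bounded_clinear_scaleC[OF P(1)] P(3)
          cinner_simps)
    then have "(norm (P x + Z x))\<^sup>2 = (norm (P x))\<^sup>2 + (norm (Z x))\<^sup>2" by (rule norm_add_sq_orthogonal)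
    then show ?thesis by (simp add: Z_def scaleC_minus_one)
  qed
  note c = DL2_gamma_conjugate[OF w G f P(1,2) Z ZZ _ pyth]
  show "P \<circ> G \<circ> P \<in> L1inf" by (rule c(1)) simp
  show "dixmier_trace \<omega> (P \<circ> G \<circ> P) =
    of_real (blinfun_apply \<omega> (Bcontfun (log_mean (\<lambda>i. sing_val G i * (norm (P (f i)))\<^sup>2))))"
    using dixmier_trace_props(3)[OF w c(1,2)] c(3) by simp
qed

section \<open>Zeta residues and logarithmic means\<close>

text \<open>Abel summation: partial sums bounded below by \<open>- K\<close> are tested against
  decreasing nonnegative weights, and only the first weight enters the bound.\<close>

lemma abel_sum_ge:
  fixes d p :: "nat \<Rightarrow> real"
  assumes p: "decseq p" "\<And>i. 0 \<le> p i" and d: "\<And>k. - K \<le> (\<Sum>i\<le>k. d i)"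
  shows "- K * p 0 \<le> (\<Sum>i\<le>n. d i * p i)"
proof -
  \<comment> \<open>The induction carries the last partial sum along; its term is nonnegative and is
    dropped at the end.\<close>
  have *: "((\<Sum>i\<le>n. d i) + K) * p n - K * p 0 \<le> (\<Sum>i\<le>n. d i * p i)" for n
  proof (induction n)
    case (Suc n)
    have "p (Suc n) \<le> p n" using p(1) by (simp add: decseq_SucD)
    then have "((\<Sum>i\<le>n. d i) + K) * p (Suc n) \<le> ((\<Sum>i\<le>n. d i) + K) * p n"
      using d[of n] by (intro mult_left_mono) auto
    then show ?case using Suc by (simp add: algebra_simps)
  qed (simp add: algebra_simps)
  have "0 \<le> ((\<Sum>i\<le>n. d i) + K) * p n" using d[of n] p(2) by (intro mult_nonneg_nonneg) auto
  then show ?thesis using *[of n] by simp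
qed

text \<open>Combines 1 - 1/t \<le> ln t with 1 + x \<le> exp x. It stands in for the calculus of
  powers in the convexity and telescoping estimates below.\<close>

lemma powr_ge_tangent:
  fixes t :: real
  assumes "t > 0" "0 \<le> a"
  shows "1 + a * (1 - 1 / t) \<le> t powr a"
proof -
  have "1 - 1 / t \<le> ln t" using ln_le_minus_one[of "1 / t"] assms by (simp add: ln_div)
  then have "1 + a * (1 - 1 / t) \<le> 1 + a * ln t" using assms by (simp add: mult_left_mono)
  also have "\<dots> \<le> exp (a * ln t)" by (rule exp_ge_add_one_self)
  finally show ?thesis using assms by (simp add: powr_def)
qed

text \<open>The previous inequality at the ratio \<open>x / y\<close>, multiplied by
  \<open>x * y powr a\<close>.\<close>

lemma powr_Suc_tangent:
  fixes x y :: real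
  assumes xy: "0 \<le> x" "0 \<le> y" and a: "0 < a"
  shows "y powr (1 + a) + (1 + a) * y powr a * (x - y) \<le> x powr (1 + a)"
proof (cases "x = 0 \<or> y = 0")
  case True
  then show ?thesis using xy a by (auto simp: powr_add algebra_simps)
next
  case False
  then have p: "x > 0" "y > 0" using xy by auto
  have "(x * y powr a) * (1 + a * (1 - 1 / (x / y))) \<le> (x * y powr a) * ((x / y) powr a)"
    using p a by (intro mult_left_mono powr_ge_tangent) auto
  also have "\<dots> = x powr (1 + a)" using p by (simp add: powr_divide powr_add)
  also have "(x * y powr a) * (1 + a * (1 - 1 / (x / y))) = y powr a * (x + a * (x - y))"
    using p by (simp add: field_simps)
  also have "\<dots> = y powr (1 + a) + (1 + a) * y powr a * (x - y)"
    using p by (simp add: powr_add algebra_simps)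
  finally show ?thesis .
qed

text \<open>Convexity gives \<open>x\<^sup>p \<ge> y\<^sup>p + p y\<^sup>p\<^sup>-\<^sup>1 (x - y)\<close>, and the linear term is handled by Abel summation, as \<open>y\<^sup>p\<^sup>-\<^sup>1\<close>
  decreases.\<close>

lemma sum_powr_majorization:
  fixes x y :: "nat \<Rightarrow> real"
  assumes x: "\<And>i. 0 \<le> x i" and y: "\<And>i. 0 \<le> y i" "decseq y" and a: "0 < a"
    and K: "\<And>k. (\<Sum>i\<le>k. y i) \<le> (\<Sum>i\<le>k. x i) + K"
  shows "(\<Sum>i\<le>n. y i powr (1 + a)) \<le> (\<Sum>i\<le>n. x i powr (1 + a)) + K * (1 + a) * y 0 powr a"
proof -
  have "- K * (y 0 powr a) \<le> (\<Sum>i\<le>n. (x i - y i) * y i powr a)"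
  proof (rule abel_sum_ge)
    show "decseq (\<lambda>i. y i powr a)" using y a by (auto simp: decseq_def intro!: powr_mono2)
    show "- K \<le> (\<Sum>i\<le>k. x i - y i)" for k using K[of k] by (simp add: sum_subtractf)
  qed auto
  then have "(1 + a) * (- K * (y 0 powr a)) \<le> (1 + a) * (\<Sum>i\<le>n. (x i - y i) * y i powr a)"
    using a by (intro mult_left_mono) auto
  also have "\<dots> \<le> (\<Sum>i\<le>n. x i powr (1 + a) - y i powr (1 + a))"
    unfolding sum_distrib_left using powr_Suc_tangent[OF x y(1) a]
    by (intro sum_mono) (simp add: algebra_simps)
  finally show ?thesis by (simp add: sum_subtractf algebra_simps)
qed

text \<open>A comparison of sum and integral for \<open>t powr (- (1 + a))\<close>, done by
  telescoping its primitive. The two inequalities are \<open>powr_ge_tangent\<close> at the ratio of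
  neighbouring integers and at its inverse.\<close>

lemma inverse_powr_telescope:
  assumes a: "0 < (a::real)"
  shows "a * real (Suc (Suc m)) powr (- (1 + a)) \<le> real (Suc m) powr (- a) - real (Suc (Suc m)) powr (- a)"
    and "real (Suc m) powr (- a) - real (Suc (Suc m)) powr (- a) \<le> a * real (Suc m) powr (- (1 + a))"
proof -
  define s t where "s = real (Suc m)" and "t = real (Suc (Suc m))"
  have st: "s > 0" "t > 0" "t - s = 1" by (auto simp: s_def t_def)
  have "t powr (- a) * (1 + a * (1 - 1 / (t / s))) \<le> t powr (- a) * ((t / s) powr a)"
    using st a by (intro mult_left_mono powr_ge_tangent) auto
  also have "\<dots> = s powr (- a)" using st by (simp add: powr_divide powr_minus_divide)
  also have "1 - 1 / (t / s) = 1 / t" using st by (simp add: field_simps)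
  finally have "a * (t powr (- a) * (1 / t)) \<le> s powr (- a) - t powr (- a)" by (simp add: algebra_simps)
  moreover have "t powr (- a) * (1 / t) = t powr (- (1 + a))"
    using st by (simp add: powr_minus_divide powr_add del: minus_add_distrib)
  ultimately show "a * t powr (- (1 + a)) \<le> s powr (- a) - t powr (- a)" by (simp only:)
  have "s powr (- a) * (1 + a * (1 - 1 / (s / t))) \<le> s powr (- a) * ((s / t) powr a)"
    using st a by (intro mult_left_mono powr_ge_tangent) auto
  also have "\<dots> = t powr (- a)" using st by (simp add: powr_divide powr_minus_divide)
  also have "1 - 1 / (s / t) = - (1 / s)" using st by (simp add: field_simps)
  finally have "s powr (- a) - t powr (- a) \<le> a * (s powr (- a) * (1 / s))" by (simp add: algebra_simps)
  moreover have "s powr (- a) * (1 / s) = s powr (- (1 + a))"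
    using st by (simp add: powr_minus_divide powr_add del: minus_add_distrib)
  ultimately show "s powr (- a) - t powr (- a) \<le> a * s powr (- (1 + a))" by (simp only:)
qed

text \<open>These are the bounds behind the limit 1 of a zeta(1 + a) for a tending to 0, kept for
  partial sums so that they can be inserted into the majorization.\<close>

lemma zeta_partial_sum_bounds:
  assumes a: "0 < (a::real)"
  shows "a * (\<Sum>i\<le>n. real (Suc i) powr (- (1 + a))) \<le> 1 + a"
    and "1 - real (Suc (Suc n)) powr (- a) \<le> a * (\<Sum>i\<le>n. real (Suc i) powr (- (1 + a)))"
proof -
  have "a * (\<Sum>i\<le>n. real (Suc i) powr (- (1 + a))) \<le> 1 + a - real (Suc n) powr (- a)" for n
  proof (induction n)
    case (Suc n)
    then show ?case using inverse_powr_telescope(1)[OF a, of n] by (simp add: distrib_left)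
  qed simp
  then show "a * (\<Sum>i\<le>n. real (Suc i) powr (- (1 + a))) \<le> 1 + a"
    by (rule order_trans) simp
  show "1 - real (Suc (Suc n)) powr (- a) \<le> a * (\<Sum>i\<le>n. real (Suc i) powr (- (1 + a)))"
  proof (induction n)
    case 0
    then show ?case using inverse_powr_telescope(2)[OF a, of 0] by simp
  next
    case (Suc n)
    then show ?case using inverse_powr_telescope(2)[OF a, of "Suc n"] by (simp add: distrib_left)
  qed
qed

text \<open>They make 1/(i + 1) the model sequence: its partial sums differ from the logarithm by a
  bounded amount, so its logarithmic means tend to 1.\<close>

lemma harmonic_sum_bounds:
  "ln (1 + real (Suc k)) \<le> (\<Sum>i\<le>k. 1 / real (Suc i))" "(\<Sum>i\<le>k. 1 / real (Suc i)) \<le> 1 + ln (1 + real (Suc k))"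
proof -
  have step: "1 / (x + 1) \<le> ln (x + 1) - ln x" "ln (x + 1) - ln x \<le> 1 / x" if x: "0 < (x::real)" for x
  proof -
    have "ln (x / (x + 1)) \<le> x / (x + 1) - 1" using x by (intro ln_le_minus_one) auto
    also have "\<dots> = - (1 / (x + 1))" using x by (simp add: field_simps)
    finally show "1 / (x + 1) \<le> ln (x + 1) - ln x" using x by (simp add: ln_div)
    have "ln ((x + 1) / x) \<le> (x + 1) / x - 1" using x by (intro ln_le_minus_one) auto
    also have "\<dots> = 1 / x" using x by (simp add: field_simps)
    finally show "ln (x + 1) - ln x \<le> 1 / x" using x by (simp add: ln_div)
  qed
  show "ln (1 + real (Suc k)) \<le> (\<Sum>i\<le>k. 1 / real (Suc i))"
  proof (induction k)
    case 0
    then show ?case using ln_le_minus_one[of 2] by simp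
  next
    case (Suc k)
    then show ?case using step(2)[of "real k + 2"] by (simp add: add_ac)
  qed
  have "(\<Sum>i\<le>k. 1 / real (Suc i)) \<le> 1 + ln (real (Suc k))"
  proof (induction k)
    case (Suc k)
    then show ?case using step(1)[of "real k + 1"] by (simp add: add_ac)
  qed simp
  also have "\<dots> \<le> 1 + ln (1 + real (Suc k))" by simp
  finally show "(\<Sum>i\<le>k. 1 / real (Suc i)) \<le> 1 + ln (1 + real (Suc k))" .
qed

text \<open>The finitely many exceptional indices are absorbed in an additive constant, which
  disappears in the limit theorems below because it comes with a factor tending to 0.\<close>

lemma eventually_le_imp_le_plus:
  fixes S R :: "nat \<Rightarrow> real"
  assumes "\<forall>\<^sub>F k in sequentially. S k \<le> R k"
  obtains K where "0 \<le> K" "\<And>k. S k \<le> R k + K"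
proof -
  obtain N where N: "\<And>k. N \<le> k \<Longrightarrow> S k \<le> R k" using assms unfolding eventually_sequentially by blast
  define K where "K = (\<Sum>k<N. \<bar>S k - R k\<bar>)"
  have K0: "0 \<le> K" by (simp add: K_def sum_nonneg)
  have "S k \<le> R k + K" for k
  proof (cases "N \<le> k")
    case False
    then have "\<bar>S k - R k\<bar> \<le> K" unfolding K_def by (intro member_le_sum) auto
    then show ?thesis by linarith
  qed (use N K0 in \<open>fastforce intro: add_increasing2\<close>)
  then show ?thesis using that K0 by blast
qed

lemma log_mean_le_iff: "log_mean u k \<le> C \<longleftrightarrow> (\<Sum>i\<le>k. u i) \<le> C * ln (1 + real (Suc k))"
  by (simp add: log_mean_def pos_divide_le_eq)

lemma log_mean_ge_iff: "C \<le> log_mean u k \<longleftrightarrow> C * ln (1 + real (Suc k)) \<le> (\<Sum>i\<le>k. u i)"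
  by (simp add: log_mean_def pos_le_divide_eq)

text \<open>Majorization by the model sequence d/(i + 1), whose partial sums dominate those of
  \<open>l\<close> up to the constant \<open>K\<close>. In the bound, the part carrying
  \<open>K\<close> has the factor \<open>a\<close> and disappears as \<open>a\<close> tends to 0,
  while the main part tends to \<open>d\<close>.\<close>

lemma sum_powr_upper:
  fixes l :: "nat \<Rightarrow> real"
  assumes l: "decseq l" "\<And>i. 0 \<le> l i" and a: "0 < a" and d: "0 \<le> d"
    and K: "0 \<le> K" "\<And>k. (\<Sum>i\<le>k. l i) \<le> d * ln (1 + real (Suc k)) + K"
  shows "summable (\<lambda>i. l i powr (1 + a))"
    "a * (\<Sum>i. l i powr (1 + a)) \<le> d powr (1 + a) * (1 + a) + a * (K * (1 + a) * l 0 powr a)"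
proof -
  have part: "a * (\<Sum>i\<le>n. l i powr (1 + a)) \<le> d powr (1 + a) * (1 + a) + a * (K * (1 + a) * l 0 powr a)" for n
  proof -
    have "(\<Sum>i\<le>n. l i powr (1 + a)) \<le> (\<Sum>i\<le>n. (d / real (Suc i)) powr (1 + a)) + K * (1 + a) * l 0 powr a"
    proof (rule sum_powr_majorization[OF _ l(2,1) a])
      fix k
      have "d * ln (1 + real (Suc k)) \<le> d * (\<Sum>i\<le>k. 1 / real (Suc i))"
        using harmonic_sum_bounds(1) d by (rule mult_left_mono)
      then show "(\<Sum>i\<le>k. l i) \<le> (\<Sum>i\<le>k. d / real (Suc i)) + K"
        using K(2)[of k] by (simp add: sum_distrib_left)
    qed (use d in auto)
    also have "(\<Sum>i\<le>n. (d / real (Suc i)) powr (1 + a)) = d powr (1 + a) * (\<Sum>i\<le>n. real (Suc i) powr (- (1 + a)))"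
      unfolding sum_distrib_left using d
      by (intro sum.cong refl) (simp add: powr_divide powr_minus_divide del: of_nat_Suc minus_add_distrib)
    finally have "a * (\<Sum>i\<le>n. l i powr (1 + a)) \<le>
        a * (d powr (1 + a) * (\<Sum>i\<le>n. real (Suc i) powr (- (1 + a))) + K * (1 + a) * l 0 powr a)"
      using a by (simp add: mult_left_mono)
    also have "\<dots> = d powr (1 + a) * (a * (\<Sum>i\<le>n. real (Suc i) powr (- (1 + a)))) + a * (K * (1 + a) * l 0 powr a)"
      by (simp add: algebra_simps)
    also have "\<dots> \<le> d powr (1 + a) * (1 + a) + a * (K * (1 + a) * l 0 powr a)"
      using zeta_partial_sum_bounds(1)[OF a] by (intro add_right_mono mult_left_mono) auto
    finally show ?thesis .
  qed
  define R where "R = d powr (1 + a) * (1 + a) + a * (K * (1 + a) * l 0 powr a)"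
  have le: "(\<Sum>i\<le>n. l i powr (1 + a)) \<le> R / a" for n
    using part[of n, folded R_def] a by (simp add: pos_le_divide_eq mult.commute)
  show sm: "summable (\<lambda>i. l i powr (1 + a))"
    by (rule bounded_imp_summable[OF _ le]) auto
  have "(\<Sum>i. l i powr (1 + a)) \<le> R / a"
  proof (rule suminf_le_const[OF sm])
    fix n
    have "(\<Sum>i<n. l i powr (1 + a)) \<le> (\<Sum>i\<le>n. l i powr (1 + a))" by (intro sum_mono2) auto
    then show "(\<Sum>i<n. l i powr (1 + a)) \<le> R / a" using le[of n] by linarith
  qed
  then show "a * (\<Sum>i. l i powr (1 + a)) \<le> R" using a by (simp add: pos_le_divide_eq mult.commute)
qed

text \<open>The comparison of \<open>sum_powr_upper\<close> with exchanged roles. The constant grows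
  from \<open>K\<close> to \<open>K + d\<close> because the harmonic sums may exceed the logarithm
  by 1.\<close>

lemma sum_powr_lower:
  fixes l :: "nat \<Rightarrow> real"
  assumes l: "\<And>i. 0 \<le> l i" and sm: "summable (\<lambda>i. l i powr (1 + a))" and a: "0 < a" and d: "0 \<le> d"
    and K: "0 \<le> K" "\<And>k. d * ln (1 + real (Suc k)) \<le> (\<Sum>i\<le>k. l i) + K"
  shows "d powr (1 + a) - a * ((K + d) * (1 + a) * d powr a) \<le> a * (\<Sum>i. l i powr (1 + a))"
proof -
  have part: "d powr (1 + a) * (1 - real (Suc (Suc n)) powr (- a)) - a * ((K + d) * (1 + a) * d powr a)
      \<le> a * (\<Sum>i. l i powr (1 + a))" for n
  proof -
    have "(\<Sum>i\<le>n. (d / real (Suc i)) powr (1 + a)) \<le> (\<Sum>i\<le>n. l i powr (1 + a)) + (K + d) * (1 + a) * (d / real (Suc 0)) powr a"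
    proof (rule sum_powr_majorization[OF l _ _ a])
      show "decseq (\<lambda>i. d / real (Suc i))" using d by (intro decseq_SucI divide_left_mono) auto
      fix k
      have "(\<Sum>i\<le>k. d / real (Suc i)) = d * (\<Sum>i\<le>k. 1 / real (Suc i))" by (simp add: sum_distrib_left)
      also have "\<dots> \<le> d * (1 + ln (1 + real (Suc k)))" using harmonic_sum_bounds(2) d by (rule mult_left_mono)
      finally show "(\<Sum>i\<le>k. d / real (Suc i)) \<le> (\<Sum>i\<le>k. l i) + (K + d)"
        using K(2)[of k] by (simp add: algebra_simps)
    qed (use d in auto)
    also have "(\<Sum>i\<le>n. l i powr (1 + a)) \<le> (\<Sum>i. l i powr (1 + a))"
      by (rule sum_le_suminf[OF sm]) auto
    also have "(\<Sum>i\<le>n. (d / real (Suc i)) powr (1 + a)) = d powr (1 + a) * (\<Sum>i\<le>n. real (Suc i) powr (- (1 + a)))"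
      unfolding sum_distrib_left using d
      by (intro sum.cong refl) (simp add: powr_divide powr_minus_divide del: of_nat_Suc minus_add_distrib)
    finally have "a * (d powr (1 + a) * (\<Sum>i\<le>n. real (Suc i) powr (- (1 + a))))
        \<le> a * ((\<Sum>i. l i powr (1 + a)) + (K + d) * (1 + a) * d powr a)"
      using a by (simp add: mult_left_mono)
    moreover have "d powr (1 + a) * (1 - real (Suc (Suc n)) powr (- a))
        \<le> d powr (1 + a) * (a * (\<Sum>i\<le>n. real (Suc i) powr (- (1 + a))))"
      using zeta_partial_sum_bounds(2)[OF a] by (intro mult_left_mono) auto
    ultimately show ?thesis by (simp add: algebra_simps)
  qed
  have "(\<lambda>n. real (Suc (Suc n)) powr (- a)) \<longlonglongrightarrow> 0"
    by (intro tendsto_neg_powr filterlim_compose[OF filterlim_real_sequentially]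
        filterlim_compose[OF filterlim_Suc] filterlim_Suc) (use a in auto)
  then have "(\<lambda>n. d powr (1 + a) * (1 - real (Suc (Suc n)) powr (- a)) - a * ((K + d) * (1 + a) * d powr a))
      \<longlonglongrightarrow> d powr (1 + a) * (1 - 0) - a * ((K + d) * (1 + a) * d powr a)"
    by (intro tendsto_intros)
  then show ?thesis using part by (intro LIMSEQ_le_const2[where X = "\<lambda>n. d powr (1 + a) * (1 - real (Suc (Suc n)) powr (- a)) - a * ((K + d) * (1 + a) * d powr a)"]) auto
qed

lemma powr_le_max_one: "0 \<le> x \<Longrightarrow> 0 \<le> a \<Longrightarrow> a \<le> 1 \<Longrightarrow> x powr a \<le> max 1 (x::real)"
proof (cases "x \<le> 1")
  case True
  assume "0 \<le> x" "0 \<le> a"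
  then have "x powr a \<le> 1 powr a" using True by (intro powr_mono2) auto
  then show ?thesis by simp
next
  case False
  assume "a \<le> 1"
  then have "x powr a \<le> x powr 1" using False by (intro powr_mono) auto
  then show ?thesis using False by simp
qed

abbreviation (input) recip :: "nat \<Rightarrow> real"
  where "recip k \<equiv> 1 / real (Suc k)"

lemma recip_bounds: "0 < recip k" "recip k \<le> 1"
  by auto

lemma recip_lim: "recip \<longlonglongrightarrow> 0"
  using LIMSEQ_inverse_real_of_nat by (simp add: inverse_eq_divide)

text \<open>For \<open>d\<close> strictly between \<open>c\<close> and the tested value
  \<open>r\<close>, comparison with d/(i + 1) holds up to a constant depending on \<open>d\<close>.
  As the exponents tend to 1 this constant drops out and the bounds tend to
  \<open>d\<close>.\<close>

lemma sum_powr_limit: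
  fixes l :: "nat \<Rightarrow> real"
  assumes l: "decseq l" "\<And>i. 0 \<le> l i" and c: "log_mean l \<longlonglongrightarrow> c"
  shows "(\<lambda>k. recip k * (\<Sum>i. l i powr (1 + recip k))) \<longlonglongrightarrow> c"
proof (rule order_tendstoI)
  have "0 \<le> log_mean l k" for k
    unfolding log_mean_ge_iff using l(2) by (simp add: sum_nonneg)
  then have c0: "0 \<le> c" by (intro LIMSEQ_le_const[OF c]) auto
  note a = recip_bounds
  have upper: "\<exists>K\<ge>0. \<forall>k. (\<Sum>i\<le>k. l i) \<le> d * ln (1 + real (Suc k)) + K" if "c < d" for d
  proof -
    have "\<forall>\<^sub>F k in sequentially. log_mean l k < d" using order_tendstoD(2)[OF c that] .
    then have "\<forall>\<^sub>F k in sequentially. (\<Sum>i\<le>k. l i) \<le> d * ln (1 + real (Suc k))"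
      by (rule eventually_mono) (metis less_imp_le log_mean_le_iff)
    then show ?thesis by (rule eventually_le_imp_le_plus) blast
  qed
  have sm: "summable (\<lambda>i. l i powr (1 + recip k))" for k
    using upper[of "c + 1"] sum_powr_upper(1)[OF l a(1), of "c + 1"] c0 by auto
  fix r
  show "\<forall>\<^sub>F k in sequentially. recip k * (\<Sum>i. l i powr (1 + recip k)) < r" if r: "c < r"
  proof -
    define d where "d = (c + r) / 2"
    have d: "c < d" "d < r" "0 < d" using r c0 by (auto simp: d_def)
    obtain K where K: "0 \<le> K" "\<And>k. (\<Sum>i\<le>k. l i) \<le> d * ln (1 + real (Suc k)) + K" using upper[OF d(1)] by blast
    have le: "recip k * (\<Sum>i. l i powr (1 + recip k))
        \<le> d powr (1 + recip k) * (1 + recip k) + recip k * (K * 2 * max 1 (l 0))" for k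
    proof -
      have "recip k * (K * (1 + recip k) * l 0 powr recip k) \<le> recip k * (K * 2 * max 1 (l 0))"
        using a[of k] K(1) l(2)[of 0] by (intro mult_left_mono mult_mono powr_le_max_one) auto
      then show ?thesis
        using sum_powr_upper(2)[OF l a(1)[of k] less_imp_le[OF d(3)] K] by linarith
    qed
    have "(\<lambda>k. d powr (1 + recip k) * (1 + recip k) + recip k * (K * 2 * max 1 (l 0)))
        \<longlonglongrightarrow> d powr (1 + 0) * (1 + 0) + 0 * (K * 2 * max 1 (l 0))"
      using d(3) by (intro tendsto_intros recip_lim) auto
    then have "\<forall>\<^sub>F k in sequentially. d powr (1 + recip k) * (1 + recip k) + recip k * (K * 2 * max 1 (l 0)) < r"
      using d by (intro order_tendstoD(2)) auto
    then show ?thesis by (rule eventually_mono) (rule le_less_trans[OF le])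
  qed
  show "\<forall>\<^sub>F k in sequentially. r < recip k * (\<Sum>i. l i powr (1 + recip k))" if r: "r < c"
  proof (cases "r < 0")
    case True
    have "0 \<le> recip k * (\<Sum>i. l i powr (1 + recip k))" for k
      using a[of k] suminf_nonneg[OF sm[of k]] by simp
    then show ?thesis using True by (intro always_eventually allI) (meson less_le_trans)
  next
    case False
    define d where "d = (c + r) / 2"
    have d: "d < c" "r < d" "0 < d" using r False by (auto simp: d_def)
    have "\<forall>\<^sub>F k in sequentially. d < log_mean l k" using order_tendstoD(1)[OF c d(1)] .
    then have "\<forall>\<^sub>F k in sequentially. d * ln (1 + real (Suc k)) \<le> (\<Sum>i\<le>k. l i)"
      by (rule eventually_mono) (metis less_imp_le log_mean_ge_iff)
    then obtain K where K: "0 \<le> K" "\<And>k. d * ln (1 + real (Suc k)) \<le> (\<Sum>i\<le>k. l i) + K"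
      by (rule eventually_le_imp_le_plus) (rule that; assumption)
    have ge: "d powr (1 + recip k) - recip k * ((K + d) * (1 + recip k) * d powr recip k)
        \<le> recip k * (\<Sum>i. l i powr (1 + recip k))" for k
      by (rule sum_powr_lower[OF l(2) sm a(1) less_imp_le[OF d(3)] K])
    have "(\<lambda>k. d powr (1 + recip k) - recip k * ((K + d) * (1 + recip k) * d powr recip k))
        \<longlonglongrightarrow> d powr (1 + 0) - 0 * ((K + d) * (1 + 0) * d powr 0)"
      using d(3) by (intro tendsto_intros recip_lim) auto
    then have "\<forall>\<^sub>F k in sequentially. r < d powr (1 + recip k) - recip k * ((K + d) * (1 + recip k) * d powr recip k)"
      using d by (intro order_tendstoD(1)) auto
    then show ?thesis by (rule eventually_mono) (rule less_le_trans[OF _ ge])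
  qed
qed

lemma sum_powr_summable:
  fixes l :: "nat \<Rightarrow> real"
  assumes l: "decseq l" "\<And>i. 0 \<le> l i" and C: "\<And>k. log_mean l k \<le> C" and a: "0 < a"
  shows "summable (\<lambda>i. l i powr (1 + a))"
proof -
  have "0 \<le> log_mean l 0" unfolding log_mean_ge_iff using l(2) by simp
  then have "0 \<le> C" using C[of 0] by linarith
  then show ?thesis
    using C unfolding log_mean_le_iff by (intro sum_powr_upper(1)[OF l a, of C 0]) auto
qed

text \<open>The sequence \<open>l i * b i\<close> need not decrease, so
  \<open>sum_powr_limit\<close> cannot be applied to it. Its partial sums are compared with
  multiples of those of \<open>l\<close>, and Abel summation against the decreasing weights
  \<open>l i powr recip k\<close> carries the comparison over to the zeta sums, whose limit is known
  for \<open>l\<close>.\<close>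

theorem abelian_zeta:
  fixes l b :: "nat \<Rightarrow> real"
  assumes l: "decseq l" "\<And>i. 0 \<le> l i" and c: "log_mean l \<longlonglongrightarrow> c"
    and b: "\<And>i. 0 \<le> b i" "\<And>i. b i \<le> 1" and cb: "log_mean (\<lambda>i. l i * b i) \<longlonglongrightarrow> cb"
  shows "(\<lambda>k. recip k * (\<Sum>i. l i powr (1 + recip k) * b i)) \<longlonglongrightarrow> cb"
proof -
  note a = recip_bounds and Z = sum_powr_limit[OF l c]
  obtain C where C: "\<And>k. \<bar>log_mean l k\<bar> \<le> C"
    using convergent_imp_Bseq[of "log_mean l"] c unfolding convergent_def Bseq_def by auto
  have sm: "summable (\<lambda>i. l i powr (1 + recip k))" for k
    using C by (intro sum_powr_summable[OF l _ a(1), of C]) (auto intro: abs_le_D1)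
  have sb: "summable (\<lambda>i. l i powr (1 + recip k) * b i)" for k
    by (rule summable_comparison_test'[OF sm]) (use b in \<open>auto simp: abs_mult intro!: mult_left_le\<close>)
  \<comment> \<open>The factor \<open>s\<close> will be 1 or -1, so one estimate serves the lower
    and the upper bound.\<close>
  have abel: "e * (\<Sum>i. l i powr (1 + recip k)) - K * max 1 (l 0) \<le> s * (\<Sum>i. l i powr (1 + recip k) * b i)"
    if K: "0 \<le> K" "\<And>k. e * (\<Sum>i\<le>k. l i) \<le> s * (\<Sum>i\<le>k. l i * b i) + K" for e s K k
  proof -
    have part: "- K * max 1 (l 0) \<le> (\<Sum>i\<le>n. s * (l i powr (1 + recip k) * b i) - e * l i powr (1 + recip k))" for n
    proof -
      have "- K * (l 0 powr recip k) \<le> (\<Sum>i\<le>n. (s * (l i * b i) - e * l i) * l i powr recip k)"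
      proof (rule abel_sum_ge)
        show "decseq (\<lambda>i. l i powr recip k)" using l by (auto simp: decseq_def intro!: powr_mono2)
        show "- K \<le> (\<Sum>i\<le>k. s * (l i * b i) - e * l i)" for k
          using K(2)[of k] by (simp add: sum_subtractf sum_distrib_left)
      qed auto
      also have "\<dots> = (\<Sum>i\<le>n. s * (l i powr (1 + recip k) * b i) - e * l i powr (1 + recip k))"
        using l(2) by (intro sum.cong refl) (simp add: powr_add algebra_simps)
      finally show ?thesis
        using mult_left_mono[OF powr_le_max_one[OF l(2)[of 0], of "recip k"] K(1)] a[of k] by simp
    qed
    have "(\<lambda>n. \<Sum>i\<le>n. s * (l i powr (1 + recip k) * b i) - e * l i powr (1 + recip k))
        \<longlonglongrightarrow> s * (\<Sum>i. l i powr (1 + recip k) * b i) - e * (\<Sum>i. l i powr (1 + recip k))"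
      using sums_diff[OF sums_mult[OF summable_sums[OF sb]] sums_mult[OF summable_sums[OF sm]]]
      unfolding sums_def_le by blast
    then have "- K * max 1 (l 0) \<le> s * (\<Sum>i. l i powr (1 + recip k) * b i) - e * (\<Sum>i. l i powr (1 + recip k))"
      using part by (intro LIMSEQ_le_const) auto
    then show ?thesis by simp
  qed
  have u0: "0 \<le> log_mean (\<lambda>i. l i * b i) k" "log_mean (\<lambda>i. l i * b i) k \<le> log_mean l k" for k
    unfolding log_mean_ge_iff[of 0] using l b by (auto intro!: log_mean_mono mult_left_le sum_nonneg)
  have cbc: "0 \<le> cb" "cb \<le> c"
    using LIMSEQ_le_const[OF cb] LIMSEQ_le[OF cb c] u0 by auto
  show ?thesis
  \<comment> \<open>The comparison ratio has \<open>c\<close> in its denominator; for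
    \<open>c = 0\<close> the weighted sums are squeezed between 0 and the unweighted ones.\<close>
  proof (cases "c = 0")
    case True
    then have "cb = 0" using cbc by simp
    moreover have "(\<lambda>k. recip k * (\<Sum>i. l i powr (1 + recip k) * b i)) \<longlonglongrightarrow> 0"
    proof (rule tendsto_sandwich[OF _ _ tendsto_const])
      show "(\<lambda>k. recip k * (\<Sum>i. l i powr (1 + recip k))) \<longlonglongrightarrow> 0" using Z True by simp
      show "\<forall>\<^sub>F k in sequentially. recip k * (\<Sum>i. l i powr (1 + recip k) * b i) \<le> recip k * (\<Sum>i. l i powr (1 + recip k))"
        using b by (intro always_eventually allI mult_left_mono suminf_le sb sm) (auto intro!: mult_left_le)
      show "\<forall>\<^sub>F k in sequentially. 0 \<le> recip k * (\<Sum>i. l i powr (1 + recip k) * b i)"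
        using b by (intro always_eventually allI mult_nonneg_nonneg suminf_nonneg sb) auto
    qed
    ultimately show ?thesis by simp
  next
    case False
    then have cp: "0 < c" using cbc by simp
    have two: "\<forall>\<^sub>F k in sequentially. s * r < s * (recip k * (\<Sum>i. l i powr (1 + recip k) * b i))"
      if s: "s * r < s * cb" for s r
    proof -
      \<comment> \<open>With this choice \<open>d * c\<close> is the midpoint of
        \<open>s * r\<close> and \<open>s * cb\<close>.\<close>
      define d where "d = s * (cb + r) / (2 * c)"
      have dc: "d * c = s * (cb + r) / 2" using cp by (simp add: d_def)
      have d: "s * r < d * c" "d * c < s * cb" using s unfolding dc by (auto simp: algebra_simps)
      have "(\<lambda>k. s * log_mean (\<lambda>i. l i * b i) k - d * log_mean l k) \<longlonglongrightarrow> s * cb - d * c"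
        by (intro tendsto_intros cb c)
      then have "\<forall>\<^sub>F k in sequentially. 0 < s * log_mean (\<lambda>i. l i * b i) k - d * log_mean l k"
        using d by (intro order_tendstoD(1)) auto
      then have "\<forall>\<^sub>F k in sequentially. d * (\<Sum>i\<le>k. l i) \<le> s * (\<Sum>i\<le>k. l i * b i)"
        by (rule eventually_mono) (simp add: log_mean_def divide_less_cancel)
      then obtain K where K: "0 \<le> K" "\<And>k. d * (\<Sum>i\<le>k. l i) \<le> s * (\<Sum>i\<le>k. l i * b i) + K"
        by (rule eventually_le_imp_le_plus) (rule that; assumption)
      have ge: "d * (recip k * (\<Sum>i. l i powr (1 + recip k))) - recip k * (K * max 1 (l 0))
          \<le> s * (recip k * (\<Sum>i. l i powr (1 + recip k) * b i))" for k
        using mult_left_mono[OF abel[OF K, of k] less_imp_le[OF a(1)[of k]]] by (simp add: algebra_simps)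
      have "(\<lambda>k. d * (recip k * (\<Sum>i. l i powr (1 + recip k))) - recip k * (K * max 1 (l 0)))
          \<longlonglongrightarrow> d * c - 0 * (K * max 1 (l 0))"
        by (intro tendsto_intros Z recip_lim)
      then have "\<forall>\<^sub>F k in sequentially. s * r < d * (recip k * (\<Sum>i. l i powr (1 + recip k))) - recip k * (K * max 1 (l 0))"
        using d by (intro order_tendstoD(1)) auto
      then show ?thesis by (rule eventually_mono) (rule less_le_trans[OF _ ge])
    qed
    show ?thesis
      using two[of 1] two[of "-1"] by (intro order_tendstoI) simp_all
  qed
qed

section \<open>Karamata's Tauberian theorem along the exponents 1/k\<close>

lemma has_integral_polynomial:
  "((\<lambda>x::real. \<Sum>j\<le>n. \<alpha> j * x ^ j) has_integral (\<Sum>j\<le>n. \<alpha> j / real (Suc j))) {0..1}"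
proof -
  have "((\<lambda>x. \<Sum>j\<le>n. \<alpha> j * x ^ Suc j / real (Suc j)) has_vector_derivative (\<Sum>j\<le>n. \<alpha> j * x ^ j)) (at x within {0..1})" for x :: real
    unfolding has_real_derivative_iff_has_vector_derivative[symmetric]
  proof (rule DERIV_sum)
    fix j
    have "((\<lambda>x. \<alpha> j / real (Suc j) * x ^ Suc j) has_real_derivative
        \<alpha> j / real (Suc j) * ((1 + real j) * (1 * x ^ j))) (at x within {0..1})"
      by (intro DERIV_cmult DERIV_power_Suc DERIV_ident)
    then show "((\<lambda>x. \<alpha> j * x ^ Suc j / real (Suc j)) has_real_derivative \<alpha> j * x ^ j) (at x within {0..1})"
      by simp
  qed
  then have "((\<lambda>x. \<Sum>j\<le>n. \<alpha> j * x ^ j) has_integral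
      (\<Sum>j\<le>n. \<alpha> j * 1 ^ Suc j / real (Suc j)) - (\<Sum>j\<le>n. \<alpha> j * 0 ^ Suc j / real (Suc j))) {0..1::real}"
    by (intro fundamental_theorem_of_calculus) auto
  then show ?thesis by simp
qed

lemma has_integral_reciprocal_tail:
  assumes "0 < a" "a \<le> (1::real)"
  shows "((\<lambda>x. if x \<in> {a..1} then 1 / x else 0) has_integral (- ln a)) {0..1}"
proof -
  have "((\<lambda>x. 1 / x) has_integral ln 1 - ln a) {a..1}"
    using assms by (intro fundamental_theorem_of_calculus)
      (auto intro!: derivative_eq_intros simp: has_real_derivative_iff_has_vector_derivative[symmetric])
  then show ?thesis using assms by (subst has_integral_restrict) auto
qed

text \<open>Polynomial bounds for 1/x cut off below a threshold, with control of their integrals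
  over [0,1]. Both come from one Stone-Weierstrass approximation \<open>P\<close>, shifted up and
  down by \<open>\<epsilon> / 2\<close>. The threshold is blurred between \<open>a\<close> and
  \<open>b\<close>: the upper bound will be used with \<open>b\<close>, the lower one with
  \<open>a\<close>, equal to exp (-1).\<close>

lemma polynomial_between:
  fixes a b \<epsilon> :: real
  assumes ab: "0 < a" "a < b" "b < 1" and \<epsilon>: "0 < \<epsilon>"
  obtains \<alpha> n \<beta> m where "\<And>x. 0 \<le> x \<Longrightarrow> x \<le> 1 \<Longrightarrow> 0 \<le> (\<Sum>j\<le>n. \<alpha> j * x ^ j)"
      "\<And>x. b \<le> x \<Longrightarrow> x \<le> 1 \<Longrightarrow> 1 / x \<le> (\<Sum>j\<le>n. \<alpha> j * x ^ j)"
      "(\<Sum>j\<le>n. \<alpha> j / real (Suc j)) \<le> - ln a + \<epsilon>"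
      "\<And>x. 0 \<le> x \<Longrightarrow> x < a \<Longrightarrow> (\<Sum>j\<le>m. \<beta> j * x ^ j) \<le> 0"
      "\<And>x. a \<le> x \<Longrightarrow> x \<le> 1 \<Longrightarrow> (\<Sum>j\<le>m. \<beta> j * x ^ j) \<le> 1 / x"
      "- ln b - \<epsilon> \<le> (\<Sum>j\<le>m. \<beta> j / real (Suc j))"
proof -
  \<comment> \<open>A continuous ramp from 0 at \<open>a\<close> to 1 at \<open>b\<close>, divided
    by \<open>x\<close>; \<open>max x a\<close> prevents division by 0 below \<open>a\<close>, where
    the ramp vanishes.\<close>
  define g where "g x = min 1 (max 0 ((x - a) / (b - a))) / max x a" for x
  have g0: "0 \<le> g x" for x using ab by (simp add: g_def)
  have g_less: "g x = 0" if "x < a" for x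
  proof -
    have "(x - a) / (b - a) \<le> 0" using that ab by (simp add: divide_nonpos_pos)
    then show ?thesis by (simp add: g_def max_def)
  qed
  have g_le: "g x \<le> 1 / x" if "a \<le> x" for x
    using that ab by (auto simp: g_def max_absorb1 intro!: divide_right_mono)
  have g_ge: "1 / x \<le> g x" if "b \<le> x" for x
  proof -
    have "1 \<le> (x - a) / (b - a)" using that ab by (simp add: le_divide_eq)
    then show ?thesis using that ab by (simp add: g_def max_absorb1 min_def max_def)
  qed
  have cont: "continuous_on {0..1} g"
    unfolding g_def using ab by (intro continuous_intros) auto
  have "0 < \<epsilon> / 2" using \<epsilon> by simp
  then obtain P where P: "real_polynomial_function P" "\<And>x. x \<in> {0..1} \<Longrightarrow> \<bar>g x - P x\<bar> < \<epsilon> / 2"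
    by (rule Stone_Weierstrass_real_polynomial_function[OF compact_Icc cont]) (rule that; assumption)
  have ex: "\<exists>\<alpha> n. (\<lambda>x. P x + c) = (\<lambda>x. \<Sum>j\<le>n. \<alpha> j * x ^ j)" for c
    using real_polynomial_function.intros(3)[OF P(1) real_polynomial_function.intros(2)[of c]]
    unfolding real_polynomial_function_iff_sum .
  obtain \<alpha> n where up: "(\<lambda>x. P x + \<epsilon> / 2) = (\<lambda>x. \<Sum>j\<le>n. \<alpha> j * x ^ j)" using ex by blast
  obtain \<beta> m where lo: "(\<lambda>x. P x + (- (\<epsilon> / 2))) = (\<lambda>x. \<Sum>j\<le>m. \<beta> j * x ^ j)" using ex by blast
  have up_x: "(\<Sum>j\<le>n. \<alpha> j * x ^ j) = P x + \<epsilon> / 2" for x using fun_cong[OF up, of x] by simp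
  have lo_x: "(\<Sum>j\<le>m. \<beta> j * x ^ j) = P x - \<epsilon> / 2" for x using fun_cong[OF lo, of x] by simp
  have up_ge: "g x \<le> (\<Sum>j\<le>n. \<alpha> j * x ^ j)" "(\<Sum>j\<le>n. \<alpha> j * x ^ j) \<le> g x + \<epsilon>" if "0 \<le> x" "x \<le> 1" for x
    using abs_less_iff[THEN iffD1, OF P(2)[of x]] that unfolding up_x by (simp_all add: field_simps)
  have lo_le: "(\<Sum>j\<le>m. \<beta> j * x ^ j) \<le> g x" "g x - \<epsilon> \<le> (\<Sum>j\<le>m. \<beta> j * x ^ j)" if "0 \<le> x" "x \<le> 1" for x
    using abs_less_iff[THEN iffD1, OF P(2)[of x]] that unfolding lo_x by (simp_all add: field_simps)
  have eps: "((\<lambda>x. \<epsilon>) has_integral \<epsilon>) {0..1::real}" using has_integral_const_real[of \<epsilon> 0 1] by simp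
  have "(\<Sum>j\<le>n. \<alpha> j / real (Suc j)) \<le> - ln a + \<epsilon>"
  proof (rule has_integral_le[OF has_integral_polynomial has_integral_add[OF has_integral_reciprocal_tail eps]])
    show "0 < a" "a \<le> 1" using ab by auto
    fix x :: real assume x: "x \<in> {0..1}"
    then have "(\<Sum>j\<le>n. \<alpha> j * x ^ j) \<le> g x + \<epsilon>" by (intro up_ge) auto
    also have "g x \<le> (if x \<in> {a..1} then 1 / x else 0)" using x g_less[of x] g_le[of x] by auto
    finally show "(\<Sum>j\<le>n. \<alpha> j * x ^ j) \<le> (if x \<in> {a..1} then 1 / x else 0) + \<epsilon>" by simp
  qed
  have "- ln b - \<epsilon> \<le> (\<Sum>j\<le>m. \<beta> j / real (Suc j))"
  proof (rule has_integral_le[OF has_integral_diff[OF has_integral_reciprocal_tail eps] has_integral_polynomial])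
    show "0 < b" "b \<le> 1" using ab by auto
    fix x :: real assume x: "x \<in> {0..1}"
    have "(if x \<in> {b..1} then 1 / x else 0) \<le> g x" using x g0[of x] g_ge[of x] by auto
    also have "g x - \<epsilon> \<le> (\<Sum>j\<le>m. \<beta> j * x ^ j)" using x by (intro lo_le) auto
    finally show "(if x \<in> {b..1} then 1 / x else 0) - \<epsilon> \<le> (\<Sum>j\<le>m. \<beta> j * x ^ j)" by simp
  qed
  have "0 \<le> (\<Sum>j\<le>n. \<alpha> j * x ^ j)" if "0 \<le> x" "x \<le> 1" for x
    using up_ge(1)[OF that] g0[of x] by linarith
  have "1 / x \<le> (\<Sum>j\<le>n. \<alpha> j * x ^ j)" if "b \<le> x" "x \<le> 1" for x
    using up_ge(1)[of x] g_ge[of x] that ab by linarith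
  have "(\<Sum>j\<le>m. \<beta> j * x ^ j) \<le> 0" if "0 \<le> x" "x < a" for x
    using lo_le(1)[of x] g_less[of x] that ab by linarith
  have "(\<Sum>j\<le>m. \<beta> j * x ^ j) \<le> 1 / x" if "a \<le> x" "x \<le> 1" for x
    using lo_le(1)[of x] g_le[of x] that ab by linarith
  show ?thesis
    by (rule that[where \<alpha> = \<alpha> and n = n and \<beta> = \<beta> and m = m]; fact)
qed

lemma div_ratio_lim: "(\<lambda>k. real (Suc k div Suc j) * recip k) \<longlonglongrightarrow> 1 / real (Suc j)"
proof (rule tendsto_sandwich)
  have eq: "real (Suc k div Suc j) = (real (Suc k) - real (Suc k mod Suc j)) / real (Suc j)" for k
  proof -
    have "real (Suc k) = real (Suc j) * real (Suc k div Suc j) + real (Suc k mod Suc j)"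
      by (metis mult_div_mod_eq of_nat_add of_nat_mult)
    then show ?thesis by (simp add: field_simps del: of_nat_Suc)
  qed
  show "\<forall>\<^sub>F k in sequentially. real (Suc k div Suc j) * recip k \<le> 1 / real (Suc j)"
    unfolding eq by (intro always_eventually allI) (simp add: field_simps del: of_nat_Suc)
  have "real (Suc k mod Suc j) \<le> real (Suc j)" for k by (simp add: less_imp_le del: of_nat_Suc)
  then show "\<forall>\<^sub>F k in sequentially. 1 / real (Suc j) - recip k \<le> real (Suc k div Suc j) * recip k"
    unfolding eq by (intro always_eventually allI) (simp add: field_simps del: of_nat_Suc)
  show "(\<lambda>k. 1 / real (Suc j) - recip k) \<longlonglongrightarrow> 1 / real (Suc j)"
    using tendsto_diff[OF tendsto_const recip_lim, of "1 / real (Suc j)"] by simp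
qed simp

lemma filterlim_div: "filterlim (\<lambda>k. Suc k div Suc j) at_top sequentially"
  unfolding filterlim_at_top eventually_sequentially
proof (intro allI)
  fix N
  have "N \<le> Suc k div Suc j" if "N * Suc j \<le> k" for k
  proof -
    have "N * Suc j div Suc j \<le> Suc k div Suc j" using that by (intro div_le_mono) simp
    then show ?thesis by (metis div_mult_self_is_m zero_less_Suc)
  qed
  then show "\<exists>M. \<forall>k\<ge>M. N \<le> Suc k div Suc j" by blast
qed

context
  fixes u x :: "nat \<Rightarrow> real" and c :: real
  assumes u: "\<And>i. 0 \<le> u i" and x: "\<And>i. 0 \<le> x i" "\<And>i. x i \<le> 1"
    and sm: "\<And>a. 0 < a \<Longrightarrow> summable (\<lambda>i. u i * x i powr a)"
    and lim: "(\<lambda>k. recip k * (\<Sum>i. u i * x i powr recip k)) \<longlonglongrightarrow> c"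
begin

text \<open>The hypothesis \<open>lim\<close> concerns the exponents 1/(k + 1). For
  \<open>m = Suc k div Suc j \<ge> 1\<close> the exponent (j + 1)/(k + 1) lies between 1/(m + 1) and
  1/m, and \<open>Z\<close> decreases in the exponent because all \<open>x i\<close> are at most 1.
  The ratio of m to k + 1 tends to 1/(j + 1), which gives the limit.\<close>

lemma karamata_power:
  "(\<lambda>k. recip k * (\<Sum>i. u i * x i powr (real (Suc j) * recip k))) \<longlonglongrightarrow> c / real (Suc j)"
proof -
  define Z where "Z a = (\<Sum>i. u i * x i powr a)" for a
  have Zmono: "Z b \<le> Z a" if "0 < a" "a \<le> b" for a b
    unfolding Z_def using that u x
    by (intro suminf_le sm mult_left_mono) (auto intro: powr_mono')
  define m where "m k = Suc k div Suc j" for k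
  define A where "A = (\<lambda>k. recip k * Z (recip k))"
  have A: "A \<longlonglongrightarrow> c" using lim by (simp add: A_def Z_def)
  have Am: "(\<lambda>k. A (m k)) \<longlonglongrightarrow> c"
    by (rule filterlim_compose[OF A]) (unfold m_def, rule filterlim_div)
  have Am1: "(\<lambda>k. A (m k - 1)) \<longlonglongrightarrow> c"
    by (rule filterlim_compose[OF A], rule filterlim_compose[OF filterlim_minus_const_nat_at_top])
      (unfold m_def, rule filterlim_div)
  show ?thesis unfolding Z_def[symmetric]
  proof (rule tendsto_sandwich)
    have "(\<lambda>k. (real (m k) * recip k) * A (m k - 1)) \<longlonglongrightarrow> 1 / real (Suc j) * c"
      unfolding m_def by (rule tendsto_mult[OF div_ratio_lim Am1[unfolded m_def]])
    then show "(\<lambda>k. (real (m k) * recip k) * A (m k - 1)) \<longlonglongrightarrow> c / real (Suc j)" by simp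
    have "(\<lambda>k. (real (m k) * recip k + recip k) * A (m k)) \<longlonglongrightarrow> (1 / real (Suc j) + 0) * c"
      unfolding m_def by (rule tendsto_mult[OF tendsto_add[OF div_ratio_lim recip_lim] Am[unfolded m_def]])
    then show "(\<lambda>k. (real (m k) * recip k + recip k) * A (m k)) \<longlonglongrightarrow> c / real (Suc j)" by simp
    have div: "m k * Suc j \<le> Suc k" "Suc k < (m k + 1) * Suc j" for k
      unfolding m_def using dividend_less_div_times[of "Suc j" "Suc k"] div_times_less_eq_dividend[of "Suc k" "Suc j"]
      by (simp_all add: algebra_simps)
    show "\<forall>\<^sub>F k in sequentially. (real (m k) * recip k) * A (m k - 1) \<le> recip k * Z (real (Suc j) * recip k)"
      \<comment> \<open>\<open>k \<ge> j\<close> ensures \<open>m k \<ge> 1\<close>; then the index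
        \<open>m k - 1\<close> belongs to the exponent \<open>1 / real (m k)\<close>.\<close>
      using eventually_ge_at_top[of j]
    proof eventually_elim
      case (elim k)
      then have mk: "m k \<ge> 1" using div(2)[of k] by (cases "m k") auto
      then have S: "Suc (m k - 1) = m k" by simp
      have "real (m k) * real (Suc j) \<le> real (Suc k)"
        using div(1)[of k] by (metis of_nat_le_iff of_nat_mult)
      then have "real (Suc j) * recip k \<le> 1 / real (m k)"
        using mk by (simp add: field_simps del: of_nat_Suc)
      then have "Z (1 / real (m k)) \<le> Z (real (Suc j) * recip k)" by (intro Zmono) auto
      moreover have "(real (m k) * recip k) * A (m k - 1) = recip k * Z (1 / real (m k))"
        unfolding A_def S using mk by simp
      ultimately show ?case by (simp only: mult_left_mono less_imp_le[OF recip_bounds(1)])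
    qed
    show "\<forall>\<^sub>F k in sequentially. recip k * Z (real (Suc j) * recip k) \<le> (real (m k) * recip k + recip k) * A (m k)"
    proof (intro always_eventually allI)
      fix k
      have "real (Suc k) \<le> real (Suc (m k)) * real (Suc j)"
        using div(2)[of k] by (metis Suc_eq_plus1 less_imp_le of_nat_le_iff of_nat_mult)
      then have "recip (m k) \<le> real (Suc j) * recip k" by (simp add: field_simps del: of_nat_Suc)
      then have "Z (real (Suc j) * recip k) \<le> Z (recip (m k))" by (intro Zmono) auto
      moreover have "(real (m k) * recip k + recip k) * A (m k) = recip k * Z (recip (m k))"
      proof -
        have "real (m k) * recip k + recip k = recip k * real (Suc (m k))" by (simp add: field_simps)
        then show ?thesis unfolding A_def by (simp del: of_nat_Suc)
      qed
      ultimately show "recip k * Z (real (Suc j) * recip k) \<le> (real (m k) * recip k + recip k) * A (m k)"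
        by (simp only: mult_left_mono less_imp_le[OF recip_bounds(1)])
    qed
  qed
qed

text \<open>Powers of \<open>y k i\<close> are the powers of \<open>x i\<close> treated in
  \<open>karamata_power\<close>. The additional factor \<open>y k i\<close> raises the exponent j to
  j + 1, which turns the limit into \<open>c\<close> times the integral of the polynomial over
  [0,1].\<close>

lemma karamata_polynomial:
  defines "y \<equiv> \<lambda>k i. x i powr recip k"
  shows "summable (\<lambda>i. u i * (y k i * (\<Sum>j\<le>n. \<alpha> j * y k i ^ j)))"
    "(\<lambda>k. recip k * (\<Sum>i. u i * (y k i * (\<Sum>j\<le>n. \<alpha> j * y k i ^ j)))) \<longlonglongrightarrow> c * (\<Sum>j\<le>n. \<alpha> j / real (Suc j))"
proof -
  have eq: "u i * (y k i * (\<Sum>j\<le>n. \<alpha> j * y k i ^ j)) = (\<Sum>j\<le>n. \<alpha> j * (u i * x i powr (real (Suc j) * recip k)))" for k i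
  proof -
    have "y k i ^ Suc j = x i powr (real (Suc j) * recip k)" for j
      unfolding y_def by (cases "x i = 0") (simp, simp add: powr_power del: power_Suc of_nat_Suc)
    then show ?thesis by (simp add: sum_distrib_left mult_ac del: of_nat_Suc)
  qed
  have s: "(\<lambda>i. u i * (y k i * (\<Sum>j\<le>n. \<alpha> j * y k i ^ j))) sums
      (\<Sum>j\<le>n. \<alpha> j * (\<Sum>i. u i * x i powr (real (Suc j) * recip k)))" for k
    unfolding eq by (intro sums_sum sums_mult summable_sums sm) simp
  show "summable (\<lambda>i. u i * (y k i * (\<Sum>j\<le>n. \<alpha> j * y k i ^ j)))" by (rule sums_summable[OF s])
  have "(\<lambda>k. \<Sum>j\<le>n. \<alpha> j * (recip k * (\<Sum>i. u i * x i powr (real (Suc j) * recip k))))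
      \<longlonglongrightarrow> (\<Sum>j\<le>n. \<alpha> j * (c / real (Suc j)))"
    by (intro tendsto_sum tendsto_mult tendsto_const karamata_power)
  then show "(\<lambda>k. recip k * (\<Sum>i. u i * (y k i * (\<Sum>j\<le>n. \<alpha> j * y k i ^ j)))) \<longlonglongrightarrow> c * (\<Sum>j\<le>n. \<alpha> j / real (Suc j))"
    unfolding sums_unique[OF s, symmetric] by (simp add: sum_distrib_left mult_ac)
qed

text \<open>The cut-off condition says \<open>exp (-1) \<le> y k i\<close>, so the sum has the form
  of \<open>karamata_polynomial\<close> with the polynomial replaced by the function that is 1/y
  above exp (-1) and 0 below. The integral of this function over [0,1] is 1, and polynomials
  enclosing it give the limit.\<close>

theorem karamata:
  assumes fin: "\<And>t. 0 < t \<Longrightarrow> finite {i. t \<le> x i}"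
  shows "(\<lambda>k. recip k * (\<Sum>i | exp (- real (Suc k)) \<le> x i. u i)) \<longlonglongrightarrow> c"
proof -
  define y where "y k i = x i powr recip k" for k i
  define B where "B k = {i. exp (- real (Suc k)) \<le> x i}" for k
  have y01: "0 \<le> y k i" "y k i \<le> 1" for k i
    using x by (auto simp: y_def intro!: powr_le1)
  have B: "i \<in> B k \<longleftrightarrow> exp (-1) \<le> y k i" for i k
  proof -
    have e: "exp (- real (Suc k)) powr recip k = exp (-1)" by (simp add: exp_powr_real del: of_nat_Suc)
    have "exp (- real (Suc k)) \<le> x i \<longleftrightarrow> exp (- real (Suc k)) powr recip k \<le> x i powr recip k"
    proof (cases "exp (- real (Suc k)) \<le> x i")
      case True
      then show ?thesis by (simp add: powr_mono2)
    next
      case False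
      then have "x i powr recip k < exp (- real (Suc k)) powr recip k"
        using x by (intro powr_less_mono2) auto
      then show ?thesis using False by simp
    qed
    then show ?thesis by (simp only: B_def y_def mem_Collect_eq e)
  qed
  have finB: "finite (B k)" for k unfolding B_def by (rule fin) simp
  have "0 \<le> recip k * (\<Sum>i. u i * x i powr recip k)" for k
    using u by (intro mult_nonneg_nonneg suminf_nonneg sm) auto
  then have c0: "0 \<le> c" by (intro LIMSEQ_le_const[OF lim]) auto
  have pos: "0 < y k i" if "i \<in> B k" for k i using that unfolding B by (meson exp_gt_zero less_le_trans)
  have "(\<lambda>k. recip k * (\<Sum>i\<in>B k. u i)) \<longlonglongrightarrow> c"
  proof (rule order_tendstoI)
    fix r assume r: "c < r"
    \<comment> \<open>The integral of the upper polynomial is at most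
      \<open>1 + 2 * \<delta>\<close>, and \<open>\<delta>\<close> is small enough for
      \<open>c * (1 + 2 * \<delta>) < r\<close>; the summand 1 in \<open>c + 1\<close> avoids
      division by 0.\<close>
    define \<delta> where "\<delta> = (r - c) / (4 * (c + 1))"
    have \<delta>: "0 < \<delta>" "c * (1 + 2 * \<delta>) < r" using r c0 by (auto simp: \<delta>_def field_simps) (smt (verit) mult_nonneg_nonneg mult_less_cancel_left)
    obtain \<alpha> n where p: "\<And>x. 0 \<le> x \<Longrightarrow> x \<le> 1 \<Longrightarrow> 0 \<le> (\<Sum>j\<le>n. \<alpha> j * x ^ j)"
      "\<And>x. exp (-1) \<le> x \<Longrightarrow> x \<le> 1 \<Longrightarrow> 1 / x \<le> (\<Sum>j\<le>n. \<alpha> j * x ^ j)"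
      "(\<Sum>j\<le>n. \<alpha> j / real (Suc j)) \<le> - ln (exp (- (1 + \<delta>))) + \<delta>"
    proof (rule polynomial_between[of "exp (- (1 + \<delta>))" "exp (-1)" \<delta>])
      fix \<alpha> n
      assume "\<And>x. 0 \<le> x \<Longrightarrow> x \<le> 1 \<Longrightarrow> 0 \<le> (\<Sum>j\<le>n. \<alpha> j * x ^ j)" and "\<And>x. exp (-1) \<le> x \<Longrightarrow> x \<le> 1 \<Longrightarrow> 1 / x \<le> (\<Sum>j\<le>n. \<alpha> j * x ^ j)" and "(\<Sum>j\<le>n. \<alpha> j / real (Suc j)) \<le> - ln (exp (- (1 + \<delta>))) + \<delta>"
      then show thesis by (rule that)
    qed (use \<delta>(1) in simp_all)
    have le: "recip k * (\<Sum>i\<in>B k. u i) \<le> recip k * (\<Sum>i. u i * (y k i * (\<Sum>j\<le>n. \<alpha> j * y k i ^ j)))" for k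
    proof (rule mult_left_mono)
      have "(\<Sum>i\<in>B k. u i) \<le> (\<Sum>i\<in>B k. u i * (y k i * (\<Sum>j\<le>n. \<alpha> j * y k i ^ j)))"
      proof (rule sum_mono)
        fix i assume i: "i \<in> B k"
        have "y k i * (1 / y k i) \<le> y k i * (\<Sum>j\<le>n. \<alpha> j * y k i ^ j)"
          using i y01 by (intro mult_left_mono p(2)) (auto simp: B)
        then have "1 \<le> y k i * (\<Sum>j\<le>n. \<alpha> j * y k i ^ j)" using pos[OF i] by simp
        from mult_left_mono[OF this u[of i]]
        show "u i \<le> u i * (y k i * (\<Sum>j\<le>n. \<alpha> j * y k i ^ j))" by simp
      qed
      also have "\<dots> \<le> (\<Sum>i. u i * (y k i * (\<Sum>j\<le>n. \<alpha> j * y k i ^ j)))"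
        using u y01 p(1) finB karamata_polynomial(1) unfolding y_def by (intro sum_le_suminf) auto
      finally show "(\<Sum>i\<in>B k. u i) \<le> (\<Sum>i. u i * (y k i * (\<Sum>j\<le>n. \<alpha> j * y k i ^ j)))" .
    qed simp
    have "(\<Sum>j\<le>n. \<alpha> j / real (Suc j)) \<le> 1 + 2 * \<delta>" using p(3) by simp
    then have "c * (\<Sum>j\<le>n. \<alpha> j / real (Suc j)) < r" using \<delta>(2) c0 by (meson le_less_trans mult_left_mono)
    from order_tendstoD(2)[OF karamata_polynomial(2) this, folded y_def]
    show "\<forall>\<^sub>F k in sequentially. recip k * (\<Sum>i\<in>B k. u i) < r"
      by (rule eventually_mono) (rule le_less_trans[OF le])
  next
    fix r assume r: "r < c"
    \<comment> \<open>The minimum with 1/2 keeps \<open>exp (- (1 - \<delta>))\<close> strictly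
      between exp (-1) and 1.\<close>
    define \<delta> where "\<delta> = min (1 / 2) ((c - r) / (4 * (c + 1)))"
    have "c * \<delta> \<le> c * ((c - r) / (4 * (c + 1)))" using c0 by (intro mult_left_mono) (auto simp: \<delta>_def)
    also have "\<dots> = (c / (c + 1)) * ((c - r) / 4)" using c0 by (simp add: field_simps)
    also have "\<dots> \<le> 1 * ((c - r) / 4)" using c0 r by (intro mult_right_mono) auto
    finally have \<delta>: "0 < \<delta>" "\<delta> < 1" "r < c * (1 - 2 * \<delta>)" using r c0 by (auto simp: \<delta>_def algebra_simps)
    obtain \<beta> m where p: "\<And>x. 0 \<le> x \<Longrightarrow> x < exp (-1) \<Longrightarrow> (\<Sum>j\<le>m. \<beta> j * x ^ j) \<le> 0"
      "\<And>x. exp (-1) \<le> x \<Longrightarrow> x \<le> 1 \<Longrightarrow> (\<Sum>j\<le>m. \<beta> j * x ^ j) \<le> 1 / x"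
      "- ln (exp (- (1 - \<delta>))) - \<delta> \<le> (\<Sum>j\<le>m. \<beta> j / real (Suc j))"
    proof (rule polynomial_between[of "exp (-1)" "exp (- (1 - \<delta>))" \<delta>])
      fix \<beta> m
      assume "\<And>x. 0 \<le> x \<Longrightarrow> x < exp (-1) \<Longrightarrow> (\<Sum>j\<le>m. \<beta> j * x ^ j) \<le> 0" and "\<And>x. exp (-1) \<le> x \<Longrightarrow> x \<le> 1 \<Longrightarrow> (\<Sum>j\<le>m. \<beta> j * x ^ j) \<le> 1 / x" and "- ln (exp (- (1 - \<delta>))) - \<delta> \<le> (\<Sum>j\<le>m. \<beta> j / real (Suc j))"
      then show thesis by (rule that)
    qed (use \<delta>(1,2) in simp_all)
    have ge: "recip k * (\<Sum>i. u i * (y k i * (\<Sum>j\<le>m. \<beta> j * y k i ^ j))) \<le> recip k * (\<Sum>i\<in>B k. u i)" for k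
    proof (rule mult_left_mono)
      have "(\<Sum>i. u i * (y k i * (\<Sum>j\<le>m. \<beta> j * y k i ^ j))) \<le> (\<Sum>i. if i \<in> B k then u i else 0)"
      proof (rule suminf_le)
        fix i
        show "u i * (y k i * (\<Sum>j\<le>m. \<beta> j * y k i ^ j)) \<le> (if i \<in> B k then u i else 0)"
        proof (cases "i \<in> B k")
          case True
          have "y k i * (\<Sum>j\<le>m. \<beta> j * y k i ^ j) \<le> y k i * (1 / y k i)"
            using True y01 by (intro mult_left_mono p(2)) (auto simp: B)
          then have "y k i * (\<Sum>j\<le>m. \<beta> j * y k i ^ j) \<le> 1" using pos[OF True] by simp
          from mult_left_mono[OF this u[of i]] show ?thesis using True by simp
        next
          case False
          then have "(\<Sum>j\<le>m. \<beta> j * y k i ^ j) \<le> 0" using y01 by (intro p(1)) (auto simp: B)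
          then show ?thesis using False u[of i] y01(1)[of k i] by (simp add: mult_nonneg_nonpos)
        qed
      next
        show "summable (\<lambda>i. u i * (y k i * (\<Sum>j\<le>m. \<beta> j * y k i ^ j)))"
          unfolding y_def by (rule karamata_polynomial(1))
        show "summable (\<lambda>i. if i \<in> B k then u i else 0)" by (rule summable_If_finite_set[OF finB])
      qed
      also have "\<dots> = (\<Sum>i\<in>B k. u i)" using sums_If_finite_set[OF finB] by (metis sums_unique)
      finally show "(\<Sum>i. u i * (y k i * (\<Sum>j\<le>m. \<beta> j * y k i ^ j))) \<le> (\<Sum>i\<in>B k. u i)" .
    qed simp
    have "1 - 2 * \<delta> \<le> (\<Sum>j\<le>m. \<beta> j / real (Suc j))" using p(3) by simp
    then have "r < c * (\<Sum>j\<le>m. \<beta> j / real (Suc j))" using \<delta>(3) c0 by (meson less_le_trans mult_left_mono)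
    from order_tendstoD(1)[OF karamata_polynomial(2) this, folded y_def]
    show "\<forall>\<^sub>F k in sequentially. r < recip k * (\<Sum>i\<in>B k. u i)"
      by (rule eventually_mono) (rule less_le_trans[OF _ ge])
  qed
  then show ?thesis by (simp add: B_def)
qed

end

section \<open>From cut-offs by size to cut-offs by index\<close>

abbreviation (input) lnk :: "nat \<Rightarrow> real"
  where "lnk k \<equiv> ln (1 + real (Suc k))"

lemma lnk_at_top: "filterlim lnk at_top sequentially"
proof -
  have "filterlim (\<lambda>k. 1 + real (Suc k)) at_top sequentially"
    by (intro filterlim_tendsto_add_at_top[OF tendsto_const]
        filterlim_compose[OF filterlim_real_sequentially filterlim_Suc])
  then show ?thesis by (rule filterlim_compose[OF ln_at_top])
qed

lemma lnk_inverse_lim: "(\<lambda>k. C / lnk k) \<longlonglongrightarrow> 0"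
  by (rule tendsto_divide_0[OF tendsto_const filterlim_at_top_imp_at_infinity[OF lnk_at_top]])

text \<open>As \<open>l\<close> decreases, (k + 2) times \<open>l (Suc k)\<close> is at most a
  partial sum and hence of order ln k. Division by k + 2 leaves less than the power of k + 2 with
  exponent e - 1, which is the stated exponential.\<close>

lemma log_mean_bounded_imp_small:
  fixes l :: "nat \<Rightarrow> real"
  assumes l: "decseq l" "\<And>i. 0 \<le> l i" and C: "\<And>k. log_mean l k \<le> C" and e: "0 < e"
  shows "\<forall>\<^sub>F k in sequentially. l (Suc k) < exp (- ((1 - e) * lnk k))"
proof -
  have "(\<lambda>n. ln (real n) / real n powr e) \<longlonglongrightarrow> 0" using e by (rule lim_ln_over_power)
  then have "(\<lambda>k. ln (real (k + 2)) / real (k + 2) powr e) \<longlonglongrightarrow> 0" by (rule LIMSEQ_ignore_initial_segment)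
  then have "(\<lambda>k. \<bar>C\<bar> * 2 * (ln (real (k + 2)) / real (k + 2) powr e)) \<longlonglongrightarrow> \<bar>C\<bar> * 2 * 0"
    by (intro tendsto_mult tendsto_const)
  then have "\<forall>\<^sub>F k in sequentially. \<bar>C\<bar> * 2 * (ln (real (k + 2)) / real (k + 2) powr e) < 1"
    by (intro order_tendstoD(2)) auto
  then show ?thesis
  proof eventually_elim
    case (elim k)
    define n where "n = real (k + 2)"
    have n: "2 \<le> n" "n = 1 + real (Suc k)" by (auto simp: n_def)
    have "n * l (Suc k) = (\<Sum>i\<le>Suc k. l (Suc k))" by (simp add: n_def)
    also have "\<dots> \<le> (\<Sum>i\<le>Suc k. l i)" using l(1) by (intro sum_mono) (auto simp: decseq_def)
    also have "\<dots> \<le> C * ln (1 + real (Suc (Suc k)))" using C[of "Suc k"] unfolding log_mean_le_iff .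
    also have "\<dots> \<le> \<bar>C\<bar> * ln (n * n)"
    proof (rule mult_mono)
      have "2 * n \<le> n * n" using n(1) by (intro mult_right_mono) auto
      then have "n + 1 \<le> n * n" using n(1) by linarith
      then show "ln (1 + real (Suc (Suc k))) \<le> ln (n * n)" by (subst ln_le_cancel_iff) (auto simp: n_def)
    qed auto
    also have "ln (n * n) = 2 * ln n" using n(1) by (subst ln_mult) auto
    finally have "n * l (Suc k) \<le> \<bar>C\<bar> * 2 * ln n" by simp
    also have "\<dots> < n powr e"
      using elim n(1) unfolding n_def[symmetric] by (simp add: pos_divide_less_eq)
    finally have "l (Suc k) < n powr e / n" using n(1) by (simp add: pos_less_divide_eq mult.commute)
    also have "\<dots> = n powr (- (1 - e))" using n(1) by (simp add: powr_diff)
    also have "\<dots> = exp (- ((1 - e) * lnk k))" using n by (simp add: powr_def algebra_simps)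
    finally show ?case .
  qed
qed

text \<open>Karamata's theorem controls sums over the indices where \<open>x i\<close> is at least
  exp (-q), the logarithmic mean a sum over \<open>i \<le> k\<close>. The two cut-offs are matched
  with q near ln (k + 2). From above, the remaining terms with \<open>i \<le> k\<close> have a
  bounded sum; from below, the decay of \<open>l\<close> puts the large terms at indices up to
  \<open>k\<close>, at the price of a factor \<open>1 - e\<close>.\<close>

theorem tauberian_zeta:
  fixes l b :: "nat \<Rightarrow> real"
  assumes l: "decseq l" "\<And>i. 0 \<le> l i" and C: "\<And>k. log_mean l k \<le> C"
    and b: "\<And>i. 0 \<le> b i" "\<And>i. b i \<le> 1"
    and lim: "(\<lambda>k. recip k * (\<Sum>i. l i powr (1 + recip k) * b i)) \<longlonglongrightarrow> c"
  shows "log_mean (\<lambda>i. l i * b i) \<longlonglongrightarrow> c"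
proof -
  \<comment> \<open>Normalizes to values at most 1. As \<open>M \<ge> 1\<close>, also
    \<open>x i \<le> l i\<close>, and the factor \<open>M powr (- recip k)\<close> tends to
    1.\<close>
  define M where "M = max 1 (l 0)"
  define x u where "x i = l i / M" and "u i = l i * b i" for i
  have M: "1 \<le> M" "0 < M" by (auto simp: M_def)
  have lM: "l i \<le> M" for i using l(1) by (auto simp: M_def decseq_def intro: order_trans[of _ "l 0"])
  have x: "0 \<le> x i" "x i \<le> 1" "x i \<le> l i" for i
    using l(2)[of i] lM[of i] M mult_left_mono[OF M(1) l(2)[of i]] by (auto simp: x_def divide_le_eq)
  have u: "0 \<le> u i" "u i \<le> l i" for i using l(2)[of i] b by (auto simp: u_def mult_left_le)
  have ux: "u i * x i powr a = M powr (- a) * (l i powr (1 + a) * b i)" for i a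
  proof -
    have "(l i / M) powr a = l i powr a / M powr a" using l(2)[of i] M by (simp add: powr_divide)
    then show ?thesis using l(2)[of i] by (simp add: u_def x_def powr_minus_divide powr_add)
  qed
  have sm0: "summable (\<lambda>i. l i powr (1 + a) * b i)" if "0 < a" for a
    by (rule summable_comparison_test'[OF sum_powr_summable[OF l C that]])
      (use b in \<open>auto simp: abs_mult intro!: mult_left_le\<close>)
  have sm: "summable (\<lambda>i. u i * x i powr a)" if "0 < a" for a
    unfolding ux by (intro summable_mult sm0 that)
  have "(\<lambda>k. M powr (- recip k) * (recip k * (\<Sum>i. l i powr (1 + recip k) * b i))) \<longlonglongrightarrow> M powr (- 0) * c"
    using M by (intro tendsto_intros lim recip_lim) auto
  then have lim': "(\<lambda>k. recip k * (\<Sum>i. u i * x i powr recip k)) \<longlonglongrightarrow> c"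
    unfolding ux suminf_mult[OF sm0[OF recip_bounds(1)]] using M by (simp add: mult_ac)
  have fin: "finite {i. t \<le> x i}" if t: "0 < t" for t
  proof -
    have "(\<lambda>i. l i powr (1 + 1)) \<longlonglongrightarrow> 0" by (rule summable_LIMSEQ_zero[OF sum_powr_summable[OF l C]]) simp
    then have "\<forall>\<^sub>F i in sequentially. l i powr (1 + 1) < t powr (1 + 1)" using t by (intro order_tendstoD(2)) auto
    then obtain N where N: "\<And>i. N \<le> i \<Longrightarrow> l i powr (1 + 1) < t powr (1 + 1)" unfolding eventually_sequentially by blast
    have "{i. t \<le> x i} \<subseteq> {..<N}"
    proof
      fix i assume "i \<in> {i. t \<le> x i}"
      then have "t \<le> l i" using x(3)[of i] by simp
      then have "t powr (1 + 1) \<le> l i powr (1 + 1)" using t by (intro powr_mono2) auto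
      then show "i \<in> {..<N}" using N[of i] by (force simp: not_le[symmetric])
    qed
    then show ?thesis by (rule finite_subset) simp
  qed
  define B where "B k = (\<Sum>i | exp (- real (Suc k)) \<le> x i. u i)" for k
  have B: "(\<lambda>k. recip k * B k) \<longlonglongrightarrow> c"
    unfolding B_def using u(1) x(1,2) sm lim' fin by (rule karamata)
  have finB: "finite {i. exp (- real (Suc k)) \<le> x i}" for k by (rule fin) simp
  have "0 \<le> recip k * B k" for k using u by (simp add: B_def sum_nonneg)
  then have c0: "0 \<le> c" by (intro LIMSEQ_le_const[OF B]) auto
  have lnk0: "0 < lnk k" for k by simp
  show ?thesis unfolding u_def[symmetric]
  proof (rule order_tendstoI)
    fix r assume r: "c < r"
    \<comment> \<open>The shift by 1 compensates that \<open>B q\<close> belongs to the threshold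
      \<open>exp (- real (Suc q))\<close>.\<close>
    define q where "q k = nat \<lceil>lnk k\<rceil> - 1" for k
    have q: "real (Suc (q k)) = of_int \<lceil>lnk k\<rceil>" for k
    proof -
      have "1 \<le> \<lceil>lnk k\<rceil>" using lnk0[of k] by linarith
      then show ?thesis by (simp add: q_def of_nat_diff)
    qed
    have q_bounds: "lnk k \<le> real (Suc (q k))" "real (Suc (q k)) \<le> lnk k + 1" for k
      unfolding q by linarith+
    have q_top: "filterlim q at_top sequentially"
    proof -
      have "filterlim (\<lambda>k. real (Suc (q k))) at_top sequentially"
        by (rule filterlim_at_top_mono[OF lnk_at_top]) (use q_bounds in auto)
      then have "filterlim (\<lambda>k. Suc (q k)) at_top sequentially" by (simp only: filterlim_sequentially_iff_filterlim_real)
      then have "filterlim (\<lambda>k. Suc (q k) - 1) at_top sequentially"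
        by (rule filterlim_compose[OF filterlim_minus_const_nat_at_top])
      then show ?thesis by simp
    qed
    have ratio: "(\<lambda>k. real (Suc (q k)) / lnk k) \<longlonglongrightarrow> 1"
    proof (rule tendsto_sandwich[OF _ _ tendsto_const])
      show "(\<lambda>k. 1 + 1 / lnk k) \<longlonglongrightarrow> 1" using tendsto_add[OF tendsto_const lnk_inverse_lim[of 1], of 1] by simp
      show "\<forall>\<^sub>F k in sequentially. 1 \<le> real (Suc (q k)) / lnk k"
        using q_bounds(1) lnk0 by (auto simp: le_divide_eq simp del: of_nat_Suc)
      show "\<forall>\<^sub>F k in sequentially. real (Suc (q k)) / lnk k \<le> 1 + 1 / lnk k"
        using q_bounds(2) by (auto simp: divide_le_eq distrib_right simp del: of_nat_Suc)
    qed
    have le: "log_mean u k \<le> recip (q k) * B (q k) * (real (Suc (q k)) / lnk k) + M / lnk k" for k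
    proof -
      define S where "S = {i. exp (- real (Suc (q k))) \<le> x i}"
      have "(\<Sum>i\<le>k. u i) = (\<Sum>i\<in>{..k} \<inter> S. u i) + (\<Sum>i\<in>{..k} - S. u i)"
        by (subst sum.Int_Diff[of _ _ S]) auto
      also have "(\<Sum>i\<in>{..k} \<inter> S. u i) \<le> B (q k)"
        unfolding B_def S_def using finB u by (intro sum_mono2) auto
      \<comment> \<open>Outside \<open>S\<close> each term is at most M/(k + 2), and there are at
        most k + 1 of them.\<close>
      also have "(\<Sum>i\<in>{..k} - S. u i) \<le> (\<Sum>i\<in>{..k} - S. M / (1 + real (Suc k)))"
      proof (rule sum_mono)
        fix i assume "i \<in> {..k} - S"
        then have "x i \<le> exp (- real (Suc (q k)))" by (simp add: S_def)
        also have "\<dots> \<le> exp (- lnk k)" using q_bounds(1)[of k] by (simp del: of_nat_Suc)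
        also have "\<dots> = 1 / (1 + real (Suc k))" by (simp add: exp_minus divide_inverse)
        finally have "M * x i \<le> M * (1 / (1 + real (Suc k)))" using M by (intro mult_left_mono) auto
        then show "u i \<le> M / (1 + real (Suc k))" using u(2)[of i] M by (simp add: x_def)
      qed
      also have "\<dots> \<le> (\<Sum>i\<in>{..k}. M / (1 + real (Suc k)))" using M by (intro sum_mono2) auto
      also have "\<dots> \<le> M" using M by (simp add: divide_le_eq)
      finally have "(\<Sum>i\<le>k. u i) \<le> B (q k) + M" by simp
      then have "log_mean u k \<le> (B (q k) + M) / lnk k" unfolding log_mean_def by (intro divide_right_mono) auto
      also have "\<dots> = recip (q k) * B (q k) * (real (Suc (q k)) / lnk k) + M / lnk k"
        by (simp add: add_divide_distrib del: of_nat_Suc)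
      finally show ?thesis .
    qed
    have "(\<lambda>k. recip (q k) * B (q k) * (real (Suc (q k)) / lnk k) + M / lnk k) \<longlonglongrightarrow> c * 1 + 0"
      by (intro tendsto_add tendsto_mult ratio lnk_inverse_lim filterlim_compose[OF B q_top])
    then have "\<forall>\<^sub>F k in sequentially. recip (q k) * B (q k) * (real (Suc (q k)) / lnk k) + M / lnk k < r"
      using r by (intro order_tendstoD(2)) auto
    then show "\<forall>\<^sub>F k in sequentially. log_mean u k < r" by (rule eventually_mono) (rule le_less_trans[OF le])
  next
    fix r assume r: "r < c"
    \<comment> \<open>The loss factor must keep \<open>c * (1 - e)\<close> above
      \<open>r\<close>.\<close>
    define e where "e = min (1 / 2) ((c - r) / (2 * (c + 1)))"
    have "c * e \<le> c * ((c - r) / (2 * (c + 1)))" using c0 by (intro mult_left_mono) (auto simp: e_def)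
    also have "\<dots> = (c / (c + 1)) * ((c - r) / 2)" using c0 by (simp add: field_simps)
    also have "\<dots> \<le> 1 * ((c - r) / 2)" using c0 r by (intro mult_right_mono) auto
    finally have e: "0 < e" "e < 1" "r < c * (1 - e)" using r c0 by (auto simp: e_def algebra_simps)
    define q where "q k = nat \<lfloor>(1 - e) * lnk k\<rfloor> - 1" for k
    have top: "filterlim (\<lambda>k. (1 - e) * lnk k) at_top sequentially"
      using e by (intro filterlim_tendsto_pos_mult_at_top[OF tendsto_const _ lnk_at_top]) auto
    have big: "\<forall>\<^sub>F k in sequentially. 2 \<le> (1 - e) * lnk k"
      using top unfolding filterlim_at_top by blast
    have q_bounds: "\<forall>\<^sub>F k in sequentially. real (Suc (q k)) \<le> (1 - e) * lnk k \<and> (1 - e) * lnk k - 1 \<le> real (Suc (q k))"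
      using big
    proof eventually_elim
      case (elim k)
      then have "2 \<le> \<lfloor>(1 - e) * lnk k\<rfloor>" by linarith
      then have "real (Suc (q k)) = of_int \<lfloor>(1 - e) * lnk k\<rfloor>" by (simp add: q_def of_nat_diff)
      then show ?case by linarith
    qed
    have q_top: "filterlim q at_top sequentially"
    proof -
      have "filterlim (\<lambda>k. -1 + (1 - e) * lnk k) at_top sequentially"
        by (intro filterlim_tendsto_add_at_top[OF tendsto_const] top)
      then have "filterlim (\<lambda>k. real (Suc (q k))) at_top sequentially"
        by (rule filterlim_at_top_mono) (use q_bounds in eventually_elim, linarith)
      then have "filterlim (\<lambda>k. Suc (q k)) at_top sequentially" by (simp only: filterlim_sequentially_iff_filterlim_real)
      then have "filterlim (\<lambda>k. Suc (q k) - 1) at_top sequentially"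
        by (rule filterlim_compose[OF filterlim_minus_const_nat_at_top])
      then show ?thesis by simp
    qed
    have ratio: "(\<lambda>k. real (Suc (q k)) / lnk k) \<longlonglongrightarrow> 1 - e"
    proof (rule tendsto_sandwich[OF _ _ _ tendsto_const])
      show "(\<lambda>k. (1 - e) - 1 / lnk k) \<longlonglongrightarrow> 1 - e"
        using tendsto_diff[OF tendsto_const lnk_inverse_lim[of 1], of "1 - e"] by simp
      show "\<forall>\<^sub>F k in sequentially. real (Suc (q k)) / lnk k \<le> 1 - e"
        using q_bounds by eventually_elim (simp add: divide_le_eq del: of_nat_Suc)
      show "\<forall>\<^sub>F k in sequentially. (1 - e) - 1 / lnk k \<le> real (Suc (q k)) / lnk k"
        using q_bounds by eventually_elim (simp add: le_divide_eq left_diff_distrib del: of_nat_Suc)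
    qed
    have "(\<lambda>k. recip (q k) * B (q k) * (real (Suc (q k)) / lnk k)) \<longlonglongrightarrow> c * (1 - e)"
      by (intro tendsto_mult ratio filterlim_compose[OF B q_top])
    then have "\<forall>\<^sub>F k in sequentially. r < recip (q k) * B (q k) * (real (Suc (q k)) / lnk k)"
      using e by (intro order_tendstoD(1)) auto
    moreover note log_mean_bounded_imp_small[OF l C e(1)] q_bounds
    ultimately show "\<forall>\<^sub>F k in sequentially. r < log_mean u k"
    proof eventually_elim
      case (elim k)
      \<comment> \<open>By monotonicity it suffices that \<open>l (Suc k)\<close> is already below
        the threshold, which \<open>log_mean_bounded_imp_small\<close> provides.\<close>
      have "{i. exp (- real (Suc (q k))) \<le> x i} \<subseteq> {..k}"
      proof (intro subsetI, rule ccontr)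
        fix i assume i: "i \<in> {i. exp (- real (Suc (q k))) \<le> x i}" "i \<notin> {..k}"
        have "x i \<le> l i" by (rule x)
        also have "l i \<le> l (Suc k)" using l(1) i(2) by (auto simp: decseq_def)
        also have "\<dots> < exp (- ((1 - e) * lnk k))" using elim by blast
        also have "\<dots> \<le> exp (- real (Suc (q k)))" using elim by (simp del: of_nat_Suc)
        finally show False using i(1) by simp
      qed
      then have "B (q k) \<le> (\<Sum>i\<le>k. u i)" unfolding B_def using u by (intro sum_mono2) auto
      then have "B (q k) / lnk k \<le> log_mean u k" unfolding log_mean_def by (intro divide_right_mono) auto
      moreover have "recip (q k) * B (q k) * (real (Suc (q k)) / lnk k) = B (q k) / lnk k"
        by (simp del: of_nat_Suc)
      ultimately show ?case using elim by linarith
    qed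
  qed
qed

section \<open>Separating logarithmic means by \<open>DL\<^sub>2\<close>\<close>

text \<open>Averaging over the points \<open>K 2\<^sup>i\<close> makes the functionals asymptotically invariant under \<open>D\<^sub>2\<close>.\<close>

definition dyadic_mean :: "nat \<Rightarrow> nat \<Rightarrow> (nat \<Rightarrow>\<^sub>C real) \<Rightarrow> real"
  where "dyadic_mean K N a = (\<Sum>i\<le>N. apply_bcontfun a (K * 2 ^ i)) / real (Suc N)"

lemma dyadic_mean_add: "dyadic_mean K N (a + b) = dyadic_mean K N a + dyadic_mean K N b"
  by (simp add: dyadic_mean_def sum.distrib add_divide_distrib)

lemma dyadic_mean_scale: "dyadic_mean K N (r *\<^sub>R a) = r * dyadic_mean K N a"
  by (simp add: dyadic_mean_def sum_distrib_left)

lemma dyadic_mean_ge: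
  assumes "\<And>i. i \<le> N \<Longrightarrow> t \<le> apply_bcontfun a (K * 2 ^ i)"
  shows "t \<le> dyadic_mean K N a"
proof -
  have "(\<Sum>i\<le>N. t) \<le> (\<Sum>i\<le>N. apply_bcontfun a (K * 2 ^ i))" using assms by (intro sum_mono) auto
  then have "real (Suc N) * t \<le> (\<Sum>i\<le>N. apply_bcontfun a (K * 2 ^ i))" by simp
  then show ?thesis by (simp add: dyadic_mean_def le_divide_eq mult.commute del: of_nat_Suc)
qed

lemma dyadic_mean_le:
  assumes "\<And>i. i \<le> N \<Longrightarrow> apply_bcontfun a (K * 2 ^ i) \<le> t"
  shows "dyadic_mean K N a \<le> t"
proof -
  have "(\<Sum>i\<le>N. apply_bcontfun a (K * 2 ^ i)) \<le> (\<Sum>i\<le>N. t)" using assms by (intro sum_mono) auto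
  then have "(\<Sum>i\<le>N. apply_bcontfun a (K * 2 ^ i)) \<le> real (Suc N) * t" by simp
  then show ?thesis by (simp add: dyadic_mean_def divide_le_eq mult.commute del: of_nat_Suc)
qed

lemma dyadic_mean_abs_le: "\<bar>dyadic_mean K N a\<bar> \<le> norm a"
  using dyadic_mean_ge[of N "- norm a" a K] dyadic_mean_le[of N a K "norm a"] apply_bcontfun_le[of a]
  by (auto simp: abs_le_iff) (metis neg_le_iff_le minus_le_iff)

text \<open>\<open>D2\<close> shifts the chain \<open>K * 2 ^ i\<close> by one place, so the two
  sums differ by their end terms, at \<open>K div 2\<close> and at \<open>K * 2 ^ N\<close>.\<close>

lemma dyadic_mean_D2: "\<bar>dyadic_mean K N (D2 a) - dyadic_mean K N a\<bar> \<le> 2 * norm a / real (Suc N)"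
proof -
  have "(\<Sum>i\<le>N. apply_bcontfun (D2 a) (K * 2 ^ i)) = apply_bcontfun a (K div 2) + (\<Sum>i<N. apply_bcontfun a (K * 2 ^ i))"
    unfolding lessThan_Suc_atMost[symmetric] sum.lessThan_Suc_shift by (simp add: D2_apply mult.left_commute)
  moreover have "(\<Sum>i\<le>N. apply_bcontfun a (K * 2 ^ i)) = (\<Sum>i<N. apply_bcontfun a (K * 2 ^ i)) + apply_bcontfun a (K * 2 ^ N)"
    unfolding lessThan_Suc_atMost[symmetric] by simp
  ultimately have "dyadic_mean K N (D2 a) - dyadic_mean K N a =
      (apply_bcontfun a (K div 2) - apply_bcontfun a (K * 2 ^ N)) / real (Suc N)"
    unfolding dyadic_mean_def diff_divide_distrib[symmetric] by simp
  moreover have "\<bar>apply_bcontfun a (K div 2) - apply_bcontfun a (K * 2 ^ N)\<bar> \<le> 2 * norm a"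
    using apply_bcontfun_le[of a "K div 2"] apply_bcontfun_le[of a "K * 2 ^ N"] by linarith
  ultimately show ?thesis by (simp add: abs_divide divide_right_mono del: of_nat_Suc)
qed

text \<open>The means are points of a product of compact intervals, so a cluster point exists by
  Tychonoff's theorem. Every closed condition that holds eventually passes to it: linearity,
  positivity, the bounds by lower and upper limits, and invariance under \<open>D2\<close> up to any
  given error.\<close>

lemma DL2_cluster_point:
  fixes K :: "nat \<Rightarrow> nat" and H :: "'h::complex_hilbert itself"
  assumes K: "\<And>N. N \<le> K N"
  obtains \<omega> where "\<omega> \<in> DL2 H"
    "\<And>a S. closed S \<Longrightarrow> \<forall>\<^sub>F N in sequentially. dyadic_mean (K N) N a \<in> S \<Longrightarrow> blinfun_apply \<omega> a \<in> S"
proof -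
  define E where "E N = dyadic_mean (K N) N" for N
  define U where "U = PiE UNIV (\<lambda>a :: nat \<Rightarrow>\<^sub>C real. {- norm a .. norm a})"
  have "compactin (product_topology (\<lambda>_. euclidean) UNIV) U"
    unfolding U_def compactin_PiE by auto
  then have "compact U" by (simp add: euclidean_product_topology)
  moreover have "filtermap E sequentially \<noteq> bot" by (simp add: filtermap_bot_iff)
  moreover have "E N \<in> U" for N
    using dyadic_mean_abs_le[of "K N" N] by (auto simp: U_def E_def abs_le_iff minus_le_iff)
  ultimately obtain \<phi> where \<phi>: "\<phi> \<in> U" "inf (nhds \<phi>) (filtermap E sequentially) \<noteq> bot"
    unfolding compact_filter by (metis (mono_tags, lifting) eventually_filtermap eventually_sequentiallyI)
  have cluster: "\<phi> \<in> Q" if Q: "closed Q" "\<forall>\<^sub>F N in sequentially. E N \<in> Q" for Q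
  proof (rule ccontr)
    assume "\<phi> \<notin> Q"
    then have "\<forall>\<^sub>F f in nhds \<phi>. f \<in> - Q" using Q(1) by (intro eventually_nhds_in_open) (auto simp: open_Compl)
    moreover have "\<forall>\<^sub>F f in filtermap E sequentially. f \<in> Q" using Q(2) by (simp add: eventually_filtermap)
    ultimately have "\<forall>\<^sub>F f in inf (nhds \<phi>) (filtermap E sequentially). False"
      unfolding eventually_inf by (intro exI[of _ "\<lambda>f. f \<in> - Q"] exI[of _ "\<lambda>f. f \<in> Q"]) auto
    then show False using \<phi>(2) by (simp add: eventually_False)
  qed
  have val: "\<phi> a \<in> S" if "closed S" "\<forall>\<^sub>F N in sequentially. E N a \<in> S" for a S
  proof -
    have "closed {f :: (nat \<Rightarrow>\<^sub>C real) \<Rightarrow> real. f a \<in> S}"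
      using closed_vimage[OF that(1) continuous_on_product_coordinates[of a]] by (simp add: vimage_def)
    then have "\<phi> \<in> {f. f a \<in> S}" by (rule cluster) (use that(2) in simp)
    then show ?thesis by simp
  qed
  have add: "\<phi> (a + b) = \<phi> a + \<phi> b" for a b
  proof -
    have "closed {f :: (nat \<Rightarrow>\<^sub>C real) \<Rightarrow> real. f (a + b) = f a + f b}"
      by (intro closed_Collect_eq continuous_on_add continuous_on_product_coordinates)
    then have "\<phi> \<in> {f. f (a + b) = f a + f b}" by (rule cluster) (simp add: E_def dyadic_mean_add)
    then show ?thesis by simp
  qed
  have scale: "\<phi> (r *\<^sub>R a) = r *\<^sub>R \<phi> a" for r a
  proof -
    have "closed {f :: (nat \<Rightarrow>\<^sub>C real) \<Rightarrow> real. f (r *\<^sub>R a) = r * f a}"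
      by (intro closed_Collect_eq continuous_on_mult continuous_on_const continuous_on_product_coordinates)
    then have "\<phi> \<in> {f. f (r *\<^sub>R a) = r * f a}" by (rule cluster) (simp add: E_def dyadic_mean_scale)
    then show ?thesis by simp
  qed
  have "norm (\<phi> a) \<le> norm a * 1" for a using \<phi>(1) by (auto simp: U_def abs_le_iff minus_le_iff PiE_iff)
  then have bl: "bounded_linear \<phi>" using add scale by (intro bounded_linear_intro)
  define \<omega> where "\<omega> = Blinfun \<phi>"
  have \<omega>: "blinfun_apply \<omega> = \<phi>" unfolding \<omega>_def by (rule bounded_linear_Blinfun_apply[OF bl])
  \<comment> \<open>Since \<open>N \<le> K N\<close>, a property of all large indices holds along
    the entire chain \<open>K N * 2 ^ i\<close> once \<open>N\<close> is large.\<close>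
  have large: "\<forall>\<^sub>F N in sequentially. \<forall>i. P (K N * 2 ^ i)" if P: "\<forall>\<^sub>F k in sequentially. P k" for P
  proof -
    obtain n where n: "\<And>k. n \<le> k \<Longrightarrow> P k" using P unfolding eventually_sequentially by blast
    have "P (K N * 2 ^ i)" if "n \<le> N" for N i
    proof (rule n)
      have "n * 1 \<le> K N * 2 ^ i" using that K[of N] by (intro mult_le_mono) auto
      then show "n \<le> K N * 2 ^ i" by simp
    qed
    then show ?thesis unfolding eventually_sequentially by blast
  qed
  have "\<omega> \<in> DL2 H"
    unfolding DL2_def mem_Collect_eq \<omega>
  proof (intro conjI allI impI)
    fix a :: "nat \<Rightarrow>\<^sub>C real" assume "\<forall>i. 0 \<le> apply_bcontfun a i"
    then have "0 \<le> E N a" for N unfolding E_def by (intro dyadic_mean_ge) auto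
    then have "\<phi> a \<in> {0..}" by (intro val) auto
    then show "0 \<le> \<phi> a" by simp
  next
    have "E N (const_bcontfun 1) = 1" for N
      unfolding E_def by (intro antisym dyadic_mean_ge dyadic_mean_le) (auto simp: const_bcontfun.rep_eq)
    then have "\<phi> (const_bcontfun 1) \<in> {1}" by (intro val) auto
    then show "\<phi> (const_bcontfun 1) = 1" by simp
  next
    fix a :: "nat \<Rightarrow>\<^sub>C real"
    show "liminf (\<lambda>i. ereal (apply_bcontfun a i)) \<le> ereal (\<phi> a)"
    proof (rule dense_le)
      fix t assume t: "t < liminf (\<lambda>i. ereal (apply_bcontfun a i))"
      then have ev: "\<forall>\<^sub>F i in sequentially. t < ereal (apply_bcontfun a i)" by (rule less_LiminfD)
      show "t \<le> ereal (\<phi> a)"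
      proof (cases t)
        case (real s)
        from large[OF ev] have "\<forall>\<^sub>F N in sequentially. E N a \<in> {s..}"
        proof eventually_elim
          case (elim N)
          then show ?case unfolding E_def real by (simp add: dyadic_mean_ge less_imp_le)
        qed
        then have "\<phi> a \<in> {s..}" by (intro val) auto
        then show ?thesis by (simp add: real)
      next
        case PInf
        then show ?thesis using t by simp
      qed simp
    qed
  next
    fix a :: "nat \<Rightarrow>\<^sub>C real"
    show "ereal (\<phi> a) \<le> limsup (\<lambda>i. ereal (apply_bcontfun a i))"
    proof (rule dense_ge)
      fix t assume t: "limsup (\<lambda>i. ereal (apply_bcontfun a i)) < t"
      then have ev: "\<forall>\<^sub>F i in sequentially. ereal (apply_bcontfun a i) < t" by (rule Limsup_lessD)
      show "ereal (\<phi> a) \<le> t"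
      proof (cases t)
        case (real s)
        from large[OF ev] have "\<forall>\<^sub>F N in sequentially. E N a \<in> {..s}"
        proof eventually_elim
          case (elim N)
          then show ?case unfolding E_def real by (simp add: dyadic_mean_le less_imp_le)
        qed
        then have "\<phi> a \<in> {..s}" by (intro val) auto
        then show ?thesis by (simp add: real)
      next
        case MInf
        then show ?thesis using t by simp
      qed simp
    qed
  next
    fix T :: "'h \<Rightarrow> 'h"
    define a where "a = gamma T"
    have "(\<lambda>N. E N (D2 a - a)) \<longlonglongrightarrow> 0"
    proof (rule Lim_null_comparison)
      have "E N (D2 a - a) = E N (D2 a) - E N a" for N
        using dyadic_mean_add[of "K N" N "D2 a - a" a] by (simp add: E_def)
      then show "\<forall>\<^sub>F N in sequentially. norm (E N (D2 a - a)) \<le> 2 * norm a * recip N"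
        using dyadic_mean_D2[of "K _" _ a] by (auto simp: E_def)
      show "(\<lambda>N. 2 * norm a * recip N) \<longlonglongrightarrow> 0" using tendsto_mult[OF tendsto_const recip_lim, of "2 * norm a"] by simp
    qed
    then have small: "\<forall>\<^sub>F N in sequentially. E N (D2 a - a) \<in> {- \<epsilon>..\<epsilon>}" if "0 < \<epsilon>" for \<epsilon>
      using that by (auto simp: tendsto_iff dist_real_def elim!: allE[of _ \<epsilon>] eventually_mono)
    have "\<phi> (D2 a - a) \<in> {- \<epsilon>..\<epsilon>}" if "0 < \<epsilon>" for \<epsilon> by (intro val small that) auto
    then have "\<bar>\<phi> (D2 a - a)\<bar> \<le> 0 + \<epsilon>" if "0 < \<epsilon>" for \<epsilon> using that by (auto simp: abs_le_iff minus_le_iff)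
    then have "\<bar>\<phi> (D2 a - a)\<bar> \<le> 0" by (rule field_le_epsilon)
    then show "\<phi> (D2 (gamma T)) = \<phi> (gamma T)" using add[of "D2 a - a" a] by (simp add: a_def)
  qed
  moreover have "blinfun_apply \<omega> a \<in> S"
    if "closed S" "\<forall>\<^sub>F N in sequentially. dyadic_mean (K N) N a \<in> S" for a S
    unfolding \<omega> using val that by (simp add: E_def)
  ultimately show ?thesis by (rule that)
qed

text \<open>Logarithmic means vary slowly: partial sums increase, and from \<open>k\<close> to
  \<open>m\<close> the logarithm grows by at most \<open>real N * ln 2\<close>, which by the last
  hypothesis is at most the fraction 1/(N + 1) of ln (k + 2). The factor comes from (1 - x)(1 + x)
  \<le> 1.\<close>

lemma log_mean_factor_le:
  assumes u: "\<And>i. 0 \<le> u i" and "k \<le> m" "m + 2 \<le> 2 ^ N * (k + 2)" "real (Suc N) * (real N * ln 2) \<le> lnk k"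
  shows "log_mean u k * (1 - recip N) \<le> log_mean u m"
proof -
  have S: "(\<Sum>i\<le>k. u i) \<le> (\<Sum>i\<le>m. u i)" using assms by (intro sum_mono2) auto
  have "ln (real (m + 2)) \<le> ln (real (2 ^ N * (k + 2)))"
    using assms(3) by (subst ln_le_cancel_iff) (auto simp del: of_nat_mult of_nat_add of_nat_power)
  also have "\<dots> = real N * ln 2 + ln (real (k + 2))"
    unfolding of_nat_mult by (subst ln_mult) (auto simp: ln_realpow)
  finally have lm: "lnk m \<le> real N * ln 2 + lnk k" by simp
  have "real N * ln 2 \<le> recip N * lnk k" using assms(4) by (simp add: field_simps)
  then have "(1 - recip N) * lnk m \<le> (1 - recip N) * ((1 + recip N) * lnk k)"
    using lm by (intro mult_left_mono) (auto simp: algebra_simps)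
  also have "\<dots> = (1 - recip N * recip N) * lnk k"
  proof -
    have "(1 - x) * ((1 + x) * y) = (1 - x * x) * y" for x y :: real by (simp add: algebra_simps)
    then show ?thesis .
  qed
  also have "\<dots> \<le> 1 * lnk k" by (intro mult_right_mono) auto
  finally have "(\<Sum>i\<le>k. u i) * ((1 - recip N) * lnk m) \<le> (\<Sum>i\<le>m. u i) * lnk k"
    using S u by (intro mult_mono) (auto intro: sum_nonneg)
  moreover have "s / a * p \<le> t / b" if "0 < a" "0 < b" "s * (p * b) \<le> t * a" for s t p a b :: real
    using that by (simp add: field_simps)
  ultimately show ?thesis unfolding log_mean_def by simp
qed

lemma log_index_large: "\<exists>k0. \<forall>k\<ge>k0. real (Suc N) * (real N * ln 2) \<le> lnk k"
  using lnk_at_top unfolding filterlim_at_top eventually_sequentially by blast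

text \<open>If the means were at least some \<open>r > c\<close> at arbitrarily large indices,
  chains starting there would keep nearly that value by \<open>log_mean_factor_le\<close>, and their
  cluster functional would exceed \<open>c\<close>. For \<open>r < c\<close> the chains must end
  near the bad indices instead, since low values are inherited by smaller indices.\<close>

theorem log_mean_limit_if_DL2_constant:
  assumes u: "\<And>i. 0 \<le> u i" and C: "\<And>k. log_mean u k \<le> C" and c: "0 \<le> c"
    and eq: "\<And>\<omega>. \<omega> \<in> DL2 TYPE('h::complex_hilbert) \<Longrightarrow> blinfun_apply \<omega> (Bcontfun (log_mean u)) = c"
  shows "log_mean u \<longlonglongrightarrow> c"
proof (rule order_tendstoI)
  have lm0: "0 \<le> log_mean u k" for k unfolding log_mean_ge_iff using u by (simp add: sum_nonneg)
  have app: "apply_bcontfun (Bcontfun (log_mean u)) = log_mean u"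
    by (rule apply_Bcontfun_nat[of _ C]) (use lm0 C in auto)
  fix r assume r: "c < r"
  show "\<forall>\<^sub>F k in sequentially. log_mean u k < r"
  proof (rule ccontr)
    assume "\<not> ?thesis"
    then have freq: "\<exists>k\<ge>n. r \<le> log_mean u k" for n by (auto simp: eventually_sequentially not_less)
    \<comment> \<open>The starting index is so large that \<open>N\<close> doublings barely change
      the logarithm.\<close>
    have "\<exists>k\<ge>N. r \<le> log_mean u k \<and> real (Suc N) * (real N * ln 2) \<le> lnk k" for N
    proof -
      obtain k0 where k0: "\<And>k. k0 \<le> k \<Longrightarrow> real (Suc N) * (real N * ln 2) \<le> lnk k" using log_index_large by blast
      obtain k where "max N k0 \<le> k" "r \<le> log_mean u k" using freq by blast
      then show ?thesis using k0[of k] by auto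
    qed
    then obtain K where K: "\<And>N. N \<le> K N" "\<And>N. r \<le> log_mean u (K N)"
      "\<And>N. real (Suc N) * (real N * ln 2) \<le> lnk (K N)" by metis
    obtain \<omega> where w: "\<omega> \<in> DL2 TYPE('h)"
      "\<And>a S. closed S \<Longrightarrow> \<forall>\<^sub>F N in sequentially. dyadic_mean (K N) N a \<in> S \<Longrightarrow> blinfun_apply \<omega> a \<in> S"
      by (rule DL2_cluster_point[OF K(1), where H = "TYPE('h)"]) (rule that; assumption)
    define s where "s = (c + r) / 2"
    have s: "c < s" "s < r" using r by (auto simp: s_def)
    have ge: "r * (1 - recip N) \<le> dyadic_mean (K N) N (Bcontfun (log_mean u))" for N
    proof (rule dyadic_mean_ge)
      fix i assume i: "i \<le> N"
      have "r * (1 - recip N) \<le> log_mean u (K N) * (1 - recip N)" using K(2) by (intro mult_right_mono) auto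
      also have "\<dots> \<le> log_mean u (K N * 2 ^ i)"
      proof (rule log_mean_factor_le[OF u _ _ K(3)])
        have "K N * 2 ^ i + 2 * 1 \<le> K N * 2 ^ N + 2 * 2 ^ N"
          using i by (intro add_mono mult_le_mono power_increasing) auto
        then show "K N * 2 ^ i + 2 \<le> 2 ^ N * (K N + 2)" by (simp add: algebra_simps)
      qed auto
      finally show "r * (1 - recip N) \<le> apply_bcontfun (Bcontfun (log_mean u)) (K N * 2 ^ i)" by (simp add: app)
    qed
    have "(\<lambda>N. r * (1 - recip N)) \<longlonglongrightarrow> r * (1 - 0)" by (intro tendsto_intros recip_lim)
    then have "\<forall>\<^sub>F N in sequentially. s < r * (1 - recip N)" using s by (intro order_tendstoD(1)) auto
    then have "\<forall>\<^sub>F N in sequentially. dyadic_mean (K N) N (Bcontfun (log_mean u)) \<in> {s..}"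
    proof eventually_elim
      case (elim N)
      then show ?case using ge[of N] by simp
    qed
    then have "blinfun_apply \<omega> (Bcontfun (log_mean u)) \<in> {s..}" by (intro w(2)) auto
    then show False using eq[OF w(1)] s by simp
  qed
next
  have lm0: "0 \<le> log_mean u k" for k unfolding log_mean_ge_iff using u by (simp add: sum_nonneg)
  have app: "apply_bcontfun (Bcontfun (log_mean u)) = log_mean u"
    by (rule apply_Bcontfun_nat[of _ C]) (use lm0 C in auto)
  fix r assume r: "r < c"
  show "\<forall>\<^sub>F k in sequentially. r < log_mean u k"
  proof (rule ccontr)
    assume "\<not> ?thesis"
    then have freq: "\<exists>k\<ge>n. log_mean u k \<le> r" for n by (auto simp: eventually_sequentially not_less)
    \<comment> \<open>Starting at \<open>k div 2 ^ N\<close>, the chain ends after \<open>N\<close>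
      doublings at or just below the bad index \<open>k\<close>.\<close>
    have "\<exists>K\<ge>N. \<exists>k. log_mean u k \<le> r \<and> K = k div 2 ^ N \<and> real (Suc N) * (real N * ln 2) \<le> lnk K" for N
    proof -
      obtain k0 where k0: "\<And>k. k0 \<le> k \<Longrightarrow> real (Suc N) * (real N * ln 2) \<le> lnk k" using log_index_large by blast
      obtain k where k: "max N k0 * 2 ^ N \<le> k" "log_mean u k \<le> r" using freq by blast
      have "max N k0 \<le> k div 2 ^ N" using div_le_mono[OF k(1), of "2 ^ N"] by (metis div_mult_self_is_m zero_less_numeral zero_less_power)
      then show ?thesis using k0[of "k div 2 ^ N"] k(2) by auto
    qed
    then have "\<exists>K k. \<forall>N. N \<le> K N \<and> log_mean u (k N) \<le> r \<and> K N = k N div 2 ^ N \<and>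
        real (Suc N) * (real N * ln 2) \<le> lnk (K N)" by metis
    then obtain K k where K: "\<And>N. N \<le> K N" "\<And>N. log_mean u (k N) \<le> r" "\<And>N. K N = k N div 2 ^ N"
      "\<And>N. real (Suc N) * (real N * ln 2) \<le> lnk (K N)" by blast
    obtain \<omega> where w: "\<omega> \<in> DL2 TYPE('h)"
      "\<And>a S. closed S \<Longrightarrow> \<forall>\<^sub>F N in sequentially. dyadic_mean (K N) N a \<in> S \<Longrightarrow> blinfun_apply \<omega> a \<in> S"
      by (rule DL2_cluster_point[OF K(1), where H = "TYPE('h)"]) (rule that; assumption)
    have r0: "0 \<le> r" using lm0 K(2) by (rule order_trans)
    define s where "s = (c + r) / 2"
    have s: "r < s" "s < c" using r by (auto simp: s_def)
    have le: "dyadic_mean (K N) N (Bcontfun (log_mean u)) * (1 - recip N) \<le> r" for N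
    proof -
      have each: "log_mean u (K N * 2 ^ i) * (1 - recip N) \<le> r" if i: "i \<le> N" for i
      proof -
        have km: "K N * 2 ^ N \<le> k N" "k N < (K N + 1) * 2 ^ N"
          unfolding K(3) using dividend_less_div_times[of "2 ^ N" "k N"] div_times_less_eq_dividend[of "k N" "2 ^ N"]
          by (simp_all add: algebra_simps)
        have "K N * 2 ^ i \<le> K N * 2 ^ N" using i by (intro mult_le_mono power_increasing) auto
        then have le1: "K N * 2 ^ i \<le> k N" using km(1) by (rule order_trans)
        have "log_mean u (K N * 2 ^ i) * (1 - recip N) \<le> log_mean u (k N)"
        proof (rule log_mean_factor_le[OF u le1])
          have K1: "K N \<le> K N * 2 ^ i" by simp
          have "k N + 2 \<le> (K N + 1) * 2 ^ N + 1 * 2 ^ N"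
            using km(2) one_le_power[of "2::nat" N] by linarith
          also have "\<dots> = 2 ^ N * (K N + 2)" by (simp add: algebra_simps)
          also have "\<dots> \<le> 2 ^ N * (K N * 2 ^ i + 2)" using K1 by (intro mult_le_mono) auto
          finally show "k N + 2 \<le> 2 ^ N * (K N * 2 ^ i + 2)" .
          have "lnk (K N) \<le> lnk (K N * 2 ^ i)" using K1 by (subst ln_le_cancel_iff) (auto simp del: of_nat_mult)
          then show "real (Suc N) * (real N * ln 2) \<le> lnk (K N * 2 ^ i)" using K(4)[of N] by linarith
        qed
        then show ?thesis using K(2)[of N] by linarith
      qed
      have "dyadic_mean (K N) N ((1 - recip N) *\<^sub>R Bcontfun (log_mean u)) \<le> r"
        using each by (intro dyadic_mean_le) (simp add: app mult.commute)
      then show ?thesis by (simp add: dyadic_mean_scale mult.commute)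
    qed
    have "(\<lambda>N. s * (1 - recip N)) \<longlonglongrightarrow> s * (1 - 0)" by (intro tendsto_intros recip_lim)
    then have "\<forall>\<^sub>F N in sequentially. r < s * (1 - recip N)" using s by (intro order_tendstoD(1)) auto
    then have "\<forall>\<^sub>F N in sequentially. dyadic_mean (K N) N (Bcontfun (log_mean u)) \<in> {..s}"
    proof eventually_elim
      case (elim N)
      show ?case
      proof (rule ccontr)
        assume "\<not> ?case"
        then have "s * (1 - recip N) \<le> dyadic_mean (K N) N (Bcontfun (log_mean u)) * (1 - recip N)"
          by (intro mult_right_mono) auto
        then show False using le[of N] elim by linarith
      qed
    qed
    then have "blinfun_apply \<omega> (Bcontfun (log_mean u)) \<in> {..s}" by (intro w(2)) auto
    then show False using eq[OF w(1)] s by simp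
  qed
qed

section \<open>Diagonal operators\<close>

lemma bounded_clinear_eq_on_onb:
  assumes S: "bounded_clinear S" and T: "bounded_clinear T" and B: "is_onb B"
    and eq: "\<And>b. b \<in> B \<Longrightarrow> S b = T b"
  shows "S = T"
proof
  fix x
  have "closed {x. S x = T x}"
    using S T by (intro closed_Collect_eq linear_continuous_on bounded_clinear_bounded_linear)
  moreover have "cspan B \<subseteq> {x. S x = T x}"
    using eq by (intro complex_vector.span_minimal)
      (auto simp: complex_vector.subspace_def bounded_clinear_simps[OF S] bounded_clinear_simps[OF T])
  ultimately have "closure (cspan B) \<subseteq> {x. S x = T x}" by (simp add: closure_minimal)
  then show "S x = T x" using B unfolding is_onb_def by auto
qed

text \<open>By Bessel's inequality the squared coefficients are summable, and the squared norm of a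
  block of the series is at most \<open>K\<^sup>2\<close> times the corresponding block of
  squares.\<close>

lemma orthosys_expansion_summable:
  fixes f :: "nat \<Rightarrow> 'a::complex_hilbert"
  assumes f: "orthosys UNIV f" and c: "\<And>i. cmod (c i) \<le> K"
  shows "summable (\<lambda>i. (c i * cinner (f i) x) *\<^sub>C f i)"
proof -
  have K: "0 \<le> K" using c[of 0] norm_ge_zero order_trans by blast
  have sq: "summable (\<lambda>i. (cmod (cinner (f i) x))\<^sup>2)"
  proof (rule bounded_imp_summable)
    show "(\<Sum>i\<le>n. (cmod (cinner (f i) x))\<^sup>2) \<le> (norm x)\<^sup>2" for n
      by (rule bessel[OF orthosys_subset[OF f]]) auto
  qed simp
  define s where "s n = (\<Sum>i<n. (c i * cinner (f i) x) *\<^sub>C f i)" for n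
  define q where "q n = (\<Sum>i<n. (cmod (cinner (f i) x))\<^sup>2)" for n
  have diff: "(norm (s n - s m))\<^sup>2 \<le> K\<^sup>2 * (q n - q m)" if "m \<le> n" for m n
  proof -
    have "s n - s m = (\<Sum>i\<in>{m..<n}. (c i * cinner (f i) x) *\<^sub>C f i)"
      using that by (simp add: s_def sum_diff_nat_ivl atLeast0LessThan[symmetric])
    then have "(norm (s n - s m))\<^sup>2 = (\<Sum>i\<in>{m..<n}. if f i = 0 then 0 else (cmod (c i * cinner (f i) x))\<^sup>2)"
      by (simp only: orthosys_norm_sum[OF orthosys_subset[OF f] finite_atLeastLessThan] subset_UNIV)
    also have "\<dots> \<le> (\<Sum>i\<in>{m..<n}. K\<^sup>2 * (cmod (cinner (f i) x))\<^sup>2)"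
      using c by (intro sum_mono) (auto simp: norm_mult power_mult_distrib intro!: mult_right_mono power_mono)
    also have "\<dots> = K\<^sup>2 * (q n - q m)"
      using that by (simp add: q_def sum_diff_nat_ivl atLeast0LessThan[symmetric] sum_distrib_left)
    finally show ?thesis .
  qed
  have "Cauchy q"
    using sq unfolding q_def summable_iff_convergent by (rule convergent_Cauchy)
  have "Cauchy s"
  proof (rule metric_CauchyI)
    fix e :: real assume e: "0 < e"
    then have "0 < e\<^sup>2 / (K\<^sup>2 + 1)" by (simp add: add_nonneg_pos)
    then obtain M where M: "\<And>m n. M \<le> m \<Longrightarrow> M \<le> n \<Longrightarrow> dist (q m) (q n) < e\<^sup>2 / (K\<^sup>2 + 1)"
      using \<open>Cauchy q\<close> unfolding Cauchy_def by metis
    have key: "dist (s m) (s n) < e" if "M \<le> m" "m \<le> n" for m n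
    proof -
      have "(norm (s n - s m))\<^sup>2 \<le> K\<^sup>2 * \<bar>q n - q m\<bar>"
        using diff[OF that(2)] by (meson abs_ge_self mult_left_mono order_trans zero_le_power2)
      also have "\<dots> \<le> (K\<^sup>2 + 1) * \<bar>q n - q m\<bar>" by (intro mult_right_mono) auto
      also have "\<dots> < (K\<^sup>2 + 1) * (e\<^sup>2 / (K\<^sup>2 + 1))"
        using M[of n m] that by (intro mult_strict_left_mono) (auto simp: dist_real_def add_nonneg_pos)
      also have "\<dots> = e\<^sup>2" using zero_le_power2[of K] by (simp add: add_nonneg_eq_0_iff)
      finally have "norm (s n - s m) < e" using e by (simp add: power_less_imp_less_base)
      then show ?thesis by (simp add: dist_norm norm_minus_commute)
    qed
    have "dist (s m) (s n) < e" if "M \<le> m" "M \<le> n" for m n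
      using key[of m n] key[of n m] that by (cases "m \<le> n") (auto simp: dist_commute)
    then show "\<exists>M. \<forall>m\<ge>M. \<forall>n\<ge>M. dist (s m) (s n) < e" by blast
  qed
  then show ?thesis unfolding summable_iff_convergent s_def by (rule Cauchy_convergent)
qed

definition diag_op :: "(nat \<Rightarrow> complex) \<Rightarrow> (nat \<Rightarrow> 'a::complex_hilbert) \<Rightarrow> 'a \<Rightarrow> 'a"
  where "diag_op c f x = (\<Sum>i. (c i * cinner (f i) x) *\<^sub>C f i)"

lemma diag_op_sums:
  assumes f: "orthosys UNIV f" and c: "\<And>i. cmod (c i) \<le> K"
  shows "(\<lambda>i. (c i * cinner (f i) x) *\<^sub>C f i) sums diag_op c f x"
  unfolding diag_op_def by (rule summable_sums[OF orthosys_expansion_summable[OF f c]])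

lemma diag_op_bounded:
  assumes f: "orthosys UNIV f" and c: "\<And>i. cmod (c i) \<le> K"
  shows "bounded_clinear (diag_op c f)"
proof (rule bounded_clinearI)
  note s = diag_op_sums[OF f, of c K, OF c]
  fix x y and a :: complex
  have "(\<lambda>i. (c i * cinner (f i) x) *\<^sub>C f i + (c i * cinner (f i) y) *\<^sub>C f i) sums (diag_op c f x + diag_op c f y)"
    by (rule sums_add[OF s s])
  then have "(\<lambda>i. (c i * cinner (f i) (x + y)) *\<^sub>C f i) sums (diag_op c f x + diag_op c f y)"
    by (simp add: cinner_add_right distrib_left scaleC_add_left)
  then show "diag_op c f (x + y) = diag_op c f x + diag_op c f y" by (rule sums_unique2[OF s])
  have "(\<lambda>i. a *\<^sub>C ((c i * cinner (f i) x) *\<^sub>C f i)) sums (a *\<^sub>C diag_op c f x)"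
    using s[of x] by (rule bounded_linear.sums[OF bounded_bilinear.bounded_linear_right[OF bounded_bilinear_scaleC]])
  then have "(\<lambda>i. (c i * cinner (f i) (a *\<^sub>C x)) *\<^sub>C f i) sums (a *\<^sub>C diag_op c f x)"
    by (simp add: cinner_scaleC_right scaleC_scaleC mult.left_commute)
  then show "diag_op c f (a *\<^sub>C x) = a *\<^sub>C diag_op c f x" by (rule sums_unique2[OF s])
  have K: "0 \<le> K" using c[of 0] norm_ge_zero order_trans by blast
  have "norm (\<Sum>i<n. (c i * cinner (f i) x) *\<^sub>C f i) \<le> K * norm x" for n
  proof (rule power2_le_imp_le)
    have "(norm (\<Sum>i<n. (c i * cinner (f i) x) *\<^sub>C f i))\<^sup>2 =
        (\<Sum>i<n. if f i = 0 then 0 else (cmod (c i * cinner (f i) x))\<^sup>2)"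
      by (rule orthosys_norm_sum[OF orthosys_subset[OF f]]) auto
    also have "\<dots> \<le> (\<Sum>i<n. K\<^sup>2 * (cmod (cinner (f i) x))\<^sup>2)"
      using c by (intro sum_mono) (auto simp: norm_mult power_mult_distrib intro!: mult_right_mono power_mono)
    also have "\<dots> \<le> K\<^sup>2 * (norm x)\<^sup>2"
      unfolding sum_distrib_left[symmetric] by (intro mult_left_mono bessel[OF orthosys_subset[OF f]]) auto
    finally show "(norm (\<Sum>i<n. (c i * cinner (f i) x) *\<^sub>C f i))\<^sup>2 \<le> (K * norm x)\<^sup>2"
      by (simp add: power_mult_distrib)
  qed (use K in auto)
  then show "norm (diag_op c f x) \<le> K * norm x"
    using tendsto_norm[OF s[of x, unfolded sums_def]] by (intro LIMSEQ_le_const2) auto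
qed

lemma cinner_diag_op_sums:
  assumes f: "orthosys UNIV f" and c: "\<And>i. cmod (c i) \<le> K"
  shows "(\<lambda>i. c i * cinner (f i) x * cinner z (f i)) sums cinner z (diag_op c f x)"
  using bounded_linear.sums[OF bounded_linear_cinner_right diag_op_sums[OF f, of c K, OF c], of z x]
  by (simp add: cinner_scaleC_right)

lemma cinner_diag_op:
  assumes f: "orthosys UNIV f" and c: "\<And>i. cmod (c i) \<le> K"
  shows "cinner (f j) (diag_op c f x) = c j * cinner (f j) x"
proof -
  have "(\<lambda>i. c i * cinner (f i) x * cinner (f j) (f i)) sums cinner (f j) (diag_op c f x)"
    by (rule cinner_diag_op_sums[OF f, of c K, OF c])
  moreover have "(\<lambda>i. c i * cinner (f i) x * cinner (f j) (f i)) = (\<lambda>i. if i = j then c j * cinner (f j) x else 0)"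
    using f by (auto simp: orthosys_def fun_eq_iff)
  ultimately show ?thesis using sums_unique2[OF _ sums_single[of j "\<lambda>_. c j * cinner (f j) x"]] by simp
qed

lemma diag_op_eq_scaled:
  assumes f: "orthosys UNIV f" and c: "\<And>i. cmod (c i) \<le> K"
    and x: "\<And>i. f i \<noteq> 0 \<Longrightarrow> cinner (f i) x \<noteq> 0 \<Longrightarrow> c i = a"
    and tot: "x = diag_op (\<lambda>_. 1) f x"
  shows "diag_op c f x = a *\<^sub>C x"
proof -
  have "(c i * cinner (f i) x) *\<^sub>C f i = a *\<^sub>C ((1 * cinner (f i) x) *\<^sub>C f i)" for i
    using x[of i] by (cases "f i = 0 \<or> cinner (f i) x = 0") (auto simp: scaleC_scaleC)
  then have "diag_op c f x = (\<Sum>i. a *\<^sub>C ((1 * cinner (f i) x) *\<^sub>C f i))"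
    unfolding diag_op_def by (simp only:)
  also have "\<dots> = a *\<^sub>C diag_op (\<lambda>_. 1) f x"
    using bounded_linear.sums[OF bounded_bilinear.bounded_linear_right[OF bounded_bilinear_scaleC]
        diag_op_sums[OF f, of "\<lambda>_. 1" 1 x], of a]
    by (simp add: sums_iff)
  finally show ?thesis using tot by simp
qed

text \<open>Turns a basis indexed by a set of naturals, possibly finite, into a sequence;
  \<open>orthosys\<close> tolerates the zero vectors.\<close>

definition extend_zero :: "nat set \<Rightarrow> (nat \<Rightarrow> 'a::complex_hilbert) \<Rightarrow> nat \<Rightarrow> 'a"
  where "extend_zero I h m = (if m \<in> I then h m else 0)"

lemma onb_orthosys:
  fixes h :: "nat \<Rightarrow> 'a::complex_hilbert"
  assumes "inj_on h I" "is_onb (h ` I)"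
  shows "orthosys I h" "orthosys UNIV (extend_zero I h)"
proof -
  have 1: "norm (h m) = 1" if "m \<in> I" for m using assms(2) that by (auto simp: is_onb_def)
  have 2: "cinner (h m) (h n) = 0" if "m \<in> I" "n \<in> I" "m \<noteq> n" for m n
  proof -
    have "h m \<noteq> h n" using assms(1) that by (auto dest: inj_onD)
    then show ?thesis using assms(2) that by (simp add: is_onb_def)
  qed
  show "orthosys I h" by (rule orthosysI) (use 1 2 in auto)
  show "orthosys UNIV (extend_zero I h)" by (rule orthosysI) (use 1 2 in \<open>auto simp: extend_zero_def\<close>)
qed

lemma onb_expansion:
  fixes h :: "nat \<Rightarrow> 'a::complex_hilbert"
  assumes h: "inj_on h I" "is_onb (h ` I)"
  shows "x = diag_op (\<lambda>_. 1) (extend_zero I h) x"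
proof -
  define d where "d = diag_op (\<lambda>_. 1) (extend_zero I h) x - x"
  have "cinner b d = 0" if b: "b \<in> h ` I" for b
  proof -
    obtain m where m: "m \<in> I" "b = h m" using b by blast
    have "cinner (extend_zero I h m) (diag_op (\<lambda>_. 1) (extend_zero I h) x) = 1 * cinner (extend_zero I h m) x"
      by (rule cinner_diag_op[OF onb_orthosys(2)[OF h], of _ 1]) simp
    then show ?thesis using m by (simp add: d_def cinner_diff_right extend_zero_def)
  qed
  then have "d = 0" by (rule onb_total[OF h(2)])
  then show ?thesis by (simp add: d_def)
qed

text \<open>Resolves the description in \<open>eigen_calculus\<close>. The diagonal operator
  satisfies it because, by symmetry of \<open>D\<close>, an eigenvector is orthogonal to all
  \<open>h m\<close> with another eigenvalue. Uniqueness holds because the basis vectors are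
  themselves eigenvectors in the domain.\<close>

lemma eigen_calculus_diag:
  fixes h :: "nat \<Rightarrow> 'a::complex_hilbert"
  assumes h: "inj_on h I" "is_onb (h ` I)"
    and dom: "\<And>m. m \<in> I \<Longrightarrow> h m \<in> domD" "\<And>m. m \<in> I \<Longrightarrow> D (h m) = of_real (ev m) *\<^sub>C h m"
    and sym: "\<And>x y. x \<in> domD \<Longrightarrow> y \<in> domD \<Longrightarrow> cinner (D x) y = cinner x (D y)"
    and G: "\<And>m. m \<in> I \<Longrightarrow> \<bar>G (ev m)\<bar> \<le> K"
  shows "bounded_clinear (eigen_calculus domD D G)"
    "\<And>t x. x \<in> domD \<Longrightarrow> D x = of_real t *\<^sub>C x \<Longrightarrow> eigen_calculus domD D G x = of_real (G t) *\<^sub>C x"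
proof -
  define f where "f = extend_zero I h"
  define c where "c m = (if m \<in> I then complex_of_real (G (ev m)) else 0)" for m
  have f: "orthosys UNIV f" unfolding f_def by (rule onb_orthosys(2)[OF h])
  have c: "cmod (c m) \<le> \<bar>K\<bar>" for m using G[of m] by (auto simp: c_def)
  define P where "P T \<longleftrightarrow> bounded_clinear T \<and>
    (\<forall>t. \<forall>x\<in>domD. D x = complex_of_real t *\<^sub>C x \<longrightarrow> T x = complex_of_real (G t) *\<^sub>C x)" for T
  have "P (diag_op c f)"
    unfolding P_def
  proof (intro conjI allI ballI impI diag_op_bounded[OF f c])
    fix t x assume x: "x \<in> domD" "D x = complex_of_real t *\<^sub>C x"
    show "diag_op c f x = complex_of_real (G t) *\<^sub>C x"
    proof (rule diag_op_eq_scaled[OF f c])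
      show "x = diag_op (\<lambda>_. 1) f x" unfolding f_def by (rule onb_expansion[OF h])
      fix m assume m: "f m \<noteq> 0" "cinner (f m) x \<noteq> 0"
      then have mI: "m \<in> I" "f m = h m" by (auto simp: f_def extend_zero_def split: if_splits)
      have "of_real (ev m) * cinner (h m) x = of_real t * cinner (h m) x"
        using sym[OF dom(1)[OF mI(1)] x(1)] by (simp add: dom(2)[OF mI(1)] x(2) cinner_scaleC_left cinner_scaleC_right)
      then have "ev m = t" using m(2) mI(2) by simp
      then show "c m = complex_of_real (G t)" using mI by (simp add: c_def)
    qed
  qed
  moreover have "T = diag_op c f" if "P T" for T
  proof (rule bounded_clinear_eq_on_onb[OF _ diag_op_bounded[OF f c] h(2)])
    show "bounded_clinear T" using that by (simp add: P_def)
    fix b assume "b \<in> h ` I"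
    then obtain m where m: "m \<in> I" "b = h m" by blast
    then show "T b = diag_op c f b" using that \<open>P (diag_op c f)\<close> dom unfolding P_def by metis
  qed
  ultimately have "P (THE T. P T)" by (rule theI)
  moreover have "eigen_calculus domD D G = (THE T. P T)" by (simp add: eigen_calculus_def P_def)
  ultimately have P: "P (eigen_calculus domD D G)" by simp
  show "bounded_clinear (eigen_calculus domD D G)" using P by (simp add: P_def)
  show "\<And>t x. x \<in> domD \<Longrightarrow> D x = of_real t *\<^sub>C x \<Longrightarrow> eigen_calculus domD D G x = of_real (G t) *\<^sub>C x"
    using P by (simp add: P_def)
qed

text \<open>Domination concerns the given basis, whereas \<open>positive_eig_system\<close> produces
  unrelated eigenvectors. For every \<open>t > 0\<close> both families span the same
  finite-dimensional eigenspace, so their indices can be matched by a bijection \<open>p t\<close>;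
  zero singular values get the zero vector.\<close>

lemma sorted_eigenvectors:
  fixes h :: "nat \<Rightarrow> 'a::complex_hilbert"
  assumes A: "positive_op A" "compact_op A" and h: "inj_on h I" "is_onb (h ` I)"
    and eig: "\<And>m. m \<in> I \<Longrightarrow> A (h m) = of_real (g m) *\<^sub>C h m"
  obtains f where "eig_vectors A f" "\<And>i. f i = 0 \<or> f i \<in> h ` I"
    "\<And>m. m \<in> I \<Longrightarrow> 0 < g m \<Longrightarrow> h m \<in> range f"
proof -
  obtain e where E: "eig_system A (sing_val A) e" using positive_eig_system[OF A] by blast
  define s where "s = sing_val A"
  define K L where "K t = {m\<in>I. g m = t}" and "L t = {i. s i = t}" for t
  have hI: "orthosys I h" by (rule onb_orthosys(1)[OF h])
  have h1: "h m \<noteq> 0" if "m \<in> I" for m using h(2) that by (auto simp: is_onb_def)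
  have same: "finite (L t) \<and> finite (K t) \<and> card (L t) = card (K t)" if t: "0 < t" for t
  proof -
    have KI: "K t \<subseteq> I" by (auto simp: K_def)
    have orth: "orthosys (K t) h" by (rule orthosys_subset[OF hI KI])
    have inj: "inj_on h (K t)" by (rule inj_on_subset[OF h(1) KI])
    have ind: "complex_vector.independent (h ` K t)"
      using orthosys_independent[OF orth inj] h1 KI by (auto simp: image_iff)
    have finL: "finite (L t)"
      using eig_system_finite_ge[OF E t] by (rule finite_subset[rotated]) (auto simp: L_def s_def)
    have sub: "h ` K t \<subseteq> {x. A x = of_real t *\<^sub>C x}" using eig by (auto simp: K_def)
    then have "h ` K t \<subseteq> cspan (e ` L t)"
      unfolding eig_system_eigenspace_span[OF A(1) E t] L_def s_def .
    then have "finite (h ` K t)"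
      using complex_vector.independent_span_bound[OF finite_imageI[OF finL] ind] by blast
    then have finK: "finite (K t)" using inj by (rule finite_imageD)
    have "{x. A x = of_real t *\<^sub>C x} = cspan (h ` K t)"
    proof (intro equalityI subsetI)
      fix x assume "x \<in> cspan (h ` K t)"
      moreover have "cspan (h ` K t) \<subseteq> {x. A x = of_real t *\<^sub>C x}"
        using sub by (rule complex_vector.span_minimal)
          (auto simp: complex_vector.subspace_def bounded_clinear_simps[OF positive_op_bounded[OF A(1)]]
            scaleC_add_right scaleC_scaleC mult.commute)
      ultimately show "x \<in> {x. A x = of_real t *\<^sub>C x}" by blast
    next
      fix x assume "x \<in> {x. A x = of_real t *\<^sub>C x}"
      then have x: "A x = of_real t *\<^sub>C x" by simp
      obtain r where r: "x = (\<Sum>j\<in>K t. cinner (h j) x *\<^sub>C h j) + r" "\<And>i. i \<in> K t \<Longrightarrow> cinner (h i) r = 0"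
        "(norm x)\<^sup>2 = (\<Sum>j\<in>K t. (cmod (cinner (h j) x))\<^sup>2) + (norm r)\<^sup>2"
        by (rule orthosys_decomp[OF orth finK, of x]) (rule that; assumption)
      \<comment> \<open>Basis vectors with other eigenvalues are orthogonal to \<open>x\<close> and
        to its expansion, those in \<open>K t\<close> to the remainder; totality of the basis then
        gives \<open>r = 0\<close>.\<close>
      have "cinner b r = 0" if b: "b \<in> h ` I" for b
      proof -
        obtain m where m: "m \<in> I" "b = h m" using b by blast
        show ?thesis
        proof (cases "m \<in> K t")
          case False
          have "of_real (g m) * cinner (h m) x = of_real t * cinner (h m) x"
            using positive_op_symmetric[OF A(1), of "h m" x] eig[OF m(1)]
            by (simp add: x cinner_scaleC_left cinner_scaleC_right)
          then have "cinner (h m) x = 0" using False m(1) by (auto simp: K_def)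
          moreover have "cinner (h m) (\<Sum>j\<in>K t. cinner (h j) x *\<^sub>C h j) = 0"
            unfolding cinner_sum_right cinner_scaleC_right
            using orthosys_orthogonal[OF hI m(1)] False KI by (intro sum.neutral) auto
          ultimately show ?thesis using m(2) by (subst (asm) r(1)) (simp add: cinner_add_right)
        qed (use r(2) m(2) in simp)
      qed
      then have "r = 0" by (rule onb_total[OF h(2)])
      then have "(\<Sum>j\<in>K t. cinner (h j) x *\<^sub>C h j) = x" using r(1) by simp
      moreover have "(\<Sum>j\<in>K t. cinner (h j) x *\<^sub>C h j) \<in> cspan (h ` K t)"
        by (intro complex_vector.span_sum complex_vector.span_scale complex_vector.span_base imageI)
      ultimately show "x \<in> cspan (h ` K t)" by simp
    qed
    then have "card (L t) = card (K t)"
      using eig_system_eigenspace[OF A(1) E t] ind inj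
      by (simp add: L_def s_def complex_vector.dim_eq_card_independent card_image)
    then show ?thesis using finL finK by blast
  qed
  have "\<exists>p. bij_betw p (L t) (K t)" if "0 < t" for t
    using same[OF that] by (intro finite_same_card_bij) auto
  then obtain p where p: "\<And>t. 0 < t \<Longrightarrow> bij_betw (p t) (L t) (K t)" by metis
  define f where "f i = (if 0 < s i then h (p (s i) i) else 0)" for i
  have pK: "p (s i) i \<in> K (s i)" if "0 < s i" for i
    using bij_betwE[OF p[OF that]] by (auto simp: L_def)
  have nn: "0 \<le> s i" for i unfolding s_def by (rule eig_systemD(4)[OF E])
  show ?thesis
  proof (rule that[of f])
    show "f i = 0 \<or> f i \<in> h ` I" for i using pK[of i] by (auto simp: f_def K_def)
    show "h m \<in> range f" if m: "m \<in> I" "0 < g m" for m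
    proof -
      have "m \<in> p (g m) ` L (g m)" using p[OF m(2)] m(1) by (auto simp: bij_betw_def K_def)
      then obtain i where "s i = g m" "m = p (g m) i" by (auto simp: L_def)
      then have "f i = h m" using m(2) by (simp add: f_def)
      then show ?thesis by (metis rangeI)
    qed
    show "eig_vectors A f"
      unfolding eig_vectors_def
    proof (intro conjI allI impI)
      show "orthosys UNIV f"
      proof (rule orthosysI)
        fix i show "norm (f i) = 1 \<or> f i = 0" using pK[of i] h(2) by (auto simp: f_def K_def is_onb_def)
      next
        fix i j :: nat assume ij: "i \<noteq> j"
        show "cinner (f i) (f j) = 0"
        proof (cases "0 < s i \<and> 0 < s j")
          case True
          then have K: "p (s i) i \<in> K (s i)" "p (s j) j \<in> K (s j)" using pK by auto
          have "p (s i) i \<noteq> p (s j) j"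
          proof
            assume eq: "p (s i) i = p (s j) j"
            then have "s i = s j" using K by (auto simp: K_def)
            then show False using eq ij p[of "s i"] True by (auto simp: bij_betw_def inj_on_def L_def)
          qed
          then show ?thesis using True K orthosys_orthogonal[OF hI] by (auto simp: f_def K_def)
        qed (auto simp: f_def)
      qed
      fix i
      show "A (f i) = of_real (sing_val A i) *\<^sub>C f i"
        using pK[of i] eig bounded_clinear_zero[OF positive_op_bounded[OF A(1)]] by (auto simp: f_def K_def s_def)
      show "sing_val A i = 0" if "f i = 0"
        using that pK[of i] h1 nn[of i] by (force simp: f_def K_def s_def split: if_splits)
    qed
  qed
qed

section \<open>The trace of a diagonal operator composed with a bounded one\<close>

lemma onb_orthosys_set: "is_onb B \<Longrightarrow> orthosys B (\<lambda>b. b)"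
  by (rule orthosysI) (auto simp: is_onb_def)

text \<open>Some finite combination \<open>p\<close> of basis vectors approximates \<open>y\<close>,
  and for each finite \<open>Y\<close> containing its support the Fourier sum over \<open>Y\<close>
  is at least as close. The basis is an arbitrary set, as required for the chosen basis in
  \<open>trace_op\<close>.\<close>

lemma parseval_onb:
  assumes B: "is_onb B"
  shows "((\<lambda>b. cinner x b * cinner b y) has_sum cinner x y) B"
  unfolding has_sum_def tendsto_iff eventually_finite_subsets_at_top
proof (intro allI impI)
  fix e :: real assume e: "0 < e"
  have orth: "orthosys B (\<lambda>b. b)" by (rule onb_orthosys_set[OF B])
  define \<delta> where "\<delta> = e / (norm x + 1)"
  have \<delta>: "0 < \<delta>" using e by (simp add: \<delta>_def add_nonneg_pos)
  have "y \<in> closure (cspan B)" using B by (simp add: is_onb_def)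
  then obtain p where p: "p \<in> cspan B" "dist p y < \<delta>" using \<delta> unfolding closure_approachable by blast
  then obtain t u where t: "finite t" "t \<subseteq> B" "p = (\<Sum>b\<in>t. u b *\<^sub>C b)"
    unfolding complex_vector.span_explicit by blast
  have "dist (\<Sum>b\<in>Y. cinner x b * cinner b y) (cinner x y) < e" if Y: "finite Y" "t \<subseteq> Y" "Y \<subseteq> B" for Y
  proof -
    have oY: "orthosys Y (\<lambda>b. b)" by (rule orthosys_subset[OF orth Y(3)])
    define s where "s = (\<Sum>b\<in>Y. cinner b y *\<^sub>C b)"
    have "b \<in> (\<lambda>b. b) ` Y" if "b \<in> t" for b using that Y(2) by auto
    then have pY: "p \<in> cspan ((\<lambda>b. b) ` Y)"
      unfolding t(3) by (intro complex_vector.span_sum complex_vector.span_scale complex_vector.span_base)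
    have p_exp: "p = (\<Sum>b\<in>Y. cinner b p *\<^sub>C b)" by (rule orthosys_span[OF oY Y(1) pY])
    have orth_r: "cinner b (y - s) = 0" if "b \<in> Y" for b
      using orthosys_cinner_sum[OF oY Y(1) that, of y] by (simp add: s_def cinner_diff_right)
    have "cinner (s - p) (y - s) = 0"
      unfolding cinner_diff_left
      by (subst p_exp, subst s_def) (simp add: cinner_sum_left cinner_scaleC_left orth_r)
    then have "(norm ((s - p) + (y - s)))\<^sup>2 = (norm (s - p))\<^sup>2 + (norm (y - s))\<^sup>2"
      by (rule norm_add_sq_orthogonal)
    then have "(norm (y - s))\<^sup>2 \<le> (norm (y - p))\<^sup>2" by simp
    then have le: "norm (y - s) \<le> norm (y - p)" by (rule power2_le_imp_le) simp
    have "cinner x s = (\<Sum>b\<in>Y. cinner x b * cinner b y)"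
      by (simp add: s_def cinner_sum_right cinner_scaleC_right mult.commute)
    then have "dist (\<Sum>b\<in>Y. cinner x b * cinner b y) (cinner x y) = cmod (cinner x (y - s))"
      by (simp add: dist_norm cinner_diff_right norm_minus_commute)
    also have "\<dots> \<le> norm x * norm (y - p)"
      by (rule order_trans[OF cinner_cauchy_schwarz]) (intro mult_left_mono le norm_ge_zero)
    also have "\<dots> \<le> norm x * \<delta>" using p(2) by (intro mult_left_mono) (auto simp: dist_norm norm_minus_commute)
    also have "\<dots> < (norm x + 1) * \<delta>" using \<delta> by simp
    also have "\<dots> = e"
    proof -
      have "norm x + 1 \<noteq> 0" using norm_ge_zero[of x] by linarith
      then show ?thesis by (simp add: \<delta>_def)
    qed
    finally show ?thesis .
  qed
  then show "\<exists>X. finite X \<and> X \<subseteq> B \<and>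
      (\<forall>Y. finite Y \<and> X \<subseteq> Y \<and> Y \<subseteq> B \<longrightarrow> dist (\<Sum>b\<in>Y. cinner x b * cinner b y) (cinner x y) < e)"
    using t by blast
qed

text \<open>The basis in \<open>trace_op\<close> is a chosen one, unrelated to \<open>f\<close>. The
  double family over basis elements and indices is absolutely summable by Cauchy-Schwarz and Bessel,
  so the sums may be interchanged, and Parseval's identity evaluates the sum over the basis.\<close>

lemma trace_op_compose_diag:
  fixes T :: "'a::complex_hilbert \<Rightarrow> 'a"
  assumes onb: "\<exists>B :: 'a set. is_onb B" and T: "bounded_clinear T"
    and f: "orthosys UNIV f" and c: "summable (\<lambda>i. cmod (c i))"
  shows "trace_op (T \<circ> diag_op c f) = (\<Sum>i. c i * cinner (f i) (T (f i)))"
proof -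
  define B where "B = (SOME B :: 'a set. is_onb B)"
  have B: "is_onb B" unfolding B_def by (rule someI_ex[OF onb])
  obtain K where K: "0 < K" "\<And>x. norm (T x) \<le> K * norm x" using bounded_clinear_bound[OF T] by blast
  have Tf: "norm (T (f i)) \<le> K" for i
    using K(2)[of "f i"] orthosys_norm_le[OF f, of i] K(1) by (simp add: mult_left_le order_trans)
  have cK: "cmod (c i) \<le> (\<Sum>i. cmod (c i))" for i
    using sum_le_suminf[OF c, of "{i}"] by simp
  define F where "F i b = c i * cinner (f i) b * cinner b (T (f i))" for i b
  have finite_CS: "(\<Sum>b\<in>Q. cmod (cinner z b) * cmod (cinner b y)) \<le> norm z * norm y"
    if Q: "finite Q" "Q \<subseteq> B" for Q z y
  proof -
    have oQ: "orthosys Q (\<lambda>b. b)" by (rule orthosys_subset[OF onb_orthosys_set[OF B] Q(2)])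
    have L: "L2_set (\<lambda>b. cmod (cinner b v)) Q \<le> norm v" for v
      unfolding L2_set_def using bessel[OF oQ Q(1), of v] by (intro real_le_lsqrt) auto
    have "(\<Sum>b\<in>Q. cmod (cinner z b) * cmod (cinner b y)) = (\<Sum>b\<in>Q. \<bar>cmod (cinner b z)\<bar> * \<bar>cmod (cinner b y)\<bar>)"
      by (intro sum.cong refl) (metis abs_norm_cancel cinner_commute complex_mod_cnj)
    also have "\<dots> \<le> L2_set (\<lambda>b. cmod (cinner b z)) Q * L2_set (\<lambda>b. cmod (cinner b y)) Q"
      by (rule L2_set_mult_ineq)
    also have "\<dots> \<le> norm z * norm y" by (intro mult_mono L) auto
    finally show ?thesis .
  qed
  have abs: "(\<lambda>x. norm ((\<lambda>(i, b). F i b) x)) summable_on UNIV \<times> B"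
    unfolding abs_summable_iff_bdd_above
  proof (rule bdd_aboveI2)
    fix X :: "(nat \<times> 'a) set" assume "X \<in> {X. X \<subseteq> UNIV \<times> B \<and> finite X}"
    then have X: "finite X" "X \<subseteq> UNIV \<times> B" by auto
    define P Q where "P = fst ` X" and "Q = snd ` X"
    have PQ: "finite P" "finite Q" "Q \<subseteq> B" "X \<subseteq> P \<times> Q" using X by (auto simp: P_def Q_def intro: rev_image_eqI)
    have "(\<Sum>x\<in>X. cmod ((\<lambda>(i, b). F i b) x)) \<le> (\<Sum>x\<in>P \<times> Q. cmod ((\<lambda>(i, b). F i b) x))"
      using PQ by (intro sum_mono2) auto
    also have "\<dots> = (\<Sum>i\<in>P. cmod (c i) * (\<Sum>b\<in>Q. cmod (cinner (f i) b) * cmod (cinner b (T (f i)))))"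
      by (simp add: sum.cartesian_product case_prod_unfold F_def norm_mult sum_distrib_left mult.assoc)
    also have "\<dots> \<le> (\<Sum>i\<in>P. cmod (c i) * (1 * K))"
      using orthosys_norm_le[OF f] Tf K(1)
      by (intro sum_mono mult_left_mono order_trans[OF finite_CS[OF PQ(2,3)]] mult_mono) auto
    also have "\<dots> = (\<Sum>i\<in>P. cmod (c i)) * K" by (simp add: sum_distrib_right)
    also have "\<dots> \<le> (\<Sum>i. cmod (c i)) * K"
      using PQ K(1) by (intro mult_right_mono sum_le_suminf c) auto
    finally show "(\<Sum>x\<in>X. cmod ((\<lambda>(i, b). F i b) x)) \<le> (\<Sum>i. cmod (c i)) * K" .
  qed
  have inner_b: "(\<Sum>\<^sub>\<infinity>b\<in>B. F i b) = c i * cinner (f i) (T (f i))" for i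
    unfolding F_def mult.assoc using has_sum_cmult_right[OF parseval_onb[OF B], of "c i" "f i" "T (f i)"]
    by (rule infsumI)
  have inner_i: "(\<Sum>\<^sub>\<infinity>i\<in>UNIV. F i b) = cinner b ((T \<circ> diag_op c f) b)" if b: "b \<in> B" for b
  proof -
    have nb: "norm b = 1" using B b by (simp add: is_onb_def)
    have "(\<lambda>i. T ((c i * cinner (f i) b) *\<^sub>C f i)) sums T (diag_op c f b)"
      by (rule bounded_linear.sums[OF bounded_clinear_bounded_linear[OF T] diag_op_sums[OF f, of c _ b, OF cK]])
    then have "(\<lambda>i. cinner b (T ((c i * cinner (f i) b) *\<^sub>C f i))) sums cinner b (T (diag_op c f b))"
      by (rule bounded_linear.sums[OF bounded_linear_cinner_right])
    then have s: "(\<lambda>i. F i b) sums cinner b (T (diag_op c f b))"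
      by (simp add: bounded_clinear_scaleC[OF T] cinner_scaleC_right F_def)
    have "summable (\<lambda>i. cmod (F i b))"
    proof (rule summable_comparison_test')
      show "summable (\<lambda>i. cmod (c i) * K)" by (rule summable_mult2[OF c])
      fix i
      have "cmod (cinner (f i) b) * cmod (cinner b (T (f i))) \<le> (1 * 1) * (1 * K)"
        using orthosys_norm_le[OF f, of i] Tf[of i] nb K(1)
        by (intro mult_mono order_trans[OF cinner_cauchy_schwarz]) auto
      then show "norm (cmod (F i b)) \<le> cmod (c i) * K"
        by (simp add: F_def norm_mult mult.assoc mult_left_mono)
    qed
    then have "((\<lambda>i. F i b) has_sum cinner b (T (diag_op c f b))) UNIV"
      using s by (rule norm_summable_imp_has_sum)
    then show ?thesis by (simp add: infsumI)
  qed
  have "trace_op (T \<circ> diag_op c f) = (\<Sum>\<^sub>\<infinity>b\<in>B. cinner b ((T \<circ> diag_op c f) b))"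
    by (simp add: trace_op_def B_def)
  also have "\<dots> = (\<Sum>\<^sub>\<infinity>b\<in>B. \<Sum>\<^sub>\<infinity>i\<in>UNIV. F i b)" by (intro infsum_cong) (simp add: inner_i)
  also have "\<dots> = (\<Sum>\<^sub>\<infinity>i\<in>UNIV. \<Sum>\<^sub>\<infinity>b\<in>B. F i b)"
    by (rule infsum_swap_banach[symmetric]) (rule abs_summable_summable[OF abs])
  also have "\<dots> = (\<Sum>\<^sub>\<infinity>i. c i * cinner (f i) (T (f i)))" by (simp only: inner_b)
  also have "\<dots> = (\<Sum>i. c i * cinner (f i) (T (f i)))"
  proof (rule infsumI, rule norm_summable_imp_has_sum)
    show s: "summable (\<lambda>i. cmod (c i * cinner (f i) (T (f i))))"
    proof (rule summable_comparison_test')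
      show "summable (\<lambda>i. cmod (c i) * K)" by (rule summable_mult2[OF c])
      fix i
      have "cmod (cinner (f i) (T (f i))) \<le> 1 * K"
        using orthosys_norm_le[OF f, of i] Tf[of i] K(1)
        by (intro order_trans[OF cinner_cauchy_schwarz] mult_mono) auto
      then show "norm (cmod (c i * cinner (f i) (T (f i)))) \<le> cmod (c i) * K"
        by (simp add: norm_mult mult_left_mono)
    qed
    show "(\<lambda>i. c i * cinner (f i) (T (f i))) sums (\<Sum>i. c i * cinner (f i) (T (f i)))"
      by (rule summable_sums[OF summable_norm_cancel[OF s]])
  qed
  finally show ?thesis .
qed

section \<open>Multiplication operators\<close>

lemma LinfI: "f \<in> borel_measurable M \<Longrightarrow> AE y in M. cmod (f y) \<le> C \<Longrightarrow> f \<in> Linf M"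
  by (auto simp: Linf_def)

lemma LinfD:
  assumes "f \<in> Linf M"
  obtains C where "f \<in> borel_measurable M" "AE y in M. cmod (f y) \<le> C" "0 \<le> C"
proof -
  obtain C where C: "f \<in> borel_measurable M" "AE y in M. cmod (f y) \<le> C" using assms by (auto simp: Linf_def)
  then have "AE y in M. cmod (f y) \<le> max C 0" by (auto elim!: eventually_mono)
  then show ?thesis using that[of "max C 0"] C by auto
qed

lemma Linf_measurable [measurable_dest]: "f \<in> Linf M \<Longrightarrow> f \<in> borel_measurable M"
  by (simp add: Linf_def)

lemma Linf_const: "(\<lambda>_. c) \<in> Linf M"
  by (rule LinfI[of _ _ "cmod c"]) auto

lemma Linf_add: "f \<in> Linf M \<Longrightarrow> g \<in> Linf M \<Longrightarrow> (\<lambda>y. f y + g y) \<in> Linf M"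
proof -
  assume f: "f \<in> Linf M" and g: "g \<in> Linf M"
  obtain C where C: "AE y in M. cmod (f y) \<le> C" using f by (auto simp: Linf_def)
  obtain D where D: "AE y in M. cmod (g y) \<le> D" using g by (auto simp: Linf_def)
  have "AE y in M. cmod (f y + g y) \<le> C + D"
    using C D by eventually_elim (meson add_mono norm_triangle_ineq order_trans)
  then show ?thesis using f g by (intro LinfI) (auto simp: Linf_def)
qed

lemma Linf_cnj: "f \<in> Linf M \<Longrightarrow> (\<lambda>y. cnj (f y)) \<in> Linf M"
  by (auto simp: Linf_def borel_measurable_continuous_on[OF continuous_on_cnj[OF continuous_on_id]])

lemma Linf_indicator: "B \<in> sets M \<Longrightarrow> (\<lambda>y. of_real (indicator B y)) \<in> Linf M"
  by (rule LinfI[of _ _ 1]) (auto simp: indicator_def)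

locale unitary_rep =
  fixes M :: "'f measure" and U :: "'h::complex_hilbert \<Rightarrow> 'f \<Rightarrow> complex"
  assumes finite_M: "finite_measure M" and unitary: "unitary_L2 M U"
begin

lemma U_L2: "U x \<in> borel_measurable M" "integrable M (\<lambda>y. (cmod (U x y))\<^sup>2)"
  using unitary by (auto simp: unitary_L2_def L2_def)

lemma U_measurable [measurable]: "U x \<in> borel_measurable M"
  by (rule U_L2)

lemma U_add: "AE y in M. U (x + x') y = U x y + U x' y"
  and U_scale: "AE y in M. U (c *\<^sub>C x) y = c * U x y"
  and U_cinner: "(\<integral>y. cnj (U x y) * U x' y \<partial>M) = cinner x x'"
  and U_surj: "g \<in> L2 M \<Longrightarrow> \<exists>x. AE y in M. U x y = g y"
  using unitary by (auto simp: unitary_L2_def)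

lemma U_norm: "(\<integral>y. (cmod (U x y))\<^sup>2 \<partial>M) = (norm x)\<^sup>2"
proof -
  have "complex_of_real (\<integral>y. (cmod (U x y))\<^sup>2 \<partial>M) = (\<integral>y. cnj (U x y) * U x y \<partial>M)"
    unfolding integral_complex_of_real[symmetric]
    by (intro Bochner_Integration.integral_cong refl) (simp add: complex_norm_square mult.commute del: of_real_power)
  then show ?thesis unfolding U_cinner cinner_self by (simp only: of_real_eq_iff)
qed

lemma U_inj:
  assumes "AE y in M. U x y = U x' y"
  shows "x = x'"
proof -
  have "AE y in M. U (x + (-1) *\<^sub>C x') y = 0"
    using assms U_add[of x "(-1) *\<^sub>C x'"] U_scale[of "-1" x'] by eventually_elim simp
  then have "(\<integral>y. (cmod (U (x + (-1) *\<^sub>C x') y))\<^sup>2 \<partial>M) = (\<integral>y. 0 \<partial>M)"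
    by (intro integral_cong_AE) (auto elim!: eventually_mono)
  then have "norm (x + (-1) *\<^sub>C x') = 0" unfolding U_norm by simp
  then show ?thesis by (simp add: scaleC_minus_one)
qed

lemma unitary_inv_eq: "AE y in M. U x y = g y \<Longrightarrow> unitary_inv M U g = x"
  unfolding unitary_inv_def
  by (rule the_equality) (auto intro!: U_inj elim: eventually_elim2)

lemma U_unitary_inv: "g \<in> L2 M \<Longrightarrow> AE y in M. U (unitary_inv M U g) y = g y"
  using U_surj[of g] unitary_inv_eq by blast

lemma L2_mult:
  assumes f: "f \<in> Linf M" and g: "g \<in> L2 M"
  shows "(\<lambda>y. f y * g y) \<in> L2 M"
proof -
  obtain C where C: "f \<in> borel_measurable M" "AE y in M. cmod (f y) \<le> C" by (rule LinfD[OF f])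
  have g': "g \<in> borel_measurable M" "integrable M (\<lambda>y. (cmod (g y))\<^sup>2)" using g by (auto simp: L2_def)
  have "integrable M (\<lambda>y. (cmod (f y * g y))\<^sup>2)"
  proof (rule Bochner_Integration.integrable_bound)
    show "integrable M (\<lambda>y. C\<^sup>2 * (cmod (g y))\<^sup>2)" using g' by simp
    show "(\<lambda>y. (cmod (f y * g y))\<^sup>2) \<in> borel_measurable M" using C(1) g'(1) by measurable
    show "AE y in M. norm ((cmod (f y * g y))\<^sup>2) \<le> norm (C\<^sup>2 * (cmod (g y))\<^sup>2)"
      using C(2) by eventually_elim (auto simp: norm_mult power_mult_distrib intro!: mult_right_mono power_mono)
  qed
  then show ?thesis using C(1) g'(1) by (simp add: L2_def)
qed

abbreviation mo :: "('f \<Rightarrow> complex) \<Rightarrow> 'h \<Rightarrow> 'h"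
  where "mo \<equiv> mult_op M U"

lemma mult_op_eqI:
  assumes "\<And>x. AE y in M. U (T x) y = f y * U x y"
  shows "T = mo f"
  by (rule ext) (simp add: mult_op_def unitary_inv_eq[OF assms])

lemma U_mult_op: "f \<in> Linf M \<Longrightarrow> AE y in M. U (mo f x) y = f y * U x y"
  unfolding mult_op_def using unitary by (intro U_unitary_inv L2_mult) (auto simp: unitary_L2_def)

lemma integrable_mult_norm_sq:
  fixes h :: "'f \<Rightarrow> 'b::{banach, second_countable_topology, real_normed_field}"
  assumes "h \<in> borel_measurable M" "AE y in M. norm (h y) \<le> C"
  shows "integrable M (\<lambda>y. h y * of_real ((cmod (U x y))\<^sup>2))"
proof (rule Bochner_Integration.integrable_bound)
  show "integrable M (\<lambda>y. C * (cmod (U x y))\<^sup>2)" using U_L2(2) by simp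
  show "(\<lambda>y. h y * of_real ((cmod (U x y))\<^sup>2)) \<in> borel_measurable M" using assms(1) by measurable
  show "AE y in M. norm (h y * of_real ((cmod (U x y))\<^sup>2)) \<le> norm (C * (cmod (U x y))\<^sup>2)"
    using assms(2)
  proof eventually_elim
    case (elim y)
    then have "norm (h y) * (cmod (U x y))\<^sup>2 \<le> \<bar>C\<bar> * (cmod (U x y))\<^sup>2" by (intro mult_right_mono) auto
    then show ?case by (simp add: norm_mult norm_power abs_mult)
  qed
qed

lemma cinner_mult_op:
  assumes "f \<in> Linf M"
  shows "cinner x (mo f x) = (\<integral>y. f y * of_real ((cmod (U x y))\<^sup>2) \<partial>M)"
  unfolding U_cinner[symmetric]
proof (rule integral_cong_AE)
  show "(\<lambda>y. cnj (U x y) * U (mo f x) y) \<in> borel_measurable M"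
    by (intro borel_measurable_times borel_measurable_continuous_on[OF continuous_on_cnj[OF continuous_on_id]] U_measurable)
  show "(\<lambda>y. f y * complex_of_real ((cmod (U x y))\<^sup>2)) \<in> borel_measurable M"
    using Linf_measurable[OF assms] by measurable
  show "AE y in M. cnj (U x y) * U (mo f x) y = f y * complex_of_real ((cmod (U x y))\<^sup>2)"
    using U_mult_op[OF assms, of x]
    by eventually_elim (simp add: complex_norm_square mult_ac del: of_real_power)
qed

lemma norm_mult_op:
  assumes "f \<in> Linf M"
  shows "(norm (mo f x))\<^sup>2 = (\<integral>y. (cmod (f y))\<^sup>2 * (cmod (U x y))\<^sup>2 \<partial>M)"
  unfolding U_norm[symmetric]
proof (rule integral_cong_AE)
  show "(\<lambda>y. (cmod (f y))\<^sup>2 * (cmod (U x y))\<^sup>2) \<in> borel_measurable M"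
    using Linf_measurable[OF assms] by measurable
  show "AE y in M. (cmod (U (mo f x) y))\<^sup>2 = (cmod (f y))\<^sup>2 * (cmod (U x y))\<^sup>2"
    using U_mult_op[OF assms, of x] by eventually_elim (simp add: norm_mult power_mult_distrib)
qed measurable

lemma mult_op_bounded:
  assumes f: "f \<in> Linf M"
  shows "bounded_clinear (mo f)"
proof -
  obtain C where C: "f \<in> borel_measurable M" "AE y in M. cmod (f y) \<le> C" "0 \<le> C" by (rule LinfD[OF f])
  show ?thesis
  proof (rule bounded_clinearI)
    fix x x' and c :: complex
    show "mo f (x + x') = mo f x + mo f x'"
    proof (rule U_inj)
      show "AE y in M. U (mo f (x + x')) y = U (mo f x + mo f x') y"
        using U_mult_op[OF f, of "x + x'"] U_mult_op[OF f, of x] U_mult_op[OF f, of x'] U_add[of x x'] U_add[of "mo f x" "mo f x'"]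
        by eventually_elim (simp add: distrib_left)
    qed
    show "mo f (c *\<^sub>C x) = c *\<^sub>C mo f x"
    proof (rule U_inj)
      show "AE y in M. U (mo f (c *\<^sub>C x)) y = U (c *\<^sub>C mo f x) y"
        using U_mult_op[OF f, of "c *\<^sub>C x"] U_mult_op[OF f, of x] U_scale[of c x] U_scale[of c "mo f x"]
        by eventually_elim simp
    qed
    show "norm (mo f x) \<le> C * norm x"
    proof (rule power2_le_imp_le)
      have C2: "AE y in M. norm ((cmod (f y))\<^sup>2) \<le> C\<^sup>2" using C(2) by eventually_elim (auto intro: power_mono)
      have m: "(\<lambda>y. (cmod (f y))\<^sup>2) \<in> borel_measurable M" using C(1) by measurable
      have "(norm (mo f x))\<^sup>2 \<le> (\<integral>y. C\<^sup>2 * (cmod (U x y))\<^sup>2 \<partial>M)"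
        unfolding norm_mult_op[OF f]
      proof (rule integral_mono_AE)
        show "integrable M (\<lambda>y. (cmod (f y))\<^sup>2 * (cmod (U x y))\<^sup>2)"
          using integrable_mult_norm_sq[OF m C2] by simp
        show "AE y in M. (cmod (f y))\<^sup>2 * (cmod (U x y))\<^sup>2 \<le> C\<^sup>2 * (cmod (U x y))\<^sup>2"
          using C2 by eventually_elim (auto intro: mult_right_mono)
      qed (use U_L2(2) in simp)
      then show "(norm (mo f x))\<^sup>2 \<le> (C * norm x)\<^sup>2" by (simp add: U_norm power_mult_distrib)
    qed (use C(3) in simp)
  qed
qed

lemma mult_op_adjoint:
  assumes f: "f \<in> Linf M"
  shows "is_adjoint (mo (\<lambda>y. cnj (f y))) (mo f)"
  unfolding is_adjoint_def
proof (intro conjI allI mult_op_bounded Linf_cnj f)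
  fix x x'
  show "cinner (mo (\<lambda>y. cnj (f y)) x) x' = cinner x (mo f x')"
    unfolding U_cinner[symmetric]
  proof (rule integral_cong_AE)
    show "AE y in M. cnj (U (mo (\<lambda>y. cnj (f y)) x) y) * U x' y = cnj (U x y) * U (mo f x') y"
      using U_mult_op[OF Linf_cnj[OF f], of x] U_mult_op[OF f, of x'] by eventually_elim simp
  qed (intro borel_measurable_times borel_measurable_continuous_on[OF continuous_on_cnj[OF continuous_on_id]] U_measurable)+
qed

lemma mult_op_compose: "f \<in> Linf M \<Longrightarrow> g \<in> Linf M \<Longrightarrow> mo f \<circ> mo g = mo (\<lambda>y. f y * g y)"
proof (rule mult_op_eqI)
  fix x assume f: "f \<in> Linf M" and g: "g \<in> Linf M"
  show "AE y in M. U ((mo f \<circ> mo g) x) y = f y * g y * U x y"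
    using U_mult_op[OF f, of "mo g x"] U_mult_op[OF g, of x] by eventually_elim simp
qed

lemma mult_op_add_const: "f \<in> Linf M \<Longrightarrow> (\<lambda>x. mo f x + c *\<^sub>C x) = mo (\<lambda>y. f y + c)"
proof (rule mult_op_eqI)
  fix x assume f: "f \<in> Linf M"
  show "AE y in M. U (mo f x + c *\<^sub>C x) y = (f y + c) * U x y"
    using U_add[of "mo f x" "c *\<^sub>C x"] U_mult_op[OF f, of x] U_scale[of c x]
    by eventually_elim (simp add: distrib_right)
qed

lemma mult_op_complemented:
  assumes f: "f \<in> Linf M"
  shows "complemented (mo f)"
proof -
  obtain C where C: "f \<in> borel_measurable M" "AE y in M. cmod (f y) \<le> C" "0 \<le> C" by (rule LinfD[OF f])
  \<comment> \<open>Multiplication by the root of C^2 - |f|^2 complements \<open>mo f\<close>; the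
    maximum with 0 covers the null set on which the bound \<open>C\<close> may fail.\<close>
  define z where "z y = complex_of_real (sqrt (max 0 (C\<^sup>2 - (cmod (f y))\<^sup>2)))" for y
  have zC: "cmod (z y) \<le> C" for y using C(3) unfolding z_def by (auto intro!: real_le_lsqrt)
  have z_meas: "z \<in> borel_measurable M" unfolding z_def using C(1) by measurable
  have z: "z \<in> Linf M" by (rule LinfI[OF z_meas, of C]) (use zC in simp)
  have "(norm (mo f x))\<^sup>2 + (norm (mo z x))\<^sup>2 = C\<^sup>2 * (norm x)\<^sup>2" for x
  proof -
    have C2: "AE y in M. norm ((cmod (f y))\<^sup>2) \<le> C\<^sup>2" using C(2) by eventually_elim (auto intro: power_mono)
    have i1: "integrable M (\<lambda>y. (cmod (f y))\<^sup>2 * (cmod (U x y))\<^sup>2)"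
      using integrable_mult_norm_sq[OF _ C2, of x] C(1) by simp
    have i2: "integrable M (\<lambda>y. (cmod (z y))\<^sup>2 * (cmod (U x y))\<^sup>2)"
      using integrable_mult_norm_sq[of "\<lambda>y. (cmod (z y))\<^sup>2" "C\<^sup>2" x] z_meas zC by (simp add: power_mono)
    have "(norm (mo f x))\<^sup>2 + (norm (mo z x))\<^sup>2 = (\<integral>y. (cmod (f y))\<^sup>2 * (cmod (U x y))\<^sup>2 + (cmod (z y))\<^sup>2 * (cmod (U x y))\<^sup>2 \<partial>M)"
      using i1 i2 by (simp add: norm_mult_op[OF f] norm_mult_op[OF z])
    also have "\<dots> = (\<integral>y. C\<^sup>2 * (cmod (U x y))\<^sup>2 \<partial>M)"
    proof (rule integral_cong_AE)
      show "AE y in M. (cmod (f y))\<^sup>2 * (cmod (U x y))\<^sup>2 + (cmod (z y))\<^sup>2 * (cmod (U x y))\<^sup>2 = C\<^sup>2 * (cmod (U x y))\<^sup>2"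
        using C2 by eventually_elim (simp add: z_def algebra_simps)
    qed (use i1 i2 in auto)
    finally show ?thesis by (simp add: U_norm)
  qed
  then show ?thesis
    unfolding complemented_def using mult_op_bounded[OF z] mult_op_adjoint[OF z] zero_le_power2[of C] by blast
qed

section \<open>Multiplication operators as a maximal abelian algebra\<close>

definition mult_alg :: "('h \<Rightarrow> 'h) set"
  where "mult_alg = mo ` Linf M"

text \<open>An operator commuting with all multiplications is multiplication by \<open>u\<close>,
  the image of the vector \<open>w\<close> represented by the constant 1. This vector exists because
  the measure is finite.\<close>

lemma mult_alg_commutant_subset:
  assumes T: "bounded_clinear T" and comm: "\<And>f. f \<in> Linf M \<Longrightarrow> T \<circ> mo f = mo f \<circ> T"
  shows "T \<in> mult_alg"
proof -
  have one: "(\<lambda>_. 1) \<in> L2 M" using finite_M by (simp add: L2_def finite_measure.integrable_const)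
  define w where "w = unitary_inv M U (\<lambda>_. 1)"
  have Uw: "AE y in M. U w y = 1" unfolding w_def by (rule U_unitary_inv[OF one])
  define u where "u = U (T w)"
  have u_meas: "u \<in> borel_measurable M" by (simp add: u_def)
  obtain K where K: "0 < K" "\<And>x. norm (T x) \<le> K * norm x" using bounded_clinear_bound[OF T] by blast
  \<comment> \<open>Testing \<open>T\<close> on the indicator of \<open>B\<close> bounds the
    integral of |u|^2 over \<open>B\<close> by K^2 times the measure of \<open>B\<close>, so
    \<open>B\<close> is a null set and \<open>u\<close> is essentially bounded.\<close>
  define B where "B = {y \<in> space M. K < cmod (u y)}"
  have B: "B \<in> sets M" unfolding B_def using u_meas by measurable
  have T_mo: "T (mo f x) = mo f (T x)" if "f \<in> Linf M" for f x
    using comm[OF that] by (metis comp_apply)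
  define f where "f y = complex_of_real (indicator B y)" for y
  have f: "f \<in> Linf M" unfolding f_def by (rule Linf_indicator[OF B])
  have cf: "(cmod (f y))\<^sup>2 = indicator B y" for y by (simp add: f_def indicator_def)
  have "norm (mo f (T w)) \<le> K * norm (mo f w)" using K(2)[of "mo f w"] by (simp add: T_mo[OF f])
  then have "(norm (mo f (T w)))\<^sup>2 \<le> K\<^sup>2 * (norm (mo f w))\<^sup>2"
    by (metis norm_ge_zero power_mono power_mult_distrib)
  moreover have "(norm (mo f w))\<^sup>2 = (\<integral>y. indicator B y \<partial>M)"
    unfolding norm_mult_op[OF f] cf using Uw B by (intro integral_cong_AE) (auto elim: eventually_mono)
  ultimately have le: "(\<integral>y. indicator B y * (cmod (u y))\<^sup>2 \<partial>M) \<le> K\<^sup>2 * (\<integral>y. indicator B y \<partial>M)"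
    by (simp add: norm_mult_op[OF f] cf u_def)
  have i1: "integrable M (\<lambda>y. indicator B y * (cmod (u y))\<^sup>2)"
    unfolding u_def using integrable_mult_norm_sq[of "indicator B :: _ \<Rightarrow> real" 1 "T w"] B by (simp add: indicator_def)
  have i2: "integrable M (indicator B :: _ \<Rightarrow> real)"
    using B finite_M by (simp add: finite_measure.emeasure_finite less_top[symmetric] integrable_real_indicator)
  have nn: "AE y in M. 0 \<le> indicator B y * ((cmod (u y))\<^sup>2 - K\<^sup>2)"
    using K(1) by (intro AE_I2) (auto simp: B_def indicator_def power_mono)
  have i3: "integrable M (\<lambda>y. indicator B y * ((cmod (u y))\<^sup>2 - K\<^sup>2))"
    using Bochner_Integration.integrable_diff[OF i1 integrable_mult_right[OF i2, of "K\<^sup>2"]] by (simp add: algebra_simps)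
  have "(\<integral>y. indicator B y * ((cmod (u y))\<^sup>2 - K\<^sup>2) \<partial>M) \<le> 0"
    using le Bochner_Integration.integral_diff[OF i1 integrable_mult_right[OF i2, of "K\<^sup>2"]] by (simp add: algebra_simps)
  then have "(\<integral>y. indicator B y * ((cmod (u y))\<^sup>2 - K\<^sup>2) \<partial>M) = 0"
    using integral_nonneg_AE[OF nn] by linarith
  then have "AE y in M. indicator B y * ((cmod (u y))\<^sup>2 - K\<^sup>2) = 0"
    using integral_nonneg_eq_0_iff_AE[OF i3 nn] by simp
  then have u_le: "AE y in M. cmod (u y) \<le> K"
    using AE_space
  proof eventually_elim
    case (elim y)
    show ?case
    proof (rule ccontr)
      assume gt: "\<not> cmod (u y) \<le> K"
      then have "K\<^sup>2 < (cmod (u y))\<^sup>2" using K(1) by (intro power_strict_mono) auto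
      then show False using elim gt by (simp add: B_def)
    qed
  qed
  have u: "u \<in> Linf M" using u_meas u_le by (rule LinfI)
  have "T = mo u"
  proof (rule mult_op_eqI)
    fix x
    \<comment> \<open>A general vector is cut off to the region where its representative is at most
      \<open>n\<close>; the result is a bounded multiplier applied to \<open>w\<close>.\<close>
    have "AE y in M. cmod (U x y) \<le> real n \<longrightarrow> U (T x) y = u y * U x y" for n
    proof -
      define b where "b y = complex_of_real (indicator {y \<in> space M. cmod (U x y) \<le> real n} y)" for y
      define g where "g y = b y * U x y" for y
      have b: "b \<in> Linf M" unfolding b_def by (rule Linf_indicator) measurable
      have g: "g \<in> Linf M"
      proof (rule LinfI)
        show "g \<in> borel_measurable M" unfolding g_def using Linf_measurable[OF b] by measurable
        show "AE y in M. cmod (g y) \<le> real n" by (intro AE_I2) (auto simp: g_def b_def indicator_def)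
      qed
      have "mo g w = mo b x"
      proof (rule U_inj)
        show "AE y in M. U (mo g w) y = U (mo b x) y"
          using U_mult_op[OF g, of w] U_mult_op[OF b, of x] Uw by eventually_elim (simp add: g_def)
      qed
      then have "mo g (T w) = mo b (T x)" by (metis T_mo[OF b] T_mo[OF g])
      moreover have "AE y in M. U (mo g (T w)) y = g y * u y" unfolding u_def by (rule U_mult_op[OF g])
      ultimately have "AE y in M. b y * U (T x) y = g y * u y"
        using U_mult_op[OF b, of "T x"] by (auto elim: eventually_elim2)
      then show ?thesis using AE_space by eventually_elim (auto simp: g_def b_def)
    qed
    then have "AE y in M. \<forall>n. cmod (U x y) \<le> real n \<longrightarrow> U (T x) y = u y * U x y"
      by (subst AE_all_countable) blast
    then show "AE y in M. U (T x) y = u y * U x y"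
      by eventually_elim (meson real_arch_simple)
  qed
  then show ?thesis using u by (auto simp: mult_alg_def)
qed

lemma mult_alg_commutant: "commutant mult_alg = mult_alg"
proof (intro equalityI subsetI)
  fix T assume "T \<in> commutant mult_alg"
  then show "T \<in> mult_alg"
    by (intro mult_alg_commutant_subset) (auto simp: commutant_def mult_alg_def)
next
  fix T assume "T \<in> mult_alg"
  then obtain f where f: "f \<in> Linf M" "T = mo f" by (auto simp: mult_alg_def)
  have "mo f \<circ> mo g = mo g \<circ> mo f" if g: "g \<in> Linf M" for g
    by (simp add: mult_op_compose[OF f(1) g] mult_op_compose[OF g f(1)] mult.commute)
  then show "T \<in> commutant mult_alg"
    using mult_op_bounded[OF f(1)] by (auto simp: commutant_def mult_alg_def f(2))
qed

lemma mult_alg_von_neumann: "von_neumann_algebra mult_alg"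
  unfolding von_neumann_algebra_def mult_alg_commutant
  using mult_op_bounded adj_eqI[OF mult_op_adjoint] Linf_cnj
  by (auto simp: mult_alg_def intro!: imageI)

text \<open>Being its own commutant, \<open>mult_alg\<close> is one of the algebras in the defining
  intersection.\<close>

lemma vn_generated_subset_mult_alg:
  assumes "S \<subseteq> mult_alg"
  shows "vn_generated S \<subseteq> mult_alg"
  unfolding vn_generated_def using mult_alg_von_neumann assms by blast

text \<open>The vector \<open>U\<^sup>* \<surd>v\<close> represents the functional as a vector state.\<close>

lemma predual_density:
  fixes v :: "'f \<Rightarrow> real"
  assumes v: "integrable M v" "\<And>y. 0 \<le> v y" and N: "N \<subseteq> mult_alg"
    and \<phi>: "\<And>f. f \<in> Linf M \<Longrightarrow> \<phi> (mo f) = (\<integral>y. f y * of_real (v y) \<partial>M)"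
  shows "\<phi> \<in> predual N"
proof -
  define g where "g y = complex_of_real (sqrt (v y))" for y
  have g2: "complex_of_real ((cmod (g y))\<^sup>2) = of_real (v y)" "(cmod (g y))\<^sup>2 = v y" for y
    using v(2) by (auto simp: g_def)
  have "g \<in> borel_measurable M" unfolding g_def using borel_measurable_integrable[OF v(1)] by measurable
  then have g: "g \<in> L2 M" using v by (simp add: L2_def g2)
  define x where "x = unitary_inv M U g"
  have Ux: "AE y in M. U x y = g y" unfolding x_def by (rule U_unitary_inv[OF g])
  \<comment> \<open>\<open>predual\<close> asks for sequences of vectors; a vector state has a
    single nonzero entry.\<close>
  define z where "z n = (if n = 0 then x else 0)" for n :: nat
  have zn: "(norm (z n))\<^sup>2 = (if n = 0 then (norm x)\<^sup>2 else 0)" for n by (simp add: z_def)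
  have "summable (\<lambda>n. (norm (z n))\<^sup>2)" unfolding zn by (rule summable_single)
  moreover have "\<phi> T = (\<Sum>n. cinner (z n) (T (z n)))" if T: "T \<in> N" for T
  proof -
    obtain f where f: "f \<in> Linf M" "T = mo f" using N T by (auto simp: mult_alg_def)
    have "(\<lambda>n. cinner (z n) (T (z n))) = (\<lambda>n. if n = 0 then cinner x (T x) else 0)"
      by (auto simp: z_def)
    then have "(\<Sum>n. cinner (z n) (T (z n))) = cinner x (T x)"
      using sums_single[of 0 "\<lambda>_. cinner x (T x)"] by (simp add: sums_iff)
    also have "\<dots> = (\<integral>y. f y * of_real ((cmod (U x y))\<^sup>2) \<partial>M)"
      unfolding f(2) by (rule cinner_mult_op[OF f(1)])
    also have "\<dots> = (\<integral>y. f y * of_real (v y) \<partial>M)"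
    proof (rule integral_cong_AE)
      show "(\<lambda>y. f y * complex_of_real ((cmod (U x y))\<^sup>2)) \<in> borel_measurable M"
        using Linf_measurable[OF f(1)] by measurable
      show "(\<lambda>y. f y * complex_of_real (v y)) \<in> borel_measurable M"
        using Linf_measurable[OF f(1)] borel_measurable_integrable[OF v(1)] by measurable
      show "AE y in M. f y * complex_of_real ((cmod (U x y))\<^sup>2) = f y * complex_of_real (v y)"
        using Ux by eventually_elim (simp add: g2 del: of_real_power)
    qed
    finally show ?thesis using \<phi>[OF f(1)] f(2) by simp
  qed
  ultimately show ?thesis unfolding predual_def by blast
qed

end

section \<open>Functionals on bounded measurable functions\<close>

definition bounded_meas :: "'a measure \<Rightarrow> ('a \<Rightarrow> real) \<Rightarrow> bool"
  where "bounded_meas M h \<longleftrightarrow> h \<in> borel_measurable M \<and> (\<exists>K. AE y in M. \<bar>h y\<bar> \<le> K)"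

lemma bounded_measI: "h \<in> borel_measurable M \<Longrightarrow> AE y in M. \<bar>h y\<bar> \<le> K \<Longrightarrow> bounded_meas M h"
  by (auto simp: bounded_meas_def)

lemma bounded_meas_indicator: "B \<in> sets M \<Longrightarrow> bounded_meas M (indicator B)"
  by (rule bounded_measI[of _ _ 1]) (auto simp: indicator_def)

lemma bounded_meas_add: "bounded_meas M g \<Longrightarrow> bounded_meas M h \<Longrightarrow> bounded_meas M (\<lambda>y. g y + h y)"
proof -
  assume g: "bounded_meas M g" and h: "bounded_meas M h"
  obtain K where K: "AE y in M. \<bar>g y\<bar> \<le> K" using g by (auto simp: bounded_meas_def)
  obtain L where L: "AE y in M. \<bar>h y\<bar> \<le> L" using h by (auto simp: bounded_meas_def)
  have "AE y in M. \<bar>g y + h y\<bar> \<le> K + L" using K L by eventually_elim linarith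
  then show ?thesis using g h by (intro bounded_measI) (auto simp: bounded_meas_def)
qed

lemma bounded_meas_scale: "bounded_meas M g \<Longrightarrow> bounded_meas M (\<lambda>y. c * g y)"
proof -
  assume g: "bounded_meas M g"
  obtain K where K: "AE y in M. \<bar>g y\<bar> \<le> K" using g by (auto simp: bounded_meas_def)
  have "AE y in M. \<bar>c * g y\<bar> \<le> \<bar>c\<bar> * K" using K by eventually_elim (simp add: abs_mult mult_left_mono)
  then show ?thesis using g by (intro bounded_measI) (auto simp: bounded_meas_def)
qed

lemma bounded_meas_sum:
  "(\<And>j. j \<in> J \<Longrightarrow> bounded_meas M (g j)) \<Longrightarrow> bounded_meas M (\<lambda>y. \<Sum>j\<in>J. g j y)"
proof (induction J rule: infinite_finite_induct)
  case (insert j J)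
  then show ?case by (simp add: bounded_meas_add)
qed (auto intro: bounded_measI[of _ _ 0])

text \<open>The level sets of the floor of \<open>h y / e\<close> cut the range into steps of length
  \<open>e\<close>, and \<open>m\<close> is large enough to cover the essential range.\<close>

lemma uniform_simple_approximation:
  assumes h: "h \<in> borel_measurable M" "AE y in M. \<bar>h y\<bar> \<le> K" and e: "0 < (e::real)"
  obtains J :: "int set" and c :: "int \<Rightarrow> real" and B where "finite J" "\<And>j. j \<in> J \<Longrightarrow> B j \<in> sets M"
    "AE y in M. \<bar>h y - (\<Sum>j\<in>J. c j * indicator (B j) y)\<bar> \<le> e"
proof -
  define m where "m = \<lceil>\<bar>K\<bar> / e\<rceil> + 1"
  define J where "J = {-m..m}"
  define B where "B j = {y \<in> space M. \<lfloor>h y / e\<rfloor> = j}" for j :: int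
  have B: "B j \<in> sets M" for j unfolding B_def using h(1) by measurable
  have "AE y in M. \<bar>h y - (\<Sum>j\<in>J. (real_of_int j * e) * indicator (B j) y)\<bar> \<le> e"
    using h(2) AE_space
  proof eventually_elim
    case (elim y)
    define k where "k = \<lfloor>h y / e\<rfloor>"
    have "h y / e \<le> \<bar>K\<bar> / e" "- \<bar>K\<bar> / e \<le> h y / e"
      using elim(1) e divide_right_mono[of "h y" "\<bar>K\<bar>" e] divide_right_mono[of "- \<bar>K\<bar>" "h y" e] by linarith+
    then have "- real_of_int m \<le> h y / e" "h y / e \<le> real_of_int m" unfolding m_def by linarith+
    then have kJ: "k \<in> J" unfolding J_def k_def atLeastAtMost_iff by linarith
    have "(\<Sum>j\<in>J. (real_of_int j * e) * indicator (B j) y) = (\<Sum>j\<in>J. if j = k then real_of_int k * e else 0)"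
      using elim(2) by (intro sum.cong) (auto simp: B_def k_def indicator_def)
    also have "\<dots> = real_of_int k * e" using kJ by (simp add: J_def)
    finally have sum: "(\<Sum>j\<in>J. (real_of_int j * e) * indicator (B j) y) = real_of_int k * e" .
    have "real_of_int k \<le> h y / e" "h y / e < real_of_int k + 1" unfolding k_def by linarith+
    then have "real_of_int k * e \<le> h y" "h y < (real_of_int k + 1) * e" using e by (auto simp: field_simps)
    then show ?case unfolding sum by (simp add: abs_le_iff algebra_simps)
  qed
  then show ?thesis using B by (intro that[of J B "\<lambda>j. real_of_int j * e"]) (auto simp: J_def)
qed

text \<open>Simple functions are uniformly dense and the bound \<open>C\<close> does not depend on
  \<open>k\<close>, so convergence on indicators suffices. Applied to a constant sequence, this also
  shows that a functional vanishes.\<close>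

lemma functional_tendsto_zero:
  fixes D :: "nat \<Rightarrow> ('a \<Rightarrow> real) \<Rightarrow> real"
  assumes add: "\<And>k g h. bounded_meas M g \<Longrightarrow> bounded_meas M h \<Longrightarrow> D k (\<lambda>y. g y + h y) = D k g + D k h"
    and scale: "\<And>k c g. bounded_meas M g \<Longrightarrow> D k (\<lambda>y. c * g y) = c * D k g"
    and bound: "\<And>k g K. g \<in> borel_measurable M \<Longrightarrow> AE y in M. \<bar>g y\<bar> \<le> K \<Longrightarrow> 0 \<le> K \<Longrightarrow> \<bar>D k g\<bar> \<le> C * K"
    and ind: "\<And>B. B \<in> sets M \<Longrightarrow> (\<lambda>k. D k (indicator B)) \<longlonglongrightarrow> 0" and h: "bounded_meas M h"
  shows "(\<lambda>k. D k h) \<longlonglongrightarrow> 0"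
proof -
  have zero: "D k (\<lambda>y. 0) = 0" for k
    using scale[OF bounded_measI[of "\<lambda>y. 0" M 0], of k 0] by simp
  have sum: "D k (\<lambda>y. \<Sum>j\<in>J. c j * indicator (B j) y) = (\<Sum>j\<in>J. c j * D k (indicator (B j)))"
    if "finite J" "\<And>j. j \<in> J \<Longrightarrow> B j \<in> sets M" for k c B and J :: "int set"
    using that
  proof (induction J)
    case (insert j J)
    have "bounded_meas M (\<lambda>y. \<Sum>j\<in>J. c j * indicator (B j) y)"
      using insert by (intro bounded_meas_sum bounded_meas_scale bounded_meas_indicator) auto
    moreover have "bounded_meas M (indicator (B j))" using insert.prems by (intro bounded_meas_indicator) simp
    moreover have "(\<lambda>y. \<Sum>i\<in>insert j J. c i * indicator (B i) y) =
        (\<lambda>y. c j * indicator (B j) y + (\<Sum>i\<in>J. c i * indicator (B i) y))"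
      by (simp only: sum.insert[OF insert.hyps])
    moreover have "D k (\<lambda>y. \<Sum>i\<in>J. c i * indicator (B i) y) = (\<Sum>i\<in>J. c i * D k (indicator (B i)))"
      by (rule insert.IH) (simp add: insert.prems)
    ultimately show ?case by (simp only: add bounded_meas_scale scale sum.insert[OF insert.hyps])
  qed (simp add: zero)
  have C: "0 \<le> \<bar>C\<bar>" by simp
  obtain K where K: "h \<in> borel_measurable M" "AE y in M. \<bar>h y\<bar> \<le> K" using h by (auto simp: bounded_meas_def)
  show ?thesis
    unfolding tendsto_iff
  proof (intro allI impI)
    fix r :: real assume r: "0 < r"
    define e where "e = r / (2 * (\<bar>C\<bar> + 1))"
    have e: "0 < e" using r by (simp add: e_def)
    obtain J :: "int set" and c :: "int \<Rightarrow> real" and B where J: "finite J" "\<And>j. j \<in> J \<Longrightarrow> B j \<in> sets M"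
      "AE y in M. \<bar>h y - (\<Sum>j\<in>J. c j * indicator (B j) y)\<bar> \<le> e"
      by (rule uniform_simple_approximation[OF K e]) (rule that; assumption)
    define s where "s y = (\<Sum>j\<in>J. c j * indicator (B j) y)" for y
    have s: "bounded_meas M s"
      unfolding s_def using J by (intro bounded_meas_sum bounded_meas_scale bounded_meas_indicator)
    have d: "bounded_meas M (\<lambda>y. h y + (-1) * s y)" by (intro bounded_meas_add bounded_meas_scale h s)
    have small: "\<bar>D k (\<lambda>y. h y + (-1) * s y)\<bar> \<le> r / 2" for k
    proof -
      have "\<bar>D k (\<lambda>y. h y + (-1) * s y)\<bar> \<le> C * e"
        using d J(3) e by (intro bound) (auto simp: bounded_meas_def s_def)
      also have "\<dots> \<le> (\<bar>C\<bar> + 1) * e" using e by (intro mult_right_mono) auto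
      also have "\<dots> = r / 2" by (simp add: e_def field_simps)
      finally show ?thesis .
    qed
    have Dh: "D k h = D k (\<lambda>y. h y + (-1) * s y) + D k s" for k
      using add[OF d s, of k] by simp
    have "(\<lambda>k. \<Sum>j\<in>J. c j * D k (indicator (B j))) \<longlonglongrightarrow> (\<Sum>j\<in>J. c j * 0)"
      using J by (intro tendsto_sum tendsto_mult tendsto_const ind)
    then have "(\<lambda>k. D k s) \<longlonglongrightarrow> 0" unfolding s_def by (simp add: sum[OF J(1,2)])
    then have "\<forall>\<^sub>F k in sequentially. dist (D k s) 0 < r / 2" by (rule tendstoD) (use r in simp)
    then show "\<forall>\<^sub>F k in sequentially. dist (D k h) 0 < r"
    proof eventually_elim
      case (elim k)
      then show ?case using small[of k] unfolding Dh[of k] dist_real_def by linarith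
    qed
  qed
qed

lemma integrable_bounded_mult:
  fixes h v :: "'a \<Rightarrow> real"
  assumes h: "bounded_meas M h" and v: "integrable M v"
  shows "integrable M (\<lambda>y. h y * v y)"
proof -
  obtain K where K: "h \<in> borel_measurable M" "AE y in M. \<bar>h y\<bar> \<le> K" using h by (auto simp: bounded_meas_def)
  show ?thesis
  proof (rule Bochner_Integration.integrable_bound)
    show "integrable M (\<lambda>y. K * v y)" using v by simp
    show "(\<lambda>y. h y * v y) \<in> borel_measurable M" using K(1) v by measurable
    show "AE y in M. norm (h y * v y) \<le> norm (K * v y)"
      using K(2) by eventually_elim (auto simp: abs_mult intro!: mult_right_mono)
  qed
qed

lemma integral_bounded_mult_le:
  fixes h v :: "'a \<Rightarrow> real"
  assumes h: "h \<in> borel_measurable M" "AE y in M. \<bar>h y\<bar> \<le> K" and v: "integrable M v" "\<And>y. 0 \<le> v y"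
  shows "\<bar>\<integral>y. h y * v y \<partial>M\<bar> \<le> K * (\<integral>y. v y \<partial>M)"
proof -
  have i: "integrable M (\<lambda>y. h y * v y)" using h v(1) by (intro integrable_bounded_mult bounded_measI)
  have "\<bar>\<integral>y. h y * v y \<partial>M\<bar> \<le> (\<integral>y. \<bar>h y * v y\<bar> \<partial>M)" by (rule integral_abs_bound)
  also have "\<dots> \<le> (\<integral>y. K * v y \<partial>M)"
  proof (rule integral_mono_AE)
    show "AE y in M. \<bar>h y * v y\<bar> \<le> K * v y"
      using h(2) by eventually_elim (use v(2) in \<open>auto simp: abs_mult intro!: mult_right_mono\<close>)
  qed (use i v in auto)
  finally show ?thesis by simp
qed

text \<open>A positive functional on bounded functions gives in general only a finitely additive set
  function. Domination by the integrable \<open>l\<close> makes it continuous at the empty set,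
  hence a measure, and absolutely continuous with respect to \<open>M\<close>; the density is its
  Radon-Nikodym derivative.\<close>

lemma dominated_functional_density:
  fixes \<Lambda> :: "('a \<Rightarrow> real) \<Rightarrow> real" and l :: "'a \<Rightarrow> real"
  assumes fin: "finite_measure M"
    and add: "\<And>g h. bounded_meas M g \<Longrightarrow> bounded_meas M h \<Longrightarrow> \<Lambda> (\<lambda>y. g y + h y) = \<Lambda> g + \<Lambda> h"
    and scale: "\<And>c g. bounded_meas M g \<Longrightarrow> \<Lambda> (\<lambda>y. c * g y) = c * \<Lambda> g"
    and bound: "\<And>g K. g \<in> borel_measurable M \<Longrightarrow> AE y in M. \<bar>g y\<bar> \<le> K \<Longrightarrow> 0 \<le> K \<Longrightarrow> \<bar>\<Lambda> g\<bar> \<le> C * K"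
    and pos: "\<And>B. B \<in> sets M \<Longrightarrow> 0 \<le> \<Lambda> (indicator B)"
    and l: "integrable M l" "\<And>B. B \<in> sets M \<Longrightarrow> \<Lambda> (indicator B) \<le> C * (\<integral>y. indicator B y * l y \<partial>M)"
  obtains v where "integrable M v" "\<And>y. 0 \<le> v y" "\<And>h. bounded_meas M h \<Longrightarrow> \<Lambda> h = (\<integral>y. h y * v y \<partial>M)"
proof -
  interpret finite_measure M by (rule fin)
  define \<mu> where "\<mu> B = ennreal (\<Lambda> (indicator B))" for B
  have "indicator {} = (\<lambda>y::'a. 0::real)" by (simp add: fun_eq_iff)
  then have zero: "\<Lambda> (indicator {}) = 0" using scale[OF bounded_measI[of "\<lambda>y. 0" M 0], of 0] by simp
  have "countably_additive (sets M) \<mu>"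
  proof (rule sets.empty_continuous_imp_countably_additive)
    show "positive (sets M) \<mu>" using zero by (simp add: positive_def \<mu>_def)
    show "additive (sets M) \<mu>"
    proof (unfold additive_def, intro ballI impI)
      fix A B assume AB: "A \<in> sets M" "B \<in> sets M" "A \<inter> B = {}"
      have "indicator (A \<union> B) = (\<lambda>y. indicator A y + indicator B y :: real)"
        using AB(3) by (auto simp: indicator_def fun_eq_iff)
      then show "\<mu> (A \<union> B) = \<mu> A + \<mu> B"
        using AB by (simp add: \<mu>_def add bounded_meas_indicator pos ennreal_plus)
    qed
    show "\<forall>A\<in>sets M. \<mu> A \<noteq> \<infinity>" by (simp add: \<mu>_def)
    fix A :: "nat \<Rightarrow> 'a set" assume A: "range A \<subseteq> sets M" "decseq A" "(\<Inter>i. A i) = {}"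
    have "(\<lambda>i. \<integral>y. indicator (A i) y * l y \<partial>M) \<longlonglongrightarrow> (\<integral>y. 0 \<partial>M)"
    proof (rule integral_dominated_convergence)
      show "integrable M (\<lambda>y. \<bar>l y\<bar>)" using l(1) by simp
      show "(\<lambda>y. indicator (A i) y * l y) \<in> borel_measurable M" for i
        using A(1) l(1) by (intro borel_measurable_times borel_measurable_indicator) auto
      show "AE y in M. norm (indicator (A i) y * l y) \<le> \<bar>l y\<bar>" for i
        by (intro AE_I2) (auto simp: indicator_def)
      show "AE y in M. (\<lambda>i. indicator (A i) y * l y) \<longlonglongrightarrow> 0"
      proof (intro AE_I2)
        fix y
        obtain n where "y \<notin> A n" using A(3) by auto
        then have "y \<notin> A i" if "n \<le> i" for i using A(2) that by (auto simp: decseq_def)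
        then have "\<forall>\<^sub>F i in sequentially. indicator (A i) y * l y = 0"
          unfolding eventually_sequentially by (intro exI[of _ n]) (simp add: indicator_def)
        then show "(\<lambda>i. indicator (A i) y * l y) \<longlonglongrightarrow> 0" by (rule tendsto_eventually)
      qed
    qed auto
    then have lim: "(\<lambda>i. C * (\<integral>y. indicator (A i) y * l y \<partial>M)) \<longlonglongrightarrow> C * 0"
      by (intro tendsto_mult tendsto_const) simp
    have "(\<lambda>i. \<Lambda> (indicator (A i))) \<longlonglongrightarrow> 0"
    proof (rule tendsto_sandwich[OF _ _ tendsto_const])
      show "(\<lambda>i. C * (\<integral>y. indicator (A i) y * l y \<partial>M)) \<longlonglongrightarrow> 0" using lim by simp
    qed (use A(1) pos l(2) in \<open>auto intro!: always_eventually\<close>)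
    then show "(\<lambda>i. \<mu> (A i)) \<longlonglongrightarrow> 0" unfolding \<mu>_def using tendsto_ennrealI by fastforce
  qed
  then have ms: "measure_space (space M) (sets M) \<mu>"
    using zero by (simp add: measure_space_def positive_def \<mu>_def sets.sigma_algebra_axioms)
  define N where "N = measure_of (space M) (sets M) \<mu>"
  have setsN: "sets N = sets M" by (simp add: N_def)
  have emN: "emeasure N B = \<mu> B" if "B \<in> sets M" for B
    unfolding N_def using that ms
    by (intro emeasure_measure_of_sigma) (auto simp: measure_space_def sets.sigma_algebra_axioms)
  have ac: "absolutely_continuous M N"
    unfolding absolutely_continuous_def
  proof
    fix B assume B: "B \<in> null_sets M"
    have "(\<integral>y. indicator B y * l y \<partial>M) = (\<integral>y. 0 \<partial>M)"
    proof (rule integral_cong_AE)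
      show "AE y in M. indicator B y * l y = 0"
        using AE_not_in[OF B] by eventually_elim (simp add: indicator_def)
    qed (use B l(1) in auto)
    then have "\<Lambda> (indicator B) = 0" using l(2)[of B] pos[of B] B by (auto simp: null_sets_def)
    then show "B \<in> null_sets N" using B by (auto simp: null_sets_def setsN emN \<mu>_def)
  qed
  define r where "r = RN_deriv M N"
  have r_meas: "r \<in> borel_measurable M" by (simp add: r_def)
  have dens: "density M r = N" unfolding r_def by (rule density_RN_deriv[OF ac setsN])
  have nnr: "(\<integral>\<^sup>+y. r y * indicator B y \<partial>M) = \<mu> B" if "B \<in> sets M" for B
    using emN[OF that] that r_meas by (simp add: dens[symmetric] emeasure_density)
  have "(\<integral>\<^sup>+y. r y \<partial>M) = (\<integral>\<^sup>+y. r y * indicator (space M) y \<partial>M)"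
    by (intro nn_integral_cong) (simp add: indicator_def)
  also have "\<dots> = \<mu> (space M)" by (rule nnr) simp
  finally have tot: "(\<integral>\<^sup>+y. r y \<partial>M) \<noteq> \<infinity>" by (simp add: \<mu>_def)
  then have rfin: "AE y in M. r y \<noteq> \<infinity>" using r_meas by (intro nn_integral_PInf_AE) auto
  define v where "v y = enn2real (r y)" for y
  have rv: "AE y in M. r y = ennreal (v y)"
    using rfin by eventually_elim (simp add: v_def less_top[symmetric])
  have v_meas: "v \<in> borel_measurable M" unfolding v_def using r_meas by measurable
  have v0: "0 \<le> v y" for y by (simp add: v_def)
  have v_int: "integrable M v"
  proof (rule integrableI_nonneg)
    have "(\<integral>\<^sup>+y. ennreal (v y) \<partial>M) = (\<integral>\<^sup>+y. r y \<partial>M)" using rv by (intro nn_integral_cong_AE) auto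
    then show "(\<integral>\<^sup>+y. ennreal (v y) \<partial>M) < \<infinity>" using tot by (simp add: less_top)
  qed (use v_meas v0 in auto)
  have ind: "\<Lambda> (indicator B) = (\<integral>y. indicator B y * v y \<partial>M)" if B: "B \<in> sets M" for B
  proof -
    have i: "integrable M (\<lambda>y. indicator B y * v y)" by (rule integrable_bounded_mult[OF bounded_meas_indicator[OF B] v_int])
    have "ennreal (\<integral>y. indicator B y * v y \<partial>M) = (\<integral>\<^sup>+y. ennreal (indicator B y * v y) \<partial>M)"
      using v0 by (intro nn_integral_eq_integral[symmetric] i) auto
    also have "\<dots> = (\<integral>\<^sup>+y. r y * indicator B y \<partial>M)"
      using rv by (intro nn_integral_cong_AE) (auto elim!: eventually_mono simp: indicator_def)
    also have "\<dots> = ennreal (\<Lambda> (indicator B))" using nnr[OF B] by (simp add: \<mu>_def)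
    finally show ?thesis
      using pos[OF B] v0 by (subst (asm) ennreal_inj) (auto intro!: integral_nonneg_AE)
  qed
  have "\<Lambda> h = (\<integral>y. h y * v y \<partial>M)" if h: "bounded_meas M h" for h
  proof -
    \<comment> \<open>The sequence is constant in \<open>k\<close>, so that convergence to 0 means
      equality.\<close>
    define D where "D (k::nat) h = \<Lambda> h - (\<integral>y. h y * v y \<partial>M)" for k h
    have "(\<lambda>k. D k h) \<longlonglongrightarrow> 0"
    proof (rule functional_tendsto_zero[where M = M and C = "C + (\<integral>y. v y \<partial>M)"])
      show "D k (\<lambda>y. g y + h y) = D k g + D k h" if "bounded_meas M g" "bounded_meas M h" for k g h
        using that by (simp add: D_def add distrib_right integrable_bounded_mult v_int)
      show "D k (\<lambda>y. c * g y) = c * D k g" if "bounded_meas M g" for k c g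
        using that by (simp add: D_def scale mult.assoc right_diff_distrib)
      show "\<bar>D k g\<bar> \<le> (C + (\<integral>y. v y \<partial>M)) * K"
        if "g \<in> borel_measurable M" "AE y in M. \<bar>g y\<bar> \<le> K" "0 \<le> K" for k g K
        using bound[OF that] integral_bounded_mult_le[OF that(1,2) v_int v0]
        by (simp add: D_def algebra_simps)
      show "(\<lambda>k. D k (indicator B)) \<longlonglongrightarrow> 0" if "B \<in> sets M" for B
        using that by (simp add: D_def ind)
    qed (rule h)
    then have "\<Lambda> h - (\<integral>y. h y * v y \<partial>M) = 0" unfolding D_def by (rule LIMSEQ_const_iff[THEN iffD1])
    then show ?thesis by simp
  qed
  then show ?thesis using v_int v0 by (intro that[of v])
qed

section \<open>The dominated setting\<close>

lemma bounded_meas_Re_Im: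
  assumes "g \<in> Linf M"
  shows "bounded_meas M (\<lambda>y. Re (g y))" "bounded_meas M (\<lambda>y. Im (g y))" "bounded_meas M (\<lambda>y. (cmod (g y))\<^sup>2)"
proof -
  obtain C where C: "g \<in> borel_measurable M" "AE y in M. cmod (g y) \<le> C" by (rule LinfD[OF assms])
  have "AE y in M. \<bar>Re (g y)\<bar> \<le> C" using C(2) by eventually_elim (meson abs_Re_le_cmod order_trans)
  then show "bounded_meas M (\<lambda>y. Re (g y))" using C(1) by (intro bounded_measI) auto
  have "AE y in M. \<bar>Im (g y)\<bar> \<le> C" using C(2) by eventually_elim (meson abs_Im_le_cmod order_trans)
  then show "bounded_meas M (\<lambda>y. Im (g y))" using C(1) by (intro bounded_measI) auto
  have "AE y in M. \<bar>(cmod (g y))\<^sup>2\<bar> \<le> C\<^sup>2" using C(2) by eventually_elim (auto intro: power_mono)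
  then show "bounded_meas M (\<lambda>y. (cmod (g y))\<^sup>2)" using C(1) by (intro bounded_measI) auto
qed

lemma integrable_Linf_mult:
  assumes g: "g \<in> Linf M" and v: "integrable M v"
  shows "integrable M (\<lambda>y. g y * (v y :: complex))"
proof -
  obtain C where C: "g \<in> borel_measurable M" "AE y in M. cmod (g y) \<le> C" "0 \<le> C" by (rule LinfD[OF g])
  show ?thesis
  proof (rule Bochner_Integration.integrable_bound)
    show "integrable M (\<lambda>y. C * cmod (v y))" using v by simp
    show "(\<lambda>y. g y * v y) \<in> borel_measurable M" using C(1) v by measurable
    show "AE y in M. norm (g y * v y) \<le> norm (C * cmod (v y))"
      using C(2) by eventually_elim (use C(3) in \<open>auto simp: norm_mult abs_mult intro!: mult_right_mono\<close>)
  qed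
qed

lemma integral_Linf_real:
  assumes g: "g \<in> Linf M" and v: "integrable M (v :: _ \<Rightarrow> real)"
  shows "(\<integral>y. g y * of_real (v y) \<partial>M) = Complex (\<integral>y. Re (g y) * v y \<partial>M) (\<integral>y. Im (g y) * v y \<partial>M)"
proof -
  have i: "integrable M (\<lambda>y. g y * complex_of_real (v y))" using v by (intro integrable_Linf_mult g) simp
  show ?thesis
    by (rule complex_eqI)
      (simp_all add: integral_Re[OF i, symmetric] integral_Im[OF i, symmetric])
qed

text \<open>Collects what the argument takes from the eigenbasis of D: sorted eigenvectors
  \<open>f\<close> of \<open>G\<close>, possibly with zero vectors, a common integrable bound for
  their densities, and the diagonal form of the positive powers of \<open>G\<close>. The operator D
  itself no longer appears.\<close>

locale dominated_rep = unitary_rep M U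
  for M :: "'f measure" and U :: "'h::complex_hilbert \<Rightarrow> 'f \<Rightarrow> complex" +
  fixes G :: "'h \<Rightarrow> 'h" and f :: "nat \<Rightarrow> 'h" and l :: "'f \<Rightarrow> real"
  assumes G_pos: "positive_op G" and G_ideal: "G \<in> L1inf" and f_eig: "eig_vectors G f"
    and l_int: "integrable M l" and l_dom: "\<And>i. AE y in M. (cmod (U (f i) y))\<^sup>2 \<le> l y"
    and powr_G: "\<And>r. 0 < r \<Longrightarrow> op_powr G r = diag_op (\<lambda>i. of_real (sing_val G i powr r)) f"
    and onb_ex: "\<exists>B :: 'h set. is_onb B"
begin

abbreviation s :: "nat \<Rightarrow> real"
  where "s \<equiv> sing_val G"

definition p :: "nat \<Rightarrow> ('f \<Rightarrow> real) \<Rightarrow> real"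
  where "p i h = (\<integral>y. h y * (cmod (U (f i) y))\<^sup>2 \<partial>M)"

abbreviation wmean :: "('f \<Rightarrow> real) \<Rightarrow> nat \<Rightarrow> real"
  where "wmean h \<equiv> log_mean (\<lambda>i. s i * p i h)"

abbreviation \<Lambda> :: "((nat \<Rightarrow>\<^sub>C real) \<Rightarrow>\<^sub>L real) \<Rightarrow> ('f \<Rightarrow> real) \<Rightarrow> real"
  where "\<Lambda> \<omega> h \<equiv> blinfun_apply \<omega> (Bcontfun (wmean h))"

lemma s_nonneg: "0 \<le> s i"
  by (rule sing_val_nonneg[OF L1inf_compact[OF G_ideal] positive_op_adjoint[OF G_pos]])

lemma s_decseq: "decseq s"
  by (rule sing_val_decseq[OF L1inf_compact[OF G_ideal] positive_op_adjoint[OF G_pos]])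

lemma log_mean_s_bounded: obtains C where "0 \<le> C" "\<And>k. log_mean s k \<le> C"
proof -
  obtain C where C: "\<And>k. \<bar>log_mean s k\<bar> \<le> C"
    using gamma_seq_bounded[OF G_ideal positive_op_adjoint[OF G_pos]] unfolding gamma_seq_log_mean by blast
  have "0 \<le> C" using C[of 0] by linarith
  then show ?thesis using C by (intro that[of C]) (auto intro: abs_le_D1)
qed

lemma norm_f_le: "(norm (f i))\<^sup>2 \<le> 1"
proof -
  have "orthosys UNIV f" using f_eig by (simp add: eig_vectors_def)
  then have "norm (f i) \<le> 1" by (rule orthosys_norm_le) simp
  then show ?thesis by (simp add: power_le_one)
qed

lemma s_mult_norm_f: "s i * (norm (f i))\<^sup>2 = s i"
  using f_eig orthosys_norm_eq[of UNIV f i] by (cases "f i = 0") (auto simp: eig_vectors_def)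

lemma U_sq_integrable: "integrable M (\<lambda>y. (cmod (U x y))\<^sup>2)"
  by (rule U_L2)

lemma p_add: "bounded_meas M g \<Longrightarrow> bounded_meas M h \<Longrightarrow> p i (\<lambda>y. g y + h y) = p i g + p i h"
  by (simp add: p_def distrib_right integrable_bounded_mult U_sq_integrable)

lemma p_scale: "p i (\<lambda>y. c * h y) = c * p i h"
  by (simp add: p_def mult.assoc)

lemma p_bound:
  assumes "h \<in> borel_measurable M" "AE y in M. \<bar>h y\<bar> \<le> K" "0 \<le> K"
  shows "\<bar>p i h\<bar> \<le> K"
proof -
  have "\<bar>p i h\<bar> \<le> K * (norm (f i))\<^sup>2"
    unfolding p_def U_norm[symmetric] by (rule integral_bounded_mult_le[OF assms(1,2) U_sq_integrable]) simp
  also have "\<dots> \<le> K" using norm_f_le[of i] assms(3) by (simp add: mult_left_le)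
  finally show ?thesis .
qed

lemma p_nonneg: "(\<And>y. 0 \<le> h y) \<Longrightarrow> 0 \<le> p i h"
  unfolding p_def by (intro integral_nonneg_AE) auto

lemma p_indicator_le: "B \<in> sets M \<Longrightarrow> p i (indicator B) \<le> (\<integral>y. indicator B y * l y \<partial>M)"
  unfolding p_def
proof (rule integral_mono_AE)
  assume B: "B \<in> sets M"
  show "integrable M (\<lambda>y. indicator B y * (cmod (U (f i) y))\<^sup>2)"
    by (rule integrable_bounded_mult[OF bounded_meas_indicator[OF B] U_sq_integrable])
  show "integrable M (\<lambda>y. indicator B y * l y)"
    by (rule integrable_bounded_mult[OF bounded_meas_indicator[OF B] l_int])
  show "AE y in M. indicator B y * (cmod (U (f i) y))\<^sup>2 \<le> indicator B y * l y"
    using l_dom[of i] by eventually_elim (auto simp: indicator_def)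
qed

lemma p_norm_sq: "g \<in> Linf M \<Longrightarrow> p i (\<lambda>y. (cmod (g y))\<^sup>2) = (norm (mo g (f i)))\<^sup>2"
  by (simp add: p_def norm_mult_op)

lemma wmean_bounded:
  assumes "bounded_meas M h"
  obtains C where "\<And>k. \<bar>wmean h k\<bar> \<le> C"
proof -
  obtain K where K: "h \<in> borel_measurable M" "AE y in M. \<bar>h y\<bar> \<le> K" using assms by (auto simp: bounded_meas_def)
  then have K': "AE y in M. \<bar>h y\<bar> \<le> \<bar>K\<bar>" by (auto elim!: eventually_mono)
  obtain C where C: "\<And>k. log_mean s k \<le> C" using log_mean_s_bounded by blast
  have "\<bar>s i * p i h\<bar> \<le> \<bar>K\<bar> * s i" for i
    using p_bound[OF K(1) K', of i] s_nonneg[of i]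
    by (simp add: abs_mult mult.commute[of "s i"] mult_right_mono)
  then have "\<bar>wmean h k\<bar> \<le> \<bar>K\<bar> * C" for k by (rule log_mean_bounded[OF _ C]) simp
  then show ?thesis by (rule that)
qed

lemma wmean_apply: "bounded_meas M h \<Longrightarrow> apply_bcontfun (Bcontfun (wmean h)) = wmean h"
  by (metis wmean_bounded apply_Bcontfun_nat)

lemma \<Lambda>_add:
  assumes "bounded_meas M g" "bounded_meas M h"
  shows "\<Lambda> \<omega> (\<lambda>y. g y + h y) = \<Lambda> \<omega> g + \<Lambda> \<omega> h"
proof -
  have eq: "wmean (\<lambda>y. g y + h y) k = wmean g k + wmean h k" for k
    by (simp add: p_add[OF assms] distrib_left log_mean_add)
  have "Bcontfun (wmean (\<lambda>y. g y + h y)) = Bcontfun (wmean g) + Bcontfun (wmean h)"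
    by (rule bcontfun_eqI)
      (simp only: wmean_apply[OF bounded_meas_add[OF assms]] plus_bcontfun.rep_eq wmean_apply[OF assms(1)]
        wmean_apply[OF assms(2)] eq)
  then show ?thesis by (simp add: blinfun.add_right)
qed

lemma \<Lambda>_scale:
  assumes "bounded_meas M g"
  shows "\<Lambda> \<omega> (\<lambda>y. c * g y) = c * \<Lambda> \<omega> g"
proof -
  have eq: "wmean (\<lambda>y. c * g y) k = c * wmean g k" for k
    by (simp only: p_scale mult.left_commute[of _ c] log_mean_scale)
  have "Bcontfun (wmean (\<lambda>y. c * g y)) = c *\<^sub>R Bcontfun (wmean g)"
    by (rule bcontfun_eqI)
      (simp only: wmean_apply[OF bounded_meas_scale[OF assms]] scaleR_bcontfun.rep_eq wmean_apply[OF assms(1)]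
        eq real_scaleR_def)
  then show ?thesis by (simp add: blinfun.scaleR_right)
qed

lemma \<Lambda>_le:
  assumes w: "\<omega> \<in> DL2 TYPE('h)" and h: "bounded_meas M h" and le: "\<And>k. wmean h k \<le> t"
  shows "\<Lambda> \<omega> h \<le> t"
proof -
  have "\<Lambda> \<omega> h \<le> blinfun_apply \<omega> (const_bcontfun t)"
    by (rule DL2_mono[OF w]) (simp add: wmean_apply[OF h] const_bcontfun.rep_eq le)
  then show ?thesis by (simp add: DL2_const[OF w])
qed

text \<open>Domination enters through \<open>p_indicator_le\<close>: each weight of a set is at most
  the integral of \<open>l\<close> over it, and averaging against the bounded logarithmic means of
  \<open>s\<close> costs the factor \<open>C\<close>.\<close>

lemma \<Lambda>_density:
  assumes w: "\<omega> \<in> DL2 TYPE('h)"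
  obtains v where "integrable M v" "\<And>y. 0 \<le> v y" "\<And>h. bounded_meas M h \<Longrightarrow> \<Lambda> \<omega> h = (\<integral>y. h y * v y \<partial>M)"
proof -
  obtain C where C: "0 \<le> C" "\<And>k. log_mean s k \<le> C" by (rule log_mean_s_bounded) (rule that; assumption)
  show ?thesis
  proof (rule dominated_functional_density[where M = M and \<Lambda> = "\<Lambda> \<omega>" and C = C and l = l])
    show "\<bar>\<Lambda> \<omega> g\<bar> \<le> C * K" if K: "g \<in> borel_measurable M" "AE y in M. \<bar>g y\<bar> \<le> K" "0 \<le> K" for g K
    proof -
      have g: "bounded_meas M g" using K by (intro bounded_measI)
      have "\<bar>s i * p i g\<bar> \<le> K * s i" for i
        using p_bound[OF K, of i] s_nonneg[of i] by (simp add: abs_mult mult.commute[of "s i"] mult_right_mono)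
      then have le: "\<bar>wmean g k\<bar> \<le> K * C" for k by (rule log_mean_bounded[OF _ C(2) K(3)])
      have "\<Lambda> \<omega> g \<le> K * C" using le by (intro \<Lambda>_le[OF w g]) (auto intro: abs_le_D1)
      moreover have "\<Lambda> \<omega> (\<lambda>y. (-1) * g y) \<le> K * C"
      proof (rule \<Lambda>_le[OF w bounded_meas_scale[OF g]])
        fix k
        have "wmean (\<lambda>y. (-1) * g y) k = (-1) * wmean g k"
          by (simp only: p_scale mult.left_commute[of _ "-1"] log_mean_scale)
        then show "wmean (\<lambda>y. (-1) * g y) k \<le> K * C" using le[of k] by (simp add: abs_le_iff)
      qed
      ultimately show ?thesis unfolding \<Lambda>_scale[OF g] by (simp add: abs_le_iff mult.commute)
    qed
    show "0 \<le> \<Lambda> \<omega> (indicator B)" if B: "B \<in> sets M" for B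
    proof (rule DL2_nonneg[OF w])
      fix k
      have "0 \<le> wmean (indicator B) k"
        unfolding log_mean_ge_iff using s_nonneg by (simp add: sum_nonneg p_nonneg)
      then show "0 \<le> apply_bcontfun (Bcontfun (wmean (indicator B))) k"
        by (simp add: wmean_apply[OF bounded_meas_indicator[OF B]])
    qed
    show "\<Lambda> \<omega> (indicator B) \<le> C * (\<integral>y. indicator B y * l y \<partial>M)" if B: "B \<in> sets M" for B
    proof (rule \<Lambda>_le[OF w bounded_meas_indicator[OF B]])
      fix k
      define q where "q = (\<integral>y. indicator B y * l y \<partial>M)"
      have q0: "0 \<le> q" using p_indicator_le[OF B, of 0] p_nonneg[of "indicator B" 0] by (simp add: q_def)
      have "wmean (indicator B) k \<le> log_mean (\<lambda>i. q * s i) k"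
        unfolding q_def
        by (intro log_mean_mono, subst mult.commute) (rule mult_right_mono[OF p_indicator_le[OF B] s_nonneg])
      also have "\<dots> = q * log_mean s k" by (rule log_mean_scale)
      also have "\<dots> \<le> q * C" using C(2) q0 by (rule mult_left_mono)
      finally show "wmean (indicator B) k \<le> C * (\<integral>y. indicator B y * l y \<partial>M)" by (simp add: q_def mult.commute)
    qed
  qed (use finite_M l_int \<Lambda>_add \<Lambda>_scale that in \<open>simp_all\<close>)
qed

text \<open>\<open>dixmier_trace_compose\<close> expresses the trace by the functional at |g + c|^2.
  Under its density the polarization identity, now for complex numbers, recombines these functions
  to \<open>g\<close>.\<close>

lemma dixmier_trace_mult:
  assumes w: "\<omega> \<in> DL2 TYPE('h)" and v: "integrable M v" "\<And>h. bounded_meas M h \<Longrightarrow> \<Lambda> \<omega> h = (\<integral>y. h y * v y \<partial>M)"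
    and g: "g \<in> Linf M"
  shows "dixmier_trace \<omega> (mo g \<circ> G) = (\<integral>y. g y * of_real (v y) \<partial>M)"
proof -
  define C where "C = {1, \<i>, -1, -\<i>}"
  have gc: "(\<lambda>y. g y + c) \<in> Linf M" for c by (rule Linf_add[OF g Linf_const])
  have compl: "complemented (\<lambda>x. mo g x + c *\<^sub>C x)" for c
    unfolding mult_op_add_const[OF g] by (rule mult_op_complemented[OF gc])
  have norm: "(norm (mo g x + c *\<^sub>C x))\<^sup>2 = (norm (mo (\<lambda>y. g y + c) x))\<^sup>2" for c x
    using fun_cong[OF mult_op_add_const[OF g, of c], of x] by simp
  have val: "blinfun_apply \<omega> (Bcontfun (log_mean (\<lambda>i. s i * (norm (mo g (f i) + c *\<^sub>C f i))\<^sup>2)))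
      = (\<integral>y. (cmod (g y + c))\<^sup>2 * v y \<partial>M)" for c
    unfolding norm p_norm_sq[OF gc, symmetric] by (rule v(2)[OF bounded_meas_Re_Im(3)[OF gc]])
  have "dixmier_trace \<omega> (mo g \<circ> G) = (\<Sum>c\<in>C. c / 4 * of_real (\<integral>y. (cmod (g y + c))\<^sup>2 * v y \<partial>M))"
    unfolding C_def dixmier_trace_compose[OF w G_pos G_ideal f_eig mult_op_bounded[OF g] mult_op_adjoint[OF g] compl] val ..
  also have "\<dots> = (\<Sum>c\<in>C. (\<integral>y. c / 4 * of_real ((cmod (g y + c))\<^sup>2 * v y) \<partial>M))"
    by (simp add: integral_complex_of_real del: of_real_mult of_real_power)
  also have "\<dots> = (\<integral>y. (\<Sum>c\<in>C. c / 4 * of_real ((cmod (g y + c))\<^sup>2 * v y)) \<partial>M)"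
  proof (rule Bochner_Integration.integral_sum[symmetric])
    fix c
    have "integrable M (\<lambda>y. (cmod (g y + c))\<^sup>2 * v y)"
      by (rule integrable_bounded_mult[OF bounded_meas_Re_Im(3)[OF gc] v(1)])
    then show "integrable M (\<lambda>y. c / 4 * complex_of_real ((cmod (g y + c))\<^sup>2 * v y))"
      by (intro integrable_mult_right integrable_of_real)
  qed
  also have "\<dots> = (\<integral>y. g y * of_real (v y) \<partial>M)"
  proof (rule Bochner_Integration.integral_cong[OF refl])
    fix y
    have polar: "(\<Sum>c\<in>C. c / 4 * of_real ((cmod (z + c))\<^sup>2)) = z" for z
      unfolding C_def
      by (simp add: complex_eq_iff[of 1 \<i>] complex_eq_iff[of \<i> 1] complex_eq_iff[of "\<i>" "-1"]
          complex_eq_iff[of "-\<i>" "1"] complex_eq_iff[of "1" "-\<i>"] complex_eq_iff[of "-1" "-\<i>"] del: of_real_power)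
        (simp add: complex_eq_iff cmod_power2, simp add: power2_eq_square field_simps)
    have "(\<Sum>c\<in>C. c / 4 * of_real ((cmod (g y + c))\<^sup>2 * v y)) = (\<Sum>c\<in>C. c / 4 * of_real ((cmod (g y + c))\<^sup>2)) * of_real (v y)"
      by (simp add: sum_distrib_right mult.assoc)
    then show "(\<Sum>c\<in>C. c / 4 * complex_of_real ((cmod (g y + c))\<^sup>2 * v y)) = g y * complex_of_real (v y)"
      unfolding polar .
  qed
  finally show ?thesis .
qed

lemma projection_trace:
  assumes w: "\<omega> \<in> DL2 TYPE('h)" and g: "g \<in> Linf M" and P: "projection_op (mo g)"
  shows "mo g \<circ> G \<circ> mo g \<in> L1inf"
    "dixmier_trace \<omega> (mo g \<circ> G \<circ> mo g) = of_real (\<Lambda> \<omega> (\<lambda>y. (cmod (g y))\<^sup>2))"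
  using connes_projection[OF w G_pos G_ideal f_eig P] by (simp_all add: p_norm_sq[OF g])

text \<open>A projection is a contraction; this supplies the upper bound 1 for the weights in the
  Tauberian theorem.\<close>

lemma projection_p_le_one:
  assumes g: "g \<in> Linf M" and P: "projection_op (mo g)"
  shows "p i (\<lambda>y. (cmod (g y))\<^sup>2) \<le> 1"
proof -
  have P: "is_adjoint (mo g) (mo g)" "mo g (mo g x) = mo g x" for x
    using P by (auto simp: projection_op_def selfadjoint_op_def is_adjoint_def o_def fun_eq_iff)
  have "(norm (mo g (f i)))\<^sup>2 = Re (cinner (f i) (mo g (f i)))"
    by (simp add: norm_sq_cinner is_adjointD[OF P(1)] P(2))
  also have "\<dots> \<le> norm (f i) * norm (mo g (f i))"
    by (rule order_trans[OF complex_Re_le_cmod cinner_cauchy_schwarz])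
  finally have "norm (mo g (f i)) * norm (mo g (f i)) \<le> norm (f i) * norm (mo g (f i))"
    by (simp add: power2_eq_square)
  then have "norm (mo g (f i)) \<le> norm (f i)"
    by (cases "mo g (f i) = 0") (auto dest: mult_right_le_imp_le)
  then have "(norm (mo g (f i)))\<^sup>2 \<le> (norm (f i))\<^sup>2" by (rule power_mono) simp
  then show ?thesis unfolding p_norm_sq[OF g] using norm_f_le by (rule order_trans)
qed

lemma indicator_projection:
  assumes B: "B \<in> sets M"
  shows "projection_op (mo (\<lambda>y. of_real (indicator B y)))"
proof -
  define g where "g = (\<lambda>y. complex_of_real (indicator B y))"
  have g: "g \<in> Linf M" unfolding g_def by (rule Linf_indicator[OF B])
  have "(\<lambda>y. cnj (g y)) = g" "(\<lambda>y. g y * g y) = g" by (auto simp: g_def indicator_def fun_eq_iff)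
  then have "is_adjoint (mo g) (mo g)" "mo g \<circ> mo g = mo g"
    using mult_op_adjoint[OF g] mult_op_compose[OF g g] by auto
  then have "projection_op (mo g)"
    using mult_op_bounded[OF g] by (simp add: projection_op_def selfadjoint_op_def is_adjoint_def)
  then show ?thesis by (simp add: g_def)
qed

lemma s_powr_summable: "0 < a \<Longrightarrow> summable (\<lambda>i. s i powr (1 + a))"
proof -
  assume "0 < a"
  obtain C where "\<And>k. log_mean s k \<le> C" using log_mean_s_bounded by blast
  then show ?thesis using \<open>0 < a\<close> by (rule sum_powr_summable[OF s_decseq s_nonneg])
qed

text \<open>Domination makes the series converge absolutely almost everywhere, with terms at most
  \<open>s i powr (1 + a)\<close> times |g| l, and \<open>p_bound\<close> controls the integrals of
  the terms. Together these justify termwise integration.\<close>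

lemma zeta_series:
  assumes a: "0 < a" and g: "g \<in> Linf M"
  defines "F \<equiv> \<lambda>i y. g y * of_real (s i powr (1 + a) * (cmod (U (f i) y))\<^sup>2)"
  shows "integrable M (\<lambda>y. \<Sum>i. F i y)"
    "(\<lambda>i. of_real (s i powr (1 + a)) * cinner (f i) (mo g (f i))) sums (\<integral>y. (\<Sum>i. F i y) \<partial>M)"
    "AE y in M. summable (\<lambda>i. F i y)"
proof -
  obtain C where C: "g \<in> borel_measurable M" "AE y in M. cmod (g y) \<le> C" "0 \<le> C" by (rule LinfD[OF g])
  have F: "F i y = of_real (s i powr (1 + a)) * (g y * of_real ((cmod (U (f i) y))\<^sup>2))" for i y
    by (simp add: F_def)
  have i0: "integrable M (\<lambda>y. g y * complex_of_real ((cmod (U (f i) y))\<^sup>2))" for i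
    by (rule integrable_mult_norm_sq[OF C(1,2)])
  then have i1: "integrable M (F i)" for i unfolding F by (intro integrable_mult_right)
  have s1: "AE y in M. summable (\<lambda>i. norm (F i y))"
  proof -
    have "AE y in M. \<forall>i. (cmod (U (f i) y))\<^sup>2 \<le> l y" using l_dom by (simp add: AE_all_countable)
    then show ?thesis
    proof eventually_elim
      case (elim y)
      show ?case
      proof (rule summable_comparison_test')
        show "summable (\<lambda>i. s i powr (1 + a) * (cmod (g y) * l y))" by (rule summable_mult2[OF s_powr_summable[OF a]])
        fix i
        have "cmod (g y) * (cmod (U (f i) y))\<^sup>2 \<le> cmod (g y) * l y" using elim by (intro mult_left_mono) auto
        then have "s i powr (1 + a) * (cmod (g y) * (cmod (U (f i) y))\<^sup>2) \<le> s i powr (1 + a) * (cmod (g y) * l y)"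
          by (rule mult_left_mono) simp
        then show "norm (norm (F i y)) \<le> s i powr (1 + a) * (cmod (g y) * l y)"
          unfolding F by (simp add: norm_mult norm_power)
      qed
    qed
  qed
  have s2: "summable (\<lambda>i. \<integral>y. norm (F i y) \<partial>M)"
  proof (rule summable_comparison_test')
    show "summable (\<lambda>i. s i powr (1 + a) * C)" by (rule summable_mult2[OF s_powr_summable[OF a]])
    fix i
    have "(\<integral>y. norm (F i y) \<partial>M) = s i powr (1 + a) * p i (\<lambda>y. cmod (g y))"
      unfolding F p_def by (simp add: norm_mult norm_power)
    also have "\<dots> \<le> s i powr (1 + a) * C"
      using p_bound[of "\<lambda>y. cmod (g y)" C i] C by (intro mult_left_mono) auto
    finally show "norm (\<integral>y. norm (F i y) \<partial>M) \<le> s i powr (1 + a) * C"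
      by (simp add: integral_nonneg_AE)
  qed
  show "integrable M (\<lambda>y. \<Sum>i. F i y)" by (rule integrable_suminf[OF i1 s1 s2])
  show "(\<lambda>i. of_real (s i powr (1 + a)) * cinner (f i) (mo g (f i))) sums (\<integral>y. (\<Sum>i. F i y) \<partial>M)"
    using sums_integral[OF i1 s1 s2] by (simp add: F cinner_mult_op[OF g])
  show "AE y in M. summable (\<lambda>i. F i y)" using s1 by eventually_elim (rule summable_norm_cancel)
qed

text \<open>\<open>zeta_density\<close> is chosen among all solutions of the trace identity, so a
  solution must be exhibited: the series of the eigenvector densities with coefficients
  \<open>s i powr (1 + a)\<close>.\<close>

lemma zeta_density_props:
  assumes a: "0 < a"
  shows "integrable M (zeta_density M U G (1 + a))"
    "\<And>g. g \<in> Linf M \<Longrightarrow> (\<integral>y. g y * zeta_density M U G (1 + a) y \<partial>M) =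
      (\<Sum>i. of_real (s i powr (1 + a)) * cinner (f i) (mo g (f i)))"
proof -
  have orth: "orthosys UNIV f" using f_eig by (simp add: eig_vectors_def)
  have tr: "trace_op (mo g \<circ> op_powr G (1 + a)) = (\<Sum>i. of_real (s i powr (1 + a)) * cinner (f i) (mo g (f i)))"
    if "g \<in> Linf M" for g
    using a s_powr_summable[OF a]
    by (simp add: powr_G trace_op_compose_diag[OF onb_ex mult_op_bounded[OF that] orth])
  define v where "v y = (\<Sum>i. 1 * complex_of_real (s i powr (1 + a) * (cmod (U (f i) y))\<^sup>2))" for y
  have v: "integrable M v" unfolding v_def by (rule zeta_series(1)[OF a Linf_const])
  have "trace_op (mo g \<circ> op_powr G (1 + a)) = (\<integral>y. g y * v y \<partial>M)" if g: "g \<in> Linf M" for g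
  proof -
    have "trace_op (mo g \<circ> op_powr G (1 + a)) = (\<integral>y. (\<Sum>i. g y * of_real (s i powr (1 + a) * (cmod (U (f i) y))\<^sup>2)) \<partial>M)"
      unfolding tr[OF g] by (rule sums_unique[OF zeta_series(2)[OF a g], symmetric])
    also have "\<dots> = (\<integral>y. g y * v y \<partial>M)"
    proof (rule integral_cong_AE)
      show "AE y in M. (\<Sum>i. g y * complex_of_real (s i powr (1 + a) * (cmod (U (f i) y))\<^sup>2)) = g y * v y"
        using zeta_series(3)[OF a Linf_const[of 1]]
      proof eventually_elim
        case (elim y)
        show ?case unfolding v_def using suminf_mult[OF elim, of "g y"] by simp
      qed
    qed (use borel_measurable_integrable[OF zeta_series(1)[OF a g]] borel_measurable_integrable[OF integrable_Linf_mult[OF g v]] in auto)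
    finally show ?thesis .
  qed
  then have "\<exists>v. integrable M v \<and> (\<forall>g\<in>Linf M. trace_op (mo g \<circ> op_powr G (1 + a)) = (\<integral>y. g y * v y \<partial>M))"
    using v by blast
  from someI_ex[OF this]
  have z: "integrable M (zeta_density M U G (1 + a))"
    "\<forall>g\<in>Linf M. trace_op (mo g \<circ> op_powr G (1 + a)) = (\<integral>y. g y * zeta_density M U G (1 + a) y \<partial>M)"
    unfolding zeta_density_def by auto
  show "integrable M (zeta_density M U G (1 + a))" by (rule z(1))
  show "\<And>g. g \<in> Linf M \<Longrightarrow> (\<integral>y. g y * zeta_density M U G (1 + a) y \<partial>M) =
      (\<Sum>i. of_real (s i powr (1 + a)) * cinner (f i) (mo g (f i)))"
    using z(2) tr by simp
qed

definition zres :: "nat \<Rightarrow> ('f \<Rightarrow> real) \<Rightarrow> real"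
  where "zres k h = recip k * (\<Sum>i. s i powr (1 + recip k) * p i h)"

abbreviation zdens :: "nat \<Rightarrow> 'f \<Rightarrow> complex"
  where "zdens k y \<equiv> complex_of_real (1 / real (Suc k)) * zeta_density M U G (1 + 1 / real (Suc k)) y"

lemma zres_summable: "bounded_meas M h \<Longrightarrow> summable (\<lambda>i. s i powr (1 + recip k) * p i h)"
proof -
  assume "bounded_meas M h"
  then obtain K where K: "h \<in> borel_measurable M" "AE y in M. \<bar>h y\<bar> \<le> K" by (auto simp: bounded_meas_def)
  then have K': "AE y in M. \<bar>h y\<bar> \<le> \<bar>K\<bar>" by (auto elim!: eventually_mono)
  show ?thesis
  proof (rule summable_comparison_test')
    show "summable (\<lambda>i. s i powr (1 + recip k) * \<bar>K\<bar>)" by (rule summable_mult2[OF s_powr_summable]) simp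
    show "norm (s i powr (1 + recip k) * p i h) \<le> s i powr (1 + recip k) * \<bar>K\<bar>" for i
      using p_bound[OF K(1) K', of i] by (simp add: abs_mult mult_left_mono)
  qed
qed

lemma zdens_integral:
  assumes g: "g \<in> Linf M"
  shows "(\<integral>y. g y * zdens k y \<partial>M) = Complex (zres k (\<lambda>y. Re (g y))) (zres k (\<lambda>y. Im (g y)))"
proof -
  have "(\<integral>y. g y * zdens k y \<partial>M) = complex_of_real (recip k) * (\<integral>y. g y * zeta_density M U G (1 + recip k) y \<partial>M)"
    by (subst integral_mult_right_zero[symmetric]) (simp add: mult_ac)
  also have "\<dots> = complex_of_real (recip k) * (\<Sum>i. of_real (s i powr (1 + recip k)) * cinner (f i) (mo g (f i)))"
    by (subst zeta_density_props(2)[OF _ g]) auto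
  also have "(\<Sum>i. of_real (s i powr (1 + recip k)) * cinner (f i) (mo g (f i)))
      = Complex (\<Sum>i. s i powr (1 + recip k) * p i (\<lambda>y. Re (g y))) (\<Sum>i. s i powr (1 + recip k) * p i (\<lambda>y. Im (g y)))"
  proof (rule sums_unique[symmetric])
    have "cinner (f i) (mo g (f i)) = Complex (p i (\<lambda>y. Re (g y))) (p i (\<lambda>y. Im (g y)))" for i
      unfolding cinner_mult_op[OF g] p_def by (rule integral_Linf_real[OF g U_sq_integrable])
    then have "of_real (s i powr (1 + recip k)) * cinner (f i) (mo g (f i)) =
        Complex (s i powr (1 + recip k) * p i (\<lambda>y. Re (g y))) (s i powr (1 + recip k) * p i (\<lambda>y. Im (g y)))" for i
      by (simp add: complex_eq_iff)
    then show "(\<lambda>i. of_real (s i powr (1 + recip k)) * cinner (f i) (mo g (f i))) sums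
        Complex (\<Sum>i. s i powr (1 + recip k) * p i (\<lambda>y. Re (g y))) (\<Sum>i. s i powr (1 + recip k) * p i (\<lambda>y. Im (g y)))"
      unfolding sums_complex_iff
      using summable_sums[OF zres_summable[OF bounded_meas_Re_Im(1)[OF g]]]
        summable_sums[OF zres_summable[OF bounded_meas_Re_Im(2)[OF g]]] by simp
  qed
  finally show ?thesis by (simp add: zres_def complex_eq_iff)
qed

text \<open>The test function is |g|^2 for a projection \<open>mo g\<close>. Once the logarithmic
  means converge, \<open>DL2_limit\<close> gives all functionals the same value.
  \<open>\<omega>0\<close> is the functional with which \<open>projection_trace\<close> yields
  membership in \<open>L1inf\<close>.\<close>

lemma spectrally_measurable_if_weak_limit:
  assumes v: "weak_L1_limit M zdens v" and \<omega>0: "\<omega>0 \<in> DL2 TYPE('h)"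
  shows "spectrally_measurable M U G"
  unfolding spectrally_measurable_def
proof (intro ballI impI)
  fix g assume g: "g \<in> Linf M" and P: "projection_op (mo g)"
  define h where "h y = (cmod (g y))\<^sup>2" for y
  have hb: "bounded_meas M h" unfolding h_def by (rule bounded_meas_Re_Im(3)[OF g])
  have hL: "(\<lambda>y. complex_of_real (h y)) \<in> Linf M"
    using hb unfolding bounded_meas_def by (auto intro!: LinfI)
  have "(\<lambda>k. \<integral>y. of_real (h y) * zdens k y \<partial>M) \<longlonglongrightarrow> (\<integral>y. of_real (h y) * v y \<partial>M)"
    using v hL by (simp add: weak_L1_limit_def)
  then have "(\<lambda>k. Re (\<integral>y. of_real (h y) * zdens k y \<partial>M)) \<longlonglongrightarrow> Re (\<integral>y. of_real (h y) * v y \<partial>M)"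
    by (rule tendsto_Re)
  then have lim: "(\<lambda>k. zres k h) \<longlonglongrightarrow> Re (\<integral>y. of_real (h y) * v y \<partial>M)"
    by (simp only: zdens_integral[OF hL] complex.sel Re_complex_of_real)
  obtain C where C: "\<And>k. log_mean s k \<le> C" using log_mean_s_bounded by blast
  have conv: "wmean h \<longlonglongrightarrow> Re (\<integral>y. of_real (h y) * v y \<partial>M)"
    by (rule tauberian_zeta[OF s_decseq s_nonneg C _ _ lim[unfolded zres_def]])
      (simp_all add: p_nonneg projection_p_le_one[OF g P, folded h_def], simp add: h_def p_nonneg)
  have "\<Lambda> \<omega> h = Re (\<integral>y. of_real (h y) * v y \<partial>M)" if w: "\<omega> \<in> DL2 TYPE('h)" for \<omega>
    by (rule DL2_limit[OF w]) (simp add: wmean_apply[OF hb] conv)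
  then show "connes_measurable (mo g \<circ> G \<circ> mo g)"
    unfolding connes_measurable_def using projection_trace[OF _ g P, folded h_def] \<omega>0 by auto
qed

text \<open>Indicators correspond to projections, for which measurability forces all functionals to
  agree with the density \<open>v\<close> of one of them. From indicators to bounded functions the
  passage is \<open>functional_tendsto_zero\<close>.\<close>

lemma weak_limit_if_spectrally_measurable:
  assumes meas: "spectrally_measurable M U G" and w: "\<omega> \<in> DL2 TYPE('h)"
    and v: "integrable M v" "\<And>y. 0 \<le> v y" "\<And>h. bounded_meas M h \<Longrightarrow> \<Lambda> \<omega> h = (\<integral>y. h y * v y \<partial>M)"
  shows "weak_L1_limit M zdens (\<lambda>y. of_real (v y))"
proof -
  obtain C where C: "\<And>k. log_mean s k \<le> C" using log_mean_s_bounded by blast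
  have p01: "0 \<le> p i (indicator B)" "p i (indicator B) \<le> 1" if "B \<in> sets M" for i B
    using p_nonneg[of "indicator B" i] p_bound[of "indicator B" 1 i] that by (auto simp: indicator_def abs_le_iff)
  have mean: "wmean (indicator B) \<longlonglongrightarrow> (\<integral>y. indicator B y * v y \<partial>M)" if B: "B \<in> sets M" for B
  proof -
    define g where "g = (\<lambda>y. complex_of_real (indicator B y))"
    have g: "g \<in> Linf M" unfolding g_def by (rule Linf_indicator[OF B])
    have P: "projection_op (mo g)" using indicator_projection[OF B] by (simp add: g_def)
    have gB: "(\<lambda>y. (cmod (g y))\<^sup>2) = indicator B" by (auto simp: g_def indicator_def fun_eq_iff)
    have eq: "\<Lambda> \<omega>' (indicator B) = (\<integral>y. indicator B y * v y \<partial>M)" if w': "\<omega>' \<in> DL2 TYPE('h)" for \<omega>'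
    proof -
      have "dixmier_trace \<omega>' (mo g \<circ> G \<circ> mo g) = dixmier_trace \<omega> (mo g \<circ> G \<circ> mo g)"
        using meas g P w w' unfolding spectrally_measurable_def connes_measurable_def by blast
      then have "\<Lambda> \<omega>' (indicator B) = \<Lambda> \<omega> (indicator B)"
        unfolding projection_trace(2)[OF w g P] projection_trace(2)[OF w' g P] gB by (simp only: of_real_eq_iff)
      then show ?thesis by (simp add: v(3)[OF bounded_meas_indicator[OF B]])
    qed
    have "wmean (indicator B) k \<le> log_mean s k" for k
      using p01[OF B] s_nonneg by (intro log_mean_mono) (simp add: mult_left_le)
    then have le: "wmean (indicator B) k \<le> C" for k using C by (rule order_trans)
    show ?thesis
      by (rule log_mean_limit_if_DL2_constant[OF _ le _ eq])
        (use p01[OF B] s_nonneg v(2) in \<open>auto intro!: integral_nonneg_AE\<close>)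
  qed
  \<comment> \<open>The whole space as test set shows that \<open>log_mean s\<close> itself
    converges, as \<open>abelian_zeta\<close> requires.\<close>
  have p_space: "s i * p i (indicator (space M)) = s i" for i
  proof -
    have "p i (indicator (space M)) = (norm (f i))\<^sup>2"
      unfolding p_def U_norm[symmetric] by (intro Bochner_Integration.integral_cong) auto
    then show ?thesis by (simp add: s_mult_norm_f)
  qed
  have s_lim: "log_mean s \<longlonglongrightarrow> (\<integral>y. indicator (space M) y * v y \<partial>M)"
    using mean[of "space M"] by (simp add: p_space)
  \<comment> \<open>A bound uniform in \<open>k\<close> lets the convergence on indicators extend to
    bounded functions.\<close>
  obtain R where R: "\<And>k. recip k * (\<Sum>i. s i powr (1 + recip k)) \<le> R"
  proof -
    have "Bseq (\<lambda>k. recip k * (\<Sum>i. s i powr (1 + recip k)))"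
      using sum_powr_limit[OF s_decseq s_nonneg s_lim] by (intro convergent_imp_Bseq convergentI)
    then obtain R where "\<And>k. norm (recip k * (\<Sum>i. s i powr (1 + recip k))) \<le> R" by (rule BseqE) blast
    then show thesis by (intro that[of R]) (rule abs_le_D1, simp only: real_norm_def)
  qed
  have lim: "(\<lambda>k. zres k h - (\<integral>y. h y * v y \<partial>M)) \<longlonglongrightarrow> 0" if h: "bounded_meas M h" for h
  proof (rule functional_tendsto_zero[where M = M and C = "R + (\<integral>y. v y \<partial>M)" and h = h])
    show "zres k (\<lambda>y. g y + h y) - (\<integral>y. (g y + h y) * v y \<partial>M) =
        zres k g - (\<integral>y. g y * v y \<partial>M) + (zres k h - (\<integral>y. h y * v y \<partial>M))"
      if "bounded_meas M g" "bounded_meas M h" for k g h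
      using that by (simp add: zres_def p_add distrib_left distrib_right suminf_add[symmetric] zres_summable
          integrable_bounded_mult v(1) del: of_nat_Suc)
    show "zres k (\<lambda>y. c * g y) - (\<integral>y. c * g y * v y \<partial>M) = c * (zres k g - (\<integral>y. g y * v y \<partial>M))"
      if "bounded_meas M g" for k c g
    proof -
      have "(\<Sum>i. s i powr (1 + recip k) * p i (\<lambda>y. c * g y)) = c * (\<Sum>i. s i powr (1 + recip k) * p i g)"
        by (subst suminf_mult[OF zres_summable[OF that], symmetric]) (simp only: p_scale mult.left_commute[of _ c])
      then have "zres k (\<lambda>y. c * g y) = c * zres k g" by (simp only: zres_def mult.left_commute[of _ c])
      moreover have "(\<integral>y. c * g y * v y \<partial>M) = c * (\<integral>y. g y * v y \<partial>M)" by (simp add: mult.assoc)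
      ultimately show ?thesis by (simp only: right_diff_distrib)
    qed
    show "\<bar>zres k g - (\<integral>y. g y * v y \<partial>M)\<bar> \<le> (R + (\<integral>y. v y \<partial>M)) * K"
      if K: "g \<in> borel_measurable M" "AE y in M. \<bar>g y\<bar> \<le> K" "0 \<le> K" for k g K
    proof -
      have g: "bounded_meas M g" using K by (intro bounded_measI)
      have sm: "summable (\<lambda>i. s i powr (1 + recip k))" by (rule s_powr_summable) simp
      have "\<bar>s i powr (1 + recip k) * p i g\<bar> \<le> s i powr (1 + recip k) * K" for i
        using p_bound[OF K, of i] by (simp add: abs_mult mult_left_mono)
      then have "norm (\<Sum>i. s i powr (1 + recip k) * p i g) \<le> (\<Sum>i. s i powr (1 + recip k) * K)"
        by (intro norm_suminf_le summable_mult2 sm) simp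
      also have "\<dots> = (\<Sum>i. s i powr (1 + recip k)) * K" by (rule suminf_mult2[OF sm, symmetric])
      finally have "recip k * \<bar>\<Sum>i. s i powr (1 + recip k) * p i g\<bar> \<le> recip k * ((\<Sum>i. s i powr (1 + recip k)) * K)"
        by (intro mult_left_mono) auto
      also have "\<dots> \<le> R * K" using mult_right_mono[OF R[of k] K(3)] by (simp add: mult.assoc)
      finally have "\<bar>zres k g\<bar> \<le> R * K" by (simp add: zres_def abs_mult)
      then show ?thesis using integral_bounded_mult_le[OF K(1,2) v(1,2)] by (simp add: algebra_simps)
    qed
    show "(\<lambda>k. zres k (indicator B) - (\<integral>y. indicator B y * v y \<partial>M)) \<longlonglongrightarrow> 0" if B: "B \<in> sets M" for B
      using abelian_zeta[OF s_decseq s_nonneg s_lim p01[OF B] mean[OF B]]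
      unfolding zres_def by (rule LIM_zero)
  qed (rule h)
  show ?thesis
    unfolding weak_L1_limit_def
  proof (intro conjI allI ballI)
    show "integrable M (zdens k)" for k
      by (intro integrable_mult_right zeta_density_props(1)) simp
    show "integrable M (\<lambda>y. complex_of_real (v y))" using v(1) by simp
    fix g assume g: "g \<in> Linf M"
    note b = bounded_meas_Re_Im[OF g]
    have "(\<lambda>k. Complex (zres k (\<lambda>y. Re (g y))) (zres k (\<lambda>y. Im (g y)))) \<longlonglongrightarrow>
        Complex (\<integral>y. Re (g y) * v y \<partial>M) (\<integral>y. Im (g y) * v y \<partial>M)"
      by (rule tendsto_Complex[OF LIM_zero_cancel[OF lim[OF b(1)]] LIM_zero_cancel[OF lim[OF b(2)]]])
    then show "(\<lambda>k. \<integral>y. g y * zdens k y \<partial>M) \<longlonglongrightarrow> (\<integral>y. g y * complex_of_real (v y) \<partial>M)"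
      by (simp only: zdens_integral[OF g] integral_Linf_real[OF g v(1)])
  qed
qed

end

section \<open>From the data on D to the dominated setting\<close>

lemma eig_vectors_cinner_eigenvector:
  assumes G: "positive_op G" and f: "eig_vectors G f" and x: "G x = of_real t *\<^sub>C x" and "sing_val G i \<noteq> t"
  shows "cinner (f i) x = 0"
proof -
  have "cinner (G (f i)) x = cinner (f i) (G x)" by (rule positive_op_symmetric[OF G])
  then have "of_real (sing_val G i) * cinner (f i) x = of_real t * cinner (f i) x"
    using f x by (simp add: eig_vectors_def cinner_scaleC_left cinner_scaleC_right)
  then show ?thesis using assms(4) by simp
qed

text \<open>Both sides are compared on the basis \<open>h\<close>. If \<open>g m = 0\<close>, then
  \<open>h m\<close> is orthogonal to every \<open>f i\<close> with positive singular value, and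
  both sides vanish since 0 powr r = 0; otherwise \<open>h m\<close> is one of the
  \<open>f i\<close>.\<close>

lemma op_powr_diag:
  fixes G :: "'h::complex_hilbert \<Rightarrow> 'h" and h :: "nat \<Rightarrow> 'h"
  assumes G: "positive_op G" "compact_op G" and f: "eig_vectors G f"
    and h: "inj_on h I" "is_onb (h ` I)" and eig: "\<And>m. m \<in> I \<Longrightarrow> G (h m) = of_real (g m) *\<^sub>C h m"
    and g: "\<And>m. m \<in> I \<Longrightarrow> 0 \<le> g m" "\<And>m. m \<in> I \<Longrightarrow> g m \<le> K"
    and ran: "\<And>m. m \<in> I \<Longrightarrow> 0 < g m \<Longrightarrow> h m \<in> range f"
    and r: "0 < r"
  shows "op_powr G r = diag_op (\<lambda>i. of_real (sing_val G i powr r)) f"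
proof (rule bounded_clinear_eq_on_onb[OF _ _ h(2)])
  define c where "c = (\<lambda>i. complex_of_real (sing_val G i powr r))"
  have orth: "orthosys UNIV f" using f by (simp add: eig_vectors_def)
  note adjG = positive_op_adjoint[OF G(1)]
  have s0: "0 \<le> sing_val G i" for i by (rule sing_val_nonneg[OF G(2) adjG])
  have c: "cmod (c i) \<le> sing_val G 0 powr r" for i
    using s0 r decseqD[OF sing_val_decseq[OF G(2) adjG], of 0 i] by (simp add: c_def powr_mono2)
  have gK: "\<bar>g m powr r\<bar> \<le> K powr r" if "m \<in> I" for m using g[OF that] r by (simp add: powr_mono2)
  note calc = eigen_calculus_diag[where domD = UNIV and D = G and G = "\<lambda>t. t powr r" and ev = g,
      OF h _ eig positive_op_symmetric[OF G(1)] gK]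
  show "bounded_clinear (op_powr G r)" unfolding op_powr_def by (rule calc(1)) auto
  show "bounded_clinear (diag_op (\<lambda>i. of_real (sing_val G i powr r)) f)"
    using diag_op_bounded[OF orth, of c, OF c] by (simp add: c_def)
  fix b assume "b \<in> h ` I"
  then obtain m where m: "m \<in> I" "b = h m" by blast
  have hm: "norm (h m) = 1" using h(2) m(1) by (auto simp: is_onb_def)
  have "diag_op c f (h m) = of_real (g m powr r) *\<^sub>C h m"
  proof (cases "g m = 0")
    case True
    have "c i * cinner (f i) (h m) = 0" for i
    proof (cases "sing_val G i = 0")
      case False
      then show ?thesis using eig_vectors_cinner_eigenvector[OF G(1) f eig[OF m(1)]] True by simp
    qed (simp add: c_def)
    then have "(\<lambda>i. (c i * cinner (f i) (h m)) *\<^sub>C f i) = (\<lambda>_. 0)" by (simp only: complex_vector.scale_zero_left)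
    then show ?thesis using True by (simp add: diag_op_def)
  next
    case False
    then obtain i where i: "h m = f i" using ran[OF m(1)] g(1)[OF m(1)] by (metis less_eq_real_def rangeE)
    have "of_real (sing_val G i) *\<^sub>C f i = of_real (g m) *\<^sub>C f i"
      using eig[OF m(1)] f i by (simp add: eig_vectors_def)
    then have si: "sing_val G i = g m" using hm i by (auto simp: complex_vector.scale_right_imp_eq)
    have "(\<lambda>j. (c j * cinner (f j) (f i)) *\<^sub>C f j) = (\<lambda>j. if j = i then c i *\<^sub>C f i else 0)"
      using orth hm i by (auto simp: orthosys_def fun_eq_iff)
    then have "diag_op c f (f i) = c i *\<^sub>C f i"
      unfolding diag_op_def using sums_unique[OF sums_single[of i "\<lambda>_. c i *\<^sub>C f i"]] by simp
    then show ?thesis by (simp add: i c_def si)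
  qed
  moreover have "op_powr G r (h m) = of_real (g m powr r) *\<^sub>C h m"
    unfolding op_powr_def by (rule calc(2)) (use eig[OF m(1)] in auto)
  ultimately show "op_powr G r b = diag_op (\<lambda>i. of_real (sing_val G i powr r)) f b"
    by (simp add: m(2) c_def)
qed

lemma Linf_component:
  fixes e :: "'f \<Rightarrow> real ^ 'n::finite"
  assumes "e \<in> borel_measurable M" "bounded (e ` space M)"
  shows "(\<lambda>y. complex_of_real (e y $ i)) \<in> Linf M"
proof -
  obtain K where K: "\<And>y. y \<in> space M \<Longrightarrow> norm (e y) \<le> K" using assms(2) by (auto simp: bounded_iff)
  show ?thesis
  proof (rule LinfI)
    have "(\<lambda>y. e y $ i) \<in> borel_measurable M"
      using borel_measurable_continuous_on[OF _ assms(1), of "\<lambda>z. z $ i"] by (simp add: continuous_on_component)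
    then show "(\<lambda>y. complex_of_real (e y $ i)) \<in> borel_measurable M" by measurable
    show "AE y in M. cmod (complex_of_real (e y $ i)) \<le> K"
      using K component_le_norm_cart order_trans by (intro AE_I2) (fastforce simp: norm_of_real)
  qed
qed

theorem theorem2p12:
  fixes domD :: "'h::complex_hilbert set" and D :: "'h \<Rightarrow> 'h"
    and I :: "nat set" and h :: "nat \<Rightarrow> 'h" and ev :: "nat \<Rightarrow> real"
    and G :: "real \<Rightarrow> real" and GD :: "'h \<Rightarrow> 'h"
    and \<omega> :: "(nat \<Rightarrow>\<^sub>C real) \<Rightarrow>\<^sub>L real" and \<phi> :: "('h \<Rightarrow> 'h) \<Rightarrow> complex"
    and A :: "'n::finite \<Rightarrow> 'h \<Rightarrow> 'h" and \<M> :: "('h \<Rightarrow> 'h) set"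
    and J :: "nat set" and \<xi> :: "nat \<Rightarrow> 'h" and \<eta> :: 'h and \<mu>\<^sub>\<eta> :: "(real ^ 'n) measure"
    and F :: "'f::topological_space set" and \<mu> :: "'f measure"
    and U :: "'h \<Rightarrow> 'f \<Rightarrow> complex" and e :: "'f \<Rightarrow> real ^ 'n"
  assumes H_separable: "separable_space (euclidean :: 'h topology)"
    and D_selfadjoint: "selfadjoint_unbounded domD D"
    and D_compact_resolvent: "compact_resolvent domD D"
    and h_basis: "inj_on h I" "is_onb (h ` I)"
    and h_eigen: "\<forall>m\<in>I. h m \<in> domD \<and> D (h m) = complex_of_real (ev m) *\<^sub>C h m"
    and G_borel: "G \<in> borel_measurable borel"
    and G_bounded: "bounded (range G)"
    and G_positive: "\<forall>t. 0 \<le> G t"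
    and GD_def: "GD = eigen_calculus domD D G"
    and GD_positive: "positive_op GD"
    and GD_ideal: "GD \<in> L1inf"
    and omega: "\<omega> \<in> DL2 TYPE('h)"
    and phi_def: "\<phi> = (\<lambda>T. dixmier_trace \<omega> (T \<circ> GD))"
    and A_selfadjoint: "\<forall>i. selfadjoint_op (A i)"
    and A_commute: "\<forall>i j. A i \<circ> A j = A j \<circ> A i"
    and A_nondegenerate: "closure (cspan (\<Union>i. range (A i))) = UNIV"
    and M_def: "\<M> = vn_generated (range A)"
    and xi_decomposition: "cyclic_decomposition \<M> J \<xi>"
    and eta_def: "\<eta> = (\<Sum>\<^sub>\<infinity>j\<in>J. (1 / 2) ^ j *\<^sub>R \<xi> j)"
    and mu_eta_def: "\<mu>\<^sub>\<eta> = spectral_measure A \<eta>"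
    and mu_borel: "sets \<mu> = sets (restrict_space borel F)"
    and mu_finite: "finite_measure \<mu>"
    and U_representation: "joint_spectral_representation A \<mu> U e"
    and D_dominated: "dominated \<mu> U I h"
    and comp_e_hom: "normal_star_hom \<mu>\<^sub>\<eta> \<mu> (\<lambda>f. f \<circ> e)"
    and comp_e_intertwines:
      "\<forall>f\<in>Linf \<mu>\<^sub>\<eta>. \<forall>x. AE y in \<mu>. U (joint_calculus A f x) y = (f \<circ> e) y * U x y"
  shows "(\<phi> \<in> predual \<M> \<and>
      (\<exists>v\<^sub>G\<^sub>\<omega> :: 'f \<Rightarrow> complex. integrable \<mu> v\<^sub>G\<^sub>\<omega> \<and>
        (\<forall>f\<in>Linf \<mu>\<^sub>\<eta>. \<phi> (joint_calculus A f) = (\<integral>y. (f \<circ> e) y * v\<^sub>G\<^sub>\<omega> y \<partial>\<mu>))))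
    \<and>
    ((\<exists>v :: 'f \<Rightarrow> complex.
        weak_L1_limit \<mu>
          (\<lambda>k y. complex_of_real (1 / real (Suc k)) * zeta_density \<mu> U GD (1 + 1 / real (Suc k)) y) v \<and>
        (\<forall>f\<in>Linf \<mu>\<^sub>\<eta>. \<phi> (joint_calculus A f) = (\<integral>y. (f \<circ> e) y * v y \<partial>\<mu>)))
      \<longleftrightarrow> spectrally_measurable \<mu> U GD)"
proof -
  have sym: "cinner (D x) y = cinner x (D y)" if "x \<in> domD" "y \<in> domD" for x y
    using D_selfadjoint that unfolding selfadjoint_unbounded_def by blast
  obtain K where K: "\<And>t. \<bar>G t\<bar> \<le> K" using G_bounded by (auto simp: bounded_iff)
  have eig: "GD (h m) = of_real (G (ev m)) *\<^sub>C h m" if "m \<in> I" for m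
    unfolding GD_def using h_eigen that
    by (intro eigen_calculus_diag(2)[where domD = domD and D = D and G = G and ev = ev, OF h_basis _ _ sym K]) auto
  obtain f where f: "eig_vectors GD f" "\<And>i. f i = 0 \<or> f i \<in> h ` I"
    "\<And>m. m \<in> I \<Longrightarrow> 0 < G (ev m) \<Longrightarrow> h m \<in> range f"
    by (rule sorted_eigenvectors[OF GD_positive L1inf_compact[OF GD_ideal] h_basis eig]) (assumption | rule that)+
  obtain l where l: "integrable \<mu> l" "\<And>m. m \<in> I \<Longrightarrow> AE y in \<mu>. (cmod (U (h m) y))\<^sup>2 \<le> l y"
    using D_dominated unfolding dominated_def by blast
  have U: "unitary_L2 \<mu> U" and e: "e \<in> borel_measurable \<mu>" "bounded (e ` space \<mu>)"
    and UA: "\<And>i x. AE y in \<mu>. U (A i x) y = complex_of_real (e y $ i) * U x y"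
    using U_representation unfolding joint_spectral_representation_def by blast+
  interpret unitary_rep \<mu> U by (rule unitary_rep.intro) (rule mu_finite, rule U)
  \<comment> \<open>The absolute value of \<open>l\<close> also dominates the zero vectors in
    \<open>f\<close>, about which the bound for the basis says nothing.\<close>
  interpret dominated_rep \<mu> U GD f "\<lambda>y. \<bar>l y\<bar>"
  proof
    show "AE y in \<mu>. (cmod (U (f i) y))\<^sup>2 \<le> \<bar>l y\<bar>" for i
    proof (cases "f i = 0")
      case True
      then show ?thesis using U_scale[of 0 0] by (auto elim!: eventually_mono)
    next
      case False
      then obtain m where "m \<in> I" "f i = h m" using f(2) by blast
      then show ?thesis using l(2)[of m] by (auto elim!: eventually_mono)
    qed
    show "op_powr GD r = diag_op (\<lambda>i. of_real (sing_val GD i powr r)) f" if "0 < r" for r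
      using op_powr_diag[OF GD_positive L1inf_compact[OF GD_ideal] f(1) h_basis eig _ _ f(3) that, of K] G_positive K
      by (meson abs_le_D1)
    show "\<exists>B :: 'h set. is_onb B" using h_basis by blast
  qed (use GD_positive GD_ideal f(1) l(1) in auto)
  obtain v where v: "integrable \<mu> v" "\<And>y. 0 \<le> v y"
    "\<And>h. bounded_meas \<mu> h \<Longrightarrow> \<Lambda> \<omega> h = (\<integral>y. h y * v y \<partial>\<mu>)"
    by (rule \<Lambda>_density[OF omega]) (rule that; assumption)
  have \<phi>: "\<phi> (mult_op \<mu> U g) = (\<integral>y. g y * of_real (v y) \<partial>\<mu>)" if "g \<in> Linf \<mu>" for g
    unfolding phi_def by (rule dixmier_trace_mult[OF omega v(1,3) that])
  \<comment> \<open>The generators are multiplications by the coordinates of \<open>e\<close>, so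
    the generated algebra consists of multiplication operators, on all of which
    \<open>\<phi>\<close> is given by the density.\<close>
  have "A i \<in> mult_alg" for i
    unfolding mult_alg_def using mult_op_eqI[OF UA] Linf_component[OF e] by blast
  then have M: "\<M> \<subseteq> mult_alg" unfolding M_def by (intro vn_generated_subset_mult_alg) auto
  have calc: "\<phi> (joint_calculus A g) = (\<integral>y. (g \<circ> e) y * of_real (v y) \<partial>\<mu>)" if g: "g \<in> Linf \<mu>\<^sub>\<eta>" for g
  proof -
    have "joint_calculus A g = mult_op \<mu> U (g \<circ> e)" using comp_e_intertwines g by (intro mult_op_eqI) blast
    moreover have "g \<circ> e \<in> Linf \<mu>" by (rule bspec[OF conjunct1[OF comp_e_hom[unfolded normal_star_hom_def]] g])
    ultimately show ?thesis by (simp only: \<phi>)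
  qed
  have vi: "integrable \<mu> (\<lambda>y. complex_of_real (v y))" using v(1) by simp
  have "\<phi> \<in> predual \<M>" by (rule predual_density[OF v(1,2) M \<phi>])
  moreover have "weak_L1_limit \<mu> zdens (\<lambda>y. of_real (v y))" if "spectrally_measurable \<mu> U GD"
    by (rule weak_limit_if_spectrally_measurable[OF that omega v])
  moreover have "spectrally_measurable \<mu> U GD" if "weak_L1_limit \<mu> zdens u" for u
    by (rule spectrally_measurable_if_weak_limit[OF that omega])
  \<comment> \<open>One density \<open>v\<close> serves as the witness in both parts.\<close>
  ultimately show ?thesis using calc vi by (intro conjI exI[of _ "\<lambda>y. of_real (v y)"] iffI) auto
qed

end
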